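(* Consider the urn model described in the context. Assume that there is an integer constant $C$ with $A_n\vee B_n\vee N_n\le C$ for all $n\ge 1$; that $E[A_n]=E[B_n]=m_n$ for all $n$, with $m_n\to m\in(0,+\infty)$; that $E[N_n|\mathcal F_{n-1}]\to N$, $E[N_n^2|\mathcal F_{n-1}]\to Q$ and $E[N_n^{-1}|\mathcal F_{n-1}]\to L$ almost surely, where $N$ and $Q$ are strictly positive finite random variables and $L$ is a positive bounded random variable; and that $E[A_n^2]\to q_A$, $E[B_n^2]\to q_B$, $E[A_nB_n]\to q_{AB}$, where $q_A,q_B,q_{AB}$ are strictly positive finite constants. Let $Z$ be the almost sure limit of $Z_n$ (which exists under these assumptions) and let $M_n=\frac1n\sum_{j=1}^n\frac{X_j}{N_j}$. Set $$\widehat m_n=\frac1n\sum_{j=1}^nA_j,\quad \widehat q_{A,n}=\frac1n\sum_{j=1}^nA_j^2,\quad \widehat q_{B,n}=\frac1n\sum_{j=1}^nB_j^2,\quad \widehat q_{AB,n}=\frac1n\sum_{j=1}^nA_jB_j,$$ $$\widehat\mu_n=\frac1n\sum_{j=1}^nN_j,\quad \widehat q_{N,n}=\frac1n\sum_{j=1}^nN_j^2,\quad \widehat\eta_n=\frac1n\sum_{j=1}^nN_j^{-1},$$ $$V'_n=M_n(1-M_n)\,\frac{(1-M_n)\widehat q_{A,n}[(1-M_n)\widehat\mu_n+M_n\widehat q_{N,n}]+M_n\widehat q_{B,n}[M_n\widehat\mu_n+(1-M_n)\widehat q_{N,n}]-2M_n(1-M_n)\widehat q_{AB,n}(\widehat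 q_{N,n}-\widehat\mu_n)}{(\widehat m_n\widehat\mu_n)^2},$$ $$W_n=2V'_n+M_n(1-M_n)\bigl[\widehat\eta_n-2(\widehat\mu_n)^{-1}\bigr].$$ Then, for every $\alpha\in(0,1)$, $M_n\pm q_{1-\frac\alpha2}\sqrt{W_n/n}$ is an asymptotic confidence interval for $Z$ of level $1-\alpha$, i.e. $$\lim_{n\to\infty}P\Bigl(W_n\ge0,\ |M_n-Z|\le q_{1-\frac\alpha2}\sqrt{W_n/n}\Bigr)=1-\alpha,$$ where $q_{1-\frac\alpha2}$ is the quantile of order $1-\frac\alpha2$ of the standard normal distribution.
   Context: Urn model. An urn initially contains $a\ge 1$ balls of color A and $b\ge 1$ balls of color B ($a,b$ integers). On a probability space $(\Omega,\mathcal A,P)$ there are random variables $N_n,X_n,A_n,B_n$, $n\ge 1$, where $N_n$ is the size of the sample drawn without replacement at time $n$, $X_n$ is the number of sampled balls of color A, and after the draw the sampled balls are returned together with $A_nX_n$ new balls of color A and $B_n(N_n-X_n)$ new balls of color B. Put, for $n\ge 0$, $H_n=a+\sum_{j=1}^n A_jX_j$ (balls of color A), $K_n=b+\sum_{j=1}^n B_j(N_j-X_j)$ (balls of color B), $S_n=H_n+K_n$. For each $n\ge1$: (A1) the conditional distribution of $N_n$ given $[N_1,X_1,A_1,B_1,\dots,N_{n-1},X_{n-1},A_{n-1},B_{n-1}]$ is concentrated on $\{1,\dots,S_{n-1}\}$; (A2) the conditional distribution of $X_n$ given $[N_1,X_1,A_1,B_1,\dots,N_{n-1},X_{n-1},A_{n-1},B_{n-1},N_n]$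 is hypergeometric with parameters $N_n,S_{n-1},H_{n-1}$, i.e. it gives mass $\binom{H_{n-1}}{k}\binom{S_{n-1}-H_{n-1}}{N_n-k}/\binom{S_{n-1}}{N_n}$ to $k$; (A3) the random vector $[A_n,B_n]$ takes values in $(\mathbb N\setminus\{0\})^2$ and is independent of $[N_1,X_1,A_1,B_1,\dots,N_{n-1},X_{n-1},A_{n-1},B_{n-1},N_n,X_n]$ ($A_n$ and $B_n$ may be correlated with each other and their law may depend on $n$). The proportion of balls of color A is $Z_n=H_n/S_n$, $n\ge0$. Filtration: $\mathcal F_0=\{\emptyset,\Omega\}$, $\mathcal F_n=\sigma(N_1,X_1,A_1,B_1,\dots,N_n,X_n,A_n,B_n)$ for $n\ge1$. *)

theory Defs
  imports "HOL-Probability.Probability"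
begin

text \<open>
  The urn is described by sequences \<open>N\<close> (sample sizes), \<open>X\<close> (sampled balls of color A),
  \<open>A\<close>, \<open>B\<close> (replacement factors) of \<open>nat\<close>-valued random variables.
  Times are \<open>1, 2, \<dots>\<close>; the values at index \<open>0\<close> are never used.
  The model forces \<open>X n \<le> N n\<close> almost surely, so the truncated subtraction in
  \<open>urn_K\<close> is the usual one outside a null set.
\<close>

definition urn_H ::
  "nat \<Rightarrow> (nat \<Rightarrow> 'a \<Rightarrow> nat) \<Rightarrow> (nat \<Rightarrow> 'a \<Rightarrow> nat) \<Rightarrow> nat \<Rightarrow> 'a \<Rightarrow> nat" where
  "urn_H a X A n \<omega> = a + (\<Sum>j=1..n. A j \<omega> * X j \<omega>)"

definition urn_K ::
  "nat \<Rightarrow> (nat \<Rightarrow> 'a \<Rightarrow> nat) \<Rightarrow> (nat \<Rightarrow> 'a \<Rightarrow> nat) \<Rightarrow> (nat \<Rightarrow> 'a \<Rightarrow> nat) \<Rightarrow> nat \<Rightarrow> 'a \<Rightarrow> nat" where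
  "urn_K b N X B n \<omega> = b + (\<Sum>j=1..n. B j \<omega> * (N j \<omega> - X j \<omega>))"

definition urn_S ::
  "nat \<Rightarrow> nat \<Rightarrow> (nat \<Rightarrow> 'a \<Rightarrow> nat) \<Rightarrow> (nat \<Rightarrow> 'a \<Rightarrow> nat) \<Rightarrow> (nat \<Rightarrow> 'a \<Rightarrow> nat)
    \<Rightarrow> (nat \<Rightarrow> 'a \<Rightarrow> nat) \<Rightarrow> nat \<Rightarrow> 'a \<Rightarrow> nat" where
  "urn_S a b N X A B n \<omega> = urn_H a X A n \<omega> + urn_K b N X B n \<omega>"

definition urn_Z ::
  "nat \<Rightarrow> nat \<Rightarrow> (nat \<Rightarrow> 'a \<Rightarrow> nat) \<Rightarrow> (nat \<Rightarrow> 'a \<Rightarrow> nat) \<Rightarrow> (nat \<Rightarrow> 'a \<Rightarrow> nat)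
    \<Rightarrow> (nat \<Rightarrow> 'a \<Rightarrow> nat) \<Rightarrow> nat \<Rightarrow> 'a \<Rightarrow> real" where
  "urn_Z a b N X A B n \<omega> = real (urn_H a X A n \<omega>) / real (urn_S a b N X A B n \<omega>)"

definition urn_hist ::
  "(nat \<Rightarrow> 'a \<Rightarrow> nat) \<Rightarrow> (nat \<Rightarrow> 'a \<Rightarrow> nat) \<Rightarrow> (nat \<Rightarrow> 'a \<Rightarrow> nat) \<Rightarrow> (nat \<Rightarrow> 'a \<Rightarrow> nat)
    \<Rightarrow> nat \<Rightarrow> 'a \<Rightarrow> (nat \<Rightarrow> nat \<times> nat \<times> nat \<times> nat)" where
  "urn_hist N X A B n \<omega> = (\<lambda>j\<in>{1..n}. (N j \<omega>, X j \<omega>, A j \<omega>, B j \<omega>))"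

definition hist_space :: "nat \<Rightarrow> (nat \<Rightarrow> nat \<times> nat \<times> nat \<times> nat) measure" where
  "hist_space n = Pi\<^sub>M {1..n} (\<lambda>_. count_space UNIV)"

text \<open>
  The sigma-algebras generated by the history up to time \<open>n\<close>, by the history up to time
  \<open>n - 1\<close> and \<open>N n\<close>, and by the history up to time \<open>n - 1\<close>, \<open>N n\<close> and \<open>X n\<close>.
  For \<open>n = 0\<close> the history is constant, so \<open>urn_F\<close> is then the trivial sigma-algebra.
\<close>

definition urn_F ::
  "'a measure \<Rightarrow> (nat \<Rightarrow> 'a \<Rightarrow> nat) \<Rightarrow> (nat \<Rightarrow> 'a \<Rightarrow> nat) \<Rightarrow> (nat \<Rightarrow> 'a \<Rightarrow> nat)
    \<Rightarrow> (nat \<Rightarrow> 'a \<Rightarrow> nat) \<Rightarrow> nat \<Rightarrow> 'a measure" where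
  "urn_F M N X A B n = vimage_algebra (space M) (urn_hist N X A B n) (hist_space n)"

definition urn_FN ::
  "'a measure \<Rightarrow> (nat \<Rightarrow> 'a \<Rightarrow> nat) \<Rightarrow> (nat \<Rightarrow> 'a \<Rightarrow> nat) \<Rightarrow> (nat \<Rightarrow> 'a \<Rightarrow> nat)
    \<Rightarrow> (nat \<Rightarrow> 'a \<Rightarrow> nat) \<Rightarrow> nat \<Rightarrow> 'a measure" where
  "urn_FN M N X A B n = vimage_algebra (space M)
     (\<lambda>\<omega>. (urn_hist N X A B (n - 1) \<omega>, N n \<omega>)) (hist_space (n - 1) \<Otimes>\<^sub>M count_space UNIV)"

definition urn_FNX ::
  "'a measure \<Rightarrow> (nat \<Rightarrow> 'a \<Rightarrow> nat) \<Rightarrow> (nat \<Rightarrow> 'a \<Rightarrow> nat) \<Rightarrow> (nat \<Rightarrow> 'a \<Rightarrow> nat)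
    \<Rightarrow> (nat \<Rightarrow> 'a \<Rightarrow> nat) \<Rightarrow> nat \<Rightarrow> 'a measure" where
  "urn_FNX M N X A B n = vimage_algebra (space M)
     (\<lambda>\<omega>. (urn_hist N X A B (n - 1) \<omega>, N n \<omega>, X n \<omega>))
     (hist_space (n - 1) \<Otimes>\<^sub>M (count_space UNIV \<Otimes>\<^sub>M count_space UNIV))"

text \<open>
  Mass function at \<open>k\<close> of the conditional distribution of a \<open>nat\<close>-valued \<open>Y\<close> given
  the sub-sigma-algebra \<open>G\<close>.
\<close>

definition cond_mass :: "'a measure \<Rightarrow> 'a measure \<Rightarrow> ('a \<Rightarrow> nat) \<Rightarrow> nat \<Rightarrow> 'a \<Rightarrow> real" where
  "cond_mass M G Y k = real_cond_exp M G (indicator {\<omega> \<in> space M. Y \<omega> = k})"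

text \<open>
  Sample size \<open>n\<close>, population size \<open>s\<close>, \<open>h\<close> marked items. The guard is needed because
  \<open>n - k\<close> is truncated.
\<close>

definition hypergeom_mass :: "nat \<Rightarrow> nat \<Rightarrow> nat \<Rightarrow> nat \<Rightarrow> real" where
  "hypergeom_mass n s h k =
     (if k \<le> n then real (h choose k) * real ((s - h) choose (n - k)) / real (s choose n) else 0)"

locale hypergeom_urn = prob_space M
  for M :: "'a measure" and a b :: nat and N X A B :: "nat \<Rightarrow> 'a \<Rightarrow> nat" +
  assumes a_pos: "1 \<le> a" and b_pos: "1 \<le> b"
  and rv_N: "\<And>n. 1 \<le> n \<Longrightarrow> N n \<in> measurable M (count_space UNIV)"
  and rv_X: "\<And>n. 1 \<le> n \<Longrightarrow> X n \<in> measurable M (count_space UNIV)"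
  and rv_A: "\<And>n. 1 \<le> n \<Longrightarrow> A n \<in> measurable M (count_space UNIV)"
  and rv_B: "\<And>n. 1 \<le> n \<Longrightarrow> B n \<in> measurable M (count_space UNIV)"
  and N_conc: "\<And>n. 1 \<le> n \<Longrightarrow> AE \<omega> in M.
        (\<Sum>k = 1..urn_S a b N X A B (n - 1) \<omega>.
           cond_mass M (urn_F M N X A B (n - 1)) (N n) k \<omega>) = 1"
  and X_hypergeom: "\<And>n k. 1 \<le> n \<Longrightarrow> AE \<omega> in M.
        cond_mass M (urn_FN M N X A B n) (X n) k \<omega> =
        hypergeom_mass (N n \<omega>) (urn_S a b N X A B (n - 1) \<omega>) (urn_H a X A (n - 1) \<omega>) k"
  and AB_pos: "\<And>n. 1 \<le> n \<Longrightarrow> AE \<omega> in M. 1 \<le> A n \<omega> \<and> 1 \<le> B n \<omega>"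
  and AB_indep: "\<And>n. 1 \<le> n \<Longrightarrow>
        indep_set
          (sets (vimage_algebra (space M) (\<lambda>\<omega>. (A n \<omega>, B n \<omega>))
                  (count_space UNIV \<Otimes>\<^sub>M count_space UNIV)))
          (sets (urn_FNX M N X A B n))"

definition emp_mean :: "(nat \<Rightarrow> 'a \<Rightarrow> real) \<Rightarrow> nat \<Rightarrow> 'a \<Rightarrow> real" where
  "emp_mean Y n \<omega> = (\<Sum>j=1..n. Y j \<omega>) / real n"

definition urn_M :: "(nat \<Rightarrow> 'a \<Rightarrow> nat) \<Rightarrow> (nat \<Rightarrow> 'a \<Rightarrow> nat) \<Rightarrow> nat \<Rightarrow> 'a \<Rightarrow> real" where
  "urn_M N X = emp_mean (\<lambda>j \<omega>. real (X j \<omega>) / real (N j \<omega>))"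

definition urn_V' ::
  "(nat \<Rightarrow> 'a \<Rightarrow> nat) \<Rightarrow> (nat \<Rightarrow> 'a \<Rightarrow> nat) \<Rightarrow> (nat \<Rightarrow> 'a \<Rightarrow> nat)
    \<Rightarrow> (nat \<Rightarrow> 'a \<Rightarrow> nat) \<Rightarrow> nat \<Rightarrow> 'a \<Rightarrow> real" where
  "urn_V' N X A B n \<omega> =
    (let z = urn_M N X n \<omega>;
         m = emp_mean (\<lambda>j \<omega>. real (A j \<omega>)) n \<omega>;
         qA = emp_mean (\<lambda>j \<omega>. (real (A j \<omega>))\<^sup>2) n \<omega>;
         qB = emp_mean (\<lambda>j \<omega>. (real (B j \<omega>))\<^sup>2) n \<omega>;
         qAB = emp_mean (\<lambda>j \<omega>. real (A j \<omega>) * real (B j \<omega>)) n \<omega>;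
         \<mu> = emp_mean (\<lambda>j \<omega>. real (N j \<omega>)) n \<omega>;
         qN = emp_mean (\<lambda>j \<omega>. (real (N j \<omega>))\<^sup>2) n \<omega>
     in z * (1 - z) *
        (((1 - z) * qA * ((1 - z) * \<mu> + z * qN) + z * qB * (z * \<mu> + (1 - z) * qN)
            - 2 * z * (1 - z) * qAB * (qN - \<mu>))
          / (m * \<mu>)\<^sup>2))"

definition urn_W ::
  "(nat \<Rightarrow> 'a \<Rightarrow> nat) \<Rightarrow> (nat \<Rightarrow> 'a \<Rightarrow> nat) \<Rightarrow> (nat \<Rightarrow> 'a \<Rightarrow> nat)
    \<Rightarrow> (nat \<Rightarrow> 'a \<Rightarrow> nat) \<Rightarrow> nat \<Rightarrow> 'a \<Rightarrow> real" where
  "urn_W N X A B n \<omega> =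
    (let z = urn_M N X n \<omega>;
         \<mu> = emp_mean (\<lambda>j \<omega>. real (N j \<omega>)) n \<omega>;
         \<eta> = emp_mean (\<lambda>j \<omega>. inverse (real (N j \<omega>))) n \<omega>
     in 2 * urn_V' N X A B n \<omega> + z * (1 - z) * (\<eta> - 2 * inverse \<mu>))"

definition quantile :: "real measure \<Rightarrow> real \<Rightarrow> real" where
  "quantile D p = Inf {x. p \<le> cdf D x}"

end

(*
  Martingale differences of order 1/n have almost surely convergent sums (second moments along the
  subsequence of cubes), whence a strong law by Kronecker's lemma. This gives the almost sure limit
  Z of the proportions and the limits of all empirical means. The weighted second-moment estimate
  E[(Z - Z_k)^2 / Z_k^2] = O(E[1 / H_k]), where E[1 / H_k] -> 0, shows that Z has no mass at 0, and
  by symmetry none at 1; together with E[A_n] = E[B_n] this makes the limit of W_n strictly positive.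

  Let zeta_j = X_j / N_j - Z_{j-1}. Up to a negligible error sqrt n (M_n - Z) is
    n^(-1/2) sum_{j <= n} (zeta_j - j (Z_j - Z_{j-1})) - n^(1/2) sum_{n < j <= n^2} (Z_j - Z_{j-1}),
  a martingale array whose sum of squares tends to the limit of W_n; the two sums contribute the
  variances of M_n - Z_n and Z_n - Z. Since that limit is random, the array is normalised by an
  early W_k, known before the bulk of the array, in McLeish's central limit theorem.
*)

theory Submission
  imports Defs "HOL-Real_Asymp.Real_Asymp"
begin

subsection \<open>Deterministic limits\<close>

text \<open>Because the limit variance W is random, a central limit theorem with a constant variance
  does not apply. Dividing by a W_k known beforehand replaces stable convergence by ordinary
  characteristic functions, but it needs W > 0 almost surely; this is why Z must avoid 0 and 1. The
  errors M_n - Z_n and Z_n - Z are put into one array since treating them separately would call for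
  joint convergence. The array may stop at n^2 because E[(Z_{n^2} - Z)^2] = O(1 / n^2), so the rest
  stays negligible after multiplication by sqrt n. The squares of the first block average to Z (1 -
  Z) L - 2 Z (1 - Z) / N + V', and the second block adds another V'. Jensen's inequality gives V' >=
  Z (1 - Z) / N, so the negative term is absorbed and at least Z (1 - Z) L > 0 remains. The
  hypotheses hold only almost surely, while martingale differences are defined here with bounds at
  every point; the processes are therefore truncated first. Conditional laws are used only through
  expectations against bounded functions of the past, which avoids choosing versions.\<close>

lemma cesaro_mean_tendsto:
  fixes f :: "nat \<Rightarrow> real"
  assumes "f \<longlonglongrightarrow> l"
  shows "(\<lambda>n. (\<Sum>j=1..n. f j) / real n) \<longlonglongrightarrow> l"
proof (rule LIMSEQ_I)
  fix r :: real assume r: "0 < r"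
  obtain n0 where n0: "\<And>n. n \<ge> n0 \<Longrightarrow> norm (f n - l) < r / 2"
    using LIMSEQ_D[OF assms, of "r/2"] r by auto
  define c where "c = (\<Sum>j=1..n0. \<bar>f j - l\<bar>)"
  have "c \<ge> 0" unfolding c_def by (simp add: sum_nonneg)
  obtain n1 :: nat where n1: "real n1 > 2 * c / r" using reals_Archimedean2 by blast
  show "\<exists>no. \<forall>n\<ge>no. norm ((\<Sum>j=1..n. f j) / real n - l) < r"
  proof (intro exI allI impI)
    fix n assume n: "n \<ge> n0 + n1 + 1"
    have "(\<Sum>j=1..n. f j) / real n - l = (\<Sum>j=1..n. f j - l) / real n"
      using n by (simp add: sum_subtractf field_simps)
    also have "norm \<dots> \<le> (\<Sum>j=1..n. \<bar>f j - l\<bar>) / real n"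
      by (simp add: divide_right_mono sum_abs)
    also have "(\<Sum>j=1..n. \<bar>f j - l\<bar>) = c + (\<Sum>j=n0+1..n. \<bar>f j - l\<bar>)"
    proof -
      have "{1..n} = {1..n0} \<union> {n0+1..n}" using n by auto
      then show ?thesis unfolding c_def by (simp add: sum.union_disjoint)
    qed
    also have "(c + (\<Sum>j=n0+1..n. \<bar>f j - l\<bar>)) / real n \<le> (c + (\<Sum>j=n0+1..n. r/2)) / real n"
      using n0 by (intro divide_right_mono add_left_mono sum_mono) (auto simp: less_imp_le)
    also have "\<dots> \<le> (c + real n * (r/2)) / real n"
      using r n by (intro divide_right_mono add_left_mono) (auto intro!: mult_right_mono)
    also have "\<dots> < r"
    proof -
      have "c < r / 2 * real n1" using n1 r by (simp add: field_simps)
      also have "\<dots> \<le> r / 2 * real n" using n r by (intro mult_left_mono) auto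
      finally have "c < r / 2 * real n" .
      then show ?thesis using n by (simp add: field_simps)
    qed
    finally show "norm ((\<Sum>j=1..n. f j) / real n - l) < r" .
  qed
qed

text \<open>Serves twice: for Kronecker's lemma, and in \<open>scalederr_decomp\<close> to turn the
  sum of j (Z_j - Z_{j-1}) into n Z_n minus the sum of the Z_{j-1}.\<close>

lemma abel_sum_by_parts:
  fixes a :: "nat \<Rightarrow> real"
  shows "(\<Sum>j=1..n. real j * a j) = real n * (\<Sum>i=1..n. a i) - (\<Sum>j=1..n. \<Sum>i=1..j-1. a i)"
  by (induction n) (auto simp: algebra_simps)

text \<open>Kronecker's lemma with weights j. By Abel summation the mean is the n-th partial sum of
  the convergent series minus the average of the earlier partial sums, and both have the same
  limit.\<close>

lemma kronecker_mean_tendsto_0: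
  fixes c :: "nat \<Rightarrow> real"
  assumes "convergent (\<lambda>n. \<Sum>j=1..n. c j / real j)"
  shows "(\<lambda>n. (\<Sum>j=1..n. c j) / real n) \<longlonglongrightarrow> 0"
proof -
  obtain s where s: "(\<lambda>n. \<Sum>j=1..n. c j / real j) \<longlonglongrightarrow> s"
    using assms by (auto simp: convergent_def)
  have eq: "(\<Sum>j=1..n. c j) / real n
     = (\<Sum>j=1..n. c j / real j) - (\<Sum>j=1..n. \<Sum>i=1..j-1. c i / real i) / real n" if "n \<ge> 1" for n
  proof -
    have "(\<Sum>j=1..n. c j) = (\<Sum>j=1..n. real j * (c j / real j))" by (intro sum.cong) auto
    also have "\<dots> = real n * (\<Sum>i=1..n. c i / real i) - (\<Sum>j=1..n. \<Sum>i=1..j-1. c i / real i)"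
      by (rule abel_sum_by_parts)
    finally show ?thesis using that by (simp add: field_simps)
  qed
  have "(\<lambda>j. \<Sum>i=1..j-1. c i / real i) \<longlonglongrightarrow> s"
    using s by (subst filterlim_sequentially_Suc[symmetric]) simp
  then have "(\<lambda>n. (\<Sum>j=1..n. \<Sum>i=1..j-1. c i / real i) / real n) \<longlonglongrightarrow> s"
    by (rule cesaro_mean_tendsto)
  from tendsto_diff[OF s this] have
    "(\<lambda>n. (\<Sum>j=1..n. c j / real j) - (\<Sum>j=1..n. \<Sum>i=1..j-1. c i / real i) / real n) \<longlonglongrightarrow> 0" by simp
  then show ?thesis
    by (rule Lim_transform_eventually)
       (use eq in \<open>auto simp: eventually_sequentially intro!: exI[of _ 1]\<close>)
qed

text \<open>Replacing \<open>k j\<close> by its limit changes each term by a null sequence, because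
  \<open>c\<close> is bounded. Only the averages of \<open>c\<close> have to converge, which is all
  that is known about the sample sizes and their powers.\<close>

lemma cesaro_mean_mult_tendsto:
  fixes c k :: "nat \<Rightarrow> real"
  assumes c: "(\<lambda>n. (\<Sum>j=1..n. c j) / real n) \<longlonglongrightarrow> l"
    and k: "k \<longlonglongrightarrow> \<kappa>" and b: "\<And>j. \<bar>c j\<bar> \<le> b"
  shows "(\<lambda>n. (\<Sum>j=1..n. k j * c j) / real n) \<longlonglongrightarrow> \<kappa> * l"
proof -
  have "(\<lambda>j. (k j - \<kappa>) * c j) \<longlonglongrightarrow> 0"
  proof (rule Lim_null_comparison)
    show "\<forall>\<^sub>F j in sequentially. norm ((k j - \<kappa>) * c j) \<le> \<bar>k j - \<kappa>\<bar> * b"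
      using b by (intro always_eventually allI) (simp add: abs_mult mult_left_mono)
    show "(\<lambda>j. \<bar>k j - \<kappa>\<bar> * b) \<longlonglongrightarrow> 0"
      by (rule tendsto_mult_left_zero) (use k LIM_zero in \<open>auto simp: tendsto_rabs_zero_iff\<close>)
  qed
  from tendsto_add[OF cesaro_mean_tendsto[OF this] tendsto_mult_left[OF c, of \<kappa>]]
  show ?thesis by (simp add: sum_distrib_left add_divide_distrib[symmetric] sum.distrib[symmetric] algebra_simps)
qed

text \<open>Telescoping against 1 / (p (p + 1)). The bound is uniform in \<open>p\<close>, so it
  survives letting the upper end tend to infinity.\<close>

lemma sum_inverse_squares_le:
  assumes "1 \<le> n"
  shows "(\<Sum>j=n+1..p. 1 / (real j)\<^sup>2) \<le> 1 / real n"
proof -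
  have "(\<Sum>j=n+1..p. 1 / (real j)\<^sup>2) \<le> 1 / real n - 1 / real p" if "n \<le> p"
    using that
  proof (induction rule: dec_induct)
    case (step p)
    have "1 / (real (Suc p))\<^sup>2 \<le> 1 / (real p * real (Suc p))"
      using step assms by (intro divide_left_mono) (auto simp: power2_eq_square)
    also have "\<dots> = 1 / real p - 1 / real (Suc p)"
      using step assms by (simp add: field_simps)
    finally have "1 / (real (Suc p))\<^sup>2 \<le> 1 / real p - 1 / real (Suc p)" .
    then show ?case using step by simp
  qed (use assms in auto)
  moreover have "1 / real n - 1 / real p \<le> 1 / real n" by simp
  ultimately show ?thesis by (cases "n \<le> p") (auto intro: order_trans)
qed

text \<open>With the upper bound this sandwiches n times the sum over n < j <= n^2, which therefore
  tends to 1.\<close>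

lemma sum_inverse_squares_ge:
  assumes "n \<le> p"
  shows "1 / real (n+1) - 1 / real (p+1) \<le> (\<Sum>j=n+1..p. 1 / (real j)\<^sup>2)"
  using assms
proof (induction rule: dec_induct)
  case (step p)
  have "1 / real (p+1) - 1 / real (p+2) = 1 / (real (p+1) * real (p+2))"
    by (simp add: field_simps)
  also have "\<dots> \<le> 1 / (real (Suc p))\<^sup>2"
    by (intro divide_left_mono) (auto simp: power2_eq_square)
  finally have "1 / real (p+1) - 1 / real (p+2) \<le> 1 / (real (Suc p))\<^sup>2" .
  then show ?case using step by simp
qed auto

text \<open>Abel summation moves the differences onto the weights 1 / j^2, whose increments are O(1
  / j^3); this beats partial sums of size o(j).\<close>

lemma tail_sum_by_parts:
  fixes r :: "nat \<Rightarrow> real"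
  defines "R \<equiv> \<lambda>n. \<Sum>j=1..n. r j"
  assumes "n \<le> p"
  shows "(\<Sum>j=n+1..p. r j / (real j)\<^sup>2) = R p / (real (p+1))\<^sup>2 - R n / (real (n+1))\<^sup>2
     + (\<Sum>j=n+1..p. R j * (1 / (real j)\<^sup>2 - 1 / (real (j+1))\<^sup>2))"
  using assms(2)
proof (induction rule: dec_induct)
  case (step p)
  have 1: "r (Suc p) / (1 + real p)\<^sup>2 = R (Suc p) / (1 + real p)\<^sup>2 - R p / (1 + real p)\<^sup>2"
    by (simp add: R_def diff_divide_distrib[symmetric])
  have "{n+1..Suc p} = insert (Suc p) {n+1..p}" using step by auto
  then show ?case using step by (simp add: 1 algebra_simps)
qed auto

text \<open>Meant for the second block of the array, where it produces the variance of Z_n - Z.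
  After centring, the partial sums are o(j), so summation by parts bounds the tail by o(1 / n); the
  constant part is handled by the sandwich for 1 / j^2. The horizon n^2 only has to outgrow
  n.\<close>

lemma cesaro_tail_tendsto:
  fixes c :: "nat \<Rightarrow> real"
  assumes c: "(\<lambda>n. (\<Sum>j=1..n. c j) / real n) \<longlonglongrightarrow> l"
  shows "(\<lambda>n. real n * (\<Sum>j=n+1..n\<^sup>2. c j / (real j)\<^sup>2)) \<longlonglongrightarrow> l"
proof -
  define R where "R n = (\<Sum>j=1..n. c j - l)" for n
  have R: "(\<lambda>n. R n / real n) \<longlonglongrightarrow> 0"
  proof (rule Lim_transform_eventually[OF LIM_zero[OF c]])
    show "\<forall>\<^sub>F n in sequentially. (\<Sum>j=1..n. c j) / real n - l = R n / real n"
      using eventually_gt_at_top[of 0]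
      by eventually_elim (simp add: R_def sum_subtractf field_simps)
  qed
  have 1: "(\<lambda>n. real n * (\<Sum>j=n+1..n\<^sup>2. (c j - l) / (real j)\<^sup>2)) \<longlonglongrightarrow> 0"
  proof (rule LIMSEQ_I)
    fix e :: real assume e: "0 < e"
    \<comment> \<open>The bounds below add up to 4 d: d from each boundary term and 2 d from the
      sum. A fifth of e leaves room for a strict inequality.\<close>
    define d where "d = e / 5"
    have d: "d > 0" using e by (simp add: d_def)
    obtain n0 where n0: "\<And>n. n \<ge> n0 \<Longrightarrow> norm (R n / real n - 0) < d"
      using LIMSEQ_D[OF R d] by auto
    show "\<exists>no. \<forall>n\<ge>no. norm (real n * (\<Sum>j=n+1..n\<^sup>2. (c j - l) / (real j)\<^sup>2) - 0) < e"
    proof (intro exI allI impI)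
      fix n assume n: "n \<ge> n0 + 1"
      have RR: "\<bar>R j\<bar> \<le> d * real j" if "j \<ge> n" for j
        using n0[of j] that n by (auto simp: field_simps abs_if split: if_splits)
      have np: "n \<le> n\<^sup>2" using n by (simp add: power2_eq_square)
      define p where "p = n\<^sup>2"
      have n1: "n \<ge> 1" "p \<ge> n" using n np p_def by auto
      have A: "\<bar>R q / (real (q+1))\<^sup>2\<bar> \<le> d / real n" if "q \<ge> n" for q
      proof -
        have "\<bar>R q / (real (q+1))\<^sup>2\<bar> \<le> d * real q / (real (q+1))\<^sup>2"
          using RR[OF that] by (simp add: divide_right_mono)
        also have "\<dots> = d * (real q / (real (q+1))\<^sup>2)" by simp
        also have "\<dots> \<le> d * (1 / real q)"
        proof -
          have "real q / (real (q+1))\<^sup>2 \<le> 1 / real q"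
          proof -
            have "real q / (real (q+1))\<^sup>2 \<le> real q / (real q)\<^sup>2"
              using n1 that by (intro divide_left_mono power_mono) auto
            then show ?thesis using n1 that by (simp add: power2_eq_square split: if_splits)
          qed
          then show ?thesis using d by (intro mult_left_mono) auto
        qed
        also have "\<dots> \<le> d * (1 / real n)"
          using d n1 that by (intro mult_left_mono divide_left_mono) auto
        finally show ?thesis by simp
      qed
      \<comment> \<open>The increment of the weight is (2 j + 1) / (j^2 (j + 1)^2), and j (2 j + 1)
        <= 2 (j + 1)^2 turns d j times it into at most 2 d / j^2.\<close>
      have B: "\<bar>R j * (1 / (real j)\<^sup>2 - 1 / (real (j+1))\<^sup>2)\<bar> \<le> 2 * d * (1 / (real j)\<^sup>2)" if "j \<ge> n" for j
      proof -
        have j: "j \<ge> 1" using that n1 by simp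
        have eq: "1 / (real j)\<^sup>2 - 1 / (real (j+1))\<^sup>2 = (2 * real j + 1) / ((real j)\<^sup>2 * (real (j+1))\<^sup>2)"
        proof -
          have "(real j)\<^sup>2 \<noteq> 0" "(real (j+1))\<^sup>2 \<noteq> 0" using j by auto
          then show ?thesis by (subst diff_frac_eq) (auto simp: power2_eq_square algebra_simps simp del: of_nat_add)
        qed
        have "\<bar>R j * (1 / (real j)\<^sup>2 - 1 / (real (j+1))\<^sup>2)\<bar> = \<bar>R j\<bar> * ((2 * real j + 1) / ((real j)\<^sup>2 * (real (j+1))\<^sup>2))"
          unfolding eq by (simp add: abs_mult)
        also have "\<dots> \<le> (d * real j) * ((2 * real j + 1) / ((real j)\<^sup>2 * (real (j+1))\<^sup>2))"
          using RR[OF that] by (intro mult_right_mono) auto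
        also have "\<dots> = d * ((real j * (2 * real j + 1)) / (real (j+1))\<^sup>2) * (1 / (real j)\<^sup>2)" by (simp add: ac_simps)
        also have "\<dots> \<le> d * 2 * (1 / (real j)\<^sup>2)"
        proof -
          have "(real j * (2 * real j + 1)) / (real (j+1))\<^sup>2 \<le> 2"
            by (rule iffD2[OF pos_divide_le_eq]) (simp, simp add: power2_eq_square algebra_simps)
          then show ?thesis using d by (intro mult_right_mono mult_left_mono) auto
        qed
        finally show ?thesis by (simp add: mult.commute)
      qed
      have "\<bar>\<Sum>j=n+1..p. (c j - l) / (real j)\<^sup>2\<bar> = \<bar>R p / (real (p+1))\<^sup>2 - R n / (real (n+1))\<^sup>2
         + (\<Sum>j=n+1..p. R j * (1 / (real j)\<^sup>2 - 1 / (real (j+1))\<^sup>2))\<bar>"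
        unfolding tail_sum_by_parts[OF n1(2)] R_def ..
      also have "\<dots> \<le> d / real n + d / real n + (\<Sum>j=n+1..p. 2 * d * (1 / (real j)\<^sup>2))"
      proof -
        have "\<bar>\<Sum>j=n+1..p. R j * (1 / (real j)\<^sup>2 - 1 / (real (j+1))\<^sup>2)\<bar>
            \<le> (\<Sum>j=n+1..p. 2 * d * (1 / (real j)\<^sup>2))"
          using B by (intro order_trans[OF sum_abs] sum_mono) auto
        then show ?thesis using A[of p] A[of n] n1 by linarith
      qed
      also have "\<dots> = 2 * d / real n + 2 * d * (\<Sum>j=n+1..p. 1 / (real j)\<^sup>2)"
        by (simp add: sum_distrib_left)
      also have "\<dots> \<le> 2 * d / real n + 2 * d * (1 / real n)"
        using d n1 by (intro add_left_mono mult_left_mono sum_inverse_squares_le) auto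
      finally have "\<bar>\<Sum>j=n+1..p. (c j - l) / (real j)\<^sup>2\<bar> \<le> 4 * d / real n" by simp
      then have "real n * \<bar>\<Sum>j=n+1..p. (c j - l) / (real j)\<^sup>2\<bar> \<le> 4 * d"
        using n1 by (simp add: field_simps)
      also have "4 * d < e" using e by (simp add: d_def)
      finally show "norm (real n * (\<Sum>j=n+1..n\<^sup>2. (c j - l) / (real j)\<^sup>2) - 0) < e"
        by (simp add: p_def abs_mult)
    qed
  qed
  have 2: "(\<lambda>n. real n * (\<Sum>j=n+1..n\<^sup>2. 1 / (real j)\<^sup>2)) \<longlonglongrightarrow> 1"
  proof (rule tendsto_sandwich)
    show "(\<lambda>n. real n * (1 / real (n+1) - 1 / real (n\<^sup>2+1))) \<longlonglongrightarrow> 1" by real_asymp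
    show "(\<lambda>n. 1) \<longlonglongrightarrow> (1::real)" by simp
    show "\<forall>\<^sub>F n in sequentially. real n * (1 / real (n+1) - 1 / real (n\<^sup>2+1)) \<le> real n * (\<Sum>j=n+1..n\<^sup>2. 1 / (real j)\<^sup>2)"
      using eventually_gt_at_top[of 0]
      by eventually_elim (intro mult_left_mono sum_inverse_squares_ge, auto simp: power2_eq_square)
    show "\<forall>\<^sub>F n in sequentially. real n * (\<Sum>j=n+1..n\<^sup>2. 1 / (real j)\<^sup>2) \<le> 1"
      using eventually_gt_at_top[of 0]
    proof eventually_elim
      case (elim n)
      then show ?case using sum_inverse_squares_le[of n "n\<^sup>2"] by (simp add: field_simps)
    qed
  qed
  have "real n * (\<Sum>j=n+1..n\<^sup>2. c j / (real j)\<^sup>2) =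
     real n * (\<Sum>j=n+1..n\<^sup>2. (c j - l) / (real j)\<^sup>2) + l * (real n * (\<Sum>j=n+1..n\<^sup>2. 1 / (real j)\<^sup>2))" for n
  proof -
    have "(\<Sum>j=n+1..n\<^sup>2. c j / (real j)\<^sup>2) = (\<Sum>j=n+1..n\<^sup>2. (c j - l) / (real j)\<^sup>2 + l * (1 / (real j)\<^sup>2))"
      by (intro sum.cong) (auto simp: diff_divide_distrib)
    then show ?thesis by (simp add: sum.distrib sum_distrib_left algebra_simps)
  qed
  with tendsto_add[OF 1 tendsto_mult_left[OF 2, of l]] show ?thesis by simp
qed


subsection \<open>Exponential estimates\<close>

text \<open>With y = x^2 / 2, both expressions agree with 1 + i x - y up to third order: the first
  by Taylor's formula, the second because exp (-y) = 1 - y + O(y^2), the product leaving the extra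
  term i x y. The three errors are at most 1/6, 1 and 1/2 times the cube of |x|, hence the constant
  2.\<close>

lemma norm_iexp_diff_le:
  assumes "\<bar>x::real\<bar> \<le> 1"
  shows "cmod (exp (\<i> * x) - (1 + \<i> * x) * exp (- (x\<^sup>2 / 2))) \<le> 2 * \<bar>x\<bar> ^ 3"
proof -
  define y where "y = x\<^sup>2 / 2"
  have 1: "cmod (exp (\<i> * x) - (1 + \<i> * x - y)) \<le> \<bar>x\<bar> ^ 3 / 6"
    using iexp_approx1[of x 2]
    by (simp add: y_def numeral_eq_Suc fact_numeral power2_eq_square algebra_simps)
  have y: "0 \<le> y" "y \<le> 1/2" using assms by (auto simp: y_def abs_square_le_1)
  have 2: "\<bar>1 - y - exp (-y)\<bar> \<le> y\<^sup>2 / 2"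
  proof -
    have "1 - y \<le> exp (-y)" using exp_ge_add_one_self[of "-y"] by simp
    moreover have "exp (-y) \<le> 1 - y + y\<^sup>2/2"
    proof -
      have "1 + y + y\<^sup>2/2 \<le> exp y" using exp_lower_Taylor_quadratic[OF y(1)] by simp
      then have "exp (-y) * (1 + y + y\<^sup>2/2) \<le> exp (-y) * exp y" by (intro mult_left_mono) auto
      also have "\<dots> = 1" by (simp add: exp_minus)
      \<comment> \<open>The product is (1 + y^2 / 2)^2 - y^2 = 1 + y^4 / 4.\<close>
      also have "1 \<le> (1 - y + y\<^sup>2/2) * (1 + y + y\<^sup>2/2)"
        using y by (simp add: algebra_simps power2_eq_square) 
      finally show ?thesis using y by (simp add: mult_le_cancel_right add_pos_nonneg)
    qed
    ultimately show ?thesis by simp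
  qed
  have e: "exp (\<i> * x) - (1 + \<i> * x) * exp (- (x\<^sup>2 / 2))
     = (exp (\<i> * x) - (1 + \<i> * x - y)) + (1 + \<i> * x) * complex_of_real (1 - y - exp (-y)) + \<i> * complex_of_real (x * y)"
    by (simp add: y_def algebra_simps exp_of_real)
  have "cmod (1 + \<i> * x) \<le> 2"
    using assms by (intro order_trans[OF norm_triangle_ineq]) (simp add: norm_mult)
  then have "cmod ((1 + \<i> * x) * complex_of_real (1 - y - exp (-y))) \<le> 2 * (y\<^sup>2 / 2)"
    unfolding norm_mult norm_of_real using 2 by (intro mult_mono) auto
  moreover have "cmod (\<i> * complex_of_real (x * y)) = \<bar>x\<bar> ^ 3 / 2"
    by (simp add: norm_mult y_def abs_mult power2_eq_square power3_eq_cube)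
  moreover have "y\<^sup>2 \<le> \<bar>x\<bar> ^ 3"
  proof -
    have "y\<^sup>2 = \<bar>x\<bar>^3 * (\<bar>x\<bar> / 4)" by (simp add: y_def power2_eq_square power3_eq_cube)
    also have "\<dots> \<le> \<bar>x\<bar>^3 * 1" using assms by (intro mult_left_mono) auto
    finally show ?thesis by simp
  qed
  moreover have "0 \<le> \<bar>x\<bar>^3" by simp
  ultimately show ?thesis unfolding e using 1
    by (intro order_trans[OF norm_triangle_ineq] order_trans[OF add_right_mono[OF norm_triangle_ineq]]) linarith
qed

text \<open>The squared modulus is (1 + x^2) exp (-x^2). Comparing two products factor by factor
  with \<open>norm_prod_diff\<close> needs every factor in the unit disc.\<close>

lemma norm_one_plus_mult_exp_le:
  "cmod ((1 + \<i> * complex_of_real x) * exp (- complex_of_real (x\<^sup>2 / 2))) \<le> 1"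
proof -
  have "(cmod ((1 + \<i> * complex_of_real x) * exp (- complex_of_real (x\<^sup>2 / 2))))\<^sup>2
     = (1 + x\<^sup>2) * exp (- x\<^sup>2)"
    by (simp add: norm_mult power_mult_distrib cmod_power2 exp_of_real[symmetric] flip: of_real_minus exp_double)
  also have "\<dots> \<le> exp (x\<^sup>2) * exp (- x\<^sup>2)"
    by (intro mult_right_mono exp_ge_add_one_self) auto
  also have "\<dots> = 1" by (simp add: exp_minus)
  finally show ?thesis unfolding power_le_one_iff[OF norm_ge_zero] by simp
qed

text \<open>The factors 1 + i x have modulus at least one, so McLeish's product stays bounded only
  through the sum of squares: each squared modulus 1 + x^2 is at most exp (x^2).\<close>

lemma norm_prod_one_plus_le:
  assumes "(\<Sum>j\<in>J. (x j)\<^sup>2) \<le> b"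
  shows "cmod (\<Prod>j\<in>J. 1 + \<i> * complex_of_real (x j)) \<le> exp (b / 2)"
proof -
  have "(cmod (\<Prod>j\<in>J. 1 + \<i> * complex_of_real (x j)))\<^sup>2 = (\<Prod>j\<in>J. 1 + (x j)\<^sup>2)"
    unfolding prod_norm[symmetric] prod_power_distrib
    by (intro prod.cong) (auto simp: cmod_power2)
  also have "\<dots> \<le> (\<Prod>j\<in>J. exp ((x j)\<^sup>2))"
    by (intro prod_mono) (auto intro: exp_ge_add_one_self)
  also have "\<dots> \<le> exp b"
    using assms by (cases "finite J") (auto simp: exp_sum[symmetric])
  also have "exp b = (exp (b/2))\<^sup>2" by (simp add: exp_double[symmetric])
  finally show ?thesis by (rule power2_le_imp_le) simp
qed

text \<open>Since all factors lie in the unit disc, the errors of the factors add up; each is cubic,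
  and one power of |x| is spent on the smallness \<open>d\<close>, leaving the sum of
  squares.\<close>

lemma norm_iexp_sum_diff_le:
  fixes x :: "'i \<Rightarrow> real"
  assumes x: "\<And>j. j \<in> J \<Longrightarrow> \<bar>x j\<bar> \<le> d" and d: "d \<le> 1" and J: "finite J"
  shows "cmod (exp (\<i> * complex_of_real (\<Sum>j\<in>J. x j))
     - (\<Prod>j\<in>J. 1 + \<i> * complex_of_real (x j)) * complex_of_real (exp (- (\<Sum>j\<in>J. (x j)\<^sup>2) / 2)))
    \<le> 2 * d * (\<Sum>j\<in>J. (x j)\<^sup>2)"
proof -
  have 1: "exp (\<i> * complex_of_real (\<Sum>j\<in>J. x j)) = (\<Prod>j\<in>J. exp (\<i> * complex_of_real (x j)))"
    using J by (simp add: sum_distrib_left exp_sum)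
  have "complex_of_real (exp (- (\<Sum>j\<in>J. (x j)\<^sup>2) / 2)) = (\<Prod>j\<in>J. exp (- complex_of_real ((x j)\<^sup>2 / 2)))"
  proof -
    have "- (\<Sum>j\<in>J. (x j)\<^sup>2) / 2 = (\<Sum>j\<in>J. - ((x j)\<^sup>2 / 2))"
      by (simp add: sum_negf sum_divide_distrib)
    then have "exp (- (\<Sum>j\<in>J. (x j)\<^sup>2) / 2) = (\<Prod>j\<in>J. exp (- ((x j)\<^sup>2 / 2)))"
      using J by (simp add: exp_sum)
    then show ?thesis by (simp add: exp_of_real[symmetric])
  qed
  then have 2: "(\<Prod>j\<in>J. 1 + \<i> * complex_of_real (x j)) * complex_of_real (exp (- (\<Sum>j\<in>J. (x j)\<^sup>2) / 2))
    = (\<Prod>j\<in>J. (1 + \<i> * complex_of_real (x j)) * exp (- complex_of_real ((x j)\<^sup>2 / 2)))"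
    by (simp only: prod.distrib)
  have "cmod (exp (\<i> * complex_of_real (\<Sum>j\<in>J. x j))
     - (\<Prod>j\<in>J. 1 + \<i> * complex_of_real (x j)) * complex_of_real (exp (- (\<Sum>j\<in>J. (x j)\<^sup>2) / 2)))
    \<le> (\<Sum>j\<in>J. cmod (exp (\<i> * complex_of_real (x j)) - (1 + \<i> * complex_of_real (x j)) * exp (- complex_of_real ((x j)\<^sup>2 / 2))))"
    unfolding 1 2 by (intro norm_prod_diff norm_one_plus_mult_exp_le) simp
  also have "\<dots> \<le> (\<Sum>j\<in>J. 2 * d * (x j)\<^sup>2)"
  proof (intro sum_mono)
    fix j assume j: "j \<in> J"
    have "cmod (exp (\<i> * complex_of_real (x j)) - (1 + \<i> * complex_of_real (x j)) * exp (- complex_of_real ((x j)\<^sup>2 / 2))) \<le> 2 * \<bar>x j\<bar> ^ 3"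
      using norm_iexp_diff_le[of "x j"] x[OF j] d by (simp add: exp_of_real[symmetric])
    also have "\<dots> = 2 * \<bar>x j\<bar> * (x j)\<^sup>2" by (simp add: power3_eq_cube power2_eq_square)
    also have "\<dots> \<le> 2 * d * (x j)\<^sup>2" using x[OF j] by (intro mult_right_mono) auto
    finally show "cmod (exp (\<i> * complex_of_real (x j)) - (1 + \<i> * complex_of_real (x j)) * exp (- complex_of_real ((x j)\<^sup>2 / 2))) \<le> 2 * d * (x j)\<^sup>2" .
  qed
  finally show ?thesis by (simp add: sum_distrib_left)
qed

lemma abs_exp_minus_diff_le:
  fixes a b :: real
  assumes "0 \<le> a" "0 \<le> b"
  shows "\<bar>exp (-a) - exp (-b)\<bar> \<le> \<bar>a - b\<bar>"
proof -
  have *: "exp (-x) - exp (-y) \<le> y - x" if "0 \<le> x" "x \<le> y" for x y :: real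
  proof -
    have "exp (-x) - exp (-y) = exp (-x) * (1 - exp (-(y - x)))"
      by (simp add: algebra_simps flip: exp_add)
    also have "\<dots> \<le> 1 * (1 - exp (-(y-x)))" using that by (intro mult_right_mono) auto
    also have "\<dots> \<le> y - x" using exp_ge_add_one_self[of "-(y-x)"] unfolding mult_1 by linarith
    finally show ?thesis .
  qed
  show ?thesis using *[of a b] *[of b a] assms by (cases "a \<le> b") auto
qed

text \<open>The bound 2 is for the event on which the limit variance is too small to rescale by; the
  Lipschitz bound is for its complement.\<close>

lemma norm_iexp_diff_le_min: "cmod (exp (\<i> * complex_of_real x) - exp (\<i> * complex_of_real y)) \<le> min 2 \<bar>x - y\<bar>"
proof (rule min.boundedI)
  show "cmod (exp (\<i> * complex_of_real x) - exp (\<i> * complex_of_real y)) \<le> 2"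
    by (intro order_trans[OF norm_triangle_ineq4]) simp
  have "exp (\<i> * complex_of_real x) - exp (\<i> * complex_of_real y)
    = exp (\<i> * complex_of_real y) * (exp (\<i> * complex_of_real (x - y)) - 1)"
    by (simp add: algebra_simps flip: exp_add)
  also have "cmod \<dots> \<le> \<bar>x - y\<bar>"
    using iexp_approx1[of "x - y" 0] by (simp add: norm_mult)
  finally show "cmod (exp (\<i> * complex_of_real x) - exp (\<i> * complex_of_real y)) \<le> \<bar>x - y\<bar>" .
qed

subsection \<open>The standard normal quantile\<close>

lemma std_normal_singleton: "measure std_normal_distribution {x} = 0"
proof -
  have "emeasure std_normal_distribution {x} = (\<integral>\<^sup>+y. ennreal (std_normal_density y) * indicator {x} y \<partial>lborel)"
    by (subst emeasure_density) auto
  also have "\<dots> = 0"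
    by (subst nn_integral_0_iff_AE) (auto intro!: AE_I[where N="{x}"] simp: indicator_def)
  finally show ?thesis by (simp add: measure_def)
qed

lemma std_normal_uminus: "measure std_normal_distribution {..<-x} = measure std_normal_distribution {x<..}"
proof -
  have "emeasure std_normal_distribution {..<-x} = (\<integral>\<^sup>+y. ennreal (std_normal_density y) * indicator {..<-x} y \<partial>lborel)"
    by (subst emeasure_density) auto
  also have "\<dots> = (\<integral>\<^sup>+y. ennreal (std_normal_density y) * indicator {..<-x} y \<partial>(distr lborel borel uminus))"
    by (simp add: lborel_distr_uminus)
  also have "\<dots> = (\<integral>\<^sup>+y. ennreal (std_normal_density y) * indicator {x<..} y \<partial>lborel)"
    by (subst nn_integral_distr) (auto intro!: nn_integral_cong simp: std_normal_density_def indicator_def)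
  also have "\<dots> = emeasure std_normal_distribution {x<..}"
    by (subst emeasure_density) auto
  finally show ?thesis by (simp add: measure_def)
qed

text \<open>The cdf stays below p to the left of the infimum and is at least p to its right, so
  continuity leaves only the value p.\<close>

lemma (in real_distribution) cdf_quantile:
  assumes cont: "isCont (cdf M) (quantile M p)" and p: "0 < p" "p < 1"
  shows "cdf M (quantile M p) = p"
proof -
  define q where "q = quantile M p"
  \<comment> \<open>An infimum of reals says something only for a nonempty set bounded below; the
    limits of the cdf at both ends provide this because 0 < p < 1.\<close>
  let ?S = "{x. p \<le> cdf M x}"
  have "\<forall>\<^sub>F x in at_top. p < cdf M x" by (rule order_tendstoD(1)[OF cdf_lim_at_top_prob]) (use p in auto)
  then obtain u where "p < cdf M u" by (auto simp: eventually_at_top_linorder)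
  then have ne: "?S \<noteq> {}" by (auto dest!: less_imp_le)
  have "\<forall>\<^sub>F x in at_bot. cdf M x < p" by (rule order_tendstoD(2)[OF cdf_lim_at_bot]) (use p in auto)
  then obtain l where l: "cdf M l < p" by (auto simp: eventually_at_bot_linorder)
  have bdd: "bdd_below ?S"
  proof (rule bdd_belowI[of _ l])
    fix x assume "x \<in> ?S" then show "l \<le> x" using l cdf_nondecreasing[of x l] by (cases "x \<le> l") auto
  qed
  have cl: "cdf M x < p" if "x < q" for x
    using that cInf_lower[OF _ bdd, of x] unfolding q_def quantile_def by force
  have cr: "p \<le> cdf M x" if qx: "q < x" for x
  proof -
    obtain y where "y \<in> ?S" "y < x" using qx cInf_lessD[OF ne, of x] unfolding q_def quantile_def by blast
    then show ?thesis using cdf_nondecreasing[of y x] by auto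
  qed
  have c: "(cdf M \<longlongrightarrow> cdf M q) (at q)" using cont by (simp add: isCont_def q_def)
  have "cdf M q \<le> p"
    by (rule tendsto_upperbound[of "cdf M" _ "at_left q"])
       (use c cl in \<open>auto simp: eventually_at_filter filterlim_at_split intro!: always_eventually less_imp_le\<close>)
  moreover have "p \<le> cdf M q"
    by (rule tendsto_lowerbound[of "cdf M" _ "at_right q"])
       (use c cr in \<open>auto simp: eventually_at_filter filterlim_at_split intro!: always_eventually less_imp_le\<close>)
  ultimately show ?thesis by (simp add: q_def)
qed

lemma measure_std_normal_quantile_interval:
  assumes \<alpha>: "0 < \<alpha>" "\<alpha> < 1"
  defines "q \<equiv> quantile std_normal_distribution (1 - \<alpha> / 2)"
  shows "measure std_normal_distribution {-q..q} = 1 - \<alpha>"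
proof -
  interpret real_distribution std_normal_distribution by (rule real_dist_normal_dist)
  have cdfq: "cdf std_normal_distribution q = 1 - \<alpha> / 2"
    unfolding q_def by (rule cdf_quantile) (use \<alpha> isCont_cdf std_normal_singleton in auto)
  have 1: "measure std_normal_distribution {..q} = 1 - \<alpha>/2" using cdfq by (simp add: cdf_def)
  have 2: "measure std_normal_distribution {q<..} = \<alpha>/2"
  proof -
    have "{q<..} = space std_normal_distribution - {..q}" by auto
    then show ?thesis using prob_compl[of "{..q}"] 1 by simp
  qed
  \<comment> \<open>Otherwise the mass 1 - \<alpha> / 2 of \<open>{..q}\<close> would be at most the
    mass \<alpha> / 2 of \<open>{..<-q}\<close>, against \<alpha> < 1.\<close>
  have "-q \<le> q"
  proof (rule ccontr)
    assume "\<not> -q \<le> q"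
    then have "measure std_normal_distribution {..q} \<le> measure std_normal_distribution {..<-q}"
      by (intro finite_measure_mono) auto
    then show False using 1 2 std_normal_uminus[of q] \<alpha> by simp
  qed
  then have "{-q..q} = {..q} - {..<-q}" "{..<-q} \<subseteq> {..q}" by auto
  then have "measure std_normal_distribution {-q..q} = measure std_normal_distribution {..q} - measure std_normal_distribution {..<-q}"
    by (simp add: finite_measure_Diff)
  then show ?thesis using 1 2 std_normal_uminus[of q] by simp
qed

subsection \<open>Martingale differences\<close>

text \<open>The bound is required at every point, not almost everywhere or on a space, so that the
  closure rules below mention no measure and boundedness can be settled by introduction
  rules.\<close>

definition bounded_fun :: "('a \<Rightarrow> real) \<Rightarrow> bool" where
  "bounded_fun f \<longleftrightarrow> (\<exists>c. \<forall>\<omega>. \<bar>f \<omega>\<bar> \<le> c)"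

lemma bounded_funI: "(\<And>\<omega>. \<bar>f \<omega>\<bar> \<le> c) \<Longrightarrow> bounded_fun f"
  by (auto simp: bounded_fun_def)

lemma bounded_fun_const: "bounded_fun (\<lambda>\<omega>. c)"
  by (auto intro: bounded_funI[of _ "\<bar>c\<bar>"])

lemma bounded_fun_mult:
  assumes "bounded_fun f" "bounded_fun g"
  shows "bounded_fun (\<lambda>\<omega>. f \<omega> * g \<omega>)"
proof -
  obtain c d where "\<And>\<omega>. \<bar>f \<omega>\<bar> \<le> c" "\<And>\<omega>. \<bar>g \<omega>\<bar> \<le> d"
    using assms by (auto simp: bounded_fun_def)
  then have "\<bar>f \<omega> * g \<omega>\<bar> \<le> \<bar>c\<bar> * \<bar>d\<bar>" for \<omega>
    unfolding abs_mult by (intro mult_mono) (auto intro: order_trans[OF _ abs_ge_self])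
  then show ?thesis by (rule bounded_funI)
qed

lemma bounded_fun_add:
  assumes "bounded_fun f" "bounded_fun g"
  shows "bounded_fun (\<lambda>\<omega>. f \<omega> + g \<omega>)"
proof -
  obtain c d where "\<And>\<omega>. \<bar>f \<omega>\<bar> \<le> c" "\<And>\<omega>. \<bar>g \<omega>\<bar> \<le> d"
    using assms by (auto simp: bounded_fun_def)
  then have "\<bar>f \<omega> + g \<omega>\<bar> \<le> c + d" for \<omega>
    by (intro order_trans[OF abs_triangle_ineq] add_mono) auto
  then show ?thesis by (rule bounded_funI)
qed

lemma bounded_fun_uminus: "bounded_fun f \<Longrightarrow> bounded_fun (\<lambda>\<omega>. - f \<omega>)"
  by (auto simp: bounded_fun_def)

lemma bounded_fun_diff:
  "bounded_fun f \<Longrightarrow> bounded_fun g \<Longrightarrow> bounded_fun (\<lambda>\<omega>. f \<omega> - g \<omega>)"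
  using bounded_fun_add[of f "\<lambda>\<omega>. - g \<omega>"] bounded_fun_uminus[of g] by simp

lemma bounded_fun_power: "bounded_fun f \<Longrightarrow> bounded_fun (\<lambda>\<omega>. f \<omega> ^ n)"
  by (induction n) (simp_all add: bounded_fun_const bounded_fun_mult)

lemma bounded_fun_divide_const: "bounded_fun f \<Longrightarrow> bounded_fun (\<lambda>\<omega>. f \<omega> / c)"
  using bounded_fun_mult[of f "\<lambda>_. inverse c"] by (simp add: divide_inverse bounded_fun_const)

lemma bounded_fun_sum:
  "(\<And>i. i \<in> I \<Longrightarrow> bounded_fun (f i)) \<Longrightarrow> bounded_fun (\<lambda>\<omega>. \<Sum>i\<in>I. f i \<omega>)"
  by (induction I rule: infinite_finite_induct) (simp_all add: bounded_fun_const bounded_fun_add)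

lemmas bounded_fun_intros = bounded_fun_const bounded_fun_mult bounded_fun_add bounded_fun_uminus
  bounded_fun_diff bounded_fun_power bounded_fun_divide_const bounded_fun_sum

lemma (in prob_space) integrable_bounded_fun:
  "bounded_fun f \<Longrightarrow> f \<in> borel_measurable M \<Longrightarrow> integrable M f"
  unfolding bounded_fun_def by (elim exE, rule integrable_const_bound) auto

text \<open>Monotone convergence: the integral of the series is the finite series of integrals, so
  the series is finite almost everywhere.\<close>

lemma AE_summable_integral:
  fixes f :: "nat \<Rightarrow> 'a \<Rightarrow> real"
  assumes int: "\<And>k. integrable M (f k)" and nn: "\<And>k x. 0 \<le> f k x"
    and s: "summable (\<lambda>k. \<integral>x. f k x \<partial>M)"
  shows "AE x in M. summable (\<lambda>k. f k x)"
proof -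
  have [measurable]: "f k \<in> borel_measurable M" for k using int by auto
  have "(\<integral>\<^sup>+x. (\<Sum>k. ennreal (f k x)) \<partial>M) = (\<Sum>k. \<integral>\<^sup>+x. ennreal (f k x) \<partial>M)"
    by (rule nn_integral_suminf) simp
  also have "\<dots> = (\<Sum>k. ennreal (\<integral>x. f k x \<partial>M))"
    by (intro suminf_cong nn_integral_eq_integral int) (simp add: nn)
  also have "\<dots> = ennreal (\<Sum>k. \<integral>x. f k x \<partial>M)"
    by (intro suminf_ennreal_eq) (auto simp: s summable_sums nn intro!: integral_nonneg)
  finally have "(\<integral>\<^sup>+x. (\<Sum>k. ennreal (f k x)) \<partial>M) \<noteq> \<infinity>" by simp
  then have "AE x in M. (\<Sum>k. ennreal (f k x)) \<noteq> \<infinity>"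
    by (intro nn_integral_PInf_AE) auto
  then show ?thesis
    by eventually_elim (auto intro!: summable_suminf_not_top nn)
qed

lemma ex_cube_interval: "\<exists>k::nat. k ^ 3 \<le> n \<and> n < (k + 1) ^ 3"
proof (induction n)
  case (Suc n)
  then obtain k where k: "k ^ 3 \<le> n" "n < (k + 1) ^ 3" by auto
  show ?case
  proof (cases "Suc n < (k + 1) ^ 3")
    case False
    then have "Suc n = (k+1)^3" using k by simp
    moreover have "(k+1)^3 < (k+1+1)^3" by (rule power_strict_mono) auto
    ultimately show ?thesis by (intro exI[of _ "k+1"]) simp
  qed (use k in \<open>auto intro!: exI[of _ k]\<close>)
qed (auto intro: exI[of _ 0])

section \<open>Martingale differences for a filtration: convergence and strong law\<close>

locale filtered_prob_space = prob_space M for M :: "'a measure" +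
  fixes F :: "nat \<Rightarrow> 'a measure"
  assumes subalg: "subalgebra M (F n)"
    and F_mono: "m \<le> n \<Longrightarrow> subalgebra (F n) (F m)"
begin

lemma measurable_F_imp_M: "f \<in> measurable (F n) N \<Longrightarrow> f \<in> measurable M N"
  using measurable_from_subalg[OF subalg] .

lemma measurable_F_mono: "f \<in> measurable (F m) N \<Longrightarrow> m \<le> n \<Longrightarrow> f \<in> measurable (F n) N"
  using measurable_from_subalg[OF F_mono] .

text \<open>Orthogonality to all bounded functions of the past says that the conditional expectation
  of \<open>w j\<close> given \<open>F (j-1)\<close> vanishes, without naming a conditional
  expectation. Index 0 has no past and is left free.\<close>

definition mart_diff :: "(nat \<Rightarrow> 'a \<Rightarrow> real) \<Rightarrow> bool" where
  "mart_diff w \<longleftrightarrow> (\<forall>j\<ge>1. w j \<in> borel_measurable (F j) \<and> bounded_fun (w j) \<and>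
     (\<forall>g\<in>borel_measurable (F (j-1)). bounded_fun g \<longrightarrow> expectation (\<lambda>\<omega>. g \<omega> * w j \<omega>) = 0))"

lemma mart_diff_measurable: "mart_diff w \<Longrightarrow> 1 \<le> j \<Longrightarrow> j \<le> n \<Longrightarrow> w j \<in> borel_measurable (F n)"
  by (auto simp: mart_diff_def intro: measurable_F_mono)

lemma mart_diff_measurable_M: "mart_diff w \<Longrightarrow> 1 \<le> j \<Longrightarrow> w j \<in> borel_measurable M"
  by (rule measurable_F_imp_M[OF mart_diff_measurable]) auto

lemma mart_diff_bounded: "mart_diff w \<Longrightarrow> 1 \<le> j \<Longrightarrow> bounded_fun (w j)"
  by (auto simp: mart_diff_def)

lemma mart_diff_expectation:
  "mart_diff w \<Longrightarrow> 1 \<le> j \<Longrightarrow> g \<in> borel_measurable (F (j-1)) \<Longrightarrow> bounded_fun g \<Longrightarrow>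
    expectation (\<lambda>\<omega>. g \<omega> * w j \<omega>) = 0"
  by (auto simp: mart_diff_def)

lemma mart_diff_cmult: "mart_diff w \<Longrightarrow> mart_diff (\<lambda>j \<omega>. a j * w j \<omega>)"
  unfolding mart_diff_def
  by (auto simp: mult.left_commute[of _ "a _"] intro: bounded_fun_mult bounded_fun_const)

text \<open>Pythagoras: the sum so far is a bounded function of the past of the next term, so the
  cross term vanishes.\<close>

lemma mart_diff_sum_squares:
  assumes w: "mart_diff w"
  shows "expectation (\<lambda>\<omega>. (\<Sum>j=n+1..p. w j \<omega>)\<^sup>2) = (\<Sum>j=n+1..p. expectation (\<lambda>\<omega>. (w j \<omega>)\<^sup>2))"
proof (cases "n \<le> p")
  case True
  then show ?thesis
  proof (induction rule: dec_induct)
    case (step p)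
    define D where "D \<omega> = (\<Sum>j=n+1..p. w j \<omega>)" for \<omega>
    have Dm: "D \<in> borel_measurable (F p)" unfolding D_def
      by (intro borel_measurable_sum mart_diff_measurable[OF w]) auto
    have Db: "bounded_fun D" unfolding D_def
      by (intro bounded_fun_sum mart_diff_bounded[OF w]) auto
    note [measurable] = measurable_F_imp_M[OF Dm] mart_diff_measurable_M[OF w, of "Suc p", simplified]
    note b = Db mart_diff_bounded[OF w, of "Suc p", simplified]
    have I: "integrable M (\<lambda>\<omega>. (D \<omega>)\<^sup>2)" "integrable M (\<lambda>\<omega>. 2 * (D \<omega> * w (Suc p) \<omega>))"
      "integrable M (\<lambda>\<omega>. (w (Suc p) \<omega>)\<^sup>2)"
      by (intro integrable_bounded_fun bounded_fun_intros b; measurable)+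
    have "{n+1..Suc p} = insert (Suc p) {n+1..p}" using step by auto
    then have "(\<Sum>j=n+1..Suc p. w j \<omega>)\<^sup>2 = (D \<omega>)\<^sup>2 + 2 * (D \<omega> * w (Suc p) \<omega>) + (w (Suc p) \<omega>)\<^sup>2" for \<omega>
      by (simp add: D_def power2_sum algebra_simps)
    then have "expectation (\<lambda>\<omega>. (\<Sum>j=n+1..Suc p. w j \<omega>)\<^sup>2)
       = expectation (\<lambda>\<omega>. (D \<omega>)\<^sup>2) + expectation (\<lambda>\<omega>. 2 * (D \<omega> * w (Suc p) \<omega>)) + expectation (\<lambda>\<omega>. (w (Suc p) \<omega>)\<^sup>2)"
      using I by simp
    also have "expectation (\<lambda>\<omega>. 2 * (D \<omega> * w (Suc p) \<omega>)) = 0"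
      using mart_diff_expectation[OF w, of "Suc p" D] Dm Db by simp
    finally show ?case using step by (simp add: D_def)
  qed auto
qed auto

text \<open>No maximal inequality is used. Along cubes the second moments of the blocks are small
  enough for absolute summability, and between two consecutive cubes even the sum of absolute values
  is O(1 / k), which fills the gaps deterministically.\<close>

lemma mart_diff_AE_convergent:
  assumes w: "mart_diff w" and bnd: "\<And>j \<omega>. 1 \<le> j \<Longrightarrow> \<bar>w j \<omega>\<bar> \<le> c / real j"
  shows "AE \<omega> in M. convergent (\<lambda>n. \<Sum>j=1..n. w j \<omega>)"
proof -
  have c: "c \<ge> 0" using bnd[of 1 undefined] by simp
  have [measurable]: "w j \<in> borel_measurable M" if "1 \<le> j" for j
    using mart_diff_measurable_M[OF w that] .
  define T where "T n \<omega> = (\<Sum>j=1..n. w j \<omega>)" for n \<omega>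
  have T_diff: "T n \<omega> - T m \<omega> = (\<Sum>j=m+1..n. w j \<omega>)" if "m \<le> n" for m n \<omega>
  proof -
    have "{1..n} = {1..m} \<union> {m+1..n}" using that by auto
    then show ?thesis unfolding T_def by (simp add: sum.union_disjoint)
  qed
  \<comment> \<open>The gap is 3 k^2 + 3 k + 1, and for k >= 1 both k and 1 are at most k^2.\<close>
  have cube: "real ((k+1)^3 - k^3) \<le> 7 * (real k)^2" if "k \<ge> 1" for k :: nat
  proof -
    have "(k+1)^3 - k^3 = 3 * k^2 + 3 * k + 1"
      by (simp add: power2_eq_square power3_eq_cube algebra_simps)
    moreover have "k \<le> k^2" "1 \<le> k^2" using that by (auto simp: power2_eq_square)
    ultimately have "(k+1)^3 - k^3 \<le> 7 * k^2" by linarith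
    then show ?thesis using of_nat_mono[of _ "7 * k^2", where 'a=real] by fastforce
  qed
  have cle: "k ^ 3 \<le> (k+1)^3" for k :: nat by (rule power_mono) auto
  define d where "d k \<omega> = T ((k+1)^3) \<omega> - T (k^3) \<omega>" for k \<omega>
  have [measurable]: "T n \<in> borel_measurable M" for n
    unfolding T_def by (intro borel_measurable_sum) auto
  have Tb: "bounded_fun (T n)" for n
    unfolding T_def by (intro bounded_fun_sum mart_diff_bounded[OF w]) auto
  have db: "bounded_fun (d k)" for k unfolding d_def by (intro bounded_fun_diff Tb)
  have [measurable]: "d k \<in> borel_measurable M" for k unfolding d_def by measurable
  \<comment> \<open>At most 7 k^2 terms of second moment at most c^2 / k^6 give O(1 / k^4) for the
    block, which is summable even after multiplication by k^2.\<close>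
  have Ed: "(real k)\<^sup>2 * expectation (\<lambda>\<omega>. (d k \<omega>)\<^sup>2) \<le> 7 * c\<^sup>2 * (1 / (real k)\<^sup>2)" for k
  proof (cases "k = 0")
    case False
    then have k: "k \<ge> 1" by simp
    have "expectation (\<lambda>\<omega>. (d k \<omega>)\<^sup>2) = (\<Sum>j=k^3+1..(k+1)^3. expectation (\<lambda>\<omega>. (w j \<omega>)\<^sup>2))"
      unfolding d_def T_diff[OF cle] using mart_diff_sum_squares[OF w] by simp
    also have "\<dots> \<le> (\<Sum>j=k^3+1..(k+1)^3. c\<^sup>2 / (real k)^6)"
    proof (intro sum_mono)
      fix j assume j: "j \<in> {k^3+1..(k+1)^3}"
      have "(w j \<omega>)\<^sup>2 \<le> (c / real k ^ 3)\<^sup>2" for \<omega>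
      proof -
        have "real k ^ 3 \<le> real j" using j by (metis atLeastAtMost_iff add_leD1 of_nat_mono of_nat_power)
        then have "c / real j \<le> c / real k ^ 3" using c k j by (intro divide_left_mono) auto
        then have "\<bar>w j \<omega>\<bar> \<le> c / real k ^ 3" using bnd[of j \<omega>] j by auto
        then have "\<bar>w j \<omega>\<bar>\<^sup>2 \<le> (c / real k ^ 3)\<^sup>2" by (intro power_mono) auto
        then show ?thesis by simp
      qed
      then have "expectation (\<lambda>\<omega>. (w j \<omega>)\<^sup>2) \<le> expectation (\<lambda>\<omega>. (c / real k ^ 3)\<^sup>2)"
        using j mart_diff_bounded[OF w, of j] by (intro integral_mono integrable_bounded_fun bounded_fun_intros) auto
      then show "expectation (\<lambda>\<omega>. (w j \<omega>)\<^sup>2) \<le> c\<^sup>2 / (real k)^6"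
        by (simp add: prob_space power_divide flip: power_mult)
    qed
    also have "\<dots> = real ((k+1)^3 - k^3) * (c\<^sup>2 / (real k)^6)" by simp
    also have "\<dots> \<le> 7 * (real k)^2 * (c\<^sup>2 / (real k)^6)"
      by (intro mult_right_mono cube[OF k]) auto
    finally have "(real k)\<^sup>2 * expectation (\<lambda>\<omega>. (d k \<omega>)\<^sup>2) \<le> (real k)\<^sup>2 * (7 * (real k)^2 * (c\<^sup>2 / (real k)^6))"
      by (intro mult_left_mono) auto
    also have "\<dots> = 7 * c\<^sup>2 * (1 / (real k)\<^sup>2)"
      using k by (simp add: field_simps power_numeral_reduce)
    finally show ?thesis .
  qed simp
  have "summable (\<lambda>k. 1 / (real k)\<^sup>2)"
    using inverse_power_summable[of 2, where 'a=real] by (simp add: inverse_eq_divide power_one_over)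
  note S2 = summable_mult[OF this, of "7 * c\<^sup>2"] this
  have "AE \<omega> in M. summable (\<lambda>k. (real k)\<^sup>2 * (d k \<omega>)\<^sup>2)"
  proof (rule AE_summable_integral)
    show "summable (\<lambda>k. expectation (\<lambda>\<omega>. (real k)\<^sup>2 * (d k \<omega>)\<^sup>2))"
      using Ed by (intro summable_comparison_test'[OF S2(1)]) (simp add: integral_nonneg)
    show "integrable M (\<lambda>\<omega>. (real k)\<^sup>2 * (d k \<omega>)\<^sup>2)" for k
      by (intro integrable_bounded_fun bounded_fun_intros db) auto
  qed simp
  then show ?thesis
  proof eventually_elim
    case (elim \<omega>)
    have sm: "summable (\<lambda>k. 1 / (real k)\<^sup>2 + (real k)\<^sup>2 * (d k \<omega>)\<^sup>2)"
      using summable_add[OF S2(2) elim] .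
    \<comment> \<open>The spare factor k^2 pays for passing from squares to absolute values, by the
      arithmetic-geometric inequality for 1 / k and k |d_k|.\<close>
    have "\<bar>d k \<omega>\<bar> \<le> 1 / (real k)\<^sup>2 + (real k)\<^sup>2 * (d k \<omega>)\<^sup>2" if "k \<ge> 1" for k
    proof -
      have "0 \<le> (1 / real k - real k * \<bar>d k \<omega>\<bar>)\<^sup>2" by simp
      also have "\<dots> = 1 / (real k)\<^sup>2 + (real k)\<^sup>2 * (d k \<omega>)\<^sup>2 - 2 * \<bar>d k \<omega>\<bar>"
        using that by (simp add: power2_diff power_mult_distrib power_divide)
      finally show ?thesis by simp
    qed
    then have "summable (\<lambda>k. d k \<omega>)"
      by (intro summable_comparison_test'[where N=1, OF sm]) simp
    then have "convergent (\<lambda>n. \<Sum>k<n. d k \<omega>)" by (simp add: summable_iff_convergent)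
    moreover have "(\<Sum>k<n. d k \<omega>) = T (n^3) \<omega>" for n
      by (induction n) (auto simp: d_def T_def)
    ultimately obtain s where s: "(\<lambda>k. T (k^3) \<omega>) \<longlonglongrightarrow> s" by (auto simp: convergent_def)
    have "(\<lambda>n. T n \<omega>) \<longlonglongrightarrow> s"
    proof (rule LIMSEQ_I)
      fix r :: real assume r: "0 < r"
      obtain K where K: "\<And>k. k \<ge> K \<Longrightarrow> norm (T (k^3) \<omega> - s) < r / 2"
        using LIMSEQ_D[OF s, of "r/2"] r by auto
      \<comment> \<open>Past the cube of k the partial sum moves by at most 7 c / k before the next
        cube, which is below r / 2 once k > 14 c / r.\<close>
      obtain K' :: nat where K': "real K' > 14 * c / r" using reals_Archimedean2 by blast
      define L where "L = Suc (max K K')"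
      show "\<exists>no. \<forall>n\<ge>no. norm (T n \<omega> - s) < r"
      proof (intro exI allI impI)
        fix n assume n: "n \<ge> L ^ 3"
        obtain k where k: "k^3 \<le> n" "n < (k+1)^3" using ex_cube_interval by blast
        have kL: "k \<ge> L"
        proof (rule ccontr)
          assume "\<not> k \<ge> L" then have "(k+1)^3 \<le> L^3" by (intro power_mono) auto
          then show False using n k by linarith
        qed
        then have k1: "k \<ge> 1" "k \<ge> K" "k \<ge> K'" by (auto simp: L_def)
        have "\<bar>T n \<omega> - T (k^3) \<omega>\<bar> \<le> (\<Sum>j=k^3+1..n. \<bar>w j \<omega>\<bar>)"
          unfolding T_diff[OF k(1)] by (rule sum_abs)
        also have "\<dots> \<le> (\<Sum>j=k^3+1..n. c / real k ^ 3)"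
        proof (intro sum_mono)
          fix j assume j: "j \<in> {k^3+1..n}"
          then have "real k ^ 3 \<le> real j" by (metis atLeastAtMost_iff add_leD1 of_nat_mono of_nat_power)
          then have "c / real j \<le> c / real k ^ 3" using c k1 j by (intro divide_left_mono) auto
          then show "\<bar>w j \<omega>\<bar> \<le> c / real k ^ 3" using bnd[of j \<omega>] j by auto
        qed
        also have "\<dots> = real (n - k^3) * (c / real k ^ 3)" by simp
        also have "\<dots> \<le> (7 * (real k)^2) * (c / real k ^ 3)"
        proof (intro mult_right_mono)
          have "real (n - k^3) \<le> real ((k+1)^3 - k^3)" using k by (intro of_nat_mono) simp
          then show "real (n - k^3) \<le> 7 * (real k)^2" using cube[OF k1(1)] by linarith
        qed (use c in auto)
        also have "\<dots> = 7 * c / real k" using k1 by (simp add: power2_eq_square power3_eq_cube)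
        also have "\<dots> < r / 2"
        proof -
          have "14 * c / r < real k" using K' k1(3) by linarith
          then show ?thesis using r k1 by (simp add: field_simps)
        qed
        finally show "norm (T n \<omega> - s) < r" using K[OF k1(2)] unfolding real_norm_def by linarith
      qed
    qed
    then show ?case by (auto simp: T_def convergent_def)
  qed
qed

text \<open>Dividing the j-th difference by j gives a convergent series, to which Kronecker's lemma
  applies.\<close>

lemma mart_diff_strong_law:
  assumes w: "mart_diff w" and bnd: "\<And>j \<omega>. 1 \<le> j \<Longrightarrow> \<bar>w j \<omega>\<bar> \<le> c"
  shows "AE \<omega> in M. (\<lambda>n. (\<Sum>j=1..n. w j \<omega>) / real n) \<longlonglongrightarrow> 0"
proof -
  have "AE \<omega> in M. convergent (\<lambda>n. \<Sum>j=1..n. (1 / real j) * w j \<omega>)"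
    by (rule mart_diff_AE_convergent[OF mart_diff_cmult[OF w], where c=c])
       (use bnd in \<open>auto simp: abs_mult divide_right_mono\<close>)
  then show ?thesis
    by eventually_elim (rule kronecker_mean_tendsto_0, simp)
qed

section \<open>Complex products of martingale differences\<close>

lemma expectation_complex_mart_diff:
  assumes w: "mart_diff w" and j: "1 \<le> j"
    and g: "g \<in> borel_measurable (F (j-1))" and b: "\<And>\<omega>. cmod (g \<omega>) \<le> B"
  shows "(\<integral>\<omega>. g \<omega> * complex_of_real (w j \<omega>) \<partial>M) = 0"
proof -
  obtain c where c: "\<And>\<omega>. \<bar>w j \<omega>\<bar> \<le> c" using mart_diff_bounded[OF w j] by (auto simp: bounded_fun_def)
  note [measurable] = measurable_F_imp_M[OF g] mart_diff_measurable_M[OF w j]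
  have int: "integrable M (\<lambda>\<omega>. g \<omega> * complex_of_real (w j \<omega>))"
    by (rule integrable_const_bound[of _ "B * c"])
       (auto simp: norm_mult intro!: mult_mono b c order_trans[OF norm_ge_zero b])
  have "Re (\<integral>\<omega>. g \<omega> * complex_of_real (w j \<omega>) \<partial>M) = expectation (\<lambda>\<omega>. Re (g \<omega>) * w j \<omega>)"
    by (simp add: integral_Re[OF int, symmetric])
  also have "\<dots> = 0"
    by (rule mart_diff_expectation[OF w j])
       (use g b in \<open>auto intro!: bounded_funI[of _ B] order_trans[OF abs_Re_le_cmod]\<close>)
  moreover have "Im (\<integral>\<omega>. g \<omega> * complex_of_real (w j \<omega>) \<partial>M) = expectation (\<lambda>\<omega>. Im (g \<omega>) * w j \<omega>)"
    by (simp add: integral_Im[OF int, symmetric])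
  moreover have "\<dots> = 0"
    by (rule mart_diff_expectation[OF w j])
       (use g b in \<open>auto intro!: bounded_funI[of _ B] order_trans[OF abs_Im_le_cmod]\<close>)
  ultimately show ?thesis by (simp add: complex_eq_iff)
qed

text \<open>McLeish's product has conditional expectation one: the last factor is 1 plus a multiple
  of \<open>w p\<close>, and everything multiplying \<open>w p\<close> is a bounded function of its
  past. The scale \<open>\<theta>\<close> and the weight \<open>h\<close> are frozen at time
  \<open>k\<close>, before the product starts, which is what allows a random rescaling.\<close>

lemma expectation_prod_mart_diff:
  assumes w: "mart_diff w" and th: "\<theta> \<in> borel_measurable (F k)" "bounded_fun \<theta>"
    and h: "h \<in> borel_measurable (F k)" "bounded_fun h" and kp: "k \<le> p"
  shows "(\<integral>\<omega>. complex_of_real (h \<omega>) * (\<Prod>j=k+1..p. 1 + \<i> * complex_of_real (\<theta> \<omega> * w j \<omega>)) \<partial>M)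
    = complex_of_real (expectation h)"
  using kp
proof (induction rule: dec_induct)
  case base
  then show ?case by simp
next
  case (step p)
  define T where "T \<omega> = complex_of_real (h \<omega>) * (\<Prod>j=k+1..p. 1 + \<i> * complex_of_real (\<theta> \<omega> * w j \<omega>))" for \<omega>
  obtain ch where ch: "\<And>\<omega>. \<bar>h \<omega>\<bar> \<le> ch" using h by (auto simp: bounded_fun_def)
  have "\<forall>j\<in>{k+1..p}. \<exists>c. \<forall>\<omega>. \<bar>\<theta> \<omega> * w j \<omega>\<bar> \<le> c"
    using bounded_fun_mult[OF th(2) mart_diff_bounded[OF w]] by (auto simp: bounded_fun_def)
  then obtain c where c: "\<And>j \<omega>. j \<in> {k+1..p} \<Longrightarrow> \<bar>\<theta> \<omega> * w j \<omega>\<bar> \<le> c j" by metis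
  define B where "B = ch * (\<Prod>j=k+1..p. 1 + c j)"
  have TB: "cmod (T \<omega>) \<le> B" for \<omega>
  proof -
    have "cmod (1 + \<i> * complex_of_real (\<theta> \<omega> * w j \<omega>)) \<le> 1 + c j" if "j \<in> {k+1..p}" for j
      using c[OF that, of \<omega>] by (intro order_trans[OF norm_triangle_ineq]) (simp add: norm_mult abs_mult)
    then show ?thesis unfolding T_def B_def norm_mult norm_of_real prod_norm[symmetric]
      by (intro mult_mono ch) (auto simp: prod_norm[symmetric] intro!: prod_mono prod_nonneg order_trans[OF abs_ge_zero ch])
  qed
  have wm: "w j \<in> borel_measurable (F p)" if "j \<in> {k+1..p}" for j
    using mart_diff_measurable[OF w] that by auto
  note [measurable] = measurable_F_mono[OF th(1) \<open>k \<le> p\<close>] measurable_F_mono[OF h(1) \<open>k \<le> p\<close>]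
  have Tm: "T \<in> borel_measurable (F p)"
    unfolding T_def using wm by (intro borel_measurable_times borel_measurable_prod borel_measurable_add) (auto intro!: borel_measurable_of_real)
  have th_meas: "\<theta> \<in> borel_measurable (F p)" by measurable
  obtain cth where cth: "\<And>\<omega>. \<bar>\<theta> \<omega>\<bar> \<le> cth" using th by (auto simp: bounded_fun_def)
  have g0: "(\<integral>\<omega>. (T \<omega> * (\<i> * complex_of_real (\<theta> \<omega>))) * complex_of_real (w (Suc p) \<omega>) \<partial>M) = 0"
  proof (rule expectation_complex_mart_diff[OF w])
    show "(\<lambda>\<omega>. T \<omega> * (\<i> * complex_of_real (\<theta> \<omega>))) \<in> borel_measurable (F (Suc p - 1))"
      using Tm th_meas by simp
    show "cmod (T \<omega> * (\<i> * complex_of_real (\<theta> \<omega>))) \<le> B * cth" for \<omega>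
      by (simp add: norm_mult) (intro mult_mono TB cth order_trans[OF norm_ge_zero TB] norm_ge_zero abs_ge_zero)
  qed simp
  obtain cw where cw: "\<And>\<omega>. \<bar>w (Suc p) \<omega>\<bar> \<le> cw" using mart_diff_bounded[OF w, of "Suc p"] by (auto simp: bounded_fun_def)
  note [measurable] = measurable_F_imp_M[OF Tm] measurable_F_imp_M[OF th_meas] mart_diff_measurable_M[OF w, of "Suc p", simplified]
  have I1: "integrable M T" by (rule integrable_const_bound[of _ B]) (auto simp: TB)
  have I2: "integrable M (\<lambda>\<omega>. (T \<omega> * (\<i> * complex_of_real (\<theta> \<omega>))) * complex_of_real (w (Suc p) \<omega>))"
    by (rule integrable_const_bound[of _ "(B * cth) * cw"])
       (auto simp: norm_mult intro!: mult_mono TB cth cw order_trans[OF norm_ge_zero TB] order_trans[OF abs_ge_zero cth] mult_nonneg_nonneg)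
  have "{k+1..Suc p} = insert (Suc p) {k+1..p}" using step by auto
  then have "complex_of_real (h \<omega>) * (\<Prod>j=k+1..Suc p. 1 + \<i> * complex_of_real (\<theta> \<omega> * w j \<omega>))
    = T \<omega> + (T \<omega> * (\<i> * complex_of_real (\<theta> \<omega>))) * complex_of_real (w (Suc p) \<omega>)" for \<omega>
    by (simp add: T_def algebra_simps)
  then have "(\<integral>\<omega>. complex_of_real (h \<omega>) * (\<Prod>j=k+1..Suc p. 1 + \<i> * complex_of_real (\<theta> \<omega> * w j \<omega>)) \<partial>M)
     = (\<integral>\<omega>. T \<omega> \<partial>M)" using I1 I2 g0 by simp
  then show ?case using step by (simp add: T_def)
qed

end

subsection \<open>A central limit theorem for martingale arrays\<close>

context filtered_prob_space
begin

text \<open>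
  McLeish's argument: on the event that \<open>V (k n)\<close> exceeds \<open>\<epsilon>\<close> the array is rescaled by the
  known quantity \<open>1 / sqrt (V (k n))\<close>, where \<open>k n\<close> tends to infinity so slowly that the first
  \<open>k n\<close> terms are negligible; the products of the factors \<open>1 + \<i> t \<xi>\<close> have conditional expectation
  one, and the random limit variance is cancelled by the rescaling.
\<close>

theorem martingale_array_clt:
  fixes \<xi> :: "nat \<Rightarrow> nat \<Rightarrow> 'a \<Rightarrow> real" and D V :: "nat \<Rightarrow> 'a \<Rightarrow> real"
  assumes md: "\<And>n. mart_diff (\<xi> n)"
    and bnd: "\<And>n j \<omega>. 1 \<le> n \<Longrightarrow> 1 \<le> j \<Longrightarrow> \<bar>\<xi> n j \<omega>\<bar> \<le> c / sqrt (real n)"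
    and sq: "\<And>n \<omega>. 1 \<le> n \<Longrightarrow> (\<Sum>j=1..p n. (\<xi> n j \<omega>)\<^sup>2) \<le> c"
    and p: "\<And>n. n \<le> p n"
    and sq_lim: "AE \<omega> in M. (\<lambda>n. \<Sum>j=1..p n. (\<xi> n j \<omega>)\<^sup>2) \<longlonglongrightarrow> W \<omega>"
    and V: "\<And>n. V n \<in> borel_measurable (F n)"
    and V_lim: "AE \<omega> in M. (\<lambda>n. V n \<omega>) \<longlonglongrightarrow> W \<omega>"
    and W: "W \<in> borel_measurable M"
    and W_pos: "AE \<omega> in M. 0 < W \<omega>"
    and D: "\<And>n. D n \<in> borel_measurable M" "\<And>n. bounded_fun (D n)"
    and D_lim: "(\<lambda>n. expectation (\<lambda>\<omega>. (D n \<omega> - (\<Sum>j=1..p n. \<xi> n j \<omega>))\<^sup>2)) \<longlonglongrightarrow> 0"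
  shows "(\<lambda>n. expectation (\<lambda>\<omega>. exp (\<i> * complex_of_real (t * (D n \<omega> / sqrt (V n \<omega>))))))
    \<longlonglongrightarrow> complex_of_real (exp (- t\<^sup>2 / 2))"
proof -
  have c0: "c \<ge> 0" using bnd[of 1 1 undefined] by simp
  \<comment> \<open>A fourth root grows to infinity, so that \<open>V (k n)\<close> tends to W, yet
    \<open>k n\<close> terms of size c / sqrt n still sum to O(n powr (-1/4)).\<close>
  define k where "k n = nat \<lfloor>sqrt (sqrt (real n))\<rfloor>" for n :: nat
  have k_le: "real (k n) \<le> sqrt (sqrt (real n))" for n unfolding k_def by simp
  have k_top: "filterlim k at_top sequentially" unfolding k_def
    by (intro filterlim_compose[OF filterlim_nat_sequentially] filterlim_compose[OF filterlim_floor_sequentially]) real_asymp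
  have kn: "k n \<le> n" for n
  proof -
    have "sqrt (sqrt (real n)) \<le> real n"
    proof (cases "n = 0")
      case False
      then have "1 \<le> real n" by simp
      then have "sqrt (real n) \<le> real n" "1 \<le> sqrt (real n)"
        by (auto intro: real_le_lsqrt simp: power2_eq_square)
      then have "sqrt (sqrt (real n)) \<le> sqrt (real n)"
        by (intro real_le_lsqrt) (auto simp: power2_eq_square)
      then show ?thesis using \<open>sqrt (real n) \<le> real n\<close> by linarith
    qed simp
    then show ?thesis using k_le[of n] by linarith
  qed
  have kp: "k n \<le> p n" for n using kn p order_trans by blast
  have k_small: "(\<lambda>n. real (k n) * (c / sqrt (real n))) \<longlonglongrightarrow> 0"
  proof (rule Lim_null_comparison)
    show "\<forall>\<^sub>F n in sequentially. norm (real (k n) * (c / sqrt (real n))) \<le> sqrt (sqrt (real n)) * (c / sqrt (real n))"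
      using c0 k_le by (intro always_eventually allI) (auto simp: abs_mult intro!: divide_right_mono mult_right_mono)
    show "(\<lambda>n. sqrt (sqrt (real n)) * (c / sqrt (real n))) \<longlonglongrightarrow> 0" by real_asymp
  qed
  define \<Xi> where "\<Xi> n \<omega> = (\<Sum>j=1..p n. \<xi> n j \<omega>)" for n \<omega>
  \<comment> \<open>The first \<open>k n\<close> terms are dropped from the array so that a scale
    known at time \<open>k n\<close> is known before all terms that remain.\<close>
  define Y where "Y n \<omega> = (\<Sum>j=k n+1..p n. \<xi> n j \<omega>)" for n \<omega>
  define Q where "Q n \<omega> = (\<Sum>j=k n+1..p n. (\<xi> n j \<omega>)\<^sup>2)" for n \<omega>
  have split: "(\<Sum>j=1..p n. f j) = (\<Sum>j=1..k n. f j) + (\<Sum>j=k n+1..p n. f j)" for f :: "nat \<Rightarrow> real" and n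
  proof -
    have "{1..p n} = {1..k n} \<union> {k n+1..p n}" using kp[of n] by auto
    then show ?thesis by (simp add: sum.union_disjoint)
  qed
  have [measurable]: "\<xi> n j \<in> borel_measurable M" if "1 \<le> j" for n j
    using mart_diff_measurable_M[OF md that] .
  have [measurable]: "\<Xi> n \<in> borel_measurable M" "Y n \<in> borel_measurable M" "Q n \<in> borel_measurable M" for n
    unfolding \<Xi>_def Y_def Q_def by (intro borel_measurable_sum borel_measurable_power; simp)+
  have [measurable]: "V n \<in> borel_measurable M" for n using V measurable_F_imp_M by blast
  note [measurable] = D(1) W
  have \<xi>b: "bounded_fun (\<xi> n j)" if "1 \<le> j" for n j using mart_diff_bounded[OF md that] .
  have \<Xi>b: "bounded_fun (\<Xi> n)" for n unfolding \<Xi>_def by (intro bounded_fun_intros \<xi>b) auto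
  have Yb: "bounded_fun (Y n)" for n unfolding Y_def by (intro bounded_fun_intros \<xi>b) auto
  have Q0: "0 \<le> Q n \<omega>" for n \<omega> unfolding Q_def by (intro sum_nonneg) auto
  have Qc: "Q n \<omega> \<le> c" if "1 \<le> n" for n \<omega>
  proof -
    have "0 \<le> (\<Sum>j=1..k n. (\<xi> n j \<omega>)\<^sup>2)" by (intro sum_nonneg) auto
    then show ?thesis using sq[OF that, of \<omega>] unfolding split Q_def by linarith
  qed
  have YX: "\<bar>\<Xi> n \<omega> - Y n \<omega>\<bar> \<le> real (k n) * (c / sqrt (real n))" if "1 \<le> n" for n \<omega>
  proof -
    have "\<bar>\<Xi> n \<omega> - Y n \<omega>\<bar> \<le> (\<Sum>j=1..k n. \<bar>\<xi> n j \<omega>\<bar>)" unfolding \<Xi>_def Y_def split by simp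
    also have "\<dots> \<le> (\<Sum>j=1..k n. c / sqrt (real n))" by (intro sum_mono bnd that) auto
    finally show ?thesis by simp
  qed
  have Q_lim: "AE \<omega> in M. (\<lambda>n. Q n \<omega>) \<longlonglongrightarrow> W \<omega>"
    using sq_lim
  proof eventually_elim
    case (elim \<omega>)
    have "(\<lambda>n. \<Sum>j=1..k n. (\<xi> n j \<omega>)\<^sup>2) \<longlonglongrightarrow> 0"
    proof (rule Lim_null_comparison)
      show "\<forall>\<^sub>F n in sequentially. norm (\<Sum>j=1..k n. (\<xi> n j \<omega>)\<^sup>2) \<le> real (k n) * (c / sqrt (real n)) * (c / sqrt (real n))"
        using eventually_gt_at_top[of 0]
      proof eventually_elim
        case (elim n)
        have "norm (\<Sum>j=1..k n. (\<xi> n j \<omega>)\<^sup>2) = (\<Sum>j=1..k n. (\<xi> n j \<omega>)\<^sup>2)" by (simp add: sum_nonneg)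
        also have "\<dots> \<le> (\<Sum>j=1..k n. (c / sqrt (real n)) * (c / sqrt (real n)))"
        proof (intro sum_mono)
          fix j assume "j \<in> {1..k n}"
          then have "\<bar>\<xi> n j \<omega>\<bar> * \<bar>\<xi> n j \<omega>\<bar> \<le> (c / sqrt (real n)) * (c / sqrt (real n))"
            using elim c0 by (intro mult_mono bnd) auto
          then show "(\<xi> n j \<omega>)\<^sup>2 \<le> (c / sqrt (real n)) * (c / sqrt (real n))" by (simp add: power2_eq_square)
        qed
        finally show ?case by simp
      qed
      have "(\<lambda>n. c / sqrt (real n)) \<longlonglongrightarrow> 0" by real_asymp
      from tendsto_mult[OF k_small this]
      show "(\<lambda>n. real (k n) * (c / sqrt (real n)) * (c / sqrt (real n))) \<longlonglongrightarrow> 0" by simp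
    qed
    from tendsto_diff[OF elim this] show ?case unfolding split Q_def by simp
  qed
  have Vk_lim: "AE \<omega> in M. (\<lambda>n. V (k n) \<omega>) \<longlonglongrightarrow> W \<omega>"
    using V_lim by eventually_elim (rule filterlim_compose[OF _ k_top])

  have E1: "(\<lambda>n. expectation (\<lambda>\<omega>. (D n \<omega> - Y n \<omega>)\<^sup>2)) \<longlonglongrightarrow> 0"
  proof (rule Lim_null_comparison)
    show "\<forall>\<^sub>F n in sequentially. norm (expectation (\<lambda>\<omega>. (D n \<omega> - Y n \<omega>)\<^sup>2))
       \<le> 2 * expectation (\<lambda>\<omega>. (D n \<omega> - \<Xi> n \<omega>)\<^sup>2) + 2 * (real (k n) * (c / sqrt (real n)))\<^sup>2"
      using eventually_gt_at_top[of 0]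
    proof eventually_elim
      case (elim n)
      have "expectation (\<lambda>\<omega>. (D n \<omega> - Y n \<omega>)\<^sup>2) \<le> expectation (\<lambda>\<omega>. 2 * (D n \<omega> - \<Xi> n \<omega>)\<^sup>2 + 2 * (real (k n) * (c / sqrt (real n)))\<^sup>2)"
      proof (intro integral_mono)
        fix \<omega>
        have "(\<Xi> n \<omega> - Y n \<omega>)\<^sup>2 \<le> (real (k n) * (c / sqrt (real n)))\<^sup>2"
          using YX[of n \<omega>] elim c0 by (intro abs_le_square_iff[THEN iffD1]) auto
        moreover have "(D n \<omega> - Y n \<omega>)\<^sup>2 \<le> 2 * (D n \<omega> - \<Xi> n \<omega>)\<^sup>2 + 2 * (\<Xi> n \<omega> - Y n \<omega>)\<^sup>2"
          using sum_squares_ge_zero[of "D n \<omega> - \<Xi> n \<omega> - (\<Xi> n \<omega> - Y n \<omega>)" 0] by (simp add: power2_eq_square algebra_simps)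
        ultimately show "(D n \<omega> - Y n \<omega>)\<^sup>2 \<le> 2 * (D n \<omega> - \<Xi> n \<omega>)\<^sup>2 + 2 * (real (k n) * (c / sqrt (real n)))\<^sup>2" by linarith
      qed (intro integrable_bounded_fun bounded_fun_intros D \<Xi>b Yb; measurable)+
      also have "\<dots> = 2 * expectation (\<lambda>\<omega>. (D n \<omega> - \<Xi> n \<omega>)\<^sup>2) + 2 * (real (k n) * (c / sqrt (real n)))\<^sup>2"
      proof -
        have "integrable M (\<lambda>\<omega>. (D n \<omega> - \<Xi> n \<omega>)\<^sup>2)"
          by (intro integrable_bounded_fun bounded_fun_intros D \<Xi>b) measurable
        then show ?thesis by (simp add: prob_space)
      qed
      finally show ?case by (simp add: integral_nonneg)
    qed
    show "(\<lambda>n. 2 * expectation (\<lambda>\<omega>. (D n \<omega> - \<Xi> n \<omega>)\<^sup>2) + 2 * (real (k n) * (c / sqrt (real n)))\<^sup>2) \<longlonglongrightarrow> 0"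
      using tendsto_add[OF tendsto_mult_left[OF D_lim, of 2] tendsto_mult_left[OF tendsto_power[OF k_small, of 2], of 2]]
      by (simp add: \<Xi>_def)
  qed
  have EX: "expectation (\<lambda>\<omega>. (\<Xi> n \<omega>)\<^sup>2) \<le> c" if "1 \<le> n" for n
  proof -
    have "expectation (\<lambda>\<omega>. (\<Xi> n \<omega>)\<^sup>2) = (\<Sum>j=1..p n. expectation (\<lambda>\<omega>. (\<xi> n j \<omega>)\<^sup>2))"
      using mart_diff_sum_squares[OF md, of n 0 "p n"] by (simp add: \<Xi>_def)
    also have "\<dots> = expectation (\<lambda>\<omega>. \<Sum>j=1..p n. (\<xi> n j \<omega>)\<^sup>2)"
      by (intro Bochner_Integration.integral_sum[symmetric] integrable_bounded_fun bounded_fun_intros \<xi>b borel_measurable_power) auto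
    also have "\<dots> \<le> expectation (\<lambda>\<omega>. c)"
      by (intro integral_mono integrable_bounded_fun bounded_fun_intros \<xi>b sq that borel_measurable_sum borel_measurable_power) auto
    finally show ?thesis by (simp add: prob_space)
  qed
  \<comment> \<open>A bound for E[D^2] with the limit 2 c; replacing \<open>V (k n)\<close> by
    \<open>V n\<close> in the denominator of D will cost \<eta> times it.\<close>
  define ED where "ED n = 2 * expectation (\<lambda>\<omega>. (D n \<omega> - \<Xi> n \<omega>)\<^sup>2) + 2 * c" for n
  have ED: "expectation (\<lambda>\<omega>. (D n \<omega>)\<^sup>2) \<le> ED n" if "1 \<le> n" for n
  proof -
    have "expectation (\<lambda>\<omega>. (D n \<omega>)\<^sup>2) \<le> expectation (\<lambda>\<omega>. 2 * (D n \<omega> - \<Xi> n \<omega>)\<^sup>2 + 2 * (\<Xi> n \<omega>)\<^sup>2)"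
    proof (intro integral_mono)
      fix \<omega> show "(D n \<omega>)\<^sup>2 \<le> 2 * (D n \<omega> - \<Xi> n \<omega>)\<^sup>2 + 2 * (\<Xi> n \<omega>)\<^sup>2"
        using sum_squares_ge_zero[of "D n \<omega> - \<Xi> n \<omega> - \<Xi> n \<omega>" 0] by (simp add: power2_eq_square algebra_simps)
    qed (intro integrable_bounded_fun bounded_fun_intros D \<Xi>b; measurable)+
    also have "\<dots> = 2 * expectation (\<lambda>\<omega>. (D n \<omega> - \<Xi> n \<omega>)\<^sup>2) + 2 * expectation (\<lambda>\<omega>. (\<Xi> n \<omega>)\<^sup>2)"
    proof -
      have "integrable M (\<lambda>\<omega>. (D n \<omega> - \<Xi> n \<omega>)\<^sup>2)" "integrable M (\<lambda>\<omega>. (\<Xi> n \<omega>)\<^sup>2)"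
        by (intro integrable_bounded_fun bounded_fun_intros D \<Xi>b; measurable)+
      then show ?thesis by simp
    qed
    finally show ?thesis using EX[OF that] by (simp add: ED_def)
  qed
  have ED_lim: "ED \<longlonglongrightarrow> 2 * c"
    unfolding ED_def using tendsto_add[OF tendsto_mult_left[OF D_lim, of 2] tendsto_const[of "2*c"]] by (simp add: \<Xi>_def)

  show ?thesis
  proof (rule LIMSEQ_I)
    fix r :: real assume r: "0 < r"
    \<comment> \<open>Error budget: three cut-off probabilities below \<eta> each, \<eta> times the
      limit 2 c of the second moments, one \<eta> from the arithmetic-geometric inequality, and one
      spare for strictness.\<close>
    define \<eta> where "\<eta> = r / (2 * c + 5)"
    have \<eta>: "\<eta> > 0" using r c0 by (simp add: \<eta>_def)
    \<comment> \<open>A continuous stand-in for the indicator of x <= 1, so that it passes to the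
      limit along \<open>V (k n)\<close>; it is 0 from 2 on.\<close>
    define f :: "real \<Rightarrow> real" where "f x = max 0 (min 1 (2 - x))" for x
    have f_cont: "isCont f x" for x unfolding f_def by (intro continuous_intros)
    have [measurable]: "f \<in> borel_measurable borel" unfolding f_def by measurable
    have f01: "0 \<le> f x" "f x \<le> 1" for x by (auto simp: f_def)
    \<comment> \<open>Positivity of W enters here: the event that W is of order \<epsilon> or less
      has small probability for small \<epsilon>, which is how \<epsilon> is chosen.\<close>
    have "(\<lambda>i. expectation (\<lambda>\<omega>. f (W \<omega> / (1 / real (Suc i))))) \<longlonglongrightarrow> expectation (\<lambda>\<omega>. 0)"
    proof (rule integral_dominated_convergence[where w="\<lambda>_. 1"])
      show "AE \<omega> in M. (\<lambda>i. f (W \<omega> / (1 / real (Suc i)))) \<longlonglongrightarrow> 0"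
        using W_pos
      proof eventually_elim
        case (elim \<omega>)
        obtain n0 :: nat where n0: "real n0 > 2 / W \<omega>" using reals_Archimedean2 by blast
        show ?case
        proof (rule tendsto_eventually)
          show "\<forall>\<^sub>F i in sequentially. f (W \<omega> / (1 / real (Suc i))) = 0"
            using eventually_ge_at_top[of n0]
          proof eventually_elim
            case (elim i)
            then have "2 / W \<omega> \<le> real (Suc i)" using n0 by linarith
            then have "2 \<le> W \<omega> * real (Suc i)" using \<open>0 < W \<omega>\<close> by (simp add: field_simps)
            then show ?case by (simp add: f_def)
          qed
        qed
      qed
    qed (use f01 in auto)
    then have "(\<lambda>i. expectation (\<lambda>\<omega>. f (W \<omega> / (1 / real (Suc i))))) \<longlonglongrightarrow> 0" by simp
    from order_tendstoD(2)[OF this \<eta>] obtain i where i: "expectation (\<lambda>\<omega>. f (W \<omega> / (1 / real (Suc i)))) < \<eta>"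
      by (auto simp: eventually_sequentially)
    define \<epsilon> where "\<epsilon> = 1 / real (Suc i)"
    have \<epsilon>: "\<epsilon> > 0" "expectation (\<lambda>\<omega>. f (W \<omega> / \<epsilon>)) < \<eta>" using i by (auto simp: \<epsilon>_def)
    define g where "g n = expectation (\<lambda>\<omega>. f (V (k n) \<omega> / \<epsilon>))" for n
    have g_lim: "g \<longlonglongrightarrow> expectation (\<lambda>\<omega>. f (W \<omega> / \<epsilon>))"
      unfolding g_def
    proof (rule integral_dominated_convergence[where w="\<lambda>_. 1"])
      show "AE \<omega> in M. (\<lambda>n. f (V (k n) \<omega> / \<epsilon>)) \<longlonglongrightarrow> f (W \<omega> / \<epsilon>)"
        using Vk_lim by eventually_elim (intro isCont_tendsto_compose[OF f_cont] tendsto_divide tendsto_const, use \<epsilon> in auto)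
    qed (use f01 in auto)
    define \<iota> where "\<iota> n \<omega> = (if V (k n) \<omega> > \<epsilon> then 1 else 0 :: real)" for n \<omega>
    \<comment> \<open>Switched off where \<open>V (k n)\<close> is not above \<epsilon>, so that the
      scale is bounded by 1 / sqrt \<epsilon>; only information available at time \<open>k n\<close>
      is used.\<close>
    define \<theta> where "\<theta> n \<omega> = (if V (k n) \<omega> > \<epsilon> then 1 / sqrt (V (k n) \<omega>) else 0)" for n \<omega>
    have Vk: "V (k n) \<in> borel_measurable (F (k n))" for n using V .
    have \<iota>m: "\<iota> n \<in> borel_measurable (F (k n))" and \<theta>m: "\<theta> n \<in> borel_measurable (F (k n))" for n
      unfolding \<iota>_def \<theta>_def using Vk[of n] by measurable
    note [measurable] = measurable_F_imp_M[OF \<iota>m] measurable_F_imp_M[OF \<theta>m]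
    have \<theta>0: "0 \<le> \<theta> n \<omega>" for n \<omega> using \<epsilon> by (auto simp: \<theta>_def)
    have \<theta>1: "\<theta> n \<omega> \<le> 1 / sqrt \<epsilon>" for n \<omega>
      using \<epsilon> by (auto simp: \<theta>_def intro!: divide_left_mono)
    have \<theta>2: "(\<theta> n \<omega>)\<^sup>2 \<le> 1 / \<epsilon>" for n \<omega>
      using power_mono[OF \<theta>1 \<theta>0, of n \<omega> 2] \<epsilon> by (simp add: power_divide)
    have \<theta>b: "bounded_fun (\<theta> n)" for n by (rule bounded_funI[of _ "1 / sqrt \<epsilon>"]) (use \<theta>0 \<theta>1 in auto)
    have \<iota>01: "0 \<le> \<iota> n \<omega>" "\<iota> n \<omega> \<le> 1" for n \<omega> by (auto simp: \<iota>_def)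
    have \<iota>f: "1 - \<iota> n \<omega> \<le> f (V (k n) \<omega> / \<epsilon>)" for n \<omega>
      using \<epsilon> by (auto simp: \<iota>_def f_def divide_le_eq)
    have E\<iota>: "expectation (\<lambda>\<omega>. 1 - \<iota> n \<omega>) \<le> g n" for n
      unfolding g_def using \<iota>f \<iota>01 f01
      by (intro integral_mono integrable_bounded_fun) (auto intro!: bounded_funI[of _ 1])
    have i\<iota>: "integrable M (\<lambda>\<omega>. 1 - \<iota> n \<omega>)" for n
      using \<iota>01 by (intro integrable_bounded_fun) (auto intro!: bounded_funI[of _ 1])
    define T where "T n \<omega> = (\<Prod>j=k n+1..p n. 1 + \<i> * complex_of_real (t * \<theta> n \<omega> * \<xi> n j \<omega>))" for n \<omega>
    define K where "K = exp (t\<^sup>2 * (1 / \<epsilon>) * c / 2)"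
    have sqx: "(\<Sum>j=k n+1..p n. (t * \<theta> n \<omega> * \<xi> n j \<omega>)\<^sup>2) = t\<^sup>2 * (\<theta> n \<omega>)\<^sup>2 * Q n \<omega>" for n \<omega>
      by (simp add: Q_def power_mult_distrib sum_distrib_left mult.assoc)
    have sqle: "t\<^sup>2 * (\<theta> n \<omega>)\<^sup>2 * Q n \<omega> \<le> t\<^sup>2 * (1 / \<epsilon>) * c" if "1 \<le> n" for n \<omega>
      using \<theta>2 Qc[OF that] Q0 \<epsilon> by (intro mult_mono) auto
    have TK: "cmod (T n \<omega>) \<le> K" if "1 \<le> n" for n \<omega>
      unfolding T_def K_def by (rule norm_prod_one_plus_le) (unfold sqx, rule sqle[OF that])
    have [measurable]: "T n \<in> borel_measurable M" for n
      unfolding T_def by (intro borel_measurable_prod borel_measurable_add borel_measurable_times borel_measurable_of_real borel_measurable_const) auto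
    define e1 where "e1 n \<omega> = complex_of_real (exp (- (t\<^sup>2 * (\<theta> n \<omega>)\<^sup>2 * Q n \<omega>) / 2))" for n \<omega>
    define e2 where "e2 n \<omega> = exp (- (t\<^sup>2 * \<iota> n \<omega>) / 2)" for n \<omega>
    have [measurable]: "e1 n \<in> borel_measurable M" "e2 n \<in> borel_measurable M" for n
      unfolding e1_def e2_def by measurable
    have e1b: "cmod (e1 n \<omega>) \<le> 1" for n \<omega> unfolding e1_def using Q0 by simp
    have e2b: "\<bar>e2 n \<omega>\<bar> \<le> 1" for n \<omega> unfolding e2_def using \<iota>01 by simp
    have e12: "cmod (e1 n \<omega> - complex_of_real (e2 n \<omega>)) \<le> 2" for n \<omega>
      using norm_triangle_ineq4[of "e1 n \<omega>" "complex_of_real (e2 n \<omega>)"] e1b[of n \<omega>] e2b[of n \<omega>]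
      unfolding norm_of_real by linarith
    have e2m: "e2 n \<in> borel_measurable (F (k n))" for n
      unfolding e2_def using \<iota>m[of n] by measurable
    define d1 where "d1 n = 2 * (\<bar>t\<bar> * (1 / sqrt \<epsilon>) * (c / sqrt (real n))) * (t\<^sup>2 * (1 / \<epsilon>) * c)" for n :: nat
    define b where "b n = expectation (\<lambda>\<omega>. cmod (e1 n \<omega> - complex_of_real (e2 n \<omega>)))" for n
    \<comment> \<open>Cost of exchanging \<open>V (k n)\<close> for \<open>V n\<close> in the
      denominator. The cap at 2 permits dominated convergence.\<close>
    define \<delta> where "\<delta> n \<omega> = min 2 (t\<^sup>2 * (1 / sqrt (V n \<omega>) - 1 / sqrt (V (k n) \<omega>))\<^sup>2 / (4 * \<eta>))" for n \<omega>
    have [measurable]: "\<delta> n \<in> borel_measurable M" for n unfolding \<delta>_def by measurable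
    define s where "s n = 3 * g n + \<eta> * ED n + expectation (\<delta> n)
       + (\<eta> + t\<^sup>2 / (4 * \<eta> * \<epsilon>) * expectation (\<lambda>\<omega>. (D n \<omega> - Y n \<omega>)\<^sup>2)) + d1 n + K * b n" for n
    have d1_lim: "d1 \<longlonglongrightarrow> 0" unfolding d1_def by real_asymp
    have b_lim: "b \<longlonglongrightarrow> 0"
    proof -
      have "b \<longlonglongrightarrow> expectation (\<lambda>\<omega>. 0)" unfolding b_def
      proof (rule integral_dominated_convergence[where w="\<lambda>_. 2"])
        show "AE \<omega> in M. norm (cmod (e1 n \<omega> - complex_of_real (e2 n \<omega>))) \<le> 2" for n
          using e12 by (intro AE_I2) simp
        show "AE \<omega> in M. (\<lambda>n. cmod (e1 n \<omega> - complex_of_real (e2 n \<omega>))) \<longlonglongrightarrow> 0"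
          using Q_lim Vk_lim W_pos
        proof eventually_elim
          case (elim \<omega>)
          \<comment> \<open>The random limit cancels: numerator and denominator tend to the same W >
            0. This is the purpose of the rescaling.\<close>
          have "(\<lambda>n. Q n \<omega> / V (k n) \<omega>) \<longlonglongrightarrow> W \<omega> / W \<omega>"
            using elim by (intro tendsto_divide) auto
          then have "(\<lambda>n. \<bar>Q n \<omega> / V (k n) \<omega> - 1\<bar>) \<longlonglongrightarrow> 0"
            using elim by (intro tendsto_rabs_zero LIM_zero) auto
          then have lim: "(\<lambda>n. t\<^sup>2 / 2 * \<bar>Q n \<omega> / V (k n) \<omega> - 1\<bar>) \<longlonglongrightarrow> 0"
            by (rule tendsto_mult_right_zero)
          show ?case
          proof (rule Lim_null_comparison[OF _ lim], intro always_eventually allI)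
            fix n
            have "cmod (e1 n \<omega> - complex_of_real (e2 n \<omega>))
              = \<bar>exp (- (t\<^sup>2 * (\<theta> n \<omega>)\<^sup>2 * Q n \<omega> / 2)) - exp (- (t\<^sup>2 * \<iota> n \<omega> / 2))\<bar>"
              unfolding e1_def e2_def by (simp flip: of_real_diff)
            also have "\<dots> \<le> \<bar>t\<^sup>2 * (\<theta> n \<omega>)\<^sup>2 * Q n \<omega> / 2 - t\<^sup>2 * \<iota> n \<omega> / 2\<bar>"
              using Q0 \<iota>01 by (intro abs_exp_minus_diff_le) auto
            also have "\<dots> = t\<^sup>2 / 2 * \<bar>(\<theta> n \<omega>)\<^sup>2 * Q n \<omega> - \<iota> n \<omega>\<bar>"
              by (simp add: abs_mult flip: diff_divide_distrib right_diff_distrib mult.assoc) (simp add: abs_mult mult.assoc flip: right_diff_distrib)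
            also have "\<dots> \<le> t\<^sup>2 / 2 * \<bar>Q n \<omega> / V (k n) \<omega> - 1\<bar>"
              using \<epsilon> by (intro mult_left_mono) (auto simp: \<theta>_def \<iota>_def power_divide)
            finally show "norm (cmod (e1 n \<omega> - complex_of_real (e2 n \<omega>))) \<le> t\<^sup>2 / 2 * \<bar>Q n \<omega> / V (k n) \<omega> - 1\<bar>" by simp
          qed
        qed
      qed auto
      then show ?thesis by simp
    qed
    have \<delta>_lim: "(\<lambda>n. expectation (\<delta> n)) \<longlonglongrightarrow> 0"
    proof -
      have "(\<lambda>n. expectation (\<delta> n)) \<longlonglongrightarrow> expectation (\<lambda>\<omega>. 0)"
      proof (rule integral_dominated_convergence[where w="\<lambda>_. 2"])
        show "AE \<omega> in M. norm (\<delta> n \<omega>) \<le> 2" for n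
          using \<eta> by (intro AE_I2) (auto simp: \<delta>_def abs_if min_def not_less intro: order_trans[of _ 0])
        show "AE \<omega> in M. (\<lambda>n. \<delta> n \<omega>) \<longlonglongrightarrow> 0"
          using V_lim Vk_lim W_pos
        proof eventually_elim
          case (elim \<omega>)
          have "(\<lambda>n. min 2 (t\<^sup>2 * (1 / sqrt (V n \<omega>) - 1 / sqrt (V (k n) \<omega>))\<^sup>2 / (4 * \<eta>)))
            \<longlonglongrightarrow> min 2 (t\<^sup>2 * (1 / sqrt (W \<omega>) - 1 / sqrt (W \<omega>))\<^sup>2 / (4 * \<eta>))"
            using elim \<eta> by (intro tendsto_intros) auto
          then show ?case by (simp add: \<delta>_def)
        qed
      qed auto
      then show ?thesis by simp
    qed
    have s_lim: "s \<longlonglongrightarrow> 3 * expectation (\<lambda>\<omega>. f (W \<omega> / \<epsilon>)) + \<eta> * (2 * c) + 0 + (\<eta> + t\<^sup>2 / (4 * \<eta> * \<epsilon>) * 0) + 0 + K * 0"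
      unfolding s_def by (intro tendsto_intros g_lim ED_lim \<delta>_lim E1 d1_lim b_lim)
    have "3 * expectation (\<lambda>\<omega>. f (W \<omega> / \<epsilon>)) + \<eta> * (2 * c) + 0 + (\<eta> + t\<^sup>2 / (4 * \<eta> * \<epsilon>) * 0) + 0 + K * 0 < 3 * \<eta> + \<eta> * (2 * c) + 2 * \<eta>"
      using \<epsilon>(2) \<eta> by simp
    also have "3 * \<eta> + \<eta> * (2 * c) + 2 * \<eta> = \<eta> * (2 * c + 5)" by (simp add: algebra_simps)
    also have "\<dots> = r" using c0 by (simp add: \<eta>_def)
    finally have s_ev: "\<forall>\<^sub>F n in sequentially. s n < r" using order_tendstoD(2)[OF s_lim] by blast
    have "(\<lambda>n. \<bar>t\<bar> * (1 / sqrt \<epsilon>) * (c / sqrt (real n))) \<longlonglongrightarrow> 0" by real_asymp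
    then have small_ev: "\<forall>\<^sub>F n in sequentially. \<bar>t\<bar> * (1 / sqrt \<epsilon>) * (c / sqrt (real n)) < 1"
      by (rule order_tendstoD) simp
    have main: "cmod (expectation (\<lambda>\<omega>. exp (\<i> * complex_of_real (t * (D n \<omega> / sqrt (V n \<omega>))))) - complex_of_real (exp (- t\<^sup>2 / 2))) \<le> s n"
      if n: "1 \<le> n" and sm: "\<bar>t\<bar> * (1 / sqrt \<epsilon>) * (c / sqrt (real n)) \<le> 1" for n
    proof -
      define eD where "eD \<omega> = exp (\<i> * complex_of_real (t * (D n \<omega> / sqrt (V n \<omega>))))" for \<omega>
      define eY where "eY \<omega> = exp (\<i> * complex_of_real (t * \<theta> n \<omega> * Y n \<omega>))" for \<omega>
      have [measurable]: "eD \<in> borel_measurable M" "eY \<in> borel_measurable M"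
        unfolding eD_def eY_def by measurable
      have ieD: "integrable M eD" and ieY: "integrable M eY"
        by (rule integrable_const_bound[of _ 1]; auto simp: eD_def eY_def)+
      have iT1: "integrable M (\<lambda>\<omega>. T n \<omega> * e1 n \<omega>)"
        by (rule integrable_const_bound[of _ "K * 1"], rule AE_I2)
           (unfold norm_mult, intro mult_mono TK n e1b, auto simp: K_def)
      have iT2: "integrable M (\<lambda>\<omega>. complex_of_real (e2 n \<omega>) * T n \<omega>)"
        by (rule integrable_const_bound[of _ "1 * K"], rule AE_I2)
           (unfold norm_mult norm_of_real, intro mult_mono TK n e2b, auto)
      \<comment> \<open>The chain of comparisons starts: \<open>eY\<close> is replaced by
        \<open>T\<close> times \<open>e1\<close> (A), \<open>e1\<close> by \<open>e2\<close> (B),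
        the expectation of \<open>T\<close> collapses (C), and \<open>e2\<close> is compared with
        the Gaussian value (Dd). Passing from \<open>eD\<close> to \<open>eY\<close> is the last
        link (E).\<close>
      have A: "cmod (expectation eY - expectation (\<lambda>\<omega>. T n \<omega> * e1 n \<omega>)) \<le> d1 n"
      proof -
        have pt: "cmod (eY \<omega> - T n \<omega> * e1 n \<omega>) \<le> d1 n" for \<omega>
        proof -
          have "cmod (exp (\<i> * complex_of_real (\<Sum>j=k n+1..p n. t * \<theta> n \<omega> * \<xi> n j \<omega>))
             - T n \<omega> * complex_of_real (exp (- (\<Sum>j=k n+1..p n. (t * \<theta> n \<omega> * \<xi> n j \<omega>)\<^sup>2) / 2)))
            \<le> 2 * (\<bar>t\<bar> * (1 / sqrt \<epsilon>) * (c / sqrt (real n))) * (\<Sum>j=k n+1..p n. (t * \<theta> n \<omega> * \<xi> n j \<omega>)\<^sup>2)"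
            unfolding T_def
          proof (rule norm_iexp_sum_diff_le)
            fix j assume "j \<in> {k n+1..p n}"
            then show "\<bar>t * \<theta> n \<omega> * \<xi> n j \<omega>\<bar> \<le> \<bar>t\<bar> * (1 / sqrt \<epsilon>) * (c / sqrt (real n))"
              unfolding abs_mult using \<theta>0 \<theta>1 \<epsilon> by (intro mult_mono bnd n) auto
          qed (use sm in auto)
          also have "\<dots> \<le> d1 n" unfolding d1_def sqx
            using c0 \<epsilon> by (intro mult_left_mono sqle n) auto
          finally show ?thesis unfolding sqx eY_def e1_def by (simp add: Y_def sum_distrib_left)
        qed
        have "cmod (expectation (\<lambda>\<omega>. eY \<omega> - T n \<omega> * e1 n \<omega>)) \<le> expectation (\<lambda>\<omega>. cmod (eY \<omega> - T n \<omega> * e1 n \<omega>))"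
          by (rule integral_norm_bound)
        also have "\<dots> \<le> expectation (\<lambda>\<omega>. d1 n)"
          by (intro integral_mono pt integrable_norm Bochner_Integration.integrable_diff ieY iT1) auto
        finally show ?thesis using ieY iT1 by (simp add: prob_space)
      qed
      have B: "cmod (expectation (\<lambda>\<omega>. T n \<omega> * e1 n \<omega>) - expectation (\<lambda>\<omega>. complex_of_real (e2 n \<omega>) * T n \<omega>)) \<le> K * b n"
      proof -
        have ie: "integrable M (\<lambda>\<omega>. cmod (e1 n \<omega> - complex_of_real (e2 n \<omega>)))"
          by (rule integrable_const_bound[of _ 2])
             (auto simp: e12)
        have "cmod (expectation (\<lambda>\<omega>. T n \<omega> * e1 n \<omega> - complex_of_real (e2 n \<omega>) * T n \<omega>))
          \<le> expectation (\<lambda>\<omega>. cmod (T n \<omega> * e1 n \<omega> - complex_of_real (e2 n \<omega>) * T n \<omega>))"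
          by (rule integral_norm_bound)
        also have "\<dots> \<le> expectation (\<lambda>\<omega>. K * cmod (e1 n \<omega> - complex_of_real (e2 n \<omega>)))"
        proof (rule integral_mono[OF integrable_norm[OF Bochner_Integration.integrable_diff[OF iT1 iT2]] integrable_mult_right[OF ie]])
          fix \<omega>
          have "T n \<omega> * e1 n \<omega> - complex_of_real (e2 n \<omega>) * T n \<omega> = T n \<omega> * (e1 n \<omega> - complex_of_real (e2 n \<omega>))"
            by (simp add: algebra_simps)
          then show "cmod (T n \<omega> * e1 n \<omega> - complex_of_real (e2 n \<omega>) * T n \<omega>) \<le> K * cmod (e1 n \<omega> - complex_of_real (e2 n \<omega>))"
            using TK[OF n] by (simp add: norm_mult mult_right_mono)
        qed
        also have "\<dots> = K * b n" by (simp add: b_def)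
        finally show ?thesis using iT1 iT2 by simp
      qed
      have C: "expectation (\<lambda>\<omega>. complex_of_real (e2 n \<omega>) * T n \<omega>) = complex_of_real (expectation (e2 n))"
      proof -
        have "expectation (\<lambda>\<omega>. complex_of_real (e2 n \<omega>) * (\<Prod>j=k n+1..p n. 1 + \<i> * complex_of_real ((t * \<theta> n \<omega>) * \<xi> n j \<omega>)))
          = complex_of_real (expectation (e2 n))"
          by (intro expectation_prod_mart_diff md e2m bounded_fun_intros \<theta>b kp bounded_funI[OF e2b]
                borel_measurable_times borel_measurable_const \<theta>m)
        then show ?thesis by (simp add: T_def mult.assoc)
      qed
      have ie2: "integrable M (e2 n)" by (intro integrable_bounded_fun bounded_funI[OF e2b]) auto
      \<comment> \<open>The two exponentials agree where \<open>\<iota>\<close> is 1; where it is 0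
        they differ by less than 1.\<close>
      have Dd: "\<bar>expectation (e2 n) - exp (- t\<^sup>2 / 2)\<bar> \<le> g n"
      proof -
        have "\<bar>expectation (\<lambda>\<omega>. e2 n \<omega> - exp (- t\<^sup>2 / 2))\<bar> \<le> expectation (\<lambda>\<omega>. \<bar>e2 n \<omega> - exp (- t\<^sup>2 / 2)\<bar>)"
          by (rule integral_abs_bound)
        also have "\<dots> \<le> expectation (\<lambda>\<omega>. 1 - \<iota> n \<omega>)"
          by (rule integral_mono[OF integrable_abs[OF Bochner_Integration.integrable_diff[OF ie2 integrable_const]] i\<iota>])
             (auto simp: e2_def \<iota>_def)
        finally show ?thesis using E\<iota>[of n] ie2 by (simp add: prob_space)
      qed
      have E: "cmod (expectation eD - expectation eY) \<le> 2 * g n + \<eta> * ED n + expectation (\<delta> n)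
         + (\<eta> + t\<^sup>2 / (4 * \<eta> * \<epsilon>) * expectation (\<lambda>\<omega>. (D n \<omega> - Y n \<omega>)\<^sup>2))"
      proof -
        have pt: "cmod (eD \<omega> - eY \<omega>) \<le> 2 * (1 - \<iota> n \<omega>) + \<eta> * (D n \<omega>)\<^sup>2 + \<delta> n \<omega> + (\<eta> + t\<^sup>2 / (4 * \<eta> * \<epsilon>) * (D n \<omega> - Y n \<omega>)\<^sup>2)" for \<omega>
        proof -
          have le: "cmod (eD \<omega> - eY \<omega>) \<le> min 2 \<bar>t * (D n \<omega> / sqrt (V n \<omega>)) - t * \<theta> n \<omega> * Y n \<omega>\<bar>"
            unfolding eD_def eY_def by (rule norm_iexp_diff_le_min)
          define u where "u = t\<^sup>2 / (4 * \<eta> * \<epsilon>) * (D n \<omega> - Y n \<omega>)\<^sup>2"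
          define v where "v = \<eta> * (D n \<omega>)\<^sup>2"
          have nn: "0 \<le> \<eta> * (D n \<omega>)\<^sup>2" "0 \<le> \<delta> n \<omega>" "0 \<le> t\<^sup>2 / (4 * \<eta> * \<epsilon>) * (D n \<omega> - Y n \<omega>)\<^sup>2"
            using \<eta> \<epsilon> by (auto simp: \<delta>_def)
          \<comment> \<open>Applied to D times the change of scale, and to 1 times the rescaled
            difference of D and Y; the small factor \<eta> goes to the terms that are only
            bounded.\<close>
          have amgm: "\<bar>x * y\<bar> \<le> \<eta> * x\<^sup>2 + y\<^sup>2 / (4 * \<eta>)" for x y :: real
          proof -
            have "0 \<le> (2 * \<eta> * \<bar>x\<bar> - \<bar>y\<bar>)\<^sup>2 / (4 * \<eta>)" using \<eta> by simp
            also have "\<dots> = \<eta> * x\<^sup>2 + y\<^sup>2 / (4 * \<eta>) - \<bar>x * y\<bar>"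
              using \<eta> by (simp add: power2_diff power_mult_distrib abs_mult field_simps) (simp add: power2_eq_square)
            finally show ?thesis by simp
          qed
          show ?thesis
          proof (cases "V (k n) \<omega> > \<epsilon>")
            case False
            then have "\<iota> n \<omega> = 0" by (simp add: \<iota>_def)
            moreover have "cmod (eD \<omega> - eY \<omega>) \<le> 2" using le by linarith
            ultimately show ?thesis using nn \<eta> unfolding u_def[symmetric] v_def[symmetric] by simp
          next
            case True
            then have th: "\<theta> n \<omega> = 1 / sqrt (V (k n) \<omega>)" "\<iota> n \<omega> = 1" by (auto simp: \<theta>_def \<iota>_def)
            define x where "x = t * (1 / sqrt (V n \<omega>) - \<theta> n \<omega>)"
            have "t * (D n \<omega> / sqrt (V n \<omega>)) - t * \<theta> n \<omega> * Y n \<omega> = D n \<omega> * x + t * \<theta> n \<omega> * (D n \<omega> - Y n \<omega>)"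
              by (simp add: x_def algebra_simps)
            then have "\<bar>t * (D n \<omega> / sqrt (V n \<omega>)) - t * \<theta> n \<omega> * Y n \<omega>\<bar> \<le> \<bar>D n \<omega> * x\<bar> + \<bar>1 * (t * \<theta> n \<omega> * (D n \<omega> - Y n \<omega>))\<bar>"
              by simp
            also have "\<dots> \<le> \<eta> * (D n \<omega>)\<^sup>2 + x\<^sup>2 / (4 * \<eta>) + (\<eta> * 1\<^sup>2 + (t * \<theta> n \<omega> * (D n \<omega> - Y n \<omega>))\<^sup>2 / (4 * \<eta>))"
              by (intro add_mono amgm)
            also have "(t * \<theta> n \<omega> * (D n \<omega> - Y n \<omega>))\<^sup>2 / (4 * \<eta>) \<le> t\<^sup>2 / (4 * \<eta> * \<epsilon>) * (D n \<omega> - Y n \<omega>)\<^sup>2"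
            proof -
              have "(t * \<theta> n \<omega> * (D n \<omega> - Y n \<omega>))\<^sup>2 / (4 * \<eta>) = (t\<^sup>2 * (D n \<omega> - Y n \<omega>)\<^sup>2 / (4 * \<eta>)) * (\<theta> n \<omega>)\<^sup>2"
                by (simp add: power_mult_distrib)
              also have "\<dots> \<le> (t\<^sup>2 * (D n \<omega> - Y n \<omega>)\<^sup>2 / (4 * \<eta>)) * (1 / \<epsilon>)"
                using \<eta> by (intro mult_left_mono \<theta>2) auto
              finally show ?thesis by (simp add: mult.commute)
            qed
            finally have *: "\<bar>t * (D n \<omega> / sqrt (V n \<omega>)) - t * \<theta> n \<omega> * Y n \<omega>\<bar>
               \<le> \<eta> * (D n \<omega>)\<^sup>2 + x\<^sup>2 / (4 * \<eta>) + (\<eta> + t\<^sup>2 / (4 * \<eta> * \<epsilon>) * (D n \<omega> - Y n \<omega>)\<^sup>2)" by simp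
            have "\<delta> n \<omega> = min 2 (x\<^sup>2 / (4 * \<eta>))"
              by (simp add: \<delta>_def x_def th power_mult_distrib)
            \<comment> \<open>Either the cap 2 in \<open>\<delta>\<close> is attained and already
              dominates the trivial bound 2, or \<open>\<delta>\<close> is the full error term and
              the second bound applies.\<close>
            moreover have "a \<le> 2 * (1 - i) + v' + d + (\<eta> + u')"
              if "d = min 2 X" "b \<le> v' + X + (\<eta> + u')" "a \<le> min 2 b" "0 \<le> v'" "0 \<le> u'" "i = 1"
              for a b X v' u' d i :: real
              using that \<eta> by (auto simp: min_def split: if_splits)
            ultimately show ?thesis using * le nn(1,3) th(2) by blast
          qed
        qed
        have i1: "integrable M (\<lambda>\<omega>. (D n \<omega>)\<^sup>2)" "integrable M (\<lambda>\<omega>. (D n \<omega> - Y n \<omega>)\<^sup>2)"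
          by (intro integrable_bounded_fun bounded_fun_intros D Yb; measurable)+
        have i2: "integrable M (\<delta> n)"
          using \<eta> by (intro integrable_const_bound[of _ 2] AE_I2) (auto simp: \<delta>_def abs_if min_def not_less intro: order_trans[of _ 0])
        have "cmod (expectation (\<lambda>\<omega>. eD \<omega> - eY \<omega>)) \<le> expectation (\<lambda>\<omega>. cmod (eD \<omega> - eY \<omega>))"
          by (rule integral_norm_bound)
        also have "\<dots> \<le> expectation (\<lambda>\<omega>. 2 * (1 - \<iota> n \<omega>) + \<eta> * (D n \<omega>)\<^sup>2 + \<delta> n \<omega> + (\<eta> + t\<^sup>2 / (4 * \<eta> * \<epsilon>) * (D n \<omega> - Y n \<omega>)\<^sup>2))"
          by (intro integral_mono pt integrable_norm Bochner_Integration.integrable_diff Bochner_Integration.integrable_add integrable_mult_right ieD ieY i1 i2 i\<iota>) auto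
        also have "\<dots> = expectation (\<lambda>\<omega>. 2 * (1 - \<iota> n \<omega>)) + \<eta> * expectation (\<lambda>\<omega>. (D n \<omega>)\<^sup>2) + expectation (\<delta> n) + (\<eta> + t\<^sup>2 / (4 * \<eta> * \<epsilon>) * expectation (\<lambda>\<omega>. (D n \<omega> - Y n \<omega>)\<^sup>2))"
          using i1 i2 integrable_mult_right[OF i\<iota>, of 2 n] by (simp add: prob_space del: integral_mult_right_zero)
        also have "\<dots> \<le> 2 * g n + \<eta> * ED n + expectation (\<delta> n) + (\<eta> + t\<^sup>2 / (4 * \<eta> * \<epsilon>) * expectation (\<lambda>\<omega>. (D n \<omega> - Y n \<omega>)\<^sup>2))"
        proof -
          have "expectation (\<lambda>\<omega>. 2 * (1 - \<iota> n \<omega>)) = 2 * expectation (\<lambda>\<omega>. 1 - \<iota> n \<omega>)"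
            by (rule integral_mult_right_zero)
          then have "expectation (\<lambda>\<omega>. 2 * (1 - \<iota> n \<omega>)) \<le> 2 * g n" using E\<iota>[of n] by linarith
          moreover have "\<eta> * expectation (\<lambda>\<omega>. (D n \<omega>)\<^sup>2) \<le> \<eta> * ED n"
            using ED[OF n] \<eta> by (intro mult_left_mono) auto
          ultimately show ?thesis by (intro add_mono order_refl)
        qed
        finally show ?thesis using ieD ieY by simp
      qed
      have Dd': "cmod (complex_of_real (expectation (e2 n)) - complex_of_real (exp (- t\<^sup>2 / 2))) \<le> g n"
        using Dd by (simp only: of_real_diff[symmetric] norm_of_real)
      have tri: "cmod (a - e) \<le> cmod (a - b) + cmod (b - c) + cmod (c - d) + cmod (d - e)" for a b c d e
        using norm_triangle_ineq[of "a - b" "b - c"] norm_triangle_ineq[of "a - c" "c - d"] norm_triangle_ineq[of "a - d" "d - e"]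
        by simp
      show ?thesis
        using tri[of "expectation eD" "complex_of_real (exp (- t\<^sup>2 / 2))" "expectation eY" "expectation (\<lambda>\<omega>. T n \<omega> * e1 n \<omega>)" "complex_of_real (expectation (e2 n))"]
          A B E Dd' unfolding C eD_def s_def by linarith
    qed
    have "\<forall>\<^sub>F n in sequentially. cmod (expectation (\<lambda>\<omega>. exp (\<i> * complex_of_real (t * (D n \<omega> / sqrt (V n \<omega>))))) - complex_of_real (exp (- t\<^sup>2 / 2))) < r"
      using s_ev small_ev eventually_ge_at_top[of 1]
      by eventually_elim (use main in \<open>meson less_imp_le order.strict_trans1\<close>)
    then show "\<exists>no. \<forall>n\<ge>no. norm (expectation (\<lambda>\<omega>. exp (\<i> * complex_of_real (t * (D n \<omega> / sqrt (V n \<omega>))))) - complex_of_real (exp (- t\<^sup>2 / 2))) < r"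
      by (simp only: eventually_sequentially)
  qed
qed

end

subsection \<open>Hypergeometric moments and the filtration of the urn\<close>

text \<open>Absorption turns k (h choose k) into h (h - 1 choose k - 1), and Vandermonde's
  convolution sums what is left.\<close>

lemma sum_binomial_falling1:
  "(\<Sum>k\<le>Suc n. k * (h choose k) * (d choose (Suc n - k))) = h * ((h + d - 1) choose n)"
proof (cases h)
  case (Suc h')
  have "(\<Sum>k\<le>Suc n. k * (h choose k) * (d choose (Suc n - k)))
    = (\<Sum>k\<le>n. Suc k * (h choose Suc k) * (d choose (n - k)))"
    by (subst sum.atMost_Suc_shift) simp
  also have "\<dots> = (\<Sum>k\<le>n. h * ((h' choose k) * (d choose (n - k))))"
    unfolding binomial_absorption Suc by (simp only: diff_Suc_1 mult.assoc)
  also have "\<dots> = h * ((h' + d) choose n)"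
    by (simp only: sum_distrib_left[symmetric] vandermonde)
  finally show ?thesis by (simp add: Suc)
qed auto

text \<open>One absorption step lowers h and k by one and leaves the first falling moment. Falling
  powers are used because absorption removes exactly one factor at a time.\<close>

lemma sum_binomial_falling2:
  "(\<Sum>k\<le>Suc (Suc n). k * (k - 1) * (h choose k) * (d choose (Suc (Suc n) - k)))
    = h * (h - 1) * ((h + d - 2) choose n)"
proof (cases h)
  case (Suc h')
  have "(\<Sum>k\<le>Suc (Suc n). k * (k - 1) * (h choose k) * (d choose (Suc (Suc n) - k)))
    = (\<Sum>k\<le>Suc n. k * (Suc k * (h choose Suc k)) * (d choose (Suc n - k)))"
    by (subst sum.atMost_Suc_shift) (simp only: diff_Suc_1 diff_Suc_Suc mult_0 add_0 mult_ac)
  also have "\<dots> = (\<Sum>k\<le>Suc n. h * (k * (h' choose k) * (d choose (Suc n - k))))"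
    unfolding binomial_absorption Suc by (simp only: mult_ac diff_Suc_1)
  also have "\<dots> = h * (h' * ((h' + d - 1) choose n))"
    by (simp only: sum_distrib_left[symmetric] sum_binomial_falling1)
  moreover have "h + d - 2 = h' + d - 1" "h - 1 = h'" using Suc by auto
  ultimately show ?thesis by (simp only: mult.assoc)
qed auto

text \<open>The fixed range up to \<open>C\<close> replaces the sample size as upper end, since the
  sample size will be random and the sum has to be exchanged with an expectation.\<close>

lemma sum_hypergeom_mass:
  assumes "n \<le> C"
  shows "(\<Sum>k\<le>C. f k * hypergeom_mass n (h + d) h k)
    = (\<Sum>k\<le>n. f k * real ((h choose k) * (d choose (n - k)))) / real ((h + d) choose n)"
proof -
  have "(\<Sum>k\<le>C. f k * hypergeom_mass n (h + d) h k) = (\<Sum>k\<le>n. f k * hypergeom_mass n (h + d) h k)"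
    using assms by (intro sum.mono_neutral_right) (auto simp: hypergeom_mass_def)
  then show ?thesis by (simp add: hypergeom_mass_def sum_divide_distrib)
qed

lemma hypergeom_mass_total:
  assumes "n \<le> C" "n \<le> h + d"
  shows "(\<Sum>k\<le>C. hypergeom_mass n (h + d) h k) = 1"
proof -
  have "(\<Sum>k\<le>C. 1 * hypergeom_mass n (h + d) h k) = 1"
    unfolding sum_hypergeom_mass[OF assms(1)]
    using assms(2) by (simp only: mult_1 of_nat_sum[symmetric] vandermonde) simp
  then show ?thesis by simp
qed

lemma hypergeom_mass_mean:
  assumes "n \<le> C" "n \<le> h + d" "1 \<le> n"
  shows "(\<Sum>k\<le>C. real k * hypergeom_mass n (h + d) h k) = real n * (real h / real (h + d))"
proof -
  obtain n' where n: "n = Suc n'" using assms(3) by (cases n) auto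
  have pos: "real ((h + d) choose n) > 0" using assms(2) by simp
  have "(\<Sum>k\<le>n. real k * real ((h choose k) * (d choose (n - k)))) = real (\<Sum>k\<le>n. k * (h choose k) * (d choose (n - k)))"
    by (simp add: mult.assoc)
  also have "\<dots> = real (h * ((h + d - 1) choose n'))" unfolding n sum_binomial_falling1 ..
  finally have 1: "(\<Sum>k\<le>C. real k * hypergeom_mass n (h + d) h k) = real h * real ((h + d - 1) choose n') / real ((h + d) choose n)"
    by (simp only: sum_hypergeom_mass[OF assms(1)] of_nat_mult)
  have 2: "real n * real ((h + d) choose n) = real (h + d) * real ((h + d - 1) choose n')"
    using binomial_absorption[of n' "h + d"] unfolding n by (metis of_nat_mult)
  have "real (h + d) > 0" using assms by simp
  then have "real ((h + d - 1) choose n') = real n * real ((h + d) choose n) / real (h + d)"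
    using 2 by (simp only: nonzero_eq_divide_eq) (simp only: mult.commute)
  then show ?thesis unfolding 1 using pos by simp
qed

lemma hypergeom_mass_factorial_moment:
  assumes "n \<le> C" "n \<le> h + d" "1 \<le> n" "2 \<le> h + d"
  shows "(\<Sum>k\<le>C. real k * (real k - 1) * hypergeom_mass n (h + d) h k)
    = real n * (real n - 1) * (real h / real (h + d)) * ((real h - 1) / (real (h + d) - 1))"
\<comment> \<open>For a sample of size one both sides vanish; the double absorption starts at size
  two.\<close>
proof (cases "n = 1")
  case True
  then show ?thesis
    using sum_hypergeom_mass[OF assms(1), of "\<lambda>k. real k * (real k - 1)" h d] by simp
next
  case False
  then have "n = Suc (Suc (n - 2))" using assms(3) by simp
  then obtain n' where n: "n = Suc (Suc n')" by blast
  have pos: "real ((h + d) choose n) > 0" using assms(2) by simp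
  have km: "real k * (real k - 1) = real (k * (k - 1))" for k
    by (cases k) (auto simp: algebra_simps)
  have "(\<Sum>k\<le>n. real k * (real k - 1) * real ((h choose k) * (d choose (n - k)))) = real (\<Sum>k\<le>n. k * (k - 1) * (h choose k) * (d choose (n - k)))"
    unfolding km by (simp add: mult.assoc del: of_nat_mult flip: of_nat_mult)
  also have "\<dots> = real (h * (h - 1) * ((h + d - 2) choose n'))" unfolding n sum_binomial_falling2 ..
  finally have 1: "(\<Sum>k\<le>C. real k * (real k - 1) * hypergeom_mass n (h + d) h k) = real h * (real h - 1) * real ((h + d - 2) choose n') / real ((h + d) choose n)"
    by (simp only: sum_hypergeom_mass[OF assms(1)] km of_nat_mult)
  have "n * ((h + d) choose n) = (h + d) * ((h + d - 1) choose (n - 1))"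
    using binomial_absorption[of "Suc n'" "h + d"] unfolding n by simp
  moreover have "(n - 1) * ((h + d - 1) choose (n - 1)) = (h + d - 1) * ((h + d - 2) choose n')"
    using binomial_absorption[of n' "h + d - 1"] unfolding n by (simp add: numeral_2_eq_2)
  ultimately have "n * (n - 1) * ((h + d) choose n) = (h + d) * (h + d - 1) * ((h + d - 2) choose n')"
    by (metis mult.assoc mult.commute)
  then have "real n * (real n - 1) * real ((h + d) choose n) = real (h + d) * (real (h + d) - 1) * real ((h + d - 2) choose n')"
    unfolding km by (metis of_nat_mult)
  moreover have "real (h + d) > 0" "real (h + d) - 1 > 0" using assms by simp_all
  ultimately have E: "real n * (real n - 1) * real ((h + d) choose n) = real (h + d) * (real (h + d) - 1) * real ((h + d - 2) choose n')"
    and P: "real (h + d) * (real (h + d) - 1) \<noteq> 0" by auto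
  have "real ((h + d - 2) choose n') = real n * (real n - 1) * real ((h + d) choose n) / (real (h + d) * (real (h + d) - 1))"
    unfolding E by (rule nonzero_mult_div_cancel_left[OF P, symmetric])
  then show ?thesis unfolding 1 using pos by simp
qed

lemma subalgebra_vimage_algebra:
  assumes "f \<in> measurable M' N'"
  shows "subalgebra M' (vimage_algebra (space M') f N')"
  unfolding subalgebra_def using sets_image_in_sets[OF refl assms] by auto

text \<open>Trades a conditional expectation for its defining property against bounded test
  functions, the only form in which it is used later.\<close>

lemma (in prob_space) expectation_real_cond_exp:
  assumes "subalgebra M G" "f \<in> borel_measurable G" "bounded_fun f" "integrable M h"
  shows "integrable M (\<lambda>\<omega>. f \<omega> * real_cond_exp M G h \<omega>)"
    and "expectation (\<lambda>\<omega>. f \<omega> * real_cond_exp M G h \<omega>) = expectation (\<lambda>\<omega>. f \<omega> * h \<omega>)"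
proof -
  interpret G: finite_measure_subalgebra M G by unfold_locales (fact assms)
  obtain c where c: "\<And>\<omega>. \<bar>f \<omega>\<bar> \<le> c" using assms(3) by (auto simp: bounded_fun_def)
  have [measurable]: "f \<in> borel_measurable M" using measurable_from_subalg[OF assms(1,2)] .
  have "integrable M (\<lambda>\<omega>. f \<omega> * h \<omega>)"
  proof (rule Bochner_Integration.integrable_bound)
    show "integrable M (\<lambda>\<omega>. c * h \<omega>)" using assms(4) by simp
    show "AE \<omega> in M. norm (f \<omega> * h \<omega>) \<le> norm (c * h \<omega>)"
      using c by (intro AE_I2) (auto simp: abs_mult intro!: mult_right_mono order_trans[OF c])
  qed (use assms(4) in measurable)
  from G.real_cond_exp_intg[OF this assms(2)] assms(4)
  show "integrable M (\<lambda>\<omega>. f \<omega> * real_cond_exp M G h \<omega>)"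
    and "expectation (\<lambda>\<omega>. f \<omega> * real_cond_exp M G h \<omega>) = expectation (\<lambda>\<omega>. f \<omega> * h \<omega>)"
    by auto
qed

context hypergeom_urn
begin

abbreviation "F \<equiv> urn_F M N X A B"
abbreviation "FN \<equiv> urn_FN M N X A B"
abbreviation "FNX \<equiv> urn_FNX M N X A B"
abbreviation "urnH \<equiv> urn_H a X A"
abbreviation "urnK \<equiv> urn_K b N X B"
abbreviation "urnS \<equiv> urn_S a b N X A B"

section \<open>The three sigma-algebras of a drawing step and measurability with respect to
  them\<close>

lemma urn_hist_measurable: "urn_hist N X A B n \<in> measurable M (hist_space n)"
proof -
  note [measurable] = rv_N rv_X rv_A rv_B
  have "(\<lambda>\<omega>. (N j \<omega>, X j \<omega>, A j \<omega>, B j \<omega>)) \<in> measurable M (count_space UNIV)" if "1 \<le> j" for j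
  proof -
    have "(\<lambda>\<omega>. (N j \<omega>, X j \<omega>, A j \<omega>, B j \<omega>)) \<in> measurable M (count_space UNIV \<Otimes>\<^sub>M (count_space UNIV \<Otimes>\<^sub>M (count_space UNIV \<Otimes>\<^sub>M count_space UNIV)))"
      using rv_N[OF that] rv_X[OF that] rv_A[OF that] rv_B[OF that] by (intro measurable_Pair)
    then show ?thesis by (simp add: pair_measure_countable)
  qed
  then show ?thesis unfolding urn_hist_def hist_space_def by (intro measurable_restrict) auto
qed

lemma space_subalgebras [simp]: "space (F n) = space M" "space (FN n) = space M" "space (FNX n) = space M"
  by (simp_all add: urn_F_def urn_FN_def urn_FNX_def)

lemma subalgebra_F: "subalgebra M (F n)"
  unfolding urn_F_def by (rule subalgebra_vimage_algebra[OF urn_hist_measurable])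

lemma subalgebra_FN: "1 \<le> n \<Longrightarrow> subalgebra M (FN n)"
  unfolding urn_FN_def
  by (rule subalgebra_vimage_algebra) (intro measurable_Pair urn_hist_measurable rv_N)

lemma subalgebra_FNX: "1 \<le> n \<Longrightarrow> subalgebra M (FNX n)"
  unfolding urn_FNX_def
  by (rule subalgebra_vimage_algebra) (intro measurable_Pair urn_hist_measurable rv_N rv_X)

lemma hist_measurable_F: "urn_hist N X A B n \<in> measurable (F n) (hist_space n)"
  unfolding urn_F_def
  by (rule measurable_vimage_algebra1) (use measurable_space[OF urn_hist_measurable] in auto)

text \<open>The earlier history is the restriction of the later one to a smaller index set; this
  makes the sigma-algebras increase.\<close>

lemma hist_measurable_F_mono:
  assumes "m \<le> n"
  shows "urn_hist N X A B m \<in> measurable (F n) (hist_space m)"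
proof -
  have "(\<lambda>\<omega>. restrict (urn_hist N X A B n \<omega>) {1..m}) \<in> measurable (F n) (hist_space m)"
    using assms measurable_compose[OF hist_measurable_F[of n, unfolded hist_space_def] measurable_restrict_subset[of "{1..m}" "{1..n}"]]
    by (simp add: hist_space_def)
  moreover have "(\<lambda>\<omega>. restrict (urn_hist N X A B n \<omega>) {1..m}) = urn_hist N X A B m"
    using assms by (auto simp: urn_hist_def fun_eq_iff)
  ultimately show ?thesis by simp
qed

lemma F_mono: "m \<le> n \<Longrightarrow> subalgebra (F n) (F m)"
  using subalgebra_vimage_algebra[OF hist_measurable_F_mono[of m n]]
  by (simp add: urn_F_def[of M N X A B m])

sublocale filtered_prob_space M F
  by unfold_locales (auto intro: subalgebra_F F_mono)

lemma measurable_F: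
  assumes "1 \<le> j" "j \<le> n"
  shows "N j \<in> measurable (F n) (count_space UNIV)" "X j \<in> measurable (F n) (count_space UNIV)"
    "A j \<in> measurable (F n) (count_space UNIV)" "B j \<in> measurable (F n) (count_space UNIV)"
proof -
  have *: "(\<lambda>\<omega>. urn_hist N X A B n \<omega> j) \<in> measurable (F n) (count_space UNIV)"
    using assms measurable_compose[OF hist_measurable_F[of n, unfolded hist_space_def] measurable_component_singleton[of j "{1..n}"]]
    by simp
  have "(\<lambda>\<omega>. f (urn_hist N X A B n \<omega> j)) \<in> measurable (F n) (count_space UNIV)" for f :: "nat \<times> nat \<times> nat \<times> nat \<Rightarrow> nat"
    by (rule measurable_compose[OF *]) simp
  from this[of fst] this[of "fst \<circ> snd"] this[of "fst \<circ> snd \<circ> snd"] this[of "snd \<circ> snd \<circ> snd"]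
  show "N j \<in> measurable (F n) (count_space UNIV)" "X j \<in> measurable (F n) (count_space UNIV)"
    "A j \<in> measurable (F n) (count_space UNIV)" "B j \<in> measurable (F n) (count_space UNIV)"
    using assms by (simp_all add: urn_hist_def)
qed

lemma measurable_FN_pair: "1 \<le> n \<Longrightarrow> (\<lambda>\<omega>. (urn_hist N X A B (n - 1) \<omega>, N n \<omega>)) \<in> measurable (FN n) (hist_space (n - 1) \<Otimes>\<^sub>M count_space UNIV)"
  unfolding urn_FN_def
  by (rule measurable_vimage_algebra1)
     (use measurable_space[OF urn_hist_measurable] in \<open>auto simp: space_pair_measure\<close>)

lemma measurable_FNX_triple: "1 \<le> n \<Longrightarrow> (\<lambda>\<omega>. (urn_hist N X A B (n - 1) \<omega>, N n \<omega>, X n \<omega>)) \<in> measurable (FNX n) (hist_space (n - 1) \<Otimes>\<^sub>M (count_space UNIV \<Otimes>\<^sub>M count_space UNIV))"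
  unfolding urn_FNX_def
  by (rule measurable_vimage_algebra1)
     (use measurable_space[OF urn_hist_measurable] in \<open>auto simp: space_pair_measure\<close>)

lemma subalgebra_FN_F: 
  assumes "1 \<le> n" shows "subalgebra (FN n) (F (n - 1))"
proof -
  have "urn_hist N X A B (n - 1) \<in> measurable (FN n) (hist_space (n - 1))"
    using measurable_compose[OF measurable_FN_pair[OF assms] measurable_fst] by simp
  from subalgebra_vimage_algebra[OF this] show ?thesis by (simp add: urn_F_def)
qed

lemma N_measurable_FN: "1 \<le> n \<Longrightarrow> N n \<in> measurable (FN n) (count_space UNIV)"
  using measurable_compose[OF measurable_FN_pair measurable_snd] by simp

lemma subalgebra_FNX_FN:
  assumes "1 \<le> n" shows "subalgebra (FNX n) (FN n)"
proof -
  have "(\<lambda>\<omega>. (urn_hist N X A B (n - 1) \<omega>, N n \<omega>)) \<in> measurable (FNX n) (hist_space (n - 1) \<Otimes>\<^sub>M count_space UNIV)"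
    using measurable_compose[OF measurable_FNX_triple[OF assms] measurable_fst]
      measurable_compose[OF measurable_compose[OF measurable_FNX_triple[OF assms] measurable_snd] measurable_fst]
    by (intro measurable_Pair) simp_all
  from subalgebra_vimage_algebra[OF this] show ?thesis by (simp add: urn_FN_def)
qed

lemma X_measurable_FNX: "1 \<le> n \<Longrightarrow> X n \<in> measurable (FNX n) (count_space UNIV)"
  using measurable_compose[OF measurable_compose[OF measurable_FNX_triple measurable_snd] measurable_snd] by simp

lemma measurable_F_imp_FN: "1 \<le> n \<Longrightarrow> f \<in> measurable (F (n - 1)) L \<Longrightarrow> f \<in> measurable (FN n) L"
  using measurable_from_subalg[OF subalgebra_FN_F] .

lemma measurable_FN_imp_FNX: "1 \<le> n \<Longrightarrow> f \<in> measurable (FN n) L \<Longrightarrow> f \<in> measurable (FNX n) L"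
  using measurable_from_subalg[OF subalgebra_FNX_FN] .

lemma measurable_FN_imp_M: "1 \<le> n \<Longrightarrow> f \<in> measurable (FN n) L \<Longrightarrow> f \<in> measurable M L"
  using measurable_from_subalg[OF subalgebra_FN] .

lemma measurable_FNX_imp_M: "1 \<le> n \<Longrightarrow> f \<in> measurable (FNX n) L \<Longrightarrow> f \<in> measurable M L"
  using measurable_from_subalg[OF subalgebra_FNX] .

lemma urn_HKS_measurable:
  "urnH n \<in> measurable (F n) (count_space UNIV)"
  "urnK n \<in> measurable (F n) (count_space UNIV)"
  "urnS n \<in> measurable (F n) (count_space UNIV)"
proof -
  have s: "(\<lambda>\<omega>. \<Sum>j=1..n. f j \<omega>) \<in> measurable (F n) (count_space UNIV)"
    if "\<And>j. j \<in> {1..n} \<Longrightarrow> f j \<in> measurable (F n) (count_space UNIV)" for f :: "nat \<Rightarrow> 'a \<Rightarrow> nat"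
    using borel_measurable_sum[of "{1..n}" f "F n"] that by (simp cong: measurable_cong_sets)
  have op: "(\<lambda>\<omega>. h (f \<omega>) (g \<omega>)) \<in> measurable (F n) (count_space UNIV)"
    if "f \<in> measurable (F n) (count_space UNIV)" "g \<in> measurable (F n) (count_space UNIV)"
    for h :: "nat \<Rightarrow> nat \<Rightarrow> nat" and f g
    using that by measurable
  show 1: "urnH n \<in> measurable (F n) (count_space UNIV)"
    unfolding urn_H_def[abs_def]
    by (intro op[of "\<lambda>_. a" _ "(+)"] s op[of _ _ "(*)"] measurable_F) auto
  show 2: "urnK n \<in> measurable (F n) (count_space UNIV)"
    unfolding urn_K_def[abs_def]
    by (intro op[of "\<lambda>_. b" _ "(+)"] s op[of _ _ "(*)"] op[of _ _ "(-)"] measurable_F) auto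
  show "urnS n \<in> measurable (F n) (count_space UNIV)"
    unfolding urn_S_def[abs_def] by (intro op[of _ _ "(+)"] 1 2)
qed

section \<open>Conditional laws tested against bounded functions\<close>

lemma cond_mass_expectation:
  assumes "subalgebra M G" "f \<in> borel_measurable G" "bounded_fun f" "Y \<in> measurable M (count_space UNIV)"
  shows "integrable M (\<lambda>\<omega>. f \<omega> * cond_mass M G Y k \<omega>)"
    and "expectation (\<lambda>\<omega>. f \<omega> * cond_mass M G Y k \<omega>) = expectation (\<lambda>\<omega>. f \<omega> * of_bool (Y \<omega> = k))"
proof -
  have [measurable]: "Y \<in> measurable M (count_space UNIV)" by fact
  have S: "{\<omega> \<in> space M. Y \<omega> = k} \<in> sets M" by measurable
  then have i: "integrable M (indicator {\<omega> \<in> space M. Y \<omega> = k} :: 'a \<Rightarrow> real)"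
    by (intro integrable_const_bound[of _ 1]) (auto simp: indicator_def)
  show "integrable M (\<lambda>\<omega>. f \<omega> * cond_mass M G Y k \<omega>)"
    unfolding cond_mass_def by (rule expectation_real_cond_exp[OF assms(1-3) i])
  have "expectation (\<lambda>\<omega>. f \<omega> * cond_mass M G Y k \<omega>) = expectation (\<lambda>\<omega>. f \<omega> * indicator {\<omega> \<in> space M. Y \<omega> = k} \<omega>)"
    unfolding cond_mass_def by (rule expectation_real_cond_exp[OF assms(1-3) i])
  also have "\<dots> = expectation (\<lambda>\<omega>. f \<omega> * of_bool (Y \<omega> = k))"
    by (intro Bochner_Integration.integral_cong) (auto simp: indicator_def)
  finally show "expectation (\<lambda>\<omega>. f \<omega> * cond_mass M G Y k \<omega>) = expectation (\<lambda>\<omega>. f \<omega> * of_bool (Y \<omega> = k))" .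
qed

text \<open>The upper end of the concentration set is random, so the event is split by the countably
  many values s of \<open>urnS (n - 1)\<close>. On each of these events of the past the masses on 1,
  ..., s sum to 1, so N_n lies there almost surely.\<close>

lemma AE_N_range:
  assumes n: "1 \<le> n"
  shows "AE \<omega> in M. 1 \<le> N n \<omega> \<and> N n \<omega> \<le> urnS (n - 1) \<omega>"
proof -
  note [measurable] = rv_N[OF n] measurable_F_imp_M[OF urn_HKS_measurable(3)[of "n-1"]]
  have "AE \<omega> in M. urnS (n - 1) \<omega> = s \<longrightarrow> 1 \<le> N n \<omega> \<and> N n \<omega> \<le> s" for s
  proof -
    define f :: "'a \<Rightarrow> real" where "f \<omega> = of_bool (urnS (n - 1) \<omega> = s)" for \<omega>
    have fm: "f \<in> borel_measurable (F (n - 1))"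
      unfolding f_def by (rule measurable_compose[OF urn_HKS_measurable(3)]) simp
    have [measurable]: "f \<in> borel_measurable M" using measurable_F_imp_M[OF fm] .
    have fb: "bounded_fun f" by (rule bounded_funI[of _ 1]) (simp add: f_def)
    have [measurable]: "(\<lambda>\<omega>. of_bool (N n \<omega> \<in> {1..s}) :: real) \<in> borel_measurable M"
      by (rule measurable_compose[OF rv_N[OF n]]) simp
    note cm = cond_mass_expectation[OF subalgebra_F[of "n-1"] fm fb rv_N[OF n]]
    have "expectation f = expectation (\<lambda>\<omega>. \<Sum>k=1..s. f \<omega> * cond_mass M (F (n - 1)) (N n) k \<omega>)"
    proof (rule integral_cong_AE)
      show "(\<lambda>\<omega>. \<Sum>k=1..s. f \<omega> * cond_mass M (F (n - 1)) (N n) k \<omega>) \<in> borel_measurable M"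
        using cm(1) by (intro borel_measurable_sum) auto
      show "AE \<omega> in M. f \<omega> = (\<Sum>k=1..s. f \<omega> * cond_mass M (F (n - 1)) (N n) k \<omega>)"
        using N_conc[OF n] by eventually_elim (auto simp: f_def)
    qed simp
    also have "\<dots> = (\<Sum>k=1..s. expectation (\<lambda>\<omega>. f \<omega> * of_bool (N n \<omega> = k)))"
      using cm by (subst Bochner_Integration.integral_sum) auto
    also have "\<dots> = expectation (\<lambda>\<omega>. \<Sum>k=1..s. f \<omega> * of_bool (N n \<omega> = k))"
      by (intro Bochner_Integration.integral_sum[symmetric] integrable_const_bound[of _ 1] AE_I2, simp add: f_def, measurable)
    also have "\<dots> = expectation (\<lambda>\<omega>. f \<omega> * of_bool (N n \<omega> \<in> {1..s}))"
      by (intro Bochner_Integration.integral_cong) (auto simp: sum_distrib_left[symmetric] of_bool_def sum.delta)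
    finally have e: "expectation f = expectation (\<lambda>\<omega>. f \<omega> * of_bool (N n \<omega> \<in> {1..s}))" .
    have i: "integrable M f" "integrable M (\<lambda>\<omega>. f \<omega> * of_bool (N n \<omega> \<in> {1..s}))"
      by (intro integrable_const_bound[of _ 1] AE_I2, simp add: f_def, measurable)+
    have "expectation (\<lambda>\<omega>. f \<omega> - f \<omega> * of_bool (N n \<omega> \<in> {1..s})) = 0" using e i by simp
    then have "AE \<omega> in M. f \<omega> - f \<omega> * of_bool (N n \<omega> \<in> {1..s}) = 0"
      using integral_nonneg_eq_0_iff_AE[OF Bochner_Integration.integrable_diff[OF i]] by (auto simp: f_def)
    then show ?thesis by eventually_elim (auto simp: f_def split: if_splits)
  qed
  then have "AE \<omega> in M. \<forall>s. urnS (n - 1) \<omega> = s \<longrightarrow> 1 \<le> N n \<omega> \<and> N n \<omega> \<le> s"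
    by (intro AE_all_countable[THEN iffD2] allI)
  then show ?thesis by eventually_elim auto
qed

lemma expectation_X_eq:
  assumes n: "1 \<le> n" and f: "f \<in> borel_measurable (FN n)" "bounded_fun f"
  shows "integrable M (\<lambda>\<omega>. f \<omega> * hypergeom_mass (N n \<omega>) (urnS (n - 1) \<omega>) (urnH (n - 1) \<omega>) k)"
    and "expectation (\<lambda>\<omega>. f \<omega> * of_bool (X n \<omega> = k)) =
      expectation (\<lambda>\<omega>. f \<omega> * hypergeom_mass (N n \<omega>) (urnS (n - 1) \<omega>) (urnH (n - 1) \<omega>) k)"
proof -
  note [measurable] = rv_N[OF n] measurable_F_imp_M[OF urn_HKS_measurable(3)[of "n-1"]] measurable_F_imp_M[OF urn_HKS_measurable(1)[of "n-1"]]
    measurable_FN_imp_M[OF n f(1)]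
  note cm = cond_mass_expectation[OF subalgebra_FN[OF n] f rv_X[OF n], of k]
  have m: "(\<lambda>\<omega>. f \<omega> * hypergeom_mass (N n \<omega>) (urnS (n - 1) \<omega>) (urnH (n - 1) \<omega>) k) \<in> borel_measurable M"
    by measurable
  have ae: "AE \<omega> in M. f \<omega> * cond_mass M (FN n) (X n) k \<omega> = f \<omega> * hypergeom_mass (N n \<omega>) (urnS (n - 1) \<omega>) (urnH (n - 1) \<omega>) k"
    using X_hypergeom[OF n, of k] by eventually_elim simp
  show "integrable M (\<lambda>\<omega>. f \<omega> * hypergeom_mass (N n \<omega>) (urnS (n - 1) \<omega>) (urnH (n - 1) \<omega>) k)"
    by (rule Bochner_Integration.integrable_cong_AE_imp[OF cm(1) m]) (use ae in auto)
  show "expectation (\<lambda>\<omega>. f \<omega> * of_bool (X n \<omega> = k)) =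
      expectation (\<lambda>\<omega>. f \<omega> * hypergeom_mass (N n \<omega>) (urnS (n - 1) \<omega>) (urnH (n - 1) \<omega>) k)"
    unfolding cm(2)[symmetric] by (rule integral_cong_AE) (use cm(1) m ae in auto)
qed

text \<open>The hypergeometric mass vanishes above the sample size; testing with the indicator of
  N_n < k, for each of the countably many k, removes the bad values of X_n.\<close>

lemma AE_X_le_N:
  assumes n: "1 \<le> n"
  shows "AE \<omega> in M. X n \<omega> \<le> N n \<omega>"
proof -
  note [measurable] = rv_N[OF n] rv_X[OF n]
  have "AE \<omega> in M. \<not> (N n \<omega> < k \<and> X n \<omega> = k)" for k
  proof -
    define f :: "'a \<Rightarrow> real" where "f \<omega> = of_bool (N n \<omega> < k)" for \<omega>
    have fm: "f \<in> borel_measurable (FN n)"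
      unfolding f_def by (rule measurable_compose[OF N_measurable_FN[OF n]]) simp
    have fb: "bounded_fun f" by (rule bounded_funI[of _ 1]) (simp add: f_def)
    have "expectation (\<lambda>\<omega>. f \<omega> * of_bool (X n \<omega> = k)) = expectation (\<lambda>\<omega>. 0)"
      unfolding expectation_X_eq(2)[OF n fm fb]
      by (intro Bochner_Integration.integral_cong) (auto simp: f_def hypergeom_mass_def)
    moreover have "integrable M (\<lambda>\<omega>. f \<omega> * of_bool (X n \<omega> = k))"
      unfolding f_def by (intro integrable_const_bound[of _ 1] AE_I2, simp, measurable)
    ultimately have "AE \<omega> in M. f \<omega> * of_bool (X n \<omega> = k) = 0"
      by (intro integral_nonneg_eq_0_iff_AE[THEN iffD1]) (auto simp: f_def)
    then show ?thesis by eventually_elim (auto simp: f_def)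
  qed
  then have "AE \<omega> in M. \<forall>k. \<not> (N n \<omega> < k \<and> X n \<omega> = k)" by (intro AE_all_countable[THEN iffD2] allI)
  then show ?thesis by eventually_elim (use linorder_not_less in blast)
qed

text \<open>The sigma-algebras generated by the two factors lie inside the two independent ones, so
  the expectation of the product factorises.\<close>

lemma expectation_AB_indep:
  fixes f :: "nat \<Rightarrow> nat \<Rightarrow> real"
  assumes n: "1 \<le> n" and f: "integrable M (\<lambda>\<omega>. f (A n \<omega>) (B n \<omega>))"
    and G: "G \<in> borel_measurable (FNX n)" "bounded_fun G"
  shows "expectation (\<lambda>\<omega>. f (A n \<omega>) (B n \<omega>) * G \<omega>) = expectation (\<lambda>\<omega>. f (A n \<omega>) (B n \<omega>)) * expectation G"
proof -
  let ?V = "vimage_algebra (space M) (\<lambda>\<omega>. (A n \<omega>, B n \<omega>)) (count_space UNIV \<Otimes>\<^sub>M count_space UNIV)"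
  have Gm: "G \<in> borel_measurable M" using measurable_FNX_imp_M[OF n G(1)] .
  have fm: "(\<lambda>\<omega>. f (A n \<omega>) (B n \<omega>)) \<in> borel_measurable ?V"
  proof -
    have "(\<lambda>\<omega>. (A n \<omega>, B n \<omega>)) \<in> measurable ?V (count_space UNIV \<Otimes>\<^sub>M count_space UNIV)"
      by (rule measurable_vimage_algebra1) (auto simp: space_pair_measure)
    from measurable_compose[OF this, of "\<lambda>(x, y). f x y"] show ?thesis by simp
  qed
  have "indep_var borel (\<lambda>\<omega>. f (A n \<omega>) (B n \<omega>)) borel G"
    unfolding indep_var_eq
  proof (intro conjI)
    show "indep_set (sigma_sets (space M) {(\<lambda>\<omega>. f (A n \<omega>) (B n \<omega>)) -` S \<inter> space M |S. S \<in> sets borel})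
       (sigma_sets (space M) {G -` S \<inter> space M |S. S \<in> sets borel})"
      unfolding indep_set_def
    proof (rule indep_sets_mono_sets[OF AB_indep[OF n, unfolded indep_set_def]])
      fix i :: bool
      have 1: "sigma_sets (space M) {(\<lambda>\<omega>. f (A n \<omega>) (B n \<omega>)) -` S \<inter> space M |S. S \<in> sets borel} \<subseteq> sets ?V"
      proof -
        have "{(\<lambda>\<omega>. f (A n \<omega>) (B n \<omega>)) -` S \<inter> space M |S. S \<in> sets borel} \<subseteq> sets ?V"
          using measurable_sets[OF fm] by auto
        from sets.sigma_sets_subset[OF this] show ?thesis by simp
      qed
      have 2: "sigma_sets (space M) {G -` S \<inter> space M |S. S \<in> sets borel} \<subseteq> sets (FNX n)"
      proof -
        have "{G -` S \<inter> space M |S. S \<in> sets borel} \<subseteq> sets (FNX n)"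
          using measurable_sets[OF G(1)] by auto
        from sets.sigma_sets_subset[OF this] show ?thesis by simp
      qed
      show "(case i of True \<Rightarrow> sigma_sets (space M) {(\<lambda>\<omega>. f (A n \<omega>) (B n \<omega>)) -` S \<inter> space M |S. S \<in> sets borel}
          | False \<Rightarrow> sigma_sets (space M) {G -` S \<inter> space M |S. S \<in> sets borel})
        \<subseteq> (case i of True \<Rightarrow> sets ?V | False \<Rightarrow> sets (FNX n))"
        using 1 2 by (cases i) auto
    qed
  qed (use f Gm in auto)
  from indep_var_lebesgue_integral[OF this f integrable_bounded_fun[OF G(2) Gm]] show ?thesis .
qed

end

subsection \<open>Truncated processes\<close>

lemma (in filtered_prob_space) mart_diffI:
  assumes "\<And>j. 1 \<le> j \<Longrightarrow> w j \<in> borel_measurable (F j)" "\<And>j. 1 \<le> j \<Longrightarrow> bounded_fun (w j)"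
    and "\<And>j g. 1 \<le> j \<Longrightarrow> g \<in> borel_measurable (F (j - 1)) \<Longrightarrow> bounded_fun g \<Longrightarrow> expectation (\<lambda>\<omega>. g \<omega> * w j \<omega>) = 0"
  shows "mart_diff w"
  using assms by (auto simp: mart_diff_def)

locale bounded_urn = hypergeom_urn M a b N X A B
  for M :: "'a measure" and a b :: nat and N X A B :: "nat \<Rightarrow> 'a \<Rightarrow> nat" +
  fixes C :: nat and m :: "nat \<Rightarrow> real"
  assumes bound: "\<And>n. 1 \<le> n \<Longrightarrow> AE \<omega> in M. max (A n \<omega>) (max (B n \<omega>) (N n \<omega>)) \<le> C"
    and mean_A: "\<And>n. 1 \<le> n \<Longrightarrow> (\<integral>\<omega>. real (A n \<omega>) \<partial>M) = m n"
    and mean_B: "\<And>n. 1 \<le> n \<Longrightarrow> (\<integral>\<omega>. real (B n \<omega>) \<partial>M) = m n"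
begin

text \<open>
  The hypotheses hold only almost surely. Truncating the four sequences gives processes that
  satisfy the bounds everywhere, are still adapted and agree almost surely with the originals.
\<close>

definition clip :: "nat \<Rightarrow> nat" where "clip k = max 1 (min k C)"

definition clipN :: "nat \<Rightarrow> 'a \<Rightarrow> real" where "clipN n \<omega> = real (clip (N n \<omega>))"
definition clipA :: "nat \<Rightarrow> 'a \<Rightarrow> real" where "clipA n \<omega> = real (clip (A n \<omega>))"
definition clipB :: "nat \<Rightarrow> 'a \<Rightarrow> real" where "clipB n \<omega> = real (clip (B n \<omega>))"
definition clipX :: "nat \<Rightarrow> 'a \<Rightarrow> real" where "clipX n \<omega> = real (min (X n \<omega>) (clip (N n \<omega>)))"

definition clipH :: "nat \<Rightarrow> 'a \<Rightarrow> real" where "clipH n \<omega> = real a + (\<Sum>j=1..n. clipA j \<omega> * clipX j \<omega>)"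
definition clipK :: "nat \<Rightarrow> 'a \<Rightarrow> real" where "clipK n \<omega> = real b + (\<Sum>j=1..n. clipB j \<omega> * (clipN j \<omega> - clipX j \<omega>))"
definition clipS :: "nat \<Rightarrow> 'a \<Rightarrow> real" where "clipS n \<omega> = clipH n \<omega> + clipK n \<omega>"
definition clipZ :: "nat \<Rightarrow> 'a \<Rightarrow> real" where "clipZ n \<omega> = clipH n \<omega> / clipS n \<omega>"

section \<open>Bounds and measurability of the truncated processes\<close>

lemma C_pos: "1 \<le> C"
proof -
  have "AE \<omega> in M. 1 \<le> C"
    using AB_pos[OF order_refl] bound[OF order_refl] by eventually_elim auto
  then show ?thesis by (simp add: AE_const)
qed

lemma clipN_bounds: "1 \<le> clipN n \<omega>" "clipN n \<omega> \<le> real C"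
  and clipA_bounds: "1 \<le> clipA n \<omega>" "clipA n \<omega> \<le> real C"
  and clipB_bounds: "1 \<le> clipB n \<omega>" "clipB n \<omega> \<le> real C"
  and clipX_bounds: "0 \<le> clipX n \<omega>" "clipX n \<omega> \<le> clipN n \<omega>"
  using C_pos by (auto simp: clipN_def clipA_def clipB_def clipX_def clip_def)

text \<open>Every sampled ball brings between 1 and C new balls, and the sample has between 1 and C
  balls. Hence the urn grows linearly at every point of the space, which is the source of all 1 / n
  bounds.\<close>

lemma step_bounds: "1 \<le> clipA n \<omega> * clipX n \<omega> + clipB n \<omega> * (clipN n \<omega> - clipX n \<omega>)"
  "clipA n \<omega> * clipX n \<omega> + clipB n \<omega> * (clipN n \<omega> - clipX n \<omega>) \<le> (real C)\<^sup>2"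
proof -
  have "1 \<le> 1 * clipX n \<omega> + 1 * (clipN n \<omega> - clipX n \<omega>)" using clipN_bounds[of n \<omega>] by simp
  also have "\<dots> \<le> clipA n \<omega> * clipX n \<omega> + clipB n \<omega> * (clipN n \<omega> - clipX n \<omega>)"
    using clipA_bounds[of n \<omega>] clipB_bounds[of n \<omega>] clipX_bounds[of n \<omega>] by (intro add_mono mult_right_mono) auto
  finally show "1 \<le> clipA n \<omega> * clipX n \<omega> + clipB n \<omega> * (clipN n \<omega> - clipX n \<omega>)" .
  have "clipA n \<omega> * clipX n \<omega> + clipB n \<omega> * (clipN n \<omega> - clipX n \<omega>) \<le> real C * clipX n \<omega> + real C * (clipN n \<omega> - clipX n \<omega>)"
    using clipA_bounds[of n \<omega>] clipB_bounds[of n \<omega>] clipX_bounds[of n \<omega>] by (intro add_mono mult_right_mono) auto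
  also have "\<dots> = real C * clipN n \<omega>" by (simp add: algebra_simps)
  also have "\<dots> \<le> real C * real C" using clipN_bounds[of n \<omega>] by (intro mult_left_mono) auto
  finally show "clipA n \<omega> * clipX n \<omega> + clipB n \<omega> * (clipN n \<omega> - clipX n \<omega>) \<le> (real C)\<^sup>2" by (simp add: power2_eq_square)
qed

lemma clipH_Suc: "clipH (Suc n) \<omega> = clipH n \<omega> + clipA (Suc n) \<omega> * clipX (Suc n) \<omega>"
  and clipK_Suc: "clipK (Suc n) \<omega> = clipK n \<omega> + clipB (Suc n) \<omega> * (clipN (Suc n) \<omega> - clipX (Suc n) \<omega>)"
  by (auto simp: clipH_def clipK_def)

lemma clipH_ge: "1 \<le> clipH n \<omega>"
  using a_pos clipA_bounds[of _ \<omega>] clipX_bounds[of _ \<omega>] unfolding clipH_def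
  by (intro add_increasing2 sum_nonneg mult_nonneg_nonneg) (auto intro: order_trans[of 0 1])

lemma clipK_ge: "1 \<le> clipK n \<omega>"
  using b_pos clipB_bounds[of _ \<omega>] clipX_bounds[of _ \<omega>] unfolding clipK_def
  by (intro add_increasing2 sum_nonneg mult_nonneg_nonneg) (auto intro: order_trans[of 0 1])

lemma clipS_ge: "real n + 2 \<le> clipS n \<omega>"
proof (induction n)
  case 0 then show ?case using a_pos b_pos by (simp add: clipS_def clipH_def clipK_def)
next
  case (Suc n) then show ?case using step_bounds(1)[of "Suc n" \<omega>] by (simp add: clipS_def clipH_Suc clipK_Suc)
qed

lemma clipS_le: "clipS n \<omega> \<le> real (a + b) + (real C)\<^sup>2 * real n"
proof (induction n)
  case 0 then show ?case by (simp add: clipS_def clipH_def clipK_def)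
next
  case (Suc n) then show ?case using step_bounds(2)[of "Suc n" \<omega>] by (simp add: clipS_def clipH_Suc clipK_Suc algebra_simps)
qed

lemma clipS_pos: "0 < clipS n \<omega>" using clipS_ge[of n \<omega>] by linarith

lemma clipZ_bounds: "0 < clipZ n \<omega>" "clipZ n \<omega> < 1"
  using clipH_ge[of n \<omega>] clipK_ge[of n \<omega>] clipS_pos[of n \<omega>] by (auto simp: clipZ_def clipS_def)

lemma one_minus_clipZ: "1 - clipZ n \<omega> = clipK n \<omega> / clipS n \<omega>"
  using clipS_pos[of n \<omega>] by (simp add: clipZ_def clipS_def field_simps)

definition invS :: "nat \<Rightarrow> 'a \<Rightarrow> real" where "invS n \<omega> = inverse (clipS n \<omega>)"

lemma invS_bounds: "0 < invS n \<omega>" "invS n \<omega> \<le> 1 / real (n + 2)"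
  using clipS_ge[of n \<omega>] clipS_pos[of n \<omega>] by (auto simp: invS_def inverse_eq_divide intro!: divide_left_mono)

definition invN :: "nat \<Rightarrow> 'a \<Rightarrow> real" where "invN n \<omega> = inverse (clipN n \<omega>)"

lemma invN_bounds: "0 < invN n \<omega>" "invN n \<omega> \<le> 1" "1 / real C \<le> invN n \<omega>" "invN n \<omega> * clipN n \<omega> = 1"
  using clipN_bounds[of n \<omega>] by (auto simp: invN_def field_simps)

text \<open>Finite population correction: the amount by which the mean of X (X - 1) falls below the
  binomial value N (N - 1) Z^2 because the balls are not replaced between draws. It is O(1 /
  n).\<close>

definition fpc :: "nat \<Rightarrow> 'a \<Rightarrow> real" where
  "fpc n \<omega> = clipN n \<omega> * (clipN n \<omega> - 1) * clipZ (n - 1) \<omega> * (1 - clipZ (n - 1) \<omega>) * inverse (clipS (n - 1) \<omega> - 1)"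

lemma fpc_bounds:
  assumes "1 \<le> n" shows "0 \<le> fpc n \<omega>" "fpc n \<omega> \<le> (real C)\<^sup>2 / real n"
proof -
  have S: "real n \<le> clipS (n - 1) \<omega> - 1" using clipS_ge[of "n - 1" \<omega>] assms by (simp add: of_nat_diff)
  then have i: "0 \<le> inverse (clipS (n - 1) \<omega> - 1)" "inverse (clipS (n - 1) \<omega> - 1) \<le> 1 / real n"
    using assms by (auto simp: inverse_eq_divide intro!: divide_left_mono)
  have z: "0 \<le> clipZ (n - 1) \<omega>" "clipZ (n - 1) \<omega> \<le> 1" "0 \<le> 1 - clipZ (n - 1) \<omega>" "1 - clipZ (n - 1) \<omega> \<le> 1"
    using clipZ_bounds[of "n - 1" \<omega>] by auto
  have n: "0 \<le> clipN n \<omega>" "0 \<le> clipN n \<omega> - 1" "clipN n \<omega> - 1 \<le> real C" "clipN n \<omega> \<le> real C" using clipN_bounds[of n \<omega>] by auto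
  show "0 \<le> fpc n \<omega>" unfolding fpc_def using i z n by (intro mult_nonneg_nonneg)
  have "fpc n \<omega> \<le> real C * real C * 1 * 1 * (1 / real n)" unfolding fpc_def
    using i z n by (intro mult_mono mult_nonneg_nonneg) auto
  then show "fpc n \<omega> \<le> (real C)\<^sup>2 / real n" by (simp add: power2_eq_square)
qed

lemma bounded_funs:
  "bounded_fun (clipN n)" "bounded_fun (clipA n)" "bounded_fun (clipB n)" "bounded_fun (clipX n)"
  "bounded_fun (clipZ n)" "bounded_fun (invN n)" "bounded_fun (invS n)"
proof -
  have b: "bounded_fun f" if "\<And>\<omega>. 0 \<le> f \<omega>" "\<And>\<omega>. f \<omega> \<le> c" for f :: "'a \<Rightarrow> real" and c
    using that by (intro bounded_funI[of f c]) auto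
  have nn: "0 \<le> clipN n \<omega>" "0 \<le> clipA n \<omega>" "0 \<le> clipB n \<omega>" for \<omega>
    using clipN_bounds[of n \<omega>] clipA_bounds[of n \<omega>] clipB_bounds[of n \<omega>] by auto
  show "bounded_fun (clipN n)" by (rule b[OF nn(1) clipN_bounds(2)])
  show "bounded_fun (clipA n)" by (rule b[OF nn(2) clipA_bounds(2)])
  show "bounded_fun (clipB n)" by (rule b[OF nn(3) clipB_bounds(2)])
  show "bounded_fun (clipX n)" by (rule b[OF clipX_bounds(1) order_trans[OF clipX_bounds(2) clipN_bounds(2)]])
  show "bounded_fun (clipZ n)" by (rule b[OF less_imp_le[OF clipZ_bounds(1)] less_imp_le[OF clipZ_bounds(2)]])
  show "bounded_fun (invN n)" by (rule b[OF less_imp_le[OF invN_bounds(1)] invN_bounds(2)])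
  show "bounded_fun (invS n)" by (rule b[OF less_imp_le[OF invS_bounds(1)] invS_bounds(2)])
qed

lemma bounded_fpc: "1 \<le> n \<Longrightarrow> bounded_fun (fpc n)"
  by (rule bounded_funI[of _ "(real C)\<^sup>2 / real n"]) (use fpc_bounds in auto)

lemma measurable_F_processes:
  assumes "1 \<le> j" "j \<le> n"
  shows "clipN j \<in> borel_measurable (F n)" "clipA j \<in> borel_measurable (F n)" "clipB j \<in> borel_measurable (F n)"
    "clipX j \<in> borel_measurable (F n)" "invN j \<in> borel_measurable (F n)"
proof -
  note [measurable] = measurable_F[OF assms]
  show 1: "clipN j \<in> borel_measurable (F n)" "clipA j \<in> borel_measurable (F n)" "clipB j \<in> borel_measurable (F n)"
    "clipX j \<in> borel_measurable (F n)"
    unfolding clipN_def clipA_def clipB_def clipX_def by measurable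
  show "invN j \<in> borel_measurable (F n)" unfolding invN_def using 1 by measurable
qed

lemma measurable_F_totals:
  assumes "j \<le> n"
  shows "clipH j \<in> borel_measurable (F n)" "clipK j \<in> borel_measurable (F n)" "clipS j \<in> borel_measurable (F n)"
    "clipZ j \<in> borel_measurable (F n)" "invS j \<in> borel_measurable (F n)"
proof -
  show 1: "clipH j \<in> borel_measurable (F n)" "clipK j \<in> borel_measurable (F n)"
    unfolding clipH_def[abs_def] clipK_def[abs_def] using assms
    by (auto intro!: borel_measurable_add borel_measurable_sum borel_measurable_times borel_measurable_diff measurable_F_processes)
  then show 2: "clipS j \<in> borel_measurable (F n)" unfolding clipS_def[abs_def] by measurable
  show "clipZ j \<in> borel_measurable (F n)" "invS j \<in> borel_measurable (F n)"
    unfolding clipZ_def[abs_def] invS_def[abs_def] using 1 2 by measurable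
qed

lemma measurable_FN_processes:
  assumes n: "1 \<le> n"
  shows "clipN n \<in> borel_measurable (FN n)" "invN n \<in> borel_measurable (FN n)"
    "clipZ (n - 1) \<in> borel_measurable (FN n)" "fpc n \<in> borel_measurable (FN n)"
proof -
  note [measurable] = N_measurable_FN[OF n] measurable_F_imp_FN[OF n measurable_F_totals(3)[OF order_refl, of "n - 1"]]
  show 1: "clipN n \<in> borel_measurable (FN n)" unfolding clipN_def[abs_def] by measurable
  then show "invN n \<in> borel_measurable (FN n)" unfolding invN_def[abs_def] by measurable
  show 2: "clipZ (n - 1) \<in> borel_measurable (FN n)"
    by (intro measurable_F_imp_FN[OF n] measurable_F_totals) simp
  show "fpc n \<in> borel_measurable (FN n)" unfolding fpc_def[abs_def] using 1 2 by measurable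
qed

lemma clipX_measurable_FNX:
  assumes n: "1 \<le> n" shows "clipX n \<in> borel_measurable (FNX n)"
proof -
  note [measurable] = measurable_FN_imp_FNX[OF n N_measurable_FN[OF n]] X_measurable_FNX[OF n]
  show ?thesis unfolding clipX_def[abs_def] by measurable
qed

lemma measurable_M_processes:
  "1 \<le> n \<Longrightarrow> clipN n \<in> borel_measurable M" "1 \<le> n \<Longrightarrow> clipA n \<in> borel_measurable M" "1 \<le> n \<Longrightarrow> clipB n \<in> borel_measurable M"
  "1 \<le> n \<Longrightarrow> clipX n \<in> borel_measurable M" "1 \<le> n \<Longrightarrow> invN n \<in> borel_measurable M"
  "clipH n \<in> borel_measurable M" "clipK n \<in> borel_measurable M" "clipS n \<in> borel_measurable M"
  "clipZ n \<in> borel_measurable M" "invS n \<in> borel_measurable M"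
  using measurable_F_imp_M[OF measurable_F_processes(1)[of n n]] measurable_F_imp_M[OF measurable_F_processes(2)[of n n]]
    measurable_F_imp_M[OF measurable_F_processes(3)[of n n]] measurable_F_imp_M[OF measurable_F_processes(4)[of n n]]
    measurable_F_imp_M[OF measurable_F_processes(5)[of n n]] measurable_F_imp_M[OF measurable_F_totals(1)[of n n]]
    measurable_F_imp_M[OF measurable_F_totals(2)[of n n]] measurable_F_imp_M[OF measurable_F_totals(3)[of n n]]
    measurable_F_imp_M[OF measurable_F_totals(4)[of n n]] measurable_F_imp_M[OF measurable_F_totals(5)[of n n]]
  by auto

lemma AE_clip_eq:
  "AE \<omega> in M. \<forall>n\<ge>1. clip (N n \<omega>) = N n \<omega> \<and> clip (A n \<omega>) = A n \<omega> \<and> clip (B n \<omega>) = B n \<omega> \<and> X n \<omega> \<le> N n \<omega>"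
proof -
  have "AE \<omega> in M. n \<ge> 1 \<longrightarrow> clip (N n \<omega>) = N n \<omega> \<and> clip (A n \<omega>) = A n \<omega> \<and> clip (B n \<omega>) = B n \<omega> \<and> X n \<omega> \<le> N n \<omega>" for n
  proof (cases "n \<ge> 1")
    case True
    show ?thesis using AB_pos[OF True] bound[OF True] AE_N_range[OF True] AE_X_le_N[OF True]
      by eventually_elim (auto simp: clip_def)
  qed simp
  then show ?thesis by (intro AE_all_countable[THEN iffD2] allI)
qed

lemma AE_processes_eq:
  "AE \<omega> in M. \<forall>n\<ge>1. real (N n \<omega>) = clipN n \<omega> \<and> real (X n \<omega>) = clipX n \<omega> \<and> real (A n \<omega>) = clipA n \<omega> \<and> real (B n \<omega>) = clipB n \<omega>"
  using AE_clip_eq by eventually_elim (auto simp: clipN_def clipX_def clipA_def clipB_def)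

lemma AE_totals_eq:
  "AE \<omega> in M. \<forall>n. real (urnH n \<omega>) = clipH n \<omega> \<and> real (urnK n \<omega>) = clipK n \<omega>
     \<and> real (urnS n \<omega>) = clipS n \<omega> \<and> urn_Z a b N X A B n \<omega> = clipZ n \<omega>"
  using AE_clip_eq
proof eventually_elim
  case (elim \<omega>)
  have H: "real (urnH n \<omega>) = clipH n \<omega>" for n
    using elim by (auto simp: urn_H_def clipH_def clipA_def clipX_def intro!: sum.cong)
  moreover have K: "real (urnK n \<omega>) = clipK n \<omega>" for n
    using elim by (auto simp: urn_K_def clipK_def clipB_def clipX_def clipN_def of_nat_diff intro!: sum.cong)
  ultimately show ?case by (auto simp: urn_S_def clipS_def urn_Z_def clipZ_def)
qed

text \<open>Averages out X_n given the past and N_n, by expanding over the finitely many values of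
  X_n and inserting the hypergeometric moments. Degree two suffices since the martingale differences
  studied are at most quadratic in X_n.\<close>

lemma expectation_clipX_poly:
  assumes n: "1 \<le> n"
    and G0: "G0 \<in> borel_measurable (FN n)" "bounded_fun G0"
    and G1: "G1 \<in> borel_measurable (FN n)" "bounded_fun G1"
    and G2: "G2 \<in> borel_measurable (FN n)" "bounded_fun G2"
  shows "expectation (\<lambda>\<omega>. G0 \<omega> + G1 \<omega> * clipX n \<omega> + G2 \<omega> * (clipX n \<omega>)\<^sup>2)
    = expectation (\<lambda>\<omega>. G0 \<omega> + G1 \<omega> * (clipN n \<omega> * clipZ (n - 1) \<omega>)
        + G2 \<omega> * (clipN n \<omega> * clipZ (n - 1) \<omega> + clipN n \<omega> * (clipN n \<omega> - 1) * (clipZ (n - 1) \<omega>)\<^sup>2 - fpc n \<omega>))"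
proof -
  define g where "g k \<omega> = G0 \<omega> + G1 \<omega> * real k + G2 \<omega> * (real k)\<^sup>2" for k :: nat and \<omega>
  define hyp where "hyp k \<omega> = hypergeom_mass (N n \<omega>) (urnS (n - 1) \<omega>) (urnH (n - 1) \<omega>) k" for k \<omega>
  have gm: "g k \<in> borel_measurable (FN n)" for k unfolding g_def[abs_def] using G0 G1 G2 by measurable
  have gb: "bounded_fun (g k)" for k unfolding g_def[abs_def] by (intro bounded_fun_intros G0 G1 G2)
  note [measurable] = measurable_FN_imp_M[OF n G0(1)] measurable_FN_imp_M[OF n G1(1)] measurable_FN_imp_M[OF n G2(1)]
    measurable_M_processes(4)[OF n] measurable_M_processes(1)[OF n] measurable_M_processes(9)[of "n - 1"]
    measurable_FN_imp_M[OF n measurable_FN_processes(4)[OF n]] rv_X[OF n] measurable_FN_imp_M[OF n gm]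
  note eX = expectation_X_eq[OF n gm gb, folded hyp_def]
  have xm: "(\<lambda>\<omega>. g k \<omega> * of_bool (X n \<omega> = k)) \<in> borel_measurable M" for k by measurable
  have ix: "integrable M (\<lambda>\<omega>. g k \<omega> * of_bool (X n \<omega> = k))" for k
    using gb[of k] xm by (intro integrable_bounded_fun bounded_fun_mult bounded_funI[of "\<lambda>\<omega>. of_bool (X n \<omega> = k)" 1]) auto
  have "expectation (\<lambda>\<omega>. G0 \<omega> + G1 \<omega> * clipX n \<omega> + G2 \<omega> * (clipX n \<omega>)\<^sup>2)
    = expectation (\<lambda>\<omega>. \<Sum>k\<le>C. g k \<omega> * of_bool (X n \<omega> = k))"
  proof (rule integral_cong_AE)
    show "AE \<omega> in M. G0 \<omega> + G1 \<omega> * clipX n \<omega> + G2 \<omega> * (clipX n \<omega>)\<^sup>2 = (\<Sum>k\<le>C. g k \<omega> * of_bool (X n \<omega> = k))"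
      using AE_clip_eq bound[OF n]
    proof eventually_elim
      case (elim \<omega>)
      then have "X n \<omega> \<le> C" "clipX n \<omega> = real (X n \<omega>)" using n by (auto simp: clipX_def)
      moreover have "(\<Sum>k\<le>C. g k \<omega> * of_bool (X n \<omega> = k)) = (\<Sum>k\<le>C. if X n \<omega> = k then g k \<omega> else 0)"
        by (intro sum.cong) auto
      ultimately show ?case by (simp add: sum.delta g_def)
    qed
  qed (use xm in measurable)
  also have "\<dots> = (\<Sum>k\<le>C. expectation (\<lambda>\<omega>. g k \<omega> * hyp k \<omega>))"
    using ix eX(2) by (subst Bochner_Integration.integral_sum) auto
  also have "\<dots> = expectation (\<lambda>\<omega>. \<Sum>k\<le>C. g k \<omega> * hyp k \<omega>)"
    using eX(1) by (subst Bochner_Integration.integral_sum) auto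
  also have "\<dots> = expectation (\<lambda>\<omega>. G0 \<omega> + G1 \<omega> * (clipN n \<omega> * clipZ (n - 1) \<omega>)
        + G2 \<omega> * (clipN n \<omega> * clipZ (n - 1) \<omega> + clipN n \<omega> * (clipN n \<omega> - 1) * (clipZ (n - 1) \<omega>)\<^sup>2 - fpc n \<omega>))"
  proof (rule integral_cong_AE)
    show "(\<lambda>\<omega>. \<Sum>k\<le>C. g k \<omega> * hyp k \<omega>) \<in> borel_measurable M"
      using eX(1) by (intro borel_measurable_sum) auto
    show "AE \<omega> in M. (\<Sum>k\<le>C. g k \<omega> * hyp k \<omega>) = G0 \<omega> + G1 \<omega> * (clipN n \<omega> * clipZ (n - 1) \<omega>)
        + G2 \<omega> * (clipN n \<omega> * clipZ (n - 1) \<omega> + clipN n \<omega> * (clipN n \<omega> - 1) * (clipZ (n - 1) \<omega>)\<^sup>2 - fpc n \<omega>)"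
      using AE_processes_eq AE_totals_eq bound[OF n] AE_N_range[OF n]
    proof eventually_elim
      case (elim \<omega>)
      define h where "h = urnH (n - 1) \<omega>"
      define d where "d = urnK (n - 1) \<omega>"
      define s where "s = clipS (n - 1) \<omega>"
      define z where "z = clipZ (n - 1) \<omega>"
      have S: "urnS (n - 1) \<omega> = h + d" by (simp add: h_def d_def urn_S_def)
      have s2: "2 \<le> s" using clipS_ge[of "n - 1" \<omega>] by (simp add: s_def)
      have hs: "real (h + d) = s" "real h = z * s"
        using elim(2) s2 by (auto simp: h_def d_def s_def z_def clipS_def clipZ_def)
      then have hd2: "2 \<le> h + d" using s2 by linarith
      have nn: "real (N n \<omega>) = clipN n \<omega>" using elim(1) n by simp
      have Nb: "N n \<omega> \<le> C" "N n \<omega> \<le> h + d" "1 \<le> N n \<omega>" using elim S by auto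
      have hyp: "hyp k \<omega> = hypergeom_mass (N n \<omega>) (h + d) h k" for k
        by (simp only: hyp_def S h_def[symmetric])
      have m0: "(\<Sum>k\<le>C. hyp k \<omega>) = 1" unfolding hyp using hypergeom_mass_total Nb by blast
      have m1: "(\<Sum>k\<le>C. real k * hyp k \<omega>) = clipN n \<omega> * z"
        unfolding hyp hypergeom_mass_mean[OF Nb] nn hs using s2 by simp
      have m2: "(\<Sum>k\<le>C. real k * (real k - 1) * hyp k \<omega>) = clipN n \<omega> * (clipN n \<omega> - 1) * z\<^sup>2 - fpc n \<omega>"
      proof -
        have "(\<Sum>k\<le>C. real k * (real k - 1) * hyp k \<omega>) = clipN n \<omega> * (clipN n \<omega> - 1) * (z * s / s) * ((z * s - 1) / (s - 1))"
          unfolding hyp hypergeom_mass_factorial_moment[OF Nb hd2] nn hs by simp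
        \<comment> \<open>The probability that a second drawn ball has colour A after a first one of
          colour A; its deviation from z is the correction.\<close>
        also have "(z * s - 1) / (s - 1) = z - (1 - z) * inverse (s - 1)"
          using s2 by (simp add: field_simps)
        also have "z * s / s = z" using s2 by simp
        also have "clipN n \<omega> * (clipN n \<omega> - 1) * z * (z - (1 - z) * inverse (s - 1)) = clipN n \<omega> * (clipN n \<omega> - 1) * z\<^sup>2 - fpc n \<omega>"
          unfolding fpc_def s_def[symmetric] z_def[symmetric] by (simp add: power2_eq_square algebra_simps)
        finally show ?thesis .
      qed
      \<comment> \<open>Here k^2 is written as k + k (k - 1), since it is the falling moments that
        have closed forms.\<close>
      have "(\<Sum>k\<le>C. g k \<omega> * hyp k \<omega>) = (\<Sum>k\<le>C. G0 \<omega> * hyp k \<omega> + (G1 \<omega> + G2 \<omega>) * (real k * hyp k \<omega>) + G2 \<omega> * (real k * (real k - 1) * hyp k \<omega>))"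
        by (intro sum.cong) (auto simp: g_def algebra_simps power2_eq_square)
      also have "\<dots> = G0 \<omega> * (\<Sum>k\<le>C. hyp k \<omega>) + (G1 \<omega> + G2 \<omega>) * (\<Sum>k\<le>C. real k * hyp k \<omega>) + G2 \<omega> * (\<Sum>k\<le>C. real k * (real k - 1) * hyp k \<omega>)"
        by (simp only: sum.distrib sum_distrib_left)
      finally show ?case unfolding m0 m1 m2 z_def by (simp add: algebra_simps)
    qed
  qed measurable
  finally show ?thesis .
qed

section \<open>Averaging over the replacement factors\<close>

definition qA :: "nat \<Rightarrow> real" where "qA n = expectation (\<lambda>\<omega>. (clipA n \<omega>)\<^sup>2)"
definition qB :: "nat \<Rightarrow> real" where "qB n = expectation (\<lambda>\<omega>. (clipB n \<omega>)\<^sup>2)"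
definition qAB :: "nat \<Rightarrow> real" where "qAB n = expectation (\<lambda>\<omega>. clipA n \<omega> * clipB n \<omega>)"

lemma expectation_clipA: "1 \<le> n \<Longrightarrow> expectation (clipA n) = m n"
  and expectation_clipB: "1 \<le> n \<Longrightarrow> expectation (clipB n) = m n"
proof -
  assume n: "1 \<le> n"
  note [measurable] = rv_A[OF n] rv_B[OF n] measurable_M_processes(2,3)[OF n]
  have "expectation (clipA n) = expectation (\<lambda>\<omega>. real (A n \<omega>))"
    by (rule integral_cong_AE) (use AE_processes_eq n in \<open>auto elim!: eventually_mono\<close>)
  then show "expectation (clipA n) = m n" using mean_A[OF n] by simp
  have "expectation (clipB n) = expectation (\<lambda>\<omega>. real (B n \<omega>))"
    by (rule integral_cong_AE) (use AE_processes_eq n in \<open>auto elim!: eventually_mono\<close>)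
  then show "expectation (clipB n) = m n" using mean_B[OF n] by simp
qed

lemma expectation_clip_indep:
  fixes f :: "real \<Rightarrow> real \<Rightarrow> real"
  assumes n: "1 \<le> n" and G: "G \<in> borel_measurable (FNX n)" "bounded_fun G"
    and f: "bounded_fun (\<lambda>\<omega>. f (clipA n \<omega>) (clipB n \<omega>))"
  shows "expectation (\<lambda>\<omega>. f (clipA n \<omega>) (clipB n \<omega>) * G \<omega>) = expectation (\<lambda>\<omega>. f (clipA n \<omega>) (clipB n \<omega>)) * expectation G"
proof -
  define f' where "f' x y = f (real (clip x)) (real (clip y))" for x y
  have eq: "f (clipA n \<omega>) (clipB n \<omega>) = f' (A n \<omega>) (B n \<omega>)" for \<omega>
    by (simp add: f'_def clipA_def clipB_def)
  note [measurable] = rv_A[OF n] rv_B[OF n]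
  have "(\<lambda>\<omega>. f' (A n \<omega>) (B n \<omega>)) \<in> borel_measurable M" by measurable
  then have "integrable M (\<lambda>\<omega>. f' (A n \<omega>) (B n \<omega>))"
    using f unfolding eq by (intro integrable_bounded_fun)
  from expectation_AB_indep[OF n this G] show ?thesis unfolding eq .
qed

lemma expectation_AB_poly:
  assumes n: "1 \<le> n"
    and P: "P0 \<in> borel_measurable (FNX n)" "PA \<in> borel_measurable (FNX n)" "PB \<in> borel_measurable (FNX n)"
      "PAA \<in> borel_measurable (FNX n)" "PBB \<in> borel_measurable (FNX n)" "PAB \<in> borel_measurable (FNX n)"
    and Pb: "bounded_fun P0" "bounded_fun PA" "bounded_fun PB" "bounded_fun PAA" "bounded_fun PBB" "bounded_fun PAB"
  shows "expectation (\<lambda>\<omega>. P0 \<omega> + clipA n \<omega> * PA \<omega> + clipB n \<omega> * PB \<omega> + (clipA n \<omega>)\<^sup>2 * PAA \<omega> + (clipB n \<omega>)\<^sup>2 * PBB \<omega> + (clipA n \<omega> * clipB n \<omega>) * PAB \<omega>)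
    = expectation (\<lambda>\<omega>. P0 \<omega> + m n * PA \<omega> + m n * PB \<omega> + qA n * PAA \<omega> + qB n * PBB \<omega> + qAB n * PAB \<omega>)"
proof -
  note [measurable] = measurable_FNX_imp_M[OF n P(1)] measurable_FNX_imp_M[OF n P(2)] measurable_FNX_imp_M[OF n P(3)]
    measurable_FNX_imp_M[OF n P(4)] measurable_FNX_imp_M[OF n P(5)] measurable_FNX_imp_M[OF n P(6)] measurable_M_processes(2,3)[OF n]
  note ib = integrable_bounded_fun
  have i: "integrable M P0" "integrable M PA" "integrable M PB" "integrable M PAA" "integrable M PBB" "integrable M PAB"
    "integrable M (\<lambda>\<omega>. clipA n \<omega> * PA \<omega>)" "integrable M (\<lambda>\<omega>. clipB n \<omega> * PB \<omega>)" "integrable M (\<lambda>\<omega>. (clipA n \<omega>)\<^sup>2 * PAA \<omega>)"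
    "integrable M (\<lambda>\<omega>. (clipB n \<omega>)\<^sup>2 * PBB \<omega>)" "integrable M (\<lambda>\<omega>. (clipA n \<omega> * clipB n \<omega>) * PAB \<omega>)"
    by (intro ib bounded_fun_intros Pb bounded_funs; measurable)+
  have e: "expectation (\<lambda>\<omega>. clipA n \<omega> * PA \<omega>) = m n * expectation PA"
    "expectation (\<lambda>\<omega>. clipB n \<omega> * PB \<omega>) = m n * expectation PB"
    "expectation (\<lambda>\<omega>. (clipA n \<omega>)\<^sup>2 * PAA \<omega>) = qA n * expectation PAA"
    "expectation (\<lambda>\<omega>. (clipB n \<omega>)\<^sup>2 * PBB \<omega>) = qB n * expectation PBB"
    "expectation (\<lambda>\<omega>. (clipA n \<omega> * clipB n \<omega>) * PAB \<omega>) = qAB n * expectation PAB"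
    using expectation_clip_indep[where f="\<lambda>x y. x", OF n P(2) Pb(2) bounded_funs(2)]
      expectation_clip_indep[where f="\<lambda>x y. y", OF n P(3) Pb(3) bounded_funs(3)]
      expectation_clip_indep[where f="\<lambda>x y. x\<^sup>2", OF n P(4) Pb(4) bounded_fun_power[OF bounded_funs(2)]]
      expectation_clip_indep[where f="\<lambda>x y. y\<^sup>2", OF n P(5) Pb(5) bounded_fun_power[OF bounded_funs(3)]]
      expectation_clip_indep[where f="\<lambda>x y. x * y", OF n P(6) Pb(6) bounded_fun_mult[OF bounded_funs(2) bounded_funs(3)]]
    by (simp_all only: expectation_clipA[OF n] expectation_clipB[OF n] qA_def qB_def qAB_def)
  show ?thesis using i e by simp
qed

text \<open>Two averagings in a row: the coefficients \<open>P\<close> may depend on X_n and meet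
  only A_n and B_n; after independence has removed these, the coefficients \<open>G\<close> depend
  on the past and N_n and meet only X_n.\<close>

lemma expectation_zeroI:
  assumes n: "1 \<le> n"
    and f: "\<And>\<omega>. f \<omega> = P0 \<omega> + clipA n \<omega> * PA \<omega> + clipB n \<omega> * PB \<omega> + (clipA n \<omega>)\<^sup>2 * PAA \<omega> + (clipB n \<omega>)\<^sup>2 * PBB \<omega> + (clipA n \<omega> * clipB n \<omega>) * PAB \<omega>"
    and P: "P0 \<in> borel_measurable (FNX n)" "PA \<in> borel_measurable (FNX n)" "PB \<in> borel_measurable (FNX n)"
      "PAA \<in> borel_measurable (FNX n)" "PBB \<in> borel_measurable (FNX n)" "PAB \<in> borel_measurable (FNX n)"
    and Pb: "bounded_fun P0" "bounded_fun PA" "bounded_fun PB" "bounded_fun PAA" "bounded_fun PBB" "bounded_fun PAB"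
    and PG: "\<And>\<omega>. P0 \<omega> + m n * PA \<omega> + m n * PB \<omega> + qA n * PAA \<omega> + qB n * PBB \<omega> + qAB n * PAB \<omega>
       = G0 \<omega> + G1 \<omega> * clipX n \<omega> + G2 \<omega> * (clipX n \<omega>)\<^sup>2"
    and G: "G0 \<in> borel_measurable (FN n)" "G1 \<in> borel_measurable (FN n)" "G2 \<in> borel_measurable (FN n)"
    and Gb: "bounded_fun G0" "bounded_fun G1" "bounded_fun G2"
    and z: "\<And>\<omega>. G0 \<omega> + G1 \<omega> * (clipN n \<omega> * clipZ (n - 1) \<omega>)
        + G2 \<omega> * (clipN n \<omega> * clipZ (n - 1) \<omega> + clipN n \<omega> * (clipN n \<omega> - 1) * (clipZ (n - 1) \<omega>)\<^sup>2 - fpc n \<omega>) = 0"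
  shows "expectation f = 0"
proof -
  have "expectation f = expectation (\<lambda>\<omega>. P0 \<omega> + m n * PA \<omega> + m n * PB \<omega> + qA n * PAA \<omega> + qB n * PBB \<omega> + qAB n * PAB \<omega>)"
    unfolding f[THEN ext] by (rule expectation_AB_poly[OF n P Pb])
  also have "\<dots> = 0"
    unfolding PG expectation_clipX_poly[OF n G(1) Gb(1) G(2) Gb(2) G(3) Gb(3)] z by simp
  finally show ?thesis .
qed

end

subsection \<open>Martingale differences of the urn\<close>

lemma (in filtered_prob_space) mart_diff_mult_predictable:
  assumes w: "mart_diff w"
    and p: "\<And>j. 1 \<le> j \<Longrightarrow> p j \<in> borel_measurable (F (j - 1))" "\<And>j. 1 \<le> j \<Longrightarrow> bounded_fun (p j)"
  shows "mart_diff (\<lambda>j \<omega>. p j \<omega> * w j \<omega>)"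
proof (rule mart_diffI)
  fix j :: nat assume j: "1 \<le> j"
  show "(\<lambda>\<omega>. p j \<omega> * w j \<omega>) \<in> borel_measurable (F j)"
    by (intro borel_measurable_times measurable_F_mono[OF p(1)[OF j]] mart_diff_measurable[OF w j]) auto
  show "bounded_fun (\<lambda>\<omega>. p j \<omega> * w j \<omega>)"
    by (intro bounded_fun_mult p(2) mart_diff_bounded[OF w] j)
  fix g assume g: "g \<in> borel_measurable (F (j - 1))" "bounded_fun g"
  have "expectation (\<lambda>\<omega>. (g \<omega> * p j \<omega>) * w j \<omega>) = 0"
    by (intro mart_diff_expectation[OF w j] borel_measurable_times g p bounded_fun_mult j)
  then show "expectation (\<lambda>\<omega>. g \<omega> * (p j \<omega> * w j \<omega>)) = 0" by (simp add: mult.assoc)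
qed

context bounded_urn
begin

definition zeta :: "nat \<Rightarrow> 'a \<Rightarrow> real" where "zeta n \<omega> = clipX n \<omega> * invN n \<omega> - clipZ (n - 1) \<omega>"
definition incnum :: "nat \<Rightarrow> 'a \<Rightarrow> real" where
  "incnum n \<omega> = (1 - clipZ (n - 1) \<omega>) * (clipA n \<omega> * clipX n \<omega>) - clipZ (n - 1) \<omega> * (clipB n \<omega> * (clipN n \<omega> - clipX n \<omega>))"

text \<open>
  The increment of \<open>clipZ\<close> at time \<open>n\<close> is \<open>incnum n / clipS n\<close>. Dividing by \<open>clipS (n - 1)\<close> instead gives the exact
  martingale difference \<open>mdinc n\<close>, at the cost of an error of order \<open>1 / n\<^sup>2\<close>. Up to the finite
  population correction in \<open>fpc\<close>, \<open>sqmean n\<close> is the second moment of a binomial variable.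
\<close>

definition mdinc :: "nat \<Rightarrow> 'a \<Rightarrow> real" where "mdinc n \<omega> = invS (n - 1) \<omega> * incnum n \<omega>"
definition sqmean :: "nat \<Rightarrow> 'a \<Rightarrow> real" where
  "sqmean n \<omega> = clipN n \<omega> * clipZ (n - 1) \<omega> + clipN n \<omega> * (clipN n \<omega> - 1) * (clipZ (n - 1) \<omega>)\<^sup>2 - fpc n \<omega>"

text \<open>
  Conditionally on the past, \<open>clipA\<close> and \<open>clipB\<close> are averaged out first, by independence, and then
  \<open>clipX\<close>, by the hypergeometric moments; what remains must vanish identically.
\<close>

lemma mart_diff_polyI:
  assumes w: "\<And>j. 1 \<le> j \<Longrightarrow> w j \<in> borel_measurable (F j)"
    and f: "\<And>j \<omega>. 1 \<le> j \<Longrightarrow> w j \<omega> = U0 j \<omega> + clipA j \<omega> * UA j \<omega> + clipB j \<omega> * UB j \<omega> + (clipA j \<omega>)\<^sup>2 * UAA j \<omega>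
       + (clipB j \<omega>)\<^sup>2 * UBB j \<omega> + (clipA j \<omega> * clipB j \<omega>) * UAB j \<omega>"
    and U: "\<And>j. 1 \<le> j \<Longrightarrow> U0 j \<in> borel_measurable (FNX j)" "\<And>j. 1 \<le> j \<Longrightarrow> UA j \<in> borel_measurable (FNX j)"
      "\<And>j. 1 \<le> j \<Longrightarrow> UB j \<in> borel_measurable (FNX j)" "\<And>j. 1 \<le> j \<Longrightarrow> UAA j \<in> borel_measurable (FNX j)"
      "\<And>j. 1 \<le> j \<Longrightarrow> UBB j \<in> borel_measurable (FNX j)" "\<And>j. 1 \<le> j \<Longrightarrow> UAB j \<in> borel_measurable (FNX j)"
    and Ub: "\<And>j. 1 \<le> j \<Longrightarrow> bounded_fun (U0 j)" "\<And>j. 1 \<le> j \<Longrightarrow> bounded_fun (UA j)" "\<And>j. 1 \<le> j \<Longrightarrow> bounded_fun (UB j)"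
      "\<And>j. 1 \<le> j \<Longrightarrow> bounded_fun (UAA j)" "\<And>j. 1 \<le> j \<Longrightarrow> bounded_fun (UBB j)" "\<And>j. 1 \<le> j \<Longrightarrow> bounded_fun (UAB j)"
    and UV: "\<And>j \<omega>. 1 \<le> j \<Longrightarrow> U0 j \<omega> + m j * UA j \<omega> + m j * UB j \<omega> + qA j * UAA j \<omega> + qB j * UBB j \<omega> + qAB j * UAB j \<omega>
       = V0 j \<omega> + V1 j \<omega> * clipX j \<omega> + V2 j \<omega> * (clipX j \<omega>)\<^sup>2"
    and V: "\<And>j. 1 \<le> j \<Longrightarrow> V0 j \<in> borel_measurable (FN j)" "\<And>j. 1 \<le> j \<Longrightarrow> V1 j \<in> borel_measurable (FN j)"
      "\<And>j. 1 \<le> j \<Longrightarrow> V2 j \<in> borel_measurable (FN j)"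
    and Vb: "\<And>j. 1 \<le> j \<Longrightarrow> bounded_fun (V0 j)" "\<And>j. 1 \<le> j \<Longrightarrow> bounded_fun (V1 j)" "\<And>j. 1 \<le> j \<Longrightarrow> bounded_fun (V2 j)"
    and z: "\<And>j \<omega>. 1 \<le> j \<Longrightarrow> V0 j \<omega> + V1 j \<omega> * (clipN j \<omega> * clipZ (j - 1) \<omega>) + V2 j \<omega> * sqmean j \<omega> = 0"
  shows "mart_diff w"
proof (rule mart_diffI)
  fix j :: nat assume j: "1 \<le> j"
  show "w j \<in> borel_measurable (F j)" by (rule w[OF j])
  show "bounded_fun (w j)" unfolding f[OF j, THEN ext] by (intro bounded_fun_intros bounded_funs Ub j)
  fix g assume g: "g \<in> borel_measurable (F (j - 1))" "bounded_fun g"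
  note gN = measurable_F_imp_FN[OF j g(1)]
  note gX = measurable_FN_imp_FNX[OF j gN]
  show "expectation (\<lambda>\<omega>. g \<omega> * w j \<omega>) = 0"
  proof (rule expectation_zeroI[OF j, where ?P0.0="\<lambda>\<omega>. g \<omega> * U0 j \<omega>" and PA="\<lambda>\<omega>. g \<omega> * UA j \<omega>" and PB="\<lambda>\<omega>. g \<omega> * UB j \<omega>"
      and PAA="\<lambda>\<omega>. g \<omega> * UAA j \<omega>" and PBB="\<lambda>\<omega>. g \<omega> * UBB j \<omega>" and PAB="\<lambda>\<omega>. g \<omega> * UAB j \<omega>"
      and ?G0.0="\<lambda>\<omega>. g \<omega> * V0 j \<omega>" and ?G1.0="\<lambda>\<omega>. g \<omega> * V1 j \<omega>" and ?G2.0="\<lambda>\<omega>. g \<omega> * V2 j \<omega>"])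
    fix \<omega>
    show "g \<omega> * w j \<omega> = g \<omega> * U0 j \<omega> + clipA j \<omega> * (g \<omega> * UA j \<omega>) + clipB j \<omega> * (g \<omega> * UB j \<omega>) + (clipA j \<omega>)\<^sup>2 * (g \<omega> * UAA j \<omega>)
       + (clipB j \<omega>)\<^sup>2 * (g \<omega> * UBB j \<omega>) + (clipA j \<omega> * clipB j \<omega>) * (g \<omega> * UAB j \<omega>)"
      unfolding f[OF j] by (simp add: algebra_simps)
    have "g \<omega> * U0 j \<omega> + m j * (g \<omega> * UA j \<omega>) + m j * (g \<omega> * UB j \<omega>) + qA j * (g \<omega> * UAA j \<omega>) + qB j * (g \<omega> * UBB j \<omega>)
       + qAB j * (g \<omega> * UAB j \<omega>) = g \<omega> * (U0 j \<omega> + m j * UA j \<omega> + m j * UB j \<omega> + qA j * UAA j \<omega> + qB j * UBB j \<omega> + qAB j * UAB j \<omega>)"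
      by (simp add: algebra_simps)
    also have "\<dots> = g \<omega> * V0 j \<omega> + (g \<omega> * V1 j \<omega>) * clipX j \<omega> + (g \<omega> * V2 j \<omega>) * (clipX j \<omega>)\<^sup>2"
      unfolding UV[OF j] by (simp add: algebra_simps)
    finally show "g \<omega> * U0 j \<omega> + m j * (g \<omega> * UA j \<omega>) + m j * (g \<omega> * UB j \<omega>) + qA j * (g \<omega> * UAA j \<omega>) + qB j * (g \<omega> * UBB j \<omega>)
       + qAB j * (g \<omega> * UAB j \<omega>) = g \<omega> * V0 j \<omega> + (g \<omega> * V1 j \<omega>) * clipX j \<omega> + (g \<omega> * V2 j \<omega>) * (clipX j \<omega>)\<^sup>2" .
    have "g \<omega> * V0 j \<omega> + (g \<omega> * V1 j \<omega>) * (clipN j \<omega> * clipZ (j - 1) \<omega>) + (g \<omega> * V2 j \<omega>) * sqmean j \<omega>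
      = g \<omega> * (V0 j \<omega> + V1 j \<omega> * (clipN j \<omega> * clipZ (j - 1) \<omega>) + V2 j \<omega> * sqmean j \<omega>)" by (simp add: algebra_simps)
    also have "\<dots> = 0" unfolding z[OF j] by simp
    finally show "g \<omega> * V0 j \<omega> + (g \<omega> * V1 j \<omega>) * (clipN j \<omega> * clipZ (j - 1) \<omega>) + (g \<omega> * V2 j \<omega>) * (clipN j \<omega> * clipZ (j - 1) \<omega>
       + clipN j \<omega> * (clipN j \<omega> - 1) * (clipZ (j - 1) \<omega>)\<^sup>2 - fpc j \<omega>) = 0" by (simp only: sqmean_def)
  qed (intro borel_measurable_times gX gN U V j bounded_fun_mult g Ub Vb)+
qed

section \<open>Measurability and boundedness of the ingredients of the martingale
  differences\<close>

lemma FNX_measurables: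
  assumes j: "1 \<le> j"
  shows "clipN j \<in> borel_measurable (FNX j)" "invN j \<in> borel_measurable (FNX j)" "clipZ (j - 1) \<in> borel_measurable (FNX j)"
    "fpc j \<in> borel_measurable (FNX j)" "clipX j \<in> borel_measurable (FNX j)" "sqmean j \<in> borel_measurable (FNX j)"
    "zeta j \<in> borel_measurable (FNX j)"
proof -
  note * = measurable_FN_processes[OF j, THEN measurable_FN_imp_FNX[OF j]] clipX_measurable_FNX[OF j]
  show "clipN j \<in> borel_measurable (FNX j)" "invN j \<in> borel_measurable (FNX j)" "clipZ (j - 1) \<in> borel_measurable (FNX j)"
    "fpc j \<in> borel_measurable (FNX j)" "clipX j \<in> borel_measurable (FNX j)" by (fact *)+
  show "sqmean j \<in> borel_measurable (FNX j)" "zeta j \<in> borel_measurable (FNX j)"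
    unfolding sqmean_def[abs_def] zeta_def[abs_def]
    by (intro borel_measurable_add borel_measurable_diff borel_measurable_times borel_measurable_power borel_measurable_const *)+
qed

lemma FN_measurables:
  assumes j: "1 \<le> j"
  shows "clipN j \<in> borel_measurable (FN j)" "invN j \<in> borel_measurable (FN j)" "clipZ (j - 1) \<in> borel_measurable (FN j)"
    "fpc j \<in> borel_measurable (FN j)" "sqmean j \<in> borel_measurable (FN j)"
proof -
  note * = measurable_FN_processes[OF j]
  show "clipN j \<in> borel_measurable (FN j)" "invN j \<in> borel_measurable (FN j)" "clipZ (j - 1) \<in> borel_measurable (FN j)"
    "fpc j \<in> borel_measurable (FN j)" by (fact *)+
  show "sqmean j \<in> borel_measurable (FN j)"
    unfolding sqmean_def[abs_def]
    by (intro borel_measurable_add borel_measurable_diff borel_measurable_times borel_measurable_power borel_measurable_const *)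
qed

lemma F_measurables:
  assumes j: "1 \<le> j"
  shows "clipN j \<in> borel_measurable (F j)" "clipA j \<in> borel_measurable (F j)" "clipB j \<in> borel_measurable (F j)" "clipX j \<in> borel_measurable (F j)"
    "invN j \<in> borel_measurable (F j)" "clipZ (j - 1) \<in> borel_measurable (F j)" "fpc j \<in> borel_measurable (F j)" "sqmean j \<in> borel_measurable (F j)"
    "zeta j \<in> borel_measurable (F j)" "incnum j \<in> borel_measurable (F j)"
proof -
  note * = measurable_F_processes[OF j order_refl] measurable_F_totals[of "j - 1" j, OF diff_le_self]
  show "clipN j \<in> borel_measurable (F j)" "clipA j \<in> borel_measurable (F j)" "clipB j \<in> borel_measurable (F j)" "clipX j \<in> borel_measurable (F j)"
    "invN j \<in> borel_measurable (F j)" "clipZ (j - 1) \<in> borel_measurable (F j)" by (fact *)+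
  show r: "fpc j \<in> borel_measurable (F j)" unfolding fpc_def[abs_def]
    by (intro borel_measurable_inverse borel_measurable_diff borel_measurable_times borel_measurable_const *)
  show "sqmean j \<in> borel_measurable (F j)"
    unfolding sqmean_def[abs_def]
    by (intro borel_measurable_add borel_measurable_diff borel_measurable_times borel_measurable_power borel_measurable_const * r)
  show "zeta j \<in> borel_measurable (F j)" "incnum j \<in> borel_measurable (F j)"
    unfolding zeta_def[abs_def] incnum_def[abs_def]
    by (intro borel_measurable_diff borel_measurable_times borel_measurable_const *)+
qed

lemmas meas_intros = borel_measurable_add borel_measurable_diff borel_measurable_times borel_measurable_power
  borel_measurable_const borel_measurable_uminus

lemma bounded_sqmean: "1 \<le> j \<Longrightarrow> bounded_fun (sqmean j)" and bounded_zeta: "bounded_fun (zeta j)"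
  and bounded_incnum: "bounded_fun (incnum j)"
  unfolding sqmean_def[abs_def] zeta_def[abs_def] incnum_def[abs_def]
  by (intro bounded_fun_intros bounded_funs bounded_fpc; simp)+

lemma invN_clipN': "invN n \<omega> * (clipN n \<omega> * x) = x" "clipN n \<omega> * (invN n \<omega> * x) = x" "clipN n \<omega> * invN n \<omega> = 1" "invN n \<omega> * clipN n \<omega> = 1"
  using clipN_bounds(1)[of n \<omega>] by (simp_all add: invN_def)

text \<open>Given the past and N_n, the mean of X_n is N_n Z_{n-1}. Dividing by N_n makes the
  sampled fraction unbiased for the proportion, whatever the sample size.\<close>

lemma mart_diff_zeta: "mart_diff zeta"
  by (rule mart_diff_polyI[where ?U0.0=zeta and UA="\<lambda>_ _. 0" and UB="\<lambda>_ _. 0" and UAA="\<lambda>_ _. 0" and UBB="\<lambda>_ _. 0" and UAB="\<lambda>_ _. 0"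
        and ?V0.0="\<lambda>j \<omega>. - clipZ (j - 1) \<omega>" and ?V1.0=invN and ?V2.0="\<lambda>_ _. 0"];
      (intro F_measurables FNX_measurables FN_measurables meas_intros bounded_fun_intros bounded_funs bounded_zeta; assumption)?)
     (auto simp: zeta_def algebra_simps invN_clipN')

text \<open>Equality of the means of A_n and B_n is decisive: averaging them leaves m (X - Z N),
  whose conditional mean is zero. This makes Z_n a martingale up to a small error.\<close>

lemma mart_diff_incnum: "mart_diff incnum"
  by (rule mart_diff_polyI[where ?U0.0="\<lambda>_ _. 0" and UA="\<lambda>j \<omega>. (1 - clipZ (j-1) \<omega>) * clipX j \<omega>" and UB="\<lambda>j \<omega>. - (clipZ (j - 1) \<omega> * (clipN j \<omega> - clipX j \<omega>))"
        and UAA="\<lambda>_ _. 0" and UBB="\<lambda>_ _. 0" and UAB="\<lambda>_ _. 0"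
        and ?V0.0="\<lambda>j \<omega>. - (m j * (clipZ (j - 1) \<omega> * clipN j \<omega>))" and ?V1.0="\<lambda>j _. m j" and ?V2.0="\<lambda>_ _. 0"];
      (intro F_measurables FNX_measurables FN_measurables meas_intros bounded_fun_intros bounded_funs bounded_zeta; assumption)?)
     (auto simp: incnum_def algebra_simps)

text \<open>With equal means, the average growth m X + m (N - X) = m N does not depend on the
  colours drawn. It will show that S_n / n tends to m N.\<close>

lemma mart_diff_growth: "mart_diff (\<lambda>j \<omega>. clipA j \<omega> * clipX j \<omega> + clipB j \<omega> * (clipN j \<omega> - clipX j \<omega>) - m j * clipN j \<omega>)"
  by (rule mart_diff_polyI[where ?U0.0="\<lambda>j \<omega>. - (m j * clipN j \<omega>)" and UA=clipX and UB="\<lambda>j \<omega>. clipN j \<omega> - clipX j \<omega>"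
        and UAA="\<lambda>_ _. 0" and UBB="\<lambda>_ _. 0" and UAB="\<lambda>_ _. 0"
        and ?V0.0="\<lambda>_ _. 0" and ?V1.0="\<lambda>j _. 0" and ?V2.0="\<lambda>_ _. 0"];
      (intro F_measurables FNX_measurables FN_measurables meas_intros bounded_fun_intros bounded_funs bounded_zeta; assumption)?)
     (auto simp: algebra_simps)

text \<open>Subtracts the variance of the sampled fraction given the past and N_j. The compensator
  still contains N_j; its averages are treated separately through the limits for N_j, N_j^2 and 1 /
  N_j.\<close>

lemma mart_diff_zeta_sq: "mart_diff (\<lambda>j \<omega>. (zeta j \<omega>)\<^sup>2 - (clipZ (j - 1) \<omega> * (1 - clipZ (j - 1) \<omega>) * invN j \<omega> - fpc j \<omega> * (invN j \<omega>)\<^sup>2))"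
  by (rule mart_diff_polyI[where ?U0.0="\<lambda>j \<omega>. (zeta j \<omega>)\<^sup>2 - (clipZ (j - 1) \<omega> * (1 - clipZ (j - 1) \<omega>) * invN j \<omega> - fpc j \<omega> * (invN j \<omega>)\<^sup>2)"
        and UA="\<lambda>_ _. 0" and UB="\<lambda>_ _. 0" and UAA="\<lambda>_ _. 0" and UBB="\<lambda>_ _. 0" and UAB="\<lambda>_ _. 0"
        and ?V0.0="\<lambda>j \<omega>. (clipZ (j - 1) \<omega>)\<^sup>2 - (clipZ (j - 1) \<omega> * (1 - clipZ (j - 1) \<omega>) * invN j \<omega> - fpc j \<omega> * (invN j \<omega>)\<^sup>2)"
        and ?V1.0="\<lambda>j \<omega>. - (2 * (clipZ (j - 1) \<omega> * invN j \<omega>))" and ?V2.0="\<lambda>j \<omega>. (invN j \<omega>)\<^sup>2"];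
      (intro F_measurables FNX_measurables FN_measurables meas_intros bounded_fun_intros bounded_funs bounded_zeta bounded_fpc; assumption)?)
     (auto simp: zeta_def sqmean_def power2_eq_square algebra_simps invN_clipN')

text \<open>The covariance of sampling error and increment. It is the source of the term -2 / N in
  the limit variance.\<close>

lemma mart_diff_zeta_incnum: "mart_diff (\<lambda>j \<omega>. zeta j \<omega> * incnum j \<omega> - m j * (clipZ (j - 1) \<omega> * (1 - clipZ (j - 1) \<omega>) - fpc j \<omega> * invN j \<omega>))"
  by (rule mart_diff_polyI[where ?U0.0="\<lambda>j \<omega>. - (m j * (clipZ (j - 1) \<omega> * (1 - clipZ (j - 1) \<omega>) - fpc j \<omega> * invN j \<omega>))"
        and UA="\<lambda>j \<omega>. zeta j \<omega> * ((1 - clipZ (j-1) \<omega>) * clipX j \<omega>)" and UB="\<lambda>j \<omega>. - (zeta j \<omega> * (clipZ (j - 1) \<omega> * (clipN j \<omega> - clipX j \<omega>)))"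
        and UAA="\<lambda>_ _. 0" and UBB="\<lambda>_ _. 0" and UAB="\<lambda>_ _. 0"
        and ?V0.0="\<lambda>j \<omega>. m j * ((clipZ (j - 1) \<omega>)\<^sup>2 * clipN j \<omega>) - m j * (clipZ (j - 1) \<omega> * (1 - clipZ (j - 1) \<omega>) - fpc j \<omega> * invN j \<omega>)"
        and ?V1.0="\<lambda>j \<omega>. - (2 * (m j * clipZ (j - 1) \<omega>))" and ?V2.0="\<lambda>j \<omega>. m j * invN j \<omega>"];
      (intro F_measurables FNX_measurables FN_measurables meas_intros bounded_fun_intros bounded_funs bounded_zeta bounded_fpc; assumption)?)
     (auto simp: zeta_def incnum_def sqmean_def power2_eq_square algebra_simps invN_clipN')

text \<open>Second moment of (1 - Z) A X - Z B (N - X) given the past and N_j: expand the square,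
  replace A^2, A B and B^2 by their expectations, X by N Z and X^2 by \<open>sqmean\<close>.\<close>

definition incvar :: "nat \<Rightarrow> 'a \<Rightarrow> real" where
  "incvar j \<omega> = qA j * ((1 - clipZ (j-1) \<omega>)\<^sup>2 * sqmean j \<omega>)
     - 2 * qAB j * (clipZ (j - 1) \<omega> * (1 - clipZ (j - 1) \<omega>) * ((clipN j \<omega>)\<^sup>2 * clipZ (j - 1) \<omega> - sqmean j \<omega>))
     + qB j * ((clipZ (j - 1) \<omega>)\<^sup>2 * ((clipN j \<omega>)\<^sup>2 - 2 * (clipN j \<omega>)\<^sup>2 * clipZ (j - 1) \<omega> + sqmean j \<omega>))"

lemma incvar_measurable:
  "1 \<le> j \<Longrightarrow> incvar j \<in> borel_measurable (F j)" "1 \<le> j \<Longrightarrow> incvar j \<in> borel_measurable (FN j)"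
  "1 \<le> j \<Longrightarrow> incvar j \<in> borel_measurable (FNX j)"
  unfolding incvar_def[abs_def] by (intro meas_intros F_measurables FN_measurables FNX_measurables; assumption)+

lemma bounded_incvar: "1 \<le> j \<Longrightarrow> bounded_fun (incvar j)"
  unfolding incvar_def[abs_def] by (intro bounded_fun_intros bounded_funs bounded_sqmean)

lemma mart_diff_incnum_sq: "mart_diff (\<lambda>j \<omega>. (incnum j \<omega>)\<^sup>2 - incvar j \<omega>)"
  by (rule mart_diff_polyI[where ?U0.0="\<lambda>j \<omega>. - incvar j \<omega>"
        and UA="\<lambda>_ _. 0" and UB="\<lambda>_ _. 0"
        and UAA="\<lambda>j \<omega>. (1 - clipZ (j-1) \<omega>)\<^sup>2 * (clipX j \<omega>)\<^sup>2" and UBB="\<lambda>j \<omega>. (clipZ (j-1) \<omega>)\<^sup>2 * (clipN j \<omega> - clipX j \<omega>)\<^sup>2"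
        and UAB="\<lambda>j \<omega>. - (2 * (clipZ (j - 1) \<omega> * (1 - clipZ (j - 1) \<omega>) * (clipX j \<omega> * (clipN j \<omega> - clipX j \<omega>))))"
        and ?V0.0="\<lambda>j \<omega>. - incvar j \<omega> + qB j * ((clipZ (j - 1) \<omega>)\<^sup>2 * (clipN j \<omega>)\<^sup>2)"
        and ?V1.0="\<lambda>j \<omega>. - (2 * qAB j * (clipZ (j - 1) \<omega> * (1 - clipZ (j - 1) \<omega>) * clipN j \<omega>)) - 2 * qB j * ((clipZ (j - 1) \<omega>)\<^sup>2 * clipN j \<omega>)"
        and ?V2.0="\<lambda>j \<omega>. qA j * (1 - clipZ (j-1) \<omega>)\<^sup>2 + 2 * qAB j * (clipZ (j - 1) \<omega> * (1 - clipZ (j - 1) \<omega>)) + qB j * (clipZ (j - 1) \<omega>)\<^sup>2"];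
      (intro incvar_measurable bounded_incvar F_measurables FNX_measurables FN_measurables meas_intros bounded_fun_intros bounded_funs bounded_zeta bounded_sqmean; assumption)?)
     (auto simp: incnum_def incvar_def power2_eq_square algebra_simps)

text \<open>Centring suffices, because A_j and B_j are independent of the past. This gives the
  limits of the empirical moments of the replacement factors.\<close>

lemma mart_diff_clip:
  fixes f :: "real \<Rightarrow> real \<Rightarrow> real"
  assumes f: "\<And>j. bounded_fun (\<lambda>\<omega>. f (clipA j \<omega>) (clipB j \<omega>))" "\<And>j. 1 \<le> j \<Longrightarrow> (\<lambda>\<omega>. f (clipA j \<omega>) (clipB j \<omega>)) \<in> borel_measurable (F j)"
  shows "mart_diff (\<lambda>j \<omega>. f (clipA j \<omega>) (clipB j \<omega>) - expectation (\<lambda>\<omega>. f (clipA j \<omega>) (clipB j \<omega>)))"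
proof (rule mart_diffI)
  fix j :: nat assume j: "1 \<le> j"
  define e where "e = expectation (\<lambda>\<omega>. f (clipA j \<omega>) (clipB j \<omega>))"
  show "(\<lambda>\<omega>. f (clipA j \<omega>) (clipB j \<omega>) - expectation (\<lambda>\<omega>. f (clipA j \<omega>) (clipB j \<omega>))) \<in> borel_measurable (F j)"
    by (intro meas_intros f j)
  show "bounded_fun (\<lambda>\<omega>. f (clipA j \<omega>) (clipB j \<omega>) - expectation (\<lambda>\<omega>. f (clipA j \<omega>) (clipB j \<omega>)))"
    by (intro bounded_fun_intros f)
  fix g assume g: "g \<in> borel_measurable (F (j - 1))" "bounded_fun g"
  have gX: "g \<in> borel_measurable (FNX j)"
    by (rule measurable_FN_imp_FNX[OF j measurable_F_imp_FN[OF j g(1)]])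
  have i: "integrable M g" "integrable M (\<lambda>\<omega>. f (clipA j \<omega>) (clipB j \<omega>) * g \<omega>)"
    by (intro integrable_bounded_fun bounded_fun_mult f g borel_measurable_times measurable_F_imp_M[OF f(2)[OF j]] measurable_F_imp_M[OF g(1)])+
  have "expectation (\<lambda>\<omega>. g \<omega> * (f (clipA j \<omega>) (clipB j \<omega>) - e)) = expectation (\<lambda>\<omega>. f (clipA j \<omega>) (clipB j \<omega>) * g \<omega> - e * g \<omega>)"
    by (simp add: algebra_simps)
  also have "\<dots> = expectation (\<lambda>\<omega>. f (clipA j \<omega>) (clipB j \<omega>) * g \<omega>) - e * expectation g"
    using i by simp
  also have "\<dots> = 0"
    unfolding expectation_clip_indep[where f=f, OF j gX g(2) f(1)] e_def by simp
  finally show "expectation (\<lambda>\<omega>. g \<omega> * (f (clipA j \<omega>) (clipB j \<omega>) - expectation (\<lambda>\<omega>. f (clipA j \<omega>) (clipB j \<omega>)))) = 0"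
    by (simp add: e_def)
qed

end

subsection \<open>Almost sure convergence of the proportion\<close>

context bounded_urn
begin

definition Csq :: real where "Csq = (real C)\<^sup>2"

lemma Csq_ge: "1 \<le> Csq" "real C \<le> Csq"
  using C_pos by (auto simp: Csq_def self_le_power)

lemma zeta_le: "\<bar>zeta n \<omega>\<bar> \<le> 1"
proof -
  have "0 \<le> clipX n \<omega> * invN n \<omega>" using clipX_bounds invN_bounds by (simp add: less_imp_le)
  moreover have "clipX n \<omega> * invN n \<omega> \<le> clipN n \<omega> * invN n \<omega>"
    using clipX_bounds invN_bounds by (intro mult_right_mono) (auto simp: less_imp_le)
  ultimately show ?thesis using clipZ_bounds[of "n-1" \<omega>] unfolding zeta_def invN_clipN' by (simp add: abs_le_iff)
qed

text \<open>Dominates the increment up to the factor C, and its mean given the past and N_n is 2 N Z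
  (1 - Z). The factor Z (1 - Z) makes steps small near 0 and 1, which the exclusion of atoms rests
  on.\<close>

definition incbound :: "nat \<Rightarrow> 'a \<Rightarrow> real" where
  "incbound n \<omega> = (1 - clipZ (n - 1) \<omega>) * clipX n \<omega> + clipZ (n - 1) \<omega> * (clipN n \<omega> - clipX n \<omega>)"

lemma incbound_nonneg: "0 \<le> incbound n \<omega>"
  unfolding incbound_def using clipZ_bounds[of "n-1" \<omega>] clipX_bounds[of n \<omega>] by simp

lemma incbound_le: "incbound n \<omega> \<le> real C"
proof -
  have "incbound n \<omega> \<le> 1 * clipX n \<omega> + 1 * (clipN n \<omega> - clipX n \<omega>)"
    unfolding incbound_def using clipZ_bounds[of "n-1" \<omega>] clipX_bounds[of n \<omega>] by (intro add_mono mult_right_mono) auto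
  then show ?thesis using clipN_bounds(2)[of n \<omega>] by simp
qed

lemma incnum_le_incbound: "\<bar>incnum n \<omega>\<bar> \<le> real C * incbound n \<omega>"
proof -
  have z: "0 \<le> clipZ (n - 1) \<omega>" "0 \<le> 1 - clipZ (n - 1) \<omega>" using clipZ_bounds[of "n-1" \<omega>] by auto
  have 1: "0 \<le> (1 - clipZ (n - 1) \<omega>) * (clipA n \<omega> * clipX n \<omega>)" "0 \<le> clipZ (n - 1) \<omega> * (clipB n \<omega> * (clipN n \<omega> - clipX n \<omega>))"
    using z clipX_bounds[of n \<omega>] clipA_bounds[of n \<omega>] clipB_bounds[of n \<omega>] by auto
  have 2: "(1 - clipZ (n - 1) \<omega>) * (clipA n \<omega> * clipX n \<omega>) \<le> (1 - clipZ (n - 1) \<omega>) * (real C * clipX n \<omega>)"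
    using z clipX_bounds[of n \<omega>] clipA_bounds[of n \<omega>] by (intro mult_left_mono mult_right_mono) auto
  have 3: "clipZ (n - 1) \<omega> * (clipB n \<omega> * (clipN n \<omega> - clipX n \<omega>)) \<le> clipZ (n - 1) \<omega> * (real C * (clipN n \<omega> - clipX n \<omega>))"
    using z clipX_bounds[of n \<omega>] clipB_bounds[of n \<omega>] by (intro mult_left_mono mult_right_mono) auto
  have "\<bar>incnum n \<omega>\<bar> \<le> (1 - clipZ (n - 1) \<omega>) * (real C * clipX n \<omega>) + clipZ (n - 1) \<omega> * (real C * (clipN n \<omega> - clipX n \<omega>))"
    unfolding incnum_def using 1 2 3 by (simp only: abs_le_iff) linarith
  also have "\<dots> = real C * incbound n \<omega>" unfolding incbound_def by (simp add: algebra_simps)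
  finally show ?thesis .
qed

lemma incnum_le: "\<bar>incnum n \<omega>\<bar> \<le> Csq"
proof -
  have "\<bar>incnum n \<omega>\<bar> \<le> real C * incbound n \<omega>" by (rule incnum_le_incbound)
  also have "\<dots> \<le> real C * real C" by (intro mult_left_mono incbound_le) auto
  finally show ?thesis by (simp add: Csq_def power2_eq_square)
qed

lemma invS_le:
  assumes "1 \<le> n"
  shows "0 \<le> invS n \<omega>" "invS n \<omega> \<le> 1 / real n" "0 \<le> invS (n - 1) \<omega>" "invS (n - 1) \<omega> \<le> 1 / real n"
proof -
  have "1 / real (n + 2) \<le> 1 / real n" "1 / real (n - 1 + 2) \<le> 1 / real n"
    using assms by (auto intro!: divide_left_mono)
  then show "0 \<le> invS n \<omega>" "invS n \<omega> \<le> 1 / real n" "0 \<le> invS (n - 1) \<omega>" "invS (n - 1) \<omega> \<le> 1 / real n"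
    using invS_bounds[of n \<omega>] invS_bounds[of "n-1" \<omega>] by auto
qed

lemma mdinc_le: "1 \<le> n \<Longrightarrow> \<bar>mdinc n \<omega>\<bar> \<le> Csq / real n"
  unfolding mdinc_def abs_mult using invS_le[of n \<omega>] incnum_le[of n \<omega>]
    mult_mono[of "\<bar>invS (n-1) \<omega>\<bar>" "1 / real n" "\<bar>incnum n \<omega>\<bar>" Csq] by simp

lemma mart_diff_mdinc: "mart_diff mdinc"
  unfolding mdinc_def[abs_def]
  by (rule mart_diff_mult_predictable[OF mart_diff_incnum measurable_F_totals(5)[OF order_refl] bounded_funs(7)])

lemma totals_step:
  assumes "1 \<le> n"
  shows "clipH n \<omega> = clipH (n - 1) \<omega> + clipA n \<omega> * clipX n \<omega>" "clipK n \<omega> = clipK (n - 1) \<omega> + clipB n \<omega> * (clipN n \<omega> - clipX n \<omega>)"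
  using clipH_Suc[of "n - 1" \<omega>] clipK_Suc[of "n - 1" \<omega>] assms by auto

lemma clipZ_step:
  assumes n: "1 \<le> n"
  shows "clipZ n \<omega> - clipZ (n - 1) \<omega> = invS n \<omega> * incnum n \<omega>"
proof -
  have s: "clipS n \<omega> \<noteq> 0" "clipS (n - 1) \<omega> \<noteq> 0" using clipS_pos[of n \<omega>] clipS_pos[of "n - 1" \<omega>] by auto
  have h: "clipH (n - 1) \<omega> = clipZ (n - 1) \<omega> * clipS (n - 1) \<omega>" using s by (simp add: clipZ_def)
  have k: "clipK (n - 1) \<omega> = (1 - clipZ (n - 1) \<omega>) * clipS (n - 1) \<omega>" using s by (simp add: one_minus_clipZ)
  have "clipZ n \<omega> - clipZ (n - 1) \<omega> = (clipH n \<omega> - clipZ (n - 1) \<omega> * clipS n \<omega>) / clipS n \<omega>"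
    using s by (simp add: clipZ_def[of n] diff_divide_distrib)
  also have "clipH n \<omega> - clipZ (n - 1) \<omega> * clipS n \<omega> = incnum n \<omega>"
    unfolding clipS_def[of n] totals_step[OF n] h k incnum_def by (simp add: algebra_simps)
  finally show ?thesis by (simp add: invS_def divide_inverse mult.commute)
qed

definition increm :: "nat \<Rightarrow> 'a \<Rightarrow> real" where "increm n \<omega> = invS n \<omega> * incnum n \<omega> - mdinc n \<omega>"

text \<open>The error comes from the growth of S by at most \<open>Csq\<close> in one step. The
  factor |incnum| is kept instead of being bounded by a constant: near 0 the error has to shrink
  with the proportion.\<close>

lemma increm_le:
  assumes n: "1 \<le> n"
  shows "\<bar>increm n \<omega>\<bar> \<le> Csq * \<bar>incnum n \<omega>\<bar> / (real n)\<^sup>2"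
proof -
  have s: "clipS n \<omega> > 0" "clipS (n - 1) \<omega> > 0" using clipS_pos by auto
  define t where "t = clipA n \<omega> * clipX n \<omega> + clipB n \<omega> * (clipN n \<omega> - clipX n \<omega>)"
  have t: "0 \<le> t" "t \<le> Csq" using step_bounds[of n \<omega>] by (auto simp: t_def Csq_def)
  have "clipS n \<omega> = clipS (n - 1) \<omega> + t" unfolding clipS_def totals_step[OF n] t_def by simp
  then have E: "invS (n - 1) \<omega> - invS n \<omega> = t * invS n \<omega> * invS (n - 1) \<omega>"
    using s by (simp add: invS_def field_simps)
  have "increm n \<omega> = - (invS (n - 1) \<omega> - invS n \<omega>) * incnum n \<omega>"
    unfolding increm_def mdinc_def by (simp add: algebra_simps)
  then have "increm n \<omega> = - (t * invS n \<omega> * invS (n - 1) \<omega>) * incnum n \<omega>" unfolding E .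
  then have "\<bar>increm n \<omega>\<bar> = t * invS n \<omega> * invS (n - 1) \<omega> * \<bar>incnum n \<omega>\<bar>"
    using t invS_le[OF n, of \<omega>] by (simp add: abs_mult)
  also have "\<dots> \<le> Csq * (1 / real n) * (1 / real n) * \<bar>incnum n \<omega>\<bar>"
    using t invS_le[OF n, of \<omega>] Csq_ge by (intro mult_mono mult_nonneg_nonneg) auto
  also have "\<dots> = Csq * \<bar>incnum n \<omega>\<bar> / (real n)\<^sup>2" by (simp add: power2_eq_square)
  finally show ?thesis .
qed

lemma increm_le': "1 \<le> n \<Longrightarrow> \<bar>increm n \<omega>\<bar> \<le> Csq\<^sup>2 * (1 / (real n)\<^sup>2)"
proof -
  assume n: "1 \<le> n"
  have "Csq * \<bar>incnum n \<omega>\<bar> / (real n)\<^sup>2 \<le> Csq * Csq / (real n)\<^sup>2"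
    using Csq_ge incnum_le[of n \<omega>] by (intro divide_right_mono mult_left_mono) auto
  then show ?thesis using increm_le[OF n, of \<omega>] by (simp add: power2_eq_square[of Csq])
qed

lemma clipZ_step': "1 \<le> n \<Longrightarrow> clipZ n \<omega> - clipZ (n - 1) \<omega> = mdinc n \<omega> + increm n \<omega>"
  using clipZ_step by (simp add: increm_def)

lemma clipZ_diff:
  assumes "n \<le> p"
  shows "clipZ p \<omega> - clipZ n \<omega> = (\<Sum>j=n+1..p. invS j \<omega> * incnum j \<omega>)"
  using assms
proof (induction rule: dec_induct)
  case (step p)
  have "{n+1..Suc p} = insert (Suc p) {n+1..p}" using step by auto
  then show ?case using step clipZ_step[of "Suc p" \<omega>] by simp
qed simp

lemma clipZ_diff': "n \<le> p \<Longrightarrow> clipZ p \<omega> - clipZ n \<omega> = (\<Sum>j=n+1..p. mdinc j \<omega>) + (\<Sum>j=n+1..p. increm j \<omega>)"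
  by (simp add: clipZ_diff increm_def sum.distrib[symmetric])

text \<open>Z_n - Z_0 is a sum of martingale differences of order 1 / j plus an absolutely summable
  remainder of order 1 / j^2.\<close>

lemma clipZ_AE_convergent: "AE \<omega> in M. convergent (\<lambda>n. clipZ n \<omega>)"
proof -
  have "AE \<omega> in M. convergent (\<lambda>n. \<Sum>j=1..n. mdinc j \<omega>)"
    by (rule mart_diff_AE_convergent[OF mart_diff_mdinc mdinc_le])
  then show ?thesis
  proof eventually_elim
    case (elim \<omega>)
    have "summable (\<lambda>k. 1 / (real k)\<^sup>2)"
      using inverse_power_summable[of 2, where 'a=real] by (simp add: inverse_eq_divide power_one_over)
    then have "summable (\<lambda>k. Csq\<^sup>2 * (1 / (real k)\<^sup>2))" by (rule summable_mult)
    then have "summable (\<lambda>k. increm k \<omega>)"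
      by (rule summable_comparison_test'[where N=1]) (use increm_le' in simp)
    then have "summable (\<lambda>k. increm (Suc k) \<omega>)" using summable_Suc_iff[of "\<lambda>k. increm k \<omega>"] by simp
    then have "convergent (\<lambda>n. \<Sum>j<n. increm (Suc j) \<omega>)" by (simp only: summable_iff_convergent)
    then have "convergent (\<lambda>n. \<Sum>j=1..n. increm j \<omega>)"
      by (simp add: sum.atLeast1_atMost_eq)
    from convergent_add[OF elim this] have "convergent (\<lambda>n. clipZ n \<omega> - clipZ 0 \<omega>)"
      using clipZ_diff'[of 0 _ \<omega>] by simp
    from convergent_add[OF this convergent_const[of "clipZ 0 \<omega>"]] show ?case by simp
  qed
qed

text \<open>Orthogonality reduces the martingale part to the tail of 1 / j^2, and the square of the
  remainder is no larger in order. The bound is uniform in the later time, so it passes to the limit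
  Z.\<close>

lemma clipZ_L2_rate:
  assumes Z: "Z \<in> borel_measurable M" "AE \<omega> in M. (\<lambda>n. clipZ n \<omega>) \<longlonglongrightarrow> Z \<omega>" and n: "1 \<le> n"
  shows "expectation (\<lambda>\<omega>. (clipZ n \<omega> - Z \<omega>)\<^sup>2) \<le> 4 * Csq ^ 4 / real n"
proof -
  note [measurable] = Z(1) measurable_M_processes(9)
  have p: "expectation (\<lambda>\<omega>. (clipZ p \<omega> - clipZ n \<omega>)\<^sup>2) \<le> 4 * Csq ^ 4 / real n" if "n \<le> p" for p
  proof -
    have dm: "mdinc j \<in> borel_measurable M" if "1 \<le> j" for j by (rule mart_diff_measurable_M[OF mart_diff_mdinc that])
    have db: "bounded_fun (mdinc j)" for j unfolding mdinc_def[abs_def] by (intro bounded_fun_intros bounded_funs bounded_incnum)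
    have Db: "bounded_fun (\<lambda>\<omega>. \<Sum>j=n+1..p. mdinc j \<omega>)" by (intro bounded_fun_intros db)
    have Dm: "(\<lambda>\<omega>. \<Sum>j=n+1..p. mdinc j \<omega>) \<in> borel_measurable M" by (intro borel_measurable_sum dm) auto
    have s2: "(\<Sum>j=n+1..p. 1 / (real j)\<^sup>2) \<le> 1 / real n" by (rule sum_inverse_squares_le[OF n])
    have A: "expectation (\<lambda>\<omega>. (\<Sum>j=n+1..p. mdinc j \<omega>)\<^sup>2) \<le> Csq\<^sup>2 * (1 / real n)"
    proof -
      have "expectation (\<lambda>\<omega>. (\<Sum>j=n+1..p. mdinc j \<omega>)\<^sup>2) = (\<Sum>j=n+1..p. expectation (\<lambda>\<omega>. (mdinc j \<omega>)\<^sup>2))"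
        by (rule mart_diff_sum_squares[OF mart_diff_mdinc])
      also have "\<dots> \<le> (\<Sum>j=n+1..p. Csq\<^sup>2 * (1 / (real j)\<^sup>2))"
      proof (intro sum_mono)
        fix j assume j: "j \<in> {n+1..p}"
        have "(mdinc j \<omega>)\<^sup>2 \<le> Csq\<^sup>2 * (1 / (real j)\<^sup>2)" for \<omega>
          using power_mono[OF mdinc_le[of j \<omega>], of 2] j by (simp add: power_divide)
        then have "expectation (\<lambda>\<omega>. (mdinc j \<omega>)\<^sup>2) \<le> expectation (\<lambda>\<omega>. Csq\<^sup>2 * (1 / (real j)\<^sup>2))"
          using dm[of j] j by (intro integral_mono integrable_bounded_fun bounded_fun_intros db borel_measurable_power) auto
        then show "expectation (\<lambda>\<omega>. (mdinc j \<omega>)\<^sup>2) \<le> Csq\<^sup>2 * (1 / (real j)\<^sup>2)" by (simp add: prob_space)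
      qed
      also have "\<dots> \<le> Csq\<^sup>2 * (1 / real n)"
        unfolding sum_distrib_left[symmetric] by (intro mult_left_mono s2) auto
      finally show ?thesis .
    qed
    have B: "(\<Sum>j=n+1..p. increm j \<omega>)\<^sup>2 \<le> Csq ^ 4 * (1 / real n)" for \<omega>
    proof -
      have "\<bar>\<Sum>j=n+1..p. increm j \<omega>\<bar> \<le> (\<Sum>j=n+1..p. Csq\<^sup>2 * (1 / (real j)\<^sup>2))"
        using n by (intro order_trans[OF sum_abs] sum_mono increm_le') auto
      also have "\<dots> \<le> Csq\<^sup>2 * (1 / real n)"
        unfolding sum_distrib_left[symmetric] by (intro mult_left_mono s2) auto
      finally have "\<bar>\<Sum>j=n+1..p. increm j \<omega>\<bar>\<^sup>2 \<le> (Csq\<^sup>2 * (1 / real n))\<^sup>2" by (intro power_mono) auto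
      also have "\<dots> = Csq ^ 4 * (1 / real n) * (1 / real n)" by (simp add: power2_eq_square power4_eq_xxxx)
      also have "\<dots> \<le> Csq ^ 4 * (1 / real n) * 1" using n by (intro mult_left_mono) auto
      finally show ?thesis by simp
    qed
    have "expectation (\<lambda>\<omega>. (clipZ p \<omega> - clipZ n \<omega>)\<^sup>2) \<le> expectation (\<lambda>\<omega>. 2 * (\<Sum>j=n+1..p. mdinc j \<omega>)\<^sup>2 + 2 * (Csq ^ 4 * (1 / real n)))"
    proof (intro integral_mono)
      fix \<omega>
      have "(clipZ p \<omega> - clipZ n \<omega>)\<^sup>2 \<le> 2 * (\<Sum>j=n+1..p. mdinc j \<omega>)\<^sup>2 + 2 * (\<Sum>j=n+1..p. increm j \<omega>)\<^sup>2"
        unfolding clipZ_diff'[OF \<open>n \<le> p\<close>]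
        using sum_squares_ge_zero[of "(\<Sum>j=n+1..p. mdinc j \<omega>) - (\<Sum>j=n+1..p. increm j \<omega>)" 0]
        by (simp add: power2_eq_square algebra_simps)
      then show "(clipZ p \<omega> - clipZ n \<omega>)\<^sup>2 \<le> 2 * (\<Sum>j=n+1..p. mdinc j \<omega>)\<^sup>2 + 2 * (Csq ^ 4 * (1 / real n))"
        using B[of \<omega>] by linarith
    next
      show "integrable M (\<lambda>\<omega>. (clipZ p \<omega> - clipZ n \<omega>)\<^sup>2)"
        by (intro integrable_bounded_fun bounded_fun_intros bounded_funs) measurable
      show "integrable M (\<lambda>\<omega>. 2 * (\<Sum>j=n+1..p. mdinc j \<omega>)\<^sup>2 + 2 * (Csq ^ 4 * (1 / real n)))"
        by (intro integrable_bounded_fun bounded_fun_add bounded_fun_mult bounded_fun_const bounded_fun_power Db meas_intros Dm)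
    qed
    also have "\<dots> = 2 * expectation (\<lambda>\<omega>. (\<Sum>j=n+1..p. mdinc j \<omega>)\<^sup>2) + 2 * (Csq ^ 4 * (1 / real n))"
    proof -
      have "integrable M (\<lambda>\<omega>. (\<Sum>j=n+1..p. mdinc j \<omega>)\<^sup>2)"
        by (intro integrable_bounded_fun bounded_fun_power Db meas_intros Dm)
      then show ?thesis by (simp add: prob_space)
    qed
    also have "\<dots> \<le> 2 * (Csq\<^sup>2 * (1 / real n)) + 2 * (Csq ^ 4 * (1 / real n))" using A by simp
    also have "Csq\<^sup>2 * (1 / real n) \<le> Csq ^ 4 * (1 / real n)"
      using Csq_ge by (intro mult_right_mono power_increasing) auto
    finally show ?thesis by simp
  qed
  have "(\<lambda>p. expectation (\<lambda>\<omega>. (clipZ p \<omega> - clipZ n \<omega>)\<^sup>2)) \<longlonglongrightarrow> expectation (\<lambda>\<omega>. (Z \<omega> - clipZ n \<omega>)\<^sup>2)"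
  proof (rule integral_dominated_convergence[where w="\<lambda>_. 1"])
    show "AE \<omega> in M. (\<lambda>p. (clipZ p \<omega> - clipZ n \<omega>)\<^sup>2) \<longlonglongrightarrow> (Z \<omega> - clipZ n \<omega>)\<^sup>2"
      using Z(2) by eventually_elim (intro tendsto_intros)
    show "AE \<omega> in M. norm ((clipZ p \<omega> - clipZ n \<omega>)\<^sup>2) \<le> 1" for p
    proof (rule AE_I2)
      fix \<omega> have "\<bar>clipZ p \<omega> - clipZ n \<omega>\<bar> \<le> 1" using clipZ_bounds[of p \<omega>] clipZ_bounds[of n \<omega>] by (simp add: abs_le_iff)
      then show "norm ((clipZ p \<omega> - clipZ n \<omega>)\<^sup>2) \<le> 1" by (simp add: abs_square_le_1)
    qed
  qed measurable
  then have "expectation (\<lambda>\<omega>. (Z \<omega> - clipZ n \<omega>)\<^sup>2) \<le> 4 * Csq ^ 4 / real n"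
    by (rule LIMSEQ_le_const2) (use p in auto)
  then show ?thesis by (simp add: power2_commute)
qed

lemma expectation_linear_clipX:
  assumes n: "1 \<le> n" and g: "g \<in> borel_measurable (FN n)" "bounded_fun g" "h \<in> borel_measurable (FN n)" "bounded_fun h"
  shows "expectation (\<lambda>\<omega>. h \<omega> + g \<omega> * clipX n \<omega>) = expectation (\<lambda>\<omega>. h \<omega> + g \<omega> * (clipN n \<omega> * clipZ (n - 1) \<omega>))"
  using expectation_clipX_poly[OF n g(3,4,1,2), of "\<lambda>_. 0"] by (simp add: bounded_fun_const)

text \<open>\<open>incbound\<close> is affine in X_n, so averaging X_n gives exactly 2 N Z (1 - Z),
  with N at most C.\<close>

lemma expectation_incbound_le:
  assumes n: "1 \<le> n" and g: "g \<in> borel_measurable (F (n - 1))" "bounded_fun g" "\<And>\<omega>. 0 \<le> g \<omega>"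
  shows "expectation (\<lambda>\<omega>. g \<omega> * incbound n \<omega>) \<le> 2 * real C * expectation (\<lambda>\<omega>. g \<omega> * (clipZ (n - 1) \<omega> * (1 - clipZ (n - 1) \<omega>)))"
proof -
  have gN: "g \<in> borel_measurable (FN n)" by (rule measurable_F_imp_FN[OF n g(1)])
  note * = FN_measurables[OF n]
  have "expectation (\<lambda>\<omega>. g \<omega> * incbound n \<omega>) = expectation (\<lambda>\<omega>. g \<omega> * (clipZ (n - 1) \<omega> * clipN n \<omega>) + (g \<omega> * (1 - 2 * clipZ (n - 1) \<omega>)) * clipX n \<omega>)"
    by (simp add: incbound_def algebra_simps)
  also have "\<dots> = expectation (\<lambda>\<omega>. g \<omega> * (clipZ (n - 1) \<omega> * clipN n \<omega>) + (g \<omega> * (1 - 2 * clipZ (n - 1) \<omega>)) * (clipN n \<omega> * clipZ (n - 1) \<omega>))"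
    by (intro expectation_linear_clipX n meas_intros gN * bounded_fun_intros g bounded_funs)
  also have "\<dots> = expectation (\<lambda>\<omega>. 2 * (g \<omega> * (clipZ (n - 1) \<omega> * (1 - clipZ (n - 1) \<omega>))) * clipN n \<omega>)"
    by (simp add: algebra_simps)
  also have "\<dots> \<le> expectation (\<lambda>\<omega>. 2 * real C * (g \<omega> * (clipZ (n - 1) \<omega> * (1 - clipZ (n - 1) \<omega>))))"
  proof (intro integral_mono)
    fix \<omega> show "2 * (g \<omega> * (clipZ (n - 1) \<omega> * (1 - clipZ (n - 1) \<omega>))) * clipN n \<omega> \<le> 2 * real C * (g \<omega> * (clipZ (n - 1) \<omega> * (1 - clipZ (n - 1) \<omega>)))"
      using mult_left_mono[OF clipN_bounds(2)[of n \<omega>], of "2 * (g \<omega> * (clipZ (n - 1) \<omega> * (1 - clipZ (n - 1) \<omega>)))"]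
        g(3)[of \<omega>] clipZ_bounds[of "n - 1" \<omega>] by (simp add: mult_ac)
  qed (intro integrable_bounded_fun bounded_fun_intros g bounded_funs meas_intros measurable_M_processes n measurable_F_imp_M[OF g(1)])+
  finally show ?thesis by (simp only: integral_mult_right_zero)
qed

end

subsection \<open>The limit proportion has no mass at 0 and 1\<close>

context bounded_urn
begin

lemma incnum_incbound_le: "1 \<le> n \<Longrightarrow> Csq * \<bar>incnum n \<omega>\<bar> / (real n)\<^sup>2 \<le> Csq * real C / (real n)\<^sup>2 * incbound n \<omega>"
proof -
  assume "1 \<le> n"
  have "Csq * \<bar>incnum n \<omega>\<bar> / (real n)\<^sup>2 \<le> Csq * (real C * incbound n \<omega>) / (real n)\<^sup>2"
    using Csq_ge incnum_le_incbound by (intro divide_right_mono mult_left_mono) auto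
  then show ?thesis by simp
qed

text \<open>
  Used for both colours: \<open>z\<close> is the proportion and \<open>G\<close> the number of balls of the colour, \<open>w\<close> the
  number of sampled ones, and \<open>s\<close> the sign with which \<open>incnum\<close> drives \<open>z\<close>.
\<close>

lemma limit_proportion_no_atom:
  fixes z G w :: "nat \<Rightarrow> 'a \<Rightarrow> real" and s :: real
  assumes zG: "\<And>n \<omega>. z n \<omega> = G n \<omega> * invS n \<omega>"
    and s: "\<bar>s\<bar> = 1"
    and step: "\<And>n \<omega>. 1 \<le> n \<Longrightarrow> z n \<omega> - z (n - 1) \<omega> = s * (invS n \<omega> * incnum n \<omega>)"
    and zz: "\<And>n \<omega>. z n \<omega> * (1 - z n \<omega>) = clipZ n \<omega> * (1 - clipZ n \<omega>)"
    and z0: "\<And>n \<omega>. 0 < z n \<omega>" and z1: "\<And>n \<omega>. z n \<omega> < 1"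
    and G1: "\<And>n \<omega>. 1 \<le> G n \<omega>"
    and Gw: "\<And>n \<omega>. 1 \<le> n \<Longrightarrow> G (n - 1) \<omega> + w n \<omega> \<le> G n \<omega>"
    and Gc: "\<And>n \<omega>. 1 \<le> n \<Longrightarrow> G n \<omega> \<le> G (n - 1) \<omega> + Csq"
    and w0: "\<And>n \<omega>. 0 \<le> w n \<omega>"
    and Gm: "\<And>n. G n \<in> borel_measurable (F n)"
    and wm: "\<And>n. 1 \<le> n \<Longrightarrow> w n \<in> borel_measurable M" and wb: "\<And>n. bounded_fun (w n)"
    and Ew: "\<And>n g. 1 \<le> n \<Longrightarrow> g \<in> borel_measurable (F (n - 1)) \<Longrightarrow> bounded_fun g \<Longrightarrow>
        expectation (\<lambda>\<omega>. g \<omega> * w n \<omega>) = expectation (\<lambda>\<omega>. g \<omega> * (clipN n \<omega> * z (n - 1) \<omega>))"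
    and zl: "zl \<in> borel_measurable M" "AE \<omega> in M. (\<lambda>n. z n \<omega>) \<longlonglongrightarrow> zl \<omega>"
  shows "AE \<omega> in M. zl \<omega> \<noteq> 0"
proof -
  have zm: "z n \<in> borel_measurable (F n)" for n
    unfolding zG[THEN ext] by (intro borel_measurable_times Gm measurable_F_totals order_refl)
  have zmM: "z n \<in> borel_measurable M" and GmM: "G n \<in> borel_measurable M" for n
    using measurable_F_imp_M[OF zm] measurable_F_imp_M[OF Gm] by auto
  have zb: "bounded_fun (z n)" for n
    by (rule bounded_funI[of _ 1]) (use z0 z1 in \<open>auto simp: abs_le_iff less_imp_le\<close>)
  define c0 where "c0 = real (a + b) + Csq"
  have c0: "1 \<le> c0" using Csq_ge by (simp add: c0_def)
  have S_le: "clipS n \<omega> \<le> c0 * real n" if "1 \<le> n" for n \<omega>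
  proof -
    have "real (a + b) * 1 \<le> real (a + b) * real n" using that by (intro mult_left_mono) auto
    then show ?thesis using clipS_le[of n \<omega>] by (simp add: c0_def Csq_def algebra_simps)
  qed
  have S_le': "clipS (n - 1) \<omega> \<le> c0 * real n" if "1 \<le> n" for n \<omega>
  proof -
    have "clipS (n - 1) \<omega> \<le> clipS n \<omega>" using step_bounds(1)[of n \<omega>] totals_step[OF that, of \<omega>] by (simp add: clipS_def)
    then show ?thesis using S_le[OF that, of \<omega>] by linarith
  qed
  have iGb: "0 < 1 / G n \<omega>" "1 / G n \<omega> \<le> 1" for n \<omega> using G1[of n \<omega>] by auto
  have biG: "bounded_fun (\<lambda>\<omega>. 1 / G n \<omega>)" for n
    by (rule bounded_funI[of _ 1]) (use iGb in \<open>auto simp: abs_le_iff less_imp_le intro: order_trans[of _ 0]\<close>)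

  \<comment> \<open>First goal: r_n = E[1 / G_n] tends to 0. On average 1 / G decreases by a
    fraction of order 1 / n per step, and the harmonic series diverges.\<close>
  define r where "r n = expectation (\<lambda>\<omega>. 1 / G n \<omega>)" for n
  have iG: "integrable M (\<lambda>\<omega>. 1 / G n \<omega>)" for n
    by (intro integrable_bounded_fun biG borel_measurable_divide GmM borel_measurable_const)
  have r0: "0 \<le> r n" for n unfolding r_def using iGb by (intro Bochner_Integration.integral_nonneg) (auto simp: less_imp_le)
  have r_le1: "r n \<le> 1" for n
  proof -
    have "r n \<le> expectation (\<lambda>\<omega>. 1)" unfolding r_def using iGb by (intro integral_mono iG) auto
    then show ?thesis by (simp add: prob_space)
  qed
  \<comment> \<open>Here 1 + Csq bounds the ratio of G_n to G_{n-1}, and c0 n bounds S_{n-1} in z =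
    G / S.\<close>
  define \<kappa> where "\<kappa> = 1 / ((1 + Csq) * c0)"
  have \<kappa>: "\<kappa> > 0" using c0 Csq_ge by (simp add: \<kappa>_def)
  have r_step: "r n \<le> r (n - 1) * exp (- (\<kappa> / real n))" if n: "1 \<le> n" for n
  proof -
    \<comment> \<open>A lower bound for 1 / (G_{n-1} G_n) that is known at time n - 1, so that it
      can be tested against \<open>w n\<close>.\<close>
    define h where "h \<omega> = 1 / ((1 + Csq) * (G (n - 1) \<omega>)\<^sup>2)" for \<omega>
    have h0: "0 \<le> h \<omega>" "h \<omega> \<le> 1" for \<omega>
    proof -
      have "1 * 1 \<le> (1 + Csq) * (G (n - 1) \<omega>)\<^sup>2" using Csq_ge G1[of "n-1" \<omega>] by (intro mult_mono) (auto simp: one_le_power)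
      then show "0 \<le> h \<omega>" "h \<omega> \<le> 1" by (auto simp: h_def)
    qed
    have hb: "bounded_fun h" by (rule bounded_funI[of _ 1]) (use h0 in auto)
    have hm: "h \<in> borel_measurable (F (n - 1))"
      unfolding h_def[abs_def] by (intro borel_measurable_divide meas_intros Gm)
    note hM = measurable_F_imp_M[OF hm]
    have ihw: "integrable M (\<lambda>\<omega>. h \<omega> * w n \<omega>)" by (intro integrable_bounded_fun bounded_fun_mult hb wb borel_measurable_times hM wm n)
    have pt: "1 / G n \<omega> \<le> 1 / G (n - 1) \<omega> - h \<omega> * w n \<omega>" for \<omega>
    proof -
      define g where "g = G (n - 1) \<omega>"
      define g' where "g' = G n \<omega>"
      have g: "1 \<le> g" "1 \<le> g'" "g + w n \<omega> \<le> g'" "g' \<le> (1 + Csq) * g"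
      proof -
        have "Csq * 1 \<le> Csq * g" using G1[of "n-1" \<omega>] Csq_ge unfolding g_def by (intro mult_left_mono) auto
        then show "g' \<le> (1 + Csq) * g" using Gc[OF n, of \<omega>] by (simp add: g_def g'_def algebra_simps)
      qed (use G1 Gw[OF n] in \<open>auto simp: g_def g'_def\<close>)
      have "h \<omega> * w n \<omega> = w n \<omega> / (g * ((1 + Csq) * g))" by (simp add: h_def g_def power2_eq_square)
      also have "\<dots> \<le> (g' - g) / (g * ((1 + Csq) * g))" using g Csq_ge by (intro divide_right_mono) auto
      also have "\<dots> \<le> (g' - g) / (g * g')" using g w0[of n \<omega>] by (intro divide_left_mono mult_left_mono) auto
      also have "\<dots> = 1 / g - 1 / g'" using g by (simp add: field_simps)
      finally show ?thesis by (simp add: g_def g'_def)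
    qed
    have "r n \<le> expectation (\<lambda>\<omega>. 1 / G (n - 1) \<omega> - h \<omega> * w n \<omega>)"
      unfolding r_def by (intro integral_mono pt iG Bochner_Integration.integrable_diff ihw)
    also have "\<dots> = r (n - 1) - expectation (\<lambda>\<omega>. h \<omega> * w n \<omega>)"
      unfolding r_def using iG ihw by simp
    also have "expectation (\<lambda>\<omega>. h \<omega> * w n \<omega>) = expectation (\<lambda>\<omega>. h \<omega> * (clipN n \<omega> * z (n - 1) \<omega>))"
      by (rule Ew[OF n hm hb])
    also have "r (n - 1) - \<dots> \<le> r (n - 1) - \<kappa> / real n * r (n - 1)"
    proof -
      have "\<kappa> / real n * r (n - 1) = expectation (\<lambda>\<omega>. \<kappa> / real n * (1 / G (n - 1) \<omega>))"
        unfolding r_def by (rule integral_mult_right_zero[symmetric])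
      also have "\<dots> \<le> expectation (\<lambda>\<omega>. h \<omega> * (clipN n \<omega> * z (n - 1) \<omega>))"
      proof (rule integral_mono)
        show "integrable M (\<lambda>\<omega>. \<kappa> / real n * (1 / G (n - 1) \<omega>))" by (intro integrable_mult_right iG)
        show "integrable M (\<lambda>\<omega>. h \<omega> * (clipN n \<omega> * z (n - 1) \<omega>))"
          by (intro integrable_bounded_fun bounded_fun_mult hb bounded_funs zb borel_measurable_times hM zmM measurable_M_processes n)
        fix \<omega>
        define g where "g = G (n - 1) \<omega>"
        have g: "1 \<le> g" using G1 by (simp add: g_def)
        have "1 / (c0 * real n) \<le> invS (n - 1) \<omega>"
          using S_le'[OF n, of \<omega>] clipS_pos[of "n-1" \<omega>] c0 n unfolding invS_def inverse_eq_divide by (intro divide_left_mono) auto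
        then have "1 / ((1 + Csq) * g) * (1 / (c0 * real n)) \<le> 1 / ((1 + Csq) * g) * invS (n - 1) \<omega>"
          using g Csq_ge by (intro mult_left_mono) auto
        also have "\<dots> = h \<omega> * (1 * z (n - 1) \<omega>)"
          unfolding h_def zG g_def[symmetric] using g by (simp add: power2_eq_square)
        also have "\<dots> \<le> h \<omega> * (clipN n \<omega> * z (n - 1) \<omega>)"
          using h0 z0[of "n - 1" \<omega>] clipN_bounds(1) by (intro mult_left_mono mult_right_mono) auto
        finally show "\<kappa> / real n * (1 / G (n - 1) \<omega>) \<le> h \<omega> * (clipN n \<omega> * z (n - 1) \<omega>)"
          by (simp add: \<kappa>_def g_def mult_ac)
      qed
      finally show ?thesis by simp
    qed
    also have "\<dots> = r (n - 1) * (1 + - (\<kappa> / real n))" by (simp add: algebra_simps)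
    also have "\<dots> \<le> r (n - 1) * exp (- (\<kappa> / real n))"
      by (intro mult_left_mono exp_ge_add_one_self r0)
    finally show ?thesis .
  qed
  have r_harm: "r n \<le> exp (- \<kappa> * harm n)" for n
  proof (induction n)
    case 0 then show ?case using r_le1[of 0] by (simp add: harm_def)
  next
    case (Suc n)
    have "r (Suc n) \<le> r n * exp (- (\<kappa> / real (Suc n)))" using r_step[of "Suc n"] by simp
    also have "\<dots> \<le> exp (- \<kappa> * harm n) * exp (- (\<kappa> / real (Suc n)))" using Suc by (intro mult_right_mono) auto
    also have "\<dots> = exp (- \<kappa> * harm (Suc n))"
      by (simp add: harm_Suc exp_add[symmetric] algebra_simps divide_inverse)
    finally show ?case .
  qed
  have r_lim: "r \<longlonglongrightarrow> 0"
  proof (rule tendsto_sandwich[where f="\<lambda>_. 0" and h="\<lambda>n. exp (- \<kappa> * harm n)"])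
    have "filterlim (\<lambda>n. - (\<kappa> * harm n)) at_bot sequentially"
      unfolding filterlim_uminus_at_bot
      using filterlim_tendsto_pos_mult_at_top[OF tendsto_const \<kappa> harm_at_top] by simp
    then show "(\<lambda>n. exp (- \<kappa> * harm n)) \<longlonglongrightarrow> 0"
      using filterlim_compose[OF exp_at_bot] by (simp add: mult_minus_left)
  qed (use r0 r_harm in auto)

  \<comment> \<open>The relative growth per step of \<open>e\<close> below is at most c / n^2: Csq C
    / n^2 from the remainder and 2 C from the mean of \<open>incbound\<close>, with C^2 =
    Csq.\<close>
  define c where "c = 2 * Csq\<^sup>2"
  have c: "c \<ge> 0" by (simp add: c_def)
  define c3 where "c3 = 6 * Csq\<^sup>2 * exp c * c0"
  \<comment> \<open>On the event that the limit is 0 the ratio (zl - z_k)^2 / z_k^2 equals 1, so its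
    expectation bounds the probability, as in Chebyshev's inequality.\<close>
  have key: "prob {\<omega> \<in> space M. zl \<omega> = 0} \<le> c3 * r k" if k: "1 \<le> k" for k
  proof -
    define g where "g \<omega> = 1 / (z k \<omega>)\<^sup>2" for \<omega>
    have g0: "0 \<le> g \<omega>" for \<omega> by (simp add: g_def)
    have izk: "1 / z k \<omega> = clipS k \<omega> * (1 / G k \<omega>)" for \<omega>
      using clipS_pos[of k \<omega>] G1[of k \<omega>] by (simp add: zG invS_def field_simps)
    have izk_le: "1 / z k \<omega> \<le> c0 * real k * (1 / G k \<omega>)" for \<omega>
      unfolding izk using S_le[OF k, of \<omega>] iGb(1)[of k \<omega>] by (intro mult_right_mono) auto
    have izk_le': "1 / z k \<omega> \<le> c0 * real k" for \<omega>
    proof -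
      have "c0 * real k * (1 / G k \<omega>) \<le> c0 * real k * 1" using iGb(2) c0 by (intro mult_left_mono) auto
      then show ?thesis using izk_le[of \<omega>] by linarith
    qed
    have g_le: "g \<omega> \<le> (c0 * real k)\<^sup>2" for \<omega>
      using power_mono[OF izk_le'[of \<omega>], of 2] z0[of k \<omega>] by (simp add: g_def power_divide)
    have gb: "bounded_fun g" by (rule bounded_funI[of _ "(c0 * real k)\<^sup>2"]) (use g0 g_le in auto)
    have gmk: "g \<in> borel_measurable (F k)" unfolding g_def[abs_def]
      by (intro borel_measurable_divide meas_intros zm)
    have gm: "g \<in> borel_measurable (F n)" if "k \<le> n" for n using measurable_F_mono[OF gmk that] .
    note gM = measurable_F_imp_M[OF gmk]
    \<comment> \<open>The weighted first moment. The martingale part of a step drops out and the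
      remainder is proportional to the proportion itself, so e_n never exceeds e_k = E[1 / z_k] by
      more than the factor exp c.\<close>
    define e where "e n = expectation (\<lambda>\<omega>. g \<omega> * z n \<omega>)" for n
    have ige: "integrable M (\<lambda>\<omega>. g \<omega> * z n \<omega>)" for n
      by (intro integrable_bounded_fun bounded_fun_mult gb zb borel_measurable_times gM zmM)
    have e0: "0 \<le> e n" for n unfolding e_def using g0 z0 by (intro Bochner_Integration.integral_nonneg) (auto simp: less_imp_le)
    have Euu: "expectation (\<lambda>\<omega>. g \<omega> * incbound n \<omega>) \<le> 2 * real C * e (n - 1)" if "k < n" for n
    proof -
      have "expectation (\<lambda>\<omega>. g \<omega> * incbound n \<omega>) \<le> 2 * real C * expectation (\<lambda>\<omega>. g \<omega> * (clipZ (n - 1) \<omega> * (1 - clipZ (n - 1) \<omega>)))"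
        using that by (intro expectation_incbound_le gm gb g0) auto
      also have "\<dots> \<le> 2 * real C * e (n - 1)"
      proof (intro mult_left_mono)
        show "expectation (\<lambda>\<omega>. g \<omega> * (clipZ (n - 1) \<omega> * (1 - clipZ (n - 1) \<omega>))) \<le> e (n - 1)"
          unfolding e_def zz[symmetric]
        proof (intro integral_mono ige)
          show "integrable M (\<lambda>\<omega>. g \<omega> * (z (n - 1) \<omega> * (1 - z (n - 1) \<omega>)))"
            by (intro integrable_bounded_fun bounded_fun_intros gb zb meas_intros gM zmM)
          fix \<omega> have "z (n - 1) \<omega> * (1 - z (n - 1) \<omega>) \<le> z (n - 1) \<omega> * 1"
            using z0[of "n-1" \<omega>] by (intro mult_left_mono) auto
          then show "g \<omega> * (z (n - 1) \<omega> * (1 - z (n - 1) \<omega>)) \<le> g \<omega> * z (n - 1) \<omega>"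
            using g0 by (intro mult_left_mono) auto
        qed
      qed auto
      finally show ?thesis .
    qed
    have uum: "(\<lambda>\<omega>. incbound n \<omega>) \<in> borel_measurable M" if "1 \<le> n" for n
      unfolding incbound_def by (intro meas_intros measurable_M_processes that)
    have uub: "bounded_fun (incbound n)" for n
      by (rule bounded_funI[of _ C]) (use incbound_nonneg incbound_le in auto)
    have iuu: "integrable M (\<lambda>\<omega>. g \<omega> * incbound n \<omega>)" if "1 \<le> n" for n
      by (intro integrable_bounded_fun bounded_fun_mult gb uub borel_measurable_times gM uum that)
    have md0: "expectation (\<lambda>\<omega>. h \<omega> * mdinc n \<omega>) = 0" "integrable M (\<lambda>\<omega>. h \<omega> * mdinc n \<omega>)"
      if "1 \<le> n" "h \<in> borel_measurable (F (n - 1))" "bounded_fun h" for h n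
      using mart_diff_expectation[OF mart_diff_mdinc that] mart_diff_bounded[OF mart_diff_mdinc that(1)]
        mart_diff_measurable_M[OF mart_diff_mdinc that(1)] measurable_F_imp_M[OF that(2)] that(3)
      by (auto intro!: integrable_bounded_fun bounded_fun_mult)
    have increm_incbound: "\<bar>increm n \<omega>\<bar> \<le> Csq * real C / (real n)\<^sup>2 * incbound n \<omega>" if "1 \<le> n" for n \<omega>
      using increm_le[OF that, of \<omega>] incnum_incbound_le[OF that, of \<omega>] by linarith
    have CC: "real C * real C = Csq" by (simp add: Csq_def power2_eq_square)
    have e_step: "e n \<le> e (n - 1) * exp (c * (1 / (real n)\<^sup>2))" if n: "k < n" for n
    proof -
      have n1: "1 \<le> n" using n by simp
      have gmn: "(\<lambda>\<omega>. s * g \<omega>) \<in> borel_measurable (F (n - 1))"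
        using n by (intro borel_measurable_times borel_measurable_const gm) auto
      have sgb: "bounded_fun (\<lambda>\<omega>. s * g \<omega>)" by (intro bounded_fun_intros gb)
      note md = md0[OF n1 gmn sgb]
      have "e n \<le> expectation (\<lambda>\<omega>. g \<omega> * z (n - 1) \<omega> + s * g \<omega> * mdinc n \<omega> + Csq * real C / (real n)\<^sup>2 * (g \<omega> * incbound n \<omega>))"
        unfolding e_def
      proof (intro integral_mono ige Bochner_Integration.integrable_add md(2) integrable_mult_right iuu n1)
        fix \<omega>
        have "z n \<omega> = z (n - 1) \<omega> + s * mdinc n \<omega> + s * increm n \<omega>"
          using step[OF n1, of \<omega>] by (simp add: increm_def algebra_simps)
        moreover have "s * increm n \<omega> \<le> Csq * real C / (real n)\<^sup>2 * incbound n \<omega>"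
        proof -
          have "s * increm n \<omega> \<le> \<bar>s * increm n \<omega>\<bar>" by simp
          also have "\<dots> = \<bar>increm n \<omega>\<bar>" using s by (simp add: abs_mult)
          finally show ?thesis using increm_incbound[OF n1, of \<omega>] by linarith
        qed
        ultimately have "g \<omega> * z n \<omega> \<le> g \<omega> * (z (n - 1) \<omega> + s * mdinc n \<omega> + Csq * real C / (real n)\<^sup>2 * incbound n \<omega>)"
          using g0 by (intro mult_left_mono) auto
        then show "g \<omega> * z n \<omega> \<le> g \<omega> * z (n - 1) \<omega> + s * g \<omega> * mdinc n \<omega> + Csq * real C / (real n)\<^sup>2 * (g \<omega> * incbound n \<omega>)"
          by (simp add: algebra_simps)
      qed
      also have "\<dots> = e (n - 1) + 0 + Csq * real C / (real n)\<^sup>2 * expectation (\<lambda>\<omega>. g \<omega> * incbound n \<omega>)"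
        unfolding e_def using ige md iuu[OF n1] by (subst Bochner_Integration.integral_add) auto
      also have "\<dots> \<le> e (n - 1) + 0 + Csq * real C / (real n)\<^sup>2 * (2 * real C * e (n - 1))"
        using Csq_ge by (intro add_left_mono mult_left_mono Euu n) auto
      also have "Csq * real C / (real n)\<^sup>2 * (2 * real C * e (n - 1)) = (real C * real C) * (2 * Csq / (real n)\<^sup>2 * e (n - 1))" by simp
      also have "\<dots> = c * (1 / (real n)\<^sup>2) * e (n - 1)" unfolding CC by (simp add: c_def power2_eq_square)
      also have "e (n - 1) + 0 + \<dots> = e (n - 1) * (1 + c * (1 / (real n)\<^sup>2))" by (simp add: algebra_simps)
      also have "\<dots> \<le> e (n - 1) * exp (c * (1 / (real n)\<^sup>2))" by (intro mult_left_mono exp_ge_add_one_self e0)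
      finally show ?thesis .
    qed
    have e_le: "e n \<le> e k * exp c" if "k \<le> n" for n
    proof -
      have "e n \<le> e k * exp (c * (\<Sum>j=k+1..n. 1 / (real j)\<^sup>2))" using that
      proof (induction rule: dec_induct)
        case (step n)
        have "e (Suc n) \<le> e n * exp (c * (1 / (real (Suc n))\<^sup>2))" using e_step[of "Suc n"] step by simp
        also have "\<dots> \<le> (e k * exp (c * (\<Sum>j=k+1..n. 1 / (real j)\<^sup>2))) * exp (c * (1 / (real (Suc n))\<^sup>2))"
          using step by (intro mult_right_mono) auto
        also have "\<dots> = e k * exp (c * (\<Sum>j=k+1..n. 1 / (real j)\<^sup>2) + c * (1 / (real (Suc n))\<^sup>2))"
          by (simp only: exp_add mult.assoc)
        also have "c * (\<Sum>j=k+1..n. 1 / (real j)\<^sup>2) + c * (1 / (real (Suc n))\<^sup>2) = c * (\<Sum>j=k+1..Suc n. 1 / (real j)\<^sup>2)"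
        proof -
          have "{k+1..Suc n} = insert (Suc n) {k+1..n}" using step by auto
          then show ?thesis by (simp add: algebra_simps)
        qed
        finally show ?case .
      qed simp
      also have "\<dots> \<le> e k * exp (c * 1)"
      proof -
        have "(\<Sum>j=k+1..n. 1 / (real j)\<^sup>2) \<le> 1 / real k" by (rule sum_inverse_squares_le[OF k])
        also have "\<dots> \<le> 1" using k by simp
        finally have "c * (\<Sum>j=k+1..n. 1 / (real j)\<^sup>2) \<le> c * 1" using c by (intro mult_left_mono)
        then show ?thesis by (intro mult_left_mono e0) (simp only: exp_le_cancel_iff)
      qed
      finally show ?thesis by simp
    qed
    \<comment> \<open>The weighted second moment. A step adds O(e_{n-1} / n^2), since its size is
      controlled by z (1 - z) <= z; summing over n > k gives O(e_k / k).\<close>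
    define v where "v n = expectation (\<lambda>\<omega>. g \<omega> * (z n \<omega> - z k \<omega>)\<^sup>2)" for n
    have iv: "integrable M (\<lambda>\<omega>. g \<omega> * (z n \<omega> - z k \<omega>)\<^sup>2)" for n
      by (intro integrable_bounded_fun bounded_fun_intros gb zb meas_intros gM zmM)
    have zd: "\<bar>z n \<omega> - z k \<omega>\<bar> \<le> 1" for n \<omega>
      using z0[of n \<omega>] z1[of n \<omega>] z0[of k \<omega>] z1[of k \<omega>] by (simp add: abs_le_iff)
    have v_step: "v n \<le> v (n - 1) + 6 * Csq\<^sup>2 * exp c * e k * (1 / (real n)\<^sup>2)" if n: "k < n" for n
    proof -
      have n1: "1 \<le> n" using n by simp
      define h where "h \<omega> = 2 * s * g \<omega> * (z (n - 1) \<omega> - z k \<omega>)" for \<omega>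
      have hm: "h \<in> borel_measurable (F (n - 1))" unfolding h_def
        using n by (intro meas_intros gm zm measurable_F_mono[OF zm]) auto
      have hb: "bounded_fun h" unfolding h_def by (intro bounded_fun_intros gb zb)
      note md = md0[OF n1 hm hb]
      have "v n \<le> expectation (\<lambda>\<omega>. g \<omega> * (z (n - 1) \<omega> - z k \<omega>)\<^sup>2 + h \<omega> * mdinc n \<omega> + 3 * Csq * real C / (real n)\<^sup>2 * (g \<omega> * incbound n \<omega>))"
        unfolding v_def
      proof (intro integral_mono iv Bochner_Integration.integrable_add md(2) integrable_mult_right iuu n1)
        fix \<omega>
        define D where "D = z (n - 1) \<omega> - z k \<omega>"
        define d where "d = invS n \<omega> * incnum n \<omega>"
        define U where "U = Csq * real C / (real n)\<^sup>2 * incbound n \<omega>"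
        have D1: "\<bar>D\<bar> \<le> 1" using zd by (simp add: D_def)
        have d2: "(s * d)\<^sup>2 \<le> U"
        proof -
          have "(s * d)\<^sup>2 = d\<^sup>2" using s by (auto simp: power_mult_distrib abs_if split: if_splits)
          also have "d\<^sup>2 = (invS n \<omega>)\<^sup>2 * (\<bar>incnum n \<omega>\<bar> * \<bar>incnum n \<omega>\<bar>)" by (simp add: d_def power2_eq_square)
          also have "\<dots> \<le> (1 / real n)\<^sup>2 * (Csq * \<bar>incnum n \<omega>\<bar>)"
            using invS_le[OF n1, of \<omega>] incnum_le[of n \<omega>] Csq_ge by (intro mult_mono power_mono) auto
          also have "\<dots> = Csq * \<bar>incnum n \<omega>\<bar> / (real n)\<^sup>2" by (simp add: power_divide)
          also have "\<dots> \<le> U" unfolding U_def by (rule incnum_incbound_le[OF n1])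
          finally show ?thesis .
        qed
        have rU: "2 * s * D * increm n \<omega> \<le> 2 * U"
        proof -
          have "2 * s * D * increm n \<omega> \<le> \<bar>2 * s * D * increm n \<omega>\<bar>" by simp
          also have "\<dots> = 2 * (\<bar>D\<bar> * \<bar>increm n \<omega>\<bar>)" using s by (simp add: abs_mult)
          also have "\<dots> \<le> 2 * (1 * U)" using D1 increm_incbound[OF n1, of \<omega>] unfolding U_def by (intro mult_left_mono mult_mono) auto
          finally show ?thesis by simp
        qed
        have "z n \<omega> - z k \<omega> = D + s * d" using step[OF n1, of \<omega>] by (simp add: D_def d_def)
        then have "(z n \<omega> - z k \<omega>)\<^sup>2 = D\<^sup>2 + 2 * s * D * d + (s * d)\<^sup>2" by (simp add: power2_eq_square algebra_simps)
        also have "d = mdinc n \<omega> + increm n \<omega>" by (simp add: d_def increm_def)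
        finally have "(z n \<omega> - z k \<omega>)\<^sup>2 = D\<^sup>2 + 2 * s * D * mdinc n \<omega> + 2 * s * D * increm n \<omega> + (s * (mdinc n \<omega> + increm n \<omega>))\<^sup>2"
          by (simp add: algebra_simps)
        \<comment> \<open>Two of the three U come from the cross term with the remainder, one from
          the squared step; the part linear in \<open>mdinc\<close> averages to zero.\<close>
        then have "(z n \<omega> - z k \<omega>)\<^sup>2 \<le> D\<^sup>2 + 2 * s * D * mdinc n \<omega> + 3 * U"
          using rU d2 by (simp add: d_def increm_def)
        then have "g \<omega> * (z n \<omega> - z k \<omega>)\<^sup>2 \<le> g \<omega> * (D\<^sup>2 + 2 * s * D * mdinc n \<omega> + 3 * U)"
          using g0 by (intro mult_left_mono) auto
        then show "g \<omega> * (z n \<omega> - z k \<omega>)\<^sup>2 \<le> g \<omega> * (z (n - 1) \<omega> - z k \<omega>)\<^sup>2 + h \<omega> * mdinc n \<omega> + 3 * Csq * real C / (real n)\<^sup>2 * (g \<omega> * incbound n \<omega>)"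
          unfolding h_def D_def[symmetric] U_def by (simp add: algebra_simps)
      qed
      also have "\<dots> = v (n - 1) + 0 + 3 * Csq * real C / (real n)\<^sup>2 * expectation (\<lambda>\<omega>. g \<omega> * incbound n \<omega>)"
        unfolding v_def using iv md iuu[OF n1] by (subst Bochner_Integration.integral_add) auto
      also have "\<dots> \<le> v (n - 1) + 0 + 3 * Csq * real C / (real n)\<^sup>2 * (2 * real C * (e k * exp c))"
      proof (intro add_left_mono mult_left_mono)
        have "2 * real C * e (n - 1) \<le> 2 * real C * (e k * exp c)" using n by (intro mult_left_mono e_le) auto
        then show "expectation (\<lambda>\<omega>. g \<omega> * incbound n \<omega>) \<le> 2 * real C * (e k * exp c)" using Euu[OF n] by linarith
      qed (use Csq_ge in auto)
      also have "3 * Csq * real C / (real n)\<^sup>2 * (2 * real C * (e k * exp c)) = (real C * real C) * (6 * Csq * exp c * e k * (1 / (real n)\<^sup>2))"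
        by simp
      also have "\<dots> = 6 * Csq\<^sup>2 * exp c * e k * (1 / (real n)\<^sup>2)" unfolding CC by (simp add: power2_eq_square)
      finally show ?thesis by simp
    qed
    have v_le: "v n \<le> 6 * Csq\<^sup>2 * exp c * e k * (1 / real k)" if "k \<le> n" for n
    proof -
      have "v n \<le> 6 * Csq\<^sup>2 * exp c * e k * (\<Sum>j=k+1..n. 1 / (real j)\<^sup>2)" using that
      proof (induction rule: dec_induct)
        case base then show ?case by (simp add: v_def)
      next
        case (step n)
        have "{k+1..Suc n} = insert (Suc n) {k+1..n}" using step by auto
        then have "6 * Csq\<^sup>2 * exp c * e k * (\<Sum>j=k+1..Suc n. 1 / (real j)\<^sup>2)
          = 6 * Csq\<^sup>2 * exp c * e k * (\<Sum>j=k+1..n. 1 / (real j)\<^sup>2) + 6 * Csq\<^sup>2 * exp c * e k * (1 / (real (Suc n))\<^sup>2)"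
          by (simp only: sum.insert finite_atLeastAtMost atLeastAtMost_iff) (simp add: algebra_simps)
        then show ?case using v_step[of "Suc n"] step by simp
      qed
      also have "\<dots> \<le> 6 * Csq\<^sup>2 * exp c * e k * (1 / real k)"
        using e0 by (intro mult_left_mono sum_inverse_squares_le k mult_nonneg_nonneg) auto
      finally show ?thesis .
    qed
    \<comment> \<open>1 / z_k = S_k / G_k is at most c0 k / G_k, so the factor k gained here cancels
      the 1 / k of the variance bound and only r_k is left.\<close>
    have ek: "e k * (1 / real k) \<le> c0 * r k"
    proof -
      have "e k \<le> expectation (\<lambda>\<omega>. c0 * real k * (1 / G k \<omega>))"
        unfolding e_def
      proof (intro integral_mono ige integrable_mult_right iG)
        fix \<omega> have "g \<omega> * z k \<omega> = 1 / z k \<omega>" using z0[of k \<omega>] by (simp add: g_def power2_eq_square)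
        then show "g \<omega> * z k \<omega> \<le> c0 * real k * (1 / G k \<omega>)" using izk_le by simp
      qed
      also have "\<dots> = c0 * real k * r k" unfolding r_def by (rule integral_mult_right_zero)
      finally have "e k * (1 / real k) \<le> (c0 * real k * r k) * (1 / real k)" by (intro mult_right_mono) auto
      then show ?thesis using k by simp
    qed
    have bnd: "v n \<le> c3 * r k" if "k \<le> n" for n
    proof -
      have "v n \<le> 6 * Csq\<^sup>2 * exp c * (e k * (1 / real k))" using v_le[OF that] by (simp add: mult.assoc)
      also have "\<dots> \<le> 6 * Csq\<^sup>2 * exp c * (c0 * r k)" using ek by (intro mult_left_mono) auto
      finally show ?thesis by (simp add: c3_def mult_ac)
    qed
    have "(\<lambda>n. v n) \<longlonglongrightarrow> expectation (\<lambda>\<omega>. g \<omega> * (zl \<omega> - z k \<omega>)\<^sup>2)"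
      unfolding v_def
    proof (rule integral_dominated_convergence[where w="\<lambda>_. (c0 * real k)\<^sup>2"])
      show "AE \<omega> in M. (\<lambda>n. g \<omega> * (z n \<omega> - z k \<omega>)\<^sup>2) \<longlonglongrightarrow> g \<omega> * (zl \<omega> - z k \<omega>)\<^sup>2"
        using zl(2) by eventually_elim (intro tendsto_intros)
      show "AE \<omega> in M. norm (g \<omega> * (z n \<omega> - z k \<omega>)\<^sup>2) \<le> (c0 * real k)\<^sup>2" for n
      proof (rule AE_I2)
        fix \<omega>
        have "g \<omega> * (z n \<omega> - z k \<omega>)\<^sup>2 \<le> (c0 * real k)\<^sup>2 * 1"
          using g0 g_le zd by (intro mult_mono) (auto simp: abs_square_le_1)
        then show "norm (g \<omega> * (z n \<omega> - z k \<omega>)\<^sup>2) \<le> (c0 * real k)\<^sup>2" using g0 by simp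
      qed
      show "(\<lambda>\<omega>. g \<omega> * (zl \<omega> - z k \<omega>)\<^sup>2) \<in> borel_measurable M" by (intro meas_intros gM zl zmM)
      show "(\<lambda>\<omega>. g \<omega> * (z n \<omega> - z k \<omega>)\<^sup>2) \<in> borel_measurable M" for n by (intro meas_intros gM zmM)
    qed simp
    then have lim_le: "expectation (\<lambda>\<omega>. g \<omega> * (zl \<omega> - z k \<omega>)\<^sup>2) \<le> c3 * r k"
      by (rule LIMSEQ_le_const2) (use bnd in auto)
    have E: "{\<omega> \<in> space M. zl \<omega> = 0} \<in> sets M" using zl(1) by measurable
    have "AE \<omega> in M. 0 \<le> zl \<omega> \<and> zl \<omega> \<le> 1" using zl(2)
    proof eventually_elim
      case (elim \<omega>)
      have "0 \<le> zl \<omega>" by (rule LIMSEQ_le_const[OF elim]) (use z0 in \<open>auto simp: less_imp_le\<close>)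
      moreover have "zl \<omega> \<le> 1" by (rule LIMSEQ_le_const2[OF elim]) (use z1 in \<open>auto simp: less_imp_le\<close>)
      ultimately show ?case by simp
    qed
    then have izl: "integrable M (\<lambda>\<omega>. g \<omega> * (zl \<omega> - z k \<omega>)\<^sup>2)"
    proof (intro integrable_const_bound[of _ "(c0 * real k)\<^sup>2"])
      assume "AE \<omega> in M. 0 \<le> zl \<omega> \<and> zl \<omega> \<le> 1"
      then show "AE \<omega> in M. norm (g \<omega> * (zl \<omega> - z k \<omega>)\<^sup>2) \<le> (c0 * real k)\<^sup>2"
      proof eventually_elim
        case (elim \<omega>)
        then have "\<bar>zl \<omega> - z k \<omega>\<bar> \<le> 1" using z0[of k \<omega>] z1[of k \<omega>] by (simp add: abs_le_iff)
        then have "g \<omega> * (zl \<omega> - z k \<omega>)\<^sup>2 \<le> (c0 * real k)\<^sup>2 * 1"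
          using g0 g_le by (intro mult_mono) (auto simp: abs_square_le_1)
        then show ?case using g0 by simp
      qed
      show "(\<lambda>\<omega>. g \<omega> * (zl \<omega> - z k \<omega>)\<^sup>2) \<in> borel_measurable M" by (intro meas_intros gM zl zmM)
    qed
    have "prob {\<omega> \<in> space M. zl \<omega> = 0} = expectation (indicator {\<omega> \<in> space M. zl \<omega> = 0})"
      using E by simp
    also have "\<dots> \<le> expectation (\<lambda>\<omega>. g \<omega> * (zl \<omega> - z k \<omega>)\<^sup>2)"
    proof (rule integral_mono[OF _ izl])
      show "integrable M (indicator {\<omega> \<in> space M. zl \<omega> = 0} :: 'a \<Rightarrow> real)"
        using E by (intro integrable_const_bound[of _ 1]) (auto simp: indicator_def)
      fix \<omega>
      show "indicator {\<omega> \<in> space M. zl \<omega> = 0} \<omega> \<le> g \<omega> * (zl \<omega> - z k \<omega>)\<^sup>2"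
        using z0[of k \<omega>] g0[of \<omega>] by (auto simp: indicator_def g_def)
    qed
    finally show ?thesis using lim_le by linarith
  qed
  have "(\<lambda>k. c3 * r k) \<longlonglongrightarrow> 0" by (rule tendsto_mult_right_zero[OF r_lim])
  then have "prob {\<omega> \<in> space M. zl \<omega> = 0} \<le> 0"
    by (rule LIMSEQ_le_const) (use key in auto)
  then have p0: "prob {\<omega> \<in> space M. zl \<omega> = 0} = 0" by (simp add: measure_le_0_iff)
  have "{\<omega> \<in> space M. zl \<omega> = 0} \<in> sets M" using zl(1) by measurable
  then show ?thesis using p0 by (intro AE_I[where N="{\<omega> \<in> space M. zl \<omega> = 0}"]) (auto simp: emeasure_eq_measure)
qed

text \<open>Colour B satisfies the same relations with 1 - Z, K and N - X in place of Z, H and X,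
  and with the sign of the increment reversed.\<close>

lemma limit_proportion_bounds:
  assumes Z: "Z \<in> borel_measurable M" "AE \<omega> in M. (\<lambda>n. clipZ n \<omega>) \<longlonglongrightarrow> Z \<omega>"
  shows "AE \<omega> in M. 0 < Z \<omega> \<and> Z \<omega> < 1"
proof -
  have step_nonneg: "clipX n \<omega> \<le> clipA n \<omega> * clipX n \<omega>" "clipN n \<omega> - clipX n \<omega> \<le> clipB n \<omega> * (clipN n \<omega> - clipX n \<omega>)" for n \<omega>
    using mult_right_mono[OF clipA_bounds(1)[of n \<omega>], of "clipX n \<omega>"] mult_right_mono[OF clipB_bounds(1)[of n \<omega>], of "clipN n \<omega> - clipX n \<omega>"]
      clipX_bounds[of n \<omega>] by auto
  have le: "clipA n \<omega> * clipX n \<omega> \<le> Csq" "clipB n \<omega> * (clipN n \<omega> - clipX n \<omega>) \<le> Csq" for n \<omega>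
    using step_bounds(2)[of n \<omega>] step_nonneg[of n \<omega>] clipX_bounds[of n \<omega>] unfolding Csq_def by linarith+
  have 0: "AE \<omega> in M. Z \<omega> \<noteq> 0"
  proof (rule limit_proportion_no_atom[where z=clipZ and G=clipH and w=clipX and s=1])
    show "clipZ n \<omega> = clipH n \<omega> * invS n \<omega>" for n \<omega> by (simp add: clipZ_def invS_def divide_inverse)
    show "clipZ n \<omega> - clipZ (n - 1) \<omega> = 1 * (invS n \<omega> * incnum n \<omega>)" if "1 \<le> n" for n \<omega> using clipZ_step[OF that] by simp
    show "clipH (n - 1) \<omega> + clipX n \<omega> \<le> clipH n \<omega>" "clipH n \<omega> \<le> clipH (n - 1) \<omega> + Csq" if "1 \<le> n" for n \<omega>
      using totals_step[OF that, of \<omega>] step_nonneg[of n \<omega>] le[of n \<omega>] by auto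
    show "expectation (\<lambda>\<omega>. g \<omega> * clipX n \<omega>) = expectation (\<lambda>\<omega>. g \<omega> * (clipN n \<omega> * clipZ (n - 1) \<omega>))"
      if "1 \<le> n" "g \<in> borel_measurable (F (n - 1))" "bounded_fun g" for n g
      using expectation_linear_clipX[OF that(1) measurable_F_imp_FN[OF that(1,2)] that(3), of "\<lambda>_. 0"] by (simp add: bounded_fun_const)
  qed (use clipZ_bounds clipH_ge clipX_bounds measurable_F_totals measurable_M_processes bounded_funs Z in auto)
  have 1: "AE \<omega> in M. 1 - Z \<omega> \<noteq> 0"
  proof (rule limit_proportion_no_atom[where z="\<lambda>n \<omega>. 1 - clipZ n \<omega>" and G=clipK and w="\<lambda>n \<omega>. clipN n \<omega> - clipX n \<omega>" and s="-1"])
    show "1 - clipZ n \<omega> = clipK n \<omega> * invS n \<omega>" for n \<omega> by (simp add: one_minus_clipZ invS_def divide_inverse)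
    show "1 - clipZ n \<omega> - (1 - clipZ (n - 1) \<omega>) = -1 * (invS n \<omega> * incnum n \<omega>)" if "1 \<le> n" for n \<omega>
      using clipZ_step[OF that, of \<omega>] by simp
    show "clipK (n - 1) \<omega> + (clipN n \<omega> - clipX n \<omega>) \<le> clipK n \<omega>" "clipK n \<omega> \<le> clipK (n - 1) \<omega> + Csq" if "1 \<le> n" for n \<omega>
      using totals_step[OF that, of \<omega>] step_nonneg[of n \<omega>] le[of n \<omega>] by auto
    show "expectation (\<lambda>\<omega>. g \<omega> * (clipN n \<omega> - clipX n \<omega>)) = expectation (\<lambda>\<omega>. g \<omega> * (clipN n \<omega> * (1 - clipZ (n - 1) \<omega>)))"
      if n: "1 \<le> n" and g: "g \<in> borel_measurable (F (n - 1))" "bounded_fun g" for n g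
    proof -
      have "expectation (\<lambda>\<omega>. g \<omega> * clipN n \<omega> + (- g \<omega>) * clipX n \<omega>) = expectation (\<lambda>\<omega>. g \<omega> * clipN n \<omega> + (- g \<omega>) * (clipN n \<omega> * clipZ (n - 1) \<omega>))"
        by (intro expectation_linear_clipX n meas_intros measurable_F_imp_FN[OF n g(1)] FN_measurables bounded_fun_intros g bounded_funs)
      then show ?thesis by (simp add: algebra_simps)
    qed
    show "AE \<omega> in M. (\<lambda>n. 1 - clipZ n \<omega>) \<longlonglongrightarrow> 1 - Z \<omega>" using Z(2) by eventually_elim (intro tendsto_intros)
    show "(\<lambda>\<omega>. 1 - Z \<omega>) \<in> borel_measurable M" by (intro meas_intros Z)
    show "(\<lambda>\<omega>. clipN n \<omega> - clipX n \<omega>) \<in> borel_measurable M" if "1 \<le> n" for n by (intro meas_intros measurable_M_processes that)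
    show "bounded_fun (\<lambda>\<omega>. clipN n \<omega> - clipX n \<omega>)" for n by (intro bounded_fun_intros bounded_funs)
  qed (use clipZ_bounds clipK_ge clipX_bounds measurable_F_totals in auto)
  show ?thesis using 0 1 Z(2)
  proof eventually_elim
    case (elim \<omega>)
    have "0 \<le> Z \<omega>" by (rule LIMSEQ_le_const[OF elim(3)]) (use clipZ_bounds in \<open>auto simp: less_imp_le\<close>)
    moreover have "Z \<omega> \<le> 1" by (rule LIMSEQ_le_const2[OF elim(3)]) (use clipZ_bounds in \<open>auto simp: less_imp_le\<close>)
    ultimately show ?case using elim by auto
  qed
qed

end

subsection \<open>Limits of empirical means\<close>

lemma (in filtered_prob_space) mart_diff_add:
  assumes "mart_diff u" "mart_diff w"
  shows "mart_diff (\<lambda>j \<omega>. u j \<omega> + w j \<omega>)"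
proof (rule mart_diffI)
  fix j :: nat assume j: "1 \<le> j"
  show "(\<lambda>\<omega>. u j \<omega> + w j \<omega>) \<in> borel_measurable (F j)"
    by (intro borel_measurable_add mart_diff_measurable assms j order_refl)
  show "bounded_fun (\<lambda>\<omega>. u j \<omega> + w j \<omega>)" by (intro bounded_fun_intros mart_diff_bounded assms j)
  fix g assume g: "g \<in> borel_measurable (F (j - 1))" "bounded_fun g"
  have i: "integrable M (\<lambda>\<omega>. g \<omega> * u j \<omega>)" "integrable M (\<lambda>\<omega>. g \<omega> * w j \<omega>)"
    by (intro integrable_bounded_fun bounded_fun_mult g mart_diff_bounded assms j borel_measurable_times
        measurable_F_imp_M[OF g(1)] mart_diff_measurable_M)+
  then show "expectation (\<lambda>\<omega>. g \<omega> * (u j \<omega> + w j \<omega>)) = 0"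
    using mart_diff_expectation[OF assms(1) j g] mart_diff_expectation[OF assms(2) j g] by (simp add: distrib_left)
qed

text \<open>Boundedness in index and point together is phrased as boundedness of one function on
  pairs, so that the same closure rules prove uniform bounds. The shift by \<open>Suc\<close> keeps
  out index 0, which \<open>mart_diff\<close> leaves free.\<close>

lemma (in filtered_prob_space) mart_diff_strong_law':
  assumes w: "mart_diff w" and b: "bounded_fun (\<lambda>p. w (Suc (fst p)) (snd p))"
  shows "AE \<omega> in M. (\<lambda>n. (\<Sum>j=1..n. w j \<omega>) / real n) \<longlonglongrightarrow> 0"
proof -
  obtain c where c: "\<And>p. \<bar>w (Suc (fst p)) (snd p)\<bar> \<le> c" using b by (auto simp: bounded_fun_def)
  show ?thesis
  proof (rule mart_diff_strong_law[OF w])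
    fix j :: nat and \<omega> assume "1 \<le> j"
    then show "\<bar>w j \<omega>\<bar> \<le> c" using c[of "(j - 1, \<omega>)"] by simp
  qed
qed

text \<open>Subtracting conditional expectations leaves martingale differences, which average to
  zero, while convergent conditional expectations average to their limit. The hypotheses speak of
  the original \<open>u'\<close>; the bounds hold everywhere only for the truncated
  \<open>u\<close>.\<close>

lemma (in filtered_prob_space) cond_exp_mean_tendsto:
  assumes u: "\<And>j. 1 \<le> j \<Longrightarrow> u j \<in> borel_measurable (F j)" "\<And>j \<omega>. 0 \<le> u j \<omega>" "\<And>j \<omega>. u j \<omega> \<le> c"
    and u': "\<And>j. 1 \<le> j \<Longrightarrow> u' j \<in> borel_measurable M" "\<And>j. 1 \<le> j \<Longrightarrow> AE \<omega> in M. u' j \<omega> = u j \<omega>"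
    and lim: "AE \<omega> in M. (\<lambda>n. real_cond_exp M (F (n - 1)) (u' n) \<omega>) \<longlonglongrightarrow> l \<omega>"
  shows "AE \<omega> in M. (\<lambda>n. (\<Sum>j=1..n. u j \<omega>) / real n) \<longlonglongrightarrow> l \<omega>"
proof -
  have c0: "0 \<le> c" using u(2,3)[of 0 undefined] by linarith
  define r where "r j = real_cond_exp M (F (j - 1)) (u' j)" for j
  \<comment> \<open>A version of the conditional expectation with the bounds 0 and c at every point,
    as \<open>mart_diff\<close> requires; \<open>r j\<close> satisfies them only almost
    everywhere.\<close>
  define ce where "ce j \<omega> = max 0 (min c (r j \<omega>))" for j \<omega>
  have ce: "0 \<le> ce j \<omega>" "ce j \<omega> \<le> c" for j \<omega> using c0 by (auto simp: ce_def)
  have ub: "bounded_fun (u j)" for j by (rule bounded_funI[of _ c]) (use u(2,3) in auto)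
  have ceb: "bounded_fun (ce j)" for j by (rule bounded_funI[of _ c]) (use ce in auto)
  have rm: "r j \<in> borel_measurable (F (j - 1))" for j unfolding r_def by simp
  have cem: "ce j \<in> borel_measurable (F (j - 1))" for j unfolding ce_def[abs_def] using rm[of j] by measurable
  have r_eq: "AE \<omega> in M. r j \<omega> = ce j \<omega>" and iu': "integrable M (u' j)" if j: "1 \<le> j" for j
  proof -
    interpret G: finite_measure_subalgebra M "F (j - 1)" by unfold_locales (rule subalg)
    have "AE \<omega> in M. norm (u' j \<omega>) \<le> c" using u'(2)[OF j] by eventually_elim (use u(2,3) in auto)
    then show i: "integrable M (u' j)" by (rule integrable_const_bound) (rule u'(1)[OF j])
    have "AE \<omega> in M. r j \<omega> \<ge> 0" unfolding r_def
      by (rule G.real_cond_exp_ge_c[OF i]) (use u'(2)[OF j] u(2) in \<open>auto elim!: eventually_mono\<close>)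
    moreover have "AE \<omega> in M. r j \<omega> \<le> c" unfolding r_def
      by (rule G.real_cond_exp_le_c[OF i]) (use u'(2)[OF j] u(3) in \<open>auto elim!: eventually_mono\<close>)
    ultimately show "AE \<omega> in M. r j \<omega> = ce j \<omega>" by eventually_elim (simp add: ce_def)
  qed
  have md: "mart_diff (\<lambda>j \<omega>. u j \<omega> - ce j \<omega>)"
  proof (rule mart_diffI)
    fix j :: nat assume j: "1 \<le> j"
    show "(\<lambda>\<omega>. u j \<omega> - ce j \<omega>) \<in> borel_measurable (F j)"
      by (intro borel_measurable_diff u j measurable_F_mono[OF cem]) simp
    show "bounded_fun (\<lambda>\<omega>. u j \<omega> - ce j \<omega>)" by (intro bounded_fun_intros ub ceb)
    fix g assume g: "g \<in> borel_measurable (F (j - 1))" "bounded_fun g"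
    note gM = measurable_F_imp_M[OF g(1)] and uM = measurable_F_imp_M[OF u(1)[OF j]] and ceM = measurable_F_imp_M[OF cem[of j]]
    have i: "integrable M (\<lambda>\<omega>. g \<omega> * u j \<omega>)" "integrable M (\<lambda>\<omega>. g \<omega> * ce j \<omega>)"
      by (intro integrable_bounded_fun bounded_fun_mult g ub ceb borel_measurable_times gM uM ceM)+
    have "expectation (\<lambda>\<omega>. g \<omega> * ce j \<omega>) = expectation (\<lambda>\<omega>. g \<omega> * r j \<omega>)"
      by (rule integral_cong_AE)
         (use r_eq[OF j] gM ceM measurable_F_imp_M[OF rm[of j]] in \<open>auto elim!: eventually_mono\<close>)
    also have "\<dots> = expectation (\<lambda>\<omega>. g \<omega> * u' j \<omega>)"
      unfolding r_def by (rule expectation_real_cond_exp[OF subalg g iu'[OF j]])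
    also have "\<dots> = expectation (\<lambda>\<omega>. g \<omega> * u j \<omega>)"
      by (rule integral_cong_AE) (use u'[OF j] gM uM in \<open>auto elim!: eventually_mono\<close>)
    finally show "expectation (\<lambda>\<omega>. g \<omega> * (u j \<omega> - ce j \<omega>)) = 0"
      using i by (simp add: right_diff_distrib)
  qed
  have "AE \<omega> in M. (\<lambda>n. (\<Sum>j=1..n. u j \<omega> - ce j \<omega>) / real n) \<longlonglongrightarrow> 0"
  proof (rule mart_diff_strong_law[OF md])
    fix j \<omega> show "\<bar>u j \<omega> - ce j \<omega>\<bar> \<le> c"
      using u(2)[of j \<omega>] u(3)[of j \<omega>] ce[of j \<omega>] by linarith
  qed
  moreover have "AE \<omega> in M. \<forall>j. 1 \<le> j \<longrightarrow> r j \<omega> = ce j \<omega>"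
  proof (intro AE_all_countable[THEN iffD2] allI)
    fix j :: nat show "AE \<omega> in M. 1 \<le> j \<longrightarrow> r j \<omega> = ce j \<omega>" using r_eq[of j] by (cases "1 \<le> j") auto
  qed
  ultimately show ?thesis using lim
  proof eventually_elim
    case (elim \<omega>)
    have "(\<lambda>n. (\<Sum>j=1..n. r j \<omega>) / real n) \<longlonglongrightarrow> l \<omega>"
      using elim(3) unfolding r_def by (rule cesaro_mean_tendsto)
    moreover have "(\<Sum>j=1..n. r j \<omega>) = (\<Sum>j=1..n. ce j \<omega>)" for n using elim(2) by (intro sum.cong) auto
    ultimately have "(\<lambda>n. (\<Sum>j=1..n. ce j \<omega>) / real n) \<longlonglongrightarrow> l \<omega>" by simp
    from tendsto_add[OF elim(1) this] show ?case
      by (simp add: sum_subtractf add_divide_distrib[symmetric])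
  qed
qed

lemma mean_add_tendsto:
  fixes f g :: "nat \<Rightarrow> real"
  assumes "(\<lambda>n. (\<Sum>j=1..n. f j) / real n) \<longlonglongrightarrow> a" "(\<lambda>n. (\<Sum>j=1..n. g j) / real n) \<longlonglongrightarrow> b"
  shows "(\<lambda>n. (\<Sum>j=1..n. f j + g j) / real n) \<longlonglongrightarrow> a + b"
  using tendsto_add[OF assms] by (simp add: sum.distrib add_divide_distrib)

lemma mean_diff_cancel_tendsto:
  fixes f g :: "nat \<Rightarrow> real"
  assumes "(\<lambda>n. (\<Sum>j=1..n. f j - g j) / real n) \<longlonglongrightarrow> 0" "(\<lambda>n. (\<Sum>j=1..n. g j) / real n) \<longlonglongrightarrow> b"
  shows "(\<lambda>n. (\<Sum>j=1..n. f j) / real n) \<longlonglongrightarrow> b"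
  using mean_add_tendsto[OF assms] by simp

locale clt_urn = bounded_urn M a b N X A B C m
  for M :: "'a measure" and a b :: nat and N X A B :: "nat \<Rightarrow> 'a \<Rightarrow> nat" and C :: nat and m :: "nat \<Rightarrow> real" +
  fixes m_inf q_A q_B q_AB :: real and N_inf Q L Z :: "'a \<Rightarrow> real"
  assumes m_lim: "m \<longlonglongrightarrow> m_inf" and m_pos: "0 < m_inf"
    and rv_limits: "N_inf \<in> borel_measurable M" "Q \<in> borel_measurable M" "L \<in> borel_measurable M" "Z \<in> borel_measurable M"
    and N_lim: "AE \<omega> in M. (\<lambda>n. real_cond_exp M (F (n - 1)) (\<lambda>\<omega>. real (N n \<omega>)) \<omega>) \<longlonglongrightarrow> N_inf \<omega>"
    and Q_lim: "AE \<omega> in M. (\<lambda>n. real_cond_exp M (F (n - 1)) (\<lambda>\<omega>. (real (N n \<omega>))\<^sup>2) \<omega>) \<longlonglongrightarrow> Q \<omega>"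
    and L_lim: "AE \<omega> in M. (\<lambda>n. real_cond_exp M (F (n - 1)) (\<lambda>\<omega>. inverse (real (N n \<omega>))) \<omega>) \<longlonglongrightarrow> L \<omega>"
    and N_pos: "AE \<omega> in M. 0 < N_inf \<omega>" and Q_pos: "AE \<omega> in M. 0 < Q \<omega>" and L_pos: "AE \<omega> in M. 0 < L \<omega>"
    and qA_lim: "(\<lambda>n. \<integral>\<omega>. (real (A n \<omega>))\<^sup>2 \<partial>M) \<longlonglongrightarrow> q_A"
    and qB_lim: "(\<lambda>n. \<integral>\<omega>. (real (B n \<omega>))\<^sup>2 \<partial>M) \<longlonglongrightarrow> q_B"
    and qAB_lim: "(\<lambda>n. \<integral>\<omega>. real (A n \<omega>) * real (B n \<omega>) \<partial>M) \<longlonglongrightarrow> q_AB"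
    and Z_lim: "AE \<omega> in M. (\<lambda>n. urn_Z a b N X A B n \<omega>) \<longlonglongrightarrow> Z \<omega>"
begin

definition mean :: "(nat \<Rightarrow> 'a \<Rightarrow> real) \<Rightarrow> nat \<Rightarrow> 'a \<Rightarrow> real" where
  "mean f n \<omega> = (\<Sum>j=1..n. f j \<omega>) / real n"

lemma clipZ_lim: "AE \<omega> in M. (\<lambda>n. clipZ n \<omega>) \<longlonglongrightarrow> Z \<omega>"
  using Z_lim AE_totals_eq by eventually_elim simp

lemma clipZ_lim': "AE \<omega> in M. (\<lambda>n. clipZ (n - 1) \<omega>) \<longlonglongrightarrow> Z \<omega>"
  using clipZ_lim
proof eventually_elim
  case (elim \<omega>)
  then show ?case by (subst filterlim_sequentially_Suc[symmetric]) simp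
qed

lemma Z_bounds: "AE \<omega> in M. 0 < Z \<omega> \<and> Z \<omega> < 1"
  by (rule limit_proportion_bounds[OF rv_limits(4) clipZ_lim])

lemma mean_clipN: "AE \<omega> in M. (\<lambda>n. mean clipN n \<omega>) \<longlonglongrightarrow> N_inf \<omega>"
  unfolding mean_def
proof (rule cond_exp_mean_tendsto[where u'="\<lambda>n \<omega>. real (N n \<omega>)" and c="real C"])
  fix j :: nat assume j: "1 \<le> j"
  show "clipN j \<in> borel_measurable (F j)" by (rule F_measurables[OF j])
  show "(\<lambda>\<omega>. real (N j \<omega>)) \<in> borel_measurable M" using rv_N[OF j] by measurable
  show "AE \<omega> in M. real (N j \<omega>) = clipN j \<omega>" using AE_processes_eq j by (auto elim!: eventually_mono)
qed (use clipN_bounds N_lim in \<open>auto intro: order_trans[of 0 1]\<close>)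

lemma mean_clipN_sq: "AE \<omega> in M. (\<lambda>n. mean (\<lambda>j \<omega>. (clipN j \<omega>)\<^sup>2) n \<omega>) \<longlonglongrightarrow> Q \<omega>"
  unfolding mean_def
proof (rule cond_exp_mean_tendsto[where u'="\<lambda>n \<omega>. (real (N n \<omega>))\<^sup>2" and c="(real C)\<^sup>2"])
  fix j :: nat assume j: "1 \<le> j"
  show "(\<lambda>\<omega>. (clipN j \<omega>)\<^sup>2) \<in> borel_measurable (F j)" by (intro meas_intros F_measurables j)
  show "(\<lambda>\<omega>. (real (N j \<omega>))\<^sup>2) \<in> borel_measurable M" using rv_N[OF j] by measurable
  show "AE \<omega> in M. (real (N j \<omega>))\<^sup>2 = (clipN j \<omega>)\<^sup>2" using AE_processes_eq j by (auto elim!: eventually_mono)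
next
  fix j \<omega> show "(clipN j \<omega>)\<^sup>2 \<le> (real C)\<^sup>2" using clipN_bounds[of j \<omega>] by (intro power_mono) auto
qed (use Q_lim in auto)

lemma mean_invN: "AE \<omega> in M. (\<lambda>n. mean invN n \<omega>) \<longlonglongrightarrow> L \<omega>"
  unfolding mean_def
proof (rule cond_exp_mean_tendsto[where u'="\<lambda>n \<omega>. inverse (real (N n \<omega>))" and c=1])
  fix j :: nat assume j: "1 \<le> j"
  show "invN j \<in> borel_measurable (F j)" by (rule F_measurables[OF j])
  show "(\<lambda>\<omega>. inverse (real (N j \<omega>))) \<in> borel_measurable M" using rv_N[OF j] by measurable
  show "AE \<omega> in M. inverse (real (N j \<omega>)) = invN j \<omega>" using AE_processes_eq j by (auto elim!: eventually_mono simp: invN_def)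
qed (use invN_bounds L_lim in \<open>auto simp: less_imp_le\<close>)

lemma abs_bounds: "\<bar>clipN n \<omega>\<bar> \<le> real C" "\<bar>clipA n \<omega>\<bar> \<le> real C" "\<bar>clipB n \<omega>\<bar> \<le> real C"
  "\<bar>clipX n \<omega>\<bar> \<le> real C" "\<bar>invN n \<omega>\<bar> \<le> 1" "\<bar>clipZ n \<omega>\<bar> \<le> 1"
  using clipN_bounds[of n \<omega>] clipA_bounds[of n \<omega>] clipB_bounds[of n \<omega>] clipX_bounds[of n \<omega>] invN_bounds[of n \<omega>] clipZ_bounds[of n \<omega>] by auto

lemma uniform_bounds:
  "bounded_fun (\<lambda>p. clipN (Suc (fst p)) (snd p))" "bounded_fun (\<lambda>p. clipA (Suc (fst p)) (snd p))" "bounded_fun (\<lambda>p. clipB (Suc (fst p)) (snd p))"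
  "bounded_fun (\<lambda>p. clipX (Suc (fst p)) (snd p))" "bounded_fun (\<lambda>p. invN (Suc (fst p)) (snd p))" "bounded_fun (\<lambda>p. zeta (Suc (fst p)) (snd p))"
  "bounded_fun (\<lambda>p. incnum (Suc (fst p)) (snd p))" "bounded_fun (\<lambda>p. clipZ (Suc (fst p) - 1) (snd p))" "bounded_fun (\<lambda>p. fpc (Suc (fst p)) (snd p))"
  "bounded_fun (\<lambda>p. m (Suc (fst p)))" "bounded_fun (\<lambda>p. qA (Suc (fst p)))" "bounded_fun (\<lambda>p. qB (Suc (fst p)))" "bounded_fun (\<lambda>p. qAB (Suc (fst p)))"
proof -
  show *: "bounded_fun (\<lambda>p. clipN (Suc (fst p)) (snd p))" "bounded_fun (\<lambda>p. clipA (Suc (fst p)) (snd p))" "bounded_fun (\<lambda>p. clipB (Suc (fst p)) (snd p))"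
    by (rule bounded_funI[OF abs_bounds(1)], rule bounded_funI[OF abs_bounds(2)], rule bounded_funI[OF abs_bounds(3)])
  show "bounded_fun (\<lambda>p. clipX (Suc (fst p)) (snd p))"
    by (rule bounded_funI[OF abs_bounds(4)])
  show "bounded_fun (\<lambda>p. invN (Suc (fst p)) (snd p))"
    by (rule bounded_funI[OF abs_bounds(5)])
  show "bounded_fun (\<lambda>p. zeta (Suc (fst p)) (snd p))" by (rule bounded_funI[OF zeta_le])
  show "bounded_fun (\<lambda>p. incnum (Suc (fst p)) (snd p))" by (rule bounded_funI[OF incnum_le])
  show "bounded_fun (\<lambda>p. clipZ (Suc (fst p) - 1) (snd p))"
    by (rule bounded_funI[OF abs_bounds(6)])
  have "\<bar>fpc (Suc i) \<omega>\<bar> \<le> (real C)\<^sup>2" for i \<omega>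
  proof -
    have "(real C)\<^sup>2 / real (Suc i) \<le> (real C)\<^sup>2 / 1" by (intro divide_left_mono) auto
    then show ?thesis using fpc_bounds[of "Suc i" \<omega>] by simp
  qed
  then show "bounded_fun (\<lambda>p. fpc (Suc (fst p)) (snd p))" by (intro bounded_funI)
  show "bounded_fun (\<lambda>p. m (Suc (fst p)))" 
  proof -
    obtain K where "\<And>n. norm (m n) \<le> K" using convergent_imp_Bseq[of m] m_lim by (auto simp: convergent_def Bseq_def)
    then show ?thesis by (intro bounded_funI) auto
  qed
  have q: "\<bar>expectation (\<lambda>\<omega>. f \<omega>)\<bar> \<le> Csq" if "\<And>\<omega>. 0 \<le> f \<omega>" "\<And>\<omega>. f \<omega> \<le> Csq" "f \<in> borel_measurable M" for f
  proof -
    have "0 \<le> expectation f" using that by (intro Bochner_Integration.integral_nonneg) auto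
    moreover have "expectation f \<le> expectation (\<lambda>\<omega>. Csq)"
      using that by (intro integral_mono integrable_bounded_fun bounded_funI[of f Csq] bounded_fun_const) auto
    ultimately show ?thesis by (simp add: prob_space)
  qed
  have p: "0 \<le> x * y \<and> x * y \<le> Csq" if "1 \<le> x" "x \<le> real C" "1 \<le> y" "y \<le> real C" for x y
    using that mult_mono[of x "real C" y "real C"] by (auto simp: Csq_def power2_eq_square)
  have n1: "1 \<le> Suc n" for n by simp
  have 1: "\<bar>qA (Suc n)\<bar> \<le> Csq" for n
    unfolding qA_def power2_eq_square
    by (rule q[OF p[OF clipA_bounds clipA_bounds, THEN conjunct1] p[OF clipA_bounds clipA_bounds, THEN conjunct2]
          borel_measurable_times[OF measurable_M_processes(2)[OF n1] measurable_M_processes(2)[OF n1]]])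
  have 2: "\<bar>qB (Suc n)\<bar> \<le> Csq" for n
    unfolding qB_def power2_eq_square
    by (rule q[OF p[OF clipB_bounds clipB_bounds, THEN conjunct1] p[OF clipB_bounds clipB_bounds, THEN conjunct2]
          borel_measurable_times[OF measurable_M_processes(3)[OF n1] measurable_M_processes(3)[OF n1]]])
  have 3: "\<bar>qAB (Suc n)\<bar> \<le> Csq" for n
    unfolding qAB_def
    by (rule q[OF p[OF clipA_bounds clipB_bounds, THEN conjunct1] p[OF clipA_bounds clipB_bounds, THEN conjunct2]
          borel_measurable_times[OF measurable_M_processes(2)[OF n1] measurable_M_processes(3)[OF n1]]])
  show "bounded_fun (\<lambda>p. qA (Suc (fst p)))" "bounded_fun (\<lambda>p. qB (Suc (fst p)))" "bounded_fun (\<lambda>p. qAB (Suc (fst p)))"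
    by (rule bounded_funI[OF 1], rule bounded_funI[OF 2], rule bounded_funI[OF 3])
qed

lemma qA_tendsto: "qA \<longlonglongrightarrow> q_A" and qB_tendsto: "qB \<longlonglongrightarrow> q_B" and qAB_tendsto: "qAB \<longlonglongrightarrow> q_AB"
proof -
  have e: "expectation (\<lambda>\<omega>. f (real (A n \<omega>)) (real (B n \<omega>))) = expectation (\<lambda>\<omega>. f (clipA n \<omega>) (clipB n \<omega>))"
    if "case_prod f \<in> borel_measurable (borel \<Otimes>\<^sub>M borel)" "1 \<le> n" for f :: "real \<Rightarrow> real \<Rightarrow> real" and n
  proof (rule integral_cong_AE)
    note [measurable] = that(1) rv_A[OF that(2)] rv_B[OF that(2)] measurable_M_processes(2,3)[OF that(2)]
    show "AE \<omega> in M. f (real (A n \<omega>)) (real (B n \<omega>)) = f (clipA n \<omega>) (clipB n \<omega>)"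
      using AE_processes_eq that(2) by (auto elim!: eventually_mono)
    have "(\<lambda>\<omega>. case_prod f (real (A n \<omega>), real (B n \<omega>))) \<in> borel_measurable M" by measurable
    then show "(\<lambda>\<omega>. f (real (A n \<omega>)) (real (B n \<omega>))) \<in> borel_measurable M" by simp
    have "(\<lambda>\<omega>. case_prod f (clipA n \<omega>, clipB n \<omega>)) \<in> borel_measurable M" by measurable
    then show "(\<lambda>\<omega>. f (clipA n \<omega>) (clipB n \<omega>)) \<in> borel_measurable M" by simp
  qed
  have ev: "\<forall>\<^sub>F n in sequentially. 1 \<le> n" by (rule eventually_ge_at_top)
  show "qA \<longlonglongrightarrow> q_A"
    by (rule Lim_transform_eventually[OF qA_lim eventually_mono[OF ev]])
       (simp add: qA_def e[of "\<lambda>x y. x\<^sup>2"])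
  show "qB \<longlonglongrightarrow> q_B"
    by (rule Lim_transform_eventually[OF qB_lim eventually_mono[OF ev]])
       (simp add: qB_def e[of "\<lambda>x y. y\<^sup>2"])
  show "qAB \<longlonglongrightarrow> q_AB"
    by (rule Lim_transform_eventually[OF qAB_lim eventually_mono[OF ev]])
       (simp add: qAB_def e[of "\<lambda>x y. x * y"])
qed

lemma mean_clip:
  fixes f :: "real \<Rightarrow> real \<Rightarrow> real"
  assumes f: "bounded_fun (\<lambda>p. f (clipA (Suc (fst p)) (snd p)) (clipB (Suc (fst p)) (snd p)))" "\<And>j. bounded_fun (\<lambda>\<omega>. f (clipA j \<omega>) (clipB j \<omega>))"
    "\<And>j. 1 \<le> j \<Longrightarrow> (\<lambda>\<omega>. f (clipA j \<omega>) (clipB j \<omega>)) \<in> borel_measurable (F j)"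
    and E: "\<And>j. 1 \<le> j \<Longrightarrow> expectation (\<lambda>\<omega>. f (clipA j \<omega>) (clipB j \<omega>)) = e j" and e: "e \<longlonglongrightarrow> l" "bounded_fun (\<lambda>p::nat\<times>'a. e (Suc (fst p)))"
  shows "AE \<omega> in M. (\<lambda>n. mean (\<lambda>j \<omega>. f (clipA j \<omega>) (clipB j \<omega>)) n \<omega>) \<longlonglongrightarrow> l"
proof -
  \<comment> \<open>Agrees with \<open>e\<close> from index 1 on; at index 0 nothing is known about
    the replacement factors.\<close>
  define e' where "e' j = expectation (\<lambda>\<omega>. f (clipA j \<omega>) (clipB j \<omega>))" for j
  have "e' (Suc n) = e (Suc n)" for n using E[of "Suc n"] by (simp add: e'_def)
  then have e': "e' \<longlonglongrightarrow> l" "bounded_fun (\<lambda>p::nat\<times>'a. e' (Suc (fst p)))"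
    using e by (subst filterlim_sequentially_Suc[symmetric], simp add: filterlim_sequentially_Suc, simp)
  have md: "mart_diff (\<lambda>j \<omega>. f (clipA j \<omega>) (clipB j \<omega>) - e' j)"
    unfolding e'_def by (rule mart_diff_clip[where f=f, OF f(2,3)])
  have "AE \<omega> in M. (\<lambda>n. (\<Sum>j=1..n. f (clipA j \<omega>) (clipB j \<omega>) - e' j) / real n) \<longlonglongrightarrow> 0"
    by (rule mart_diff_strong_law'[OF md]) (intro bounded_fun_diff f e')
  then show ?thesis unfolding mean_def
    by eventually_elim (erule mean_diff_cancel_tendsto[OF _ cesaro_mean_tendsto[OF e'(1)]])
qed

lemma mean_clipA: "AE \<omega> in M. (\<lambda>n. mean clipA n \<omega>) \<longlonglongrightarrow> m_inf"
  by (rule mean_clip[where f="\<lambda>x y. x" and e=m])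
     (intro uniform_bounds bounded_funs F_measurables expectation_clipA m_lim; assumption)+

lemma mean_clipA_sq: "AE \<omega> in M. (\<lambda>n. mean (\<lambda>j \<omega>. (clipA j \<omega>)\<^sup>2) n \<omega>) \<longlonglongrightarrow> q_A"
  by (rule mean_clip[where f="\<lambda>x y. x\<^sup>2" and e=qA])
     (auto simp: qA_def[symmetric] intro!: bounded_fun_power uniform_bounds bounded_funs meas_intros F_measurables qA_tendsto)

lemma mean_clipB_sq: "AE \<omega> in M. (\<lambda>n. mean (\<lambda>j \<omega>. (clipB j \<omega>)\<^sup>2) n \<omega>) \<longlonglongrightarrow> q_B"
  by (rule mean_clip[where f="\<lambda>x y. y\<^sup>2" and e=qB])
     (auto simp: qB_def[symmetric] intro!: bounded_fun_power uniform_bounds bounded_funs meas_intros F_measurables qB_tendsto)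

lemma mean_clipA_clipB: "AE \<omega> in M. (\<lambda>n. mean (\<lambda>j \<omega>. clipA j \<omega> * clipB j \<omega>) n \<omega>) \<longlonglongrightarrow> q_AB"
  by (rule mean_clip[where f="\<lambda>x y. x * y" and e=qAB])
     (auto simp: qAB_def[symmetric] intro!: bounded_fun_mult uniform_bounds bounded_funs meas_intros F_measurables qAB_tendsto)

text \<open>The sampling errors average to zero and the proportions Z_{j-1} average to Z, so M_n is
  consistent.\<close>

lemma mean_fraction: "AE \<omega> in M. (\<lambda>n. mean (\<lambda>j \<omega>. clipX j \<omega> * invN j \<omega>) n \<omega>) \<longlonglongrightarrow> Z \<omega>"
proof -
  have "AE \<omega> in M. (\<lambda>n. (\<Sum>j=1..n. zeta j \<omega>) / real n) \<longlonglongrightarrow> 0"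
    by (rule mart_diff_strong_law'[OF mart_diff_zeta uniform_bounds(6)])
  then show ?thesis using clipZ_lim' unfolding mean_def
  proof eventually_elim
    case (elim \<omega>)
    show ?case using elim(1) unfolding zeta_def by (rule mean_diff_cancel_tendsto[OF _ cesaro_mean_tendsto[OF elim(2)]])
  qed
qed

lemma fpc_tendsto: "(\<lambda>n. fpc n \<omega>) \<longlonglongrightarrow> 0"
proof (rule Lim_null_comparison)
  show "\<forall>\<^sub>F n in sequentially. norm (fpc n \<omega>) \<le> Csq / real n"
    using eventually_ge_at_top[of 1] by eventually_elim (use fpc_bounds in \<open>simp add: Csq_def\<close>)
  show "(\<lambda>n. Csq / real n) \<longlonglongrightarrow> 0" by real_asymp
qed

text \<open>S grows by m_j N_j on average. The limit is needed for the factor j / S_{j-1} by which j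
  times \<open>mdinc\<close> differs from \<open>incnum\<close>.\<close>

lemma scale_tendsto: "AE \<omega> in M. (\<lambda>n. real n * invS (n - 1) \<omega>) \<longlonglongrightarrow> 1 / (m_inf * N_inf \<omega>)"
proof -
  have "AE \<omega> in M. (\<lambda>n. (\<Sum>j=1..n. clipA j \<omega> * clipX j \<omega> + clipB j \<omega> * (clipN j \<omega> - clipX j \<omega>) - m j * clipN j \<omega>) / real n) \<longlonglongrightarrow> 0"
    by (rule mart_diff_strong_law'[OF mart_diff_growth]) (intro bounded_fun_intros uniform_bounds)
  then show ?thesis using mean_clipN N_pos
  proof eventually_elim
    case (elim \<omega>)
    define st where "st j = clipA j \<omega> * clipX j \<omega> + clipB j \<omega> * (clipN j \<omega> - clipX j \<omega>)" for j
    have "(\<lambda>n. (\<Sum>j=1..n. m j * clipN j \<omega>) / real n) \<longlonglongrightarrow> m_inf * N_inf \<omega>"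
      by (rule cesaro_mean_mult_tendsto[OF elim(2)[unfolded mean_def] m_lim abs_bounds(1)])
    from mean_diff_cancel_tendsto[OF elim(1) this]
    have 1: "(\<lambda>n. (\<Sum>j=1..n. st j) / real n) \<longlonglongrightarrow> m_inf * N_inf \<omega>" by (simp add: st_def)
    have 2: "(\<lambda>n. st n / real n) \<longlonglongrightarrow> 0"
    proof (rule Lim_null_comparison)
      show "\<forall>\<^sub>F n in sequentially. norm (st n / real n) \<le> Csq / real n"
      proof (intro always_eventually allI)
        fix n
        have "\<bar>st n\<bar> \<le> Csq" using step_bounds[of n \<omega>] unfolding st_def Csq_def by linarith
        then show "norm (st n / real n) \<le> Csq / real n" by (simp add: divide_right_mono)
      qed
      show "(\<lambda>n. Csq / real n) \<longlonglongrightarrow> 0" by real_asymp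
    qed
    have 3: "(\<lambda>n. real (a + b) / real n) \<longlonglongrightarrow> 0" by real_asymp
    have S: "clipS n \<omega> = real (a + b) + (\<Sum>j=1..n. st j)" for n
      by (simp add: clipS_def clipH_def clipK_def st_def sum.distrib)
    have "(\<lambda>n. clipS (n - 1) \<omega> / real n) \<longlonglongrightarrow> m_inf * N_inf \<omega>"
    proof (rule Lim_transform_eventually)
      show "(\<lambda>n. real (a + b) / real n + (\<Sum>j=1..n. st j) / real n - st n / real n) \<longlonglongrightarrow> m_inf * N_inf \<omega>"
        using tendsto_diff[OF tendsto_add[OF 3 1] 2] by simp
      show "\<forall>\<^sub>F n in sequentially. real (a + b) / real n + (\<Sum>j=1..n. st j) / real n - st n / real n = clipS (n - 1) \<omega> / real n"
        using eventually_ge_at_top[of 1]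
      proof eventually_elim
        case (elim n)
        then obtain k where "n = Suc k" by (cases n) auto
        then show ?case unfolding S by (simp add: add_divide_distrib)
      qed
    qed
    then have "(\<lambda>n. inverse (clipS (n - 1) \<omega> / real n)) \<longlonglongrightarrow> inverse (m_inf * N_inf \<omega>)"
      using elim(3) m_pos by (intro tendsto_inverse) auto
    then show ?case by (simp add: invS_def inverse_eq_divide)
  qed
qed

text \<open>The compensator is Z_{j-1} (1 - Z_{j-1}) / N_j up to the vanishing correction
  \<open>fpc\<close>, and the averages of 1 / N_j tend to L.\<close>

lemma mean_zeta_sq: "AE \<omega> in M. (\<lambda>n. mean (\<lambda>j \<omega>. (zeta j \<omega>)\<^sup>2) n \<omega>) \<longlonglongrightarrow> Z \<omega> * (1 - Z \<omega>) * L \<omega>"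
proof -
  have "AE \<omega> in M. (\<lambda>n. (\<Sum>j=1..n. (zeta j \<omega>)\<^sup>2 - (clipZ (j - 1) \<omega> * (1 - clipZ (j - 1) \<omega>) * invN j \<omega> - fpc j \<omega> * (invN j \<omega>)\<^sup>2)) / real n) \<longlonglongrightarrow> 0"
    by (rule mart_diff_strong_law'[OF mart_diff_zeta_sq]) (intro bounded_fun_intros uniform_bounds)
  then show ?thesis using clipZ_lim' mean_invN unfolding mean_def
  proof eventually_elim
    case (elim \<omega>)
    have ib: "\<bar>invN j \<omega>\<bar> \<le> 1" for j using invN_bounds[of j \<omega>] by auto
    have "(\<lambda>n. (\<Sum>j=1..n. (clipZ (j - 1) \<omega> * (1 - clipZ (j - 1) \<omega>)) * invN j \<omega>) / real n) \<longlonglongrightarrow> Z \<omega> * (1 - Z \<omega>) * L \<omega>"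
      by (rule cesaro_mean_mult_tendsto[OF elim(3) _ ib]) (intro tendsto_intros elim(2))
    moreover have "(\<lambda>n. (\<Sum>j=1..n. (- (fpc j \<omega> * invN j \<omega>)) * invN j \<omega>) / real n) \<longlonglongrightarrow> 0 * L \<omega>"
    proof (rule cesaro_mean_mult_tendsto[OF elim(3) _ ib])
      have "(\<lambda>j. \<bar>fpc j \<omega>\<bar>) \<longlonglongrightarrow> 0" using fpc_tendsto by (rule tendsto_rabs_zero)
      then show "(\<lambda>j. - (fpc j \<omega> * invN j \<omega>)) \<longlonglongrightarrow> 0"
        by (rule Lim_null_comparison[rotated]) (use ib in \<open>auto simp: abs_mult intro!: always_eventually mult_left_le\<close>)
    qed
    ultimately have "(\<lambda>n. (\<Sum>j=1..n. (clipZ (j - 1) \<omega> * (1 - clipZ (j - 1) \<omega>)) * invN j \<omega> + (- (fpc j \<omega> * invN j \<omega>)) * invN j \<omega>) / real n)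
       \<longlonglongrightarrow> Z \<omega> * (1 - Z \<omega>) * L \<omega> + 0 * L \<omega>" by (rule mean_add_tendsto)
    then have "(\<lambda>n. (\<Sum>j=1..n. clipZ (j - 1) \<omega> * (1 - clipZ (j - 1) \<omega>) * invN j \<omega> - fpc j \<omega> * (invN j \<omega>)\<^sup>2) / real n)
       \<longlonglongrightarrow> Z \<omega> * (1 - Z \<omega>) * L \<omega>" by (simp add: power2_eq_square mult.assoc)
    then show ?case by (rule mean_diff_cancel_tendsto[OF elim(1)])
  qed
qed

lemma mean_zeta_incnum: "AE \<omega> in M. (\<lambda>n. mean (\<lambda>j \<omega>. zeta j \<omega> * incnum j \<omega>) n \<omega>) \<longlonglongrightarrow> m_inf * (Z \<omega> * (1 - Z \<omega>))"
proof -
  have "AE \<omega> in M. (\<lambda>n. (\<Sum>j=1..n. zeta j \<omega> * incnum j \<omega> - m j * (clipZ (j - 1) \<omega> * (1 - clipZ (j - 1) \<omega>) - fpc j \<omega> * invN j \<omega>)) / real n) \<longlonglongrightarrow> 0"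
    by (rule mart_diff_strong_law'[OF mart_diff_zeta_incnum]) (intro bounded_fun_intros uniform_bounds)
  then show ?thesis using clipZ_lim' unfolding mean_def
  proof eventually_elim
    case (elim \<omega>)
    have ib: "\<bar>invN j \<omega>\<bar> \<le> 1" for j using invN_bounds[of j \<omega>] by auto
    have "(\<lambda>j. \<bar>fpc j \<omega>\<bar>) \<longlonglongrightarrow> 0" using fpc_tendsto by (rule tendsto_rabs_zero)
    then have "(\<lambda>j. fpc j \<omega> * invN j \<omega>) \<longlonglongrightarrow> 0"
      by (rule Lim_null_comparison[rotated]) (use ib in \<open>auto simp: abs_mult intro!: always_eventually mult_left_le\<close>)
    then have "(\<lambda>j. m j * (clipZ (j - 1) \<omega> * (1 - clipZ (j - 1) \<omega>) - fpc j \<omega> * invN j \<omega>)) \<longlonglongrightarrow> m_inf * (Z \<omega> * (1 - Z \<omega>) - 0)"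
      by (intro tendsto_intros m_lim elim(2))
    then show ?case by (intro mean_diff_cancel_tendsto[OF elim(1)] cesaro_mean_tendsto) simp
  qed
qed

text \<open>The limit of the averages of \<open>incvar\<close>. Dividing it by (m N)^2 gives the
  limit of V'.\<close>

definition step_var :: "'a \<Rightarrow> real" where
  "step_var \<omega> = Z \<omega> * (1 - Z \<omega>) * ((1 - Z \<omega>) * q_A * ((1 - Z \<omega>) * N_inf \<omega> + Z \<omega> * Q \<omega>)
     + Z \<omega> * q_B * (Z \<omega> * N_inf \<omega> + (1 - Z \<omega>) * Q \<omega>) - 2 * Z \<omega> * (1 - Z \<omega>) * q_AB * (Q \<omega> - N_inf \<omega>))"

lemma mean_incnum_sq: "AE \<omega> in M. (\<lambda>n. mean (\<lambda>j \<omega>. (incnum j \<omega>)\<^sup>2) n \<omega>) \<longlonglongrightarrow> step_var \<omega>"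
proof -
  have "AE \<omega> in M. (\<lambda>n. (\<Sum>j=1..n. (incnum j \<omega>)\<^sup>2 - incvar j \<omega>) / real n) \<longlonglongrightarrow> 0"
    by (rule mart_diff_strong_law'[OF mart_diff_incnum_sq]) (unfold incvar_def sqmean_def, intro bounded_fun_intros uniform_bounds)
  then show ?thesis using clipZ_lim' mean_clipN mean_clipN_sq unfolding mean_def
  proof eventually_elim
    case (elim \<omega>)
    define z where "z j = clipZ (j - 1) \<omega>" for j
    \<comment> \<open>The total coefficient of \<open>sqmean\<close> in \<open>incvar\<close>. With
      it, \<open>incvar\<close> splits into a multiple of N_j, a multiple of N_j^2 and a null
      sequence, to which the known averages apply.\<close>
    define q where "q j = qA j * (1 - z j)\<^sup>2 + 2 * qAB j * (z j * (1 - z j)) + qB j * (z j)\<^sup>2" for j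
    define q' where "q' = q_A * (1 - Z \<omega>)\<^sup>2 + 2 * q_AB * (Z \<omega> * (1 - Z \<omega>)) + q_B * (Z \<omega>)\<^sup>2"
    have z: "z \<longlonglongrightarrow> Z \<omega>" using elim(2) unfolding z_def[abs_def] .
    have q: "q \<longlonglongrightarrow> q'" unfolding q_def q'_def by (intro tendsto_intros qA_tendsto qB_tendsto qAB_tendsto z)
    have nb: "\<bar>clipN j \<omega>\<bar> \<le> real C" "\<bar>(clipN j \<omega>)\<^sup>2\<bar> \<le> (real C)\<^sup>2" for j
      using clipN_bounds[of j \<omega>] by (auto intro!: power_mono)
    have 1: "(\<lambda>n. (\<Sum>j=1..n. ((z j - (z j)\<^sup>2) * q j) * clipN j \<omega>) / real n) \<longlonglongrightarrow> ((Z \<omega> - (Z \<omega>)\<^sup>2) * q') * N_inf \<omega>"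
      by (rule cesaro_mean_mult_tendsto[OF elim(3) _ nb(1)]) (intro tendsto_intros z q)
    have 2: "(\<lambda>n. (\<Sum>j=1..n. ((z j)\<^sup>2 * q j - 2 * qAB j * ((z j)\<^sup>2 * (1 - z j)) + qB j * ((z j)\<^sup>2 * (1 - 2 * z j))) * (clipN j \<omega>)\<^sup>2) / real n)
       \<longlonglongrightarrow> ((Z \<omega>)\<^sup>2 * q' - 2 * q_AB * ((Z \<omega>)\<^sup>2 * (1 - Z \<omega>)) + q_B * ((Z \<omega>)\<^sup>2 * (1 - 2 * Z \<omega>))) * Q \<omega>"
      by (rule cesaro_mean_mult_tendsto[OF elim(4) _ nb(2)]) (intro tendsto_intros z q qA_tendsto qB_tendsto qAB_tendsto)
    have "(\<lambda>j. - (fpc j \<omega> * q j)) \<longlonglongrightarrow> - (0 * q')" by (intro tendsto_intros fpc_tendsto q)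
    then have 3: "(\<lambda>n. (\<Sum>j=1..n. - (fpc j \<omega> * q j)) / real n) \<longlonglongrightarrow> 0" by (intro cesaro_mean_tendsto) simp
    have "(\<lambda>n. (\<Sum>j=1..n. ((z j - (z j)\<^sup>2) * q j) * clipN j \<omega> + (((z j)\<^sup>2 * q j - 2 * qAB j * ((z j)\<^sup>2 * (1 - z j)) + qB j * ((z j)\<^sup>2 * (1 - 2 * z j))) * (clipN j \<omega>)\<^sup>2
       + - (fpc j \<omega> * q j))) / real n) \<longlonglongrightarrow> ((Z \<omega> - (Z \<omega>)\<^sup>2) * q') * N_inf \<omega>
       + (((Z \<omega>)\<^sup>2 * q' - 2 * q_AB * ((Z \<omega>)\<^sup>2 * (1 - Z \<omega>)) + q_B * ((Z \<omega>)\<^sup>2 * (1 - 2 * Z \<omega>))) * Q \<omega> + 0)"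
      by (intro mean_add_tendsto 1 2 3)
    also have "((Z \<omega> - (Z \<omega>)\<^sup>2) * q') * N_inf \<omega>
       + (((Z \<omega>)\<^sup>2 * q' - 2 * q_AB * ((Z \<omega>)\<^sup>2 * (1 - Z \<omega>)) + q_B * ((Z \<omega>)\<^sup>2 * (1 - 2 * Z \<omega>))) * Q \<omega> + 0) = step_var \<omega>"
      unfolding step_var_def q'_def by (simp add: power2_eq_square algebra_simps)
    finally have "(\<lambda>n. (\<Sum>j=1..n. ((z j - (z j)\<^sup>2) * q j) * clipN j \<omega> + (((z j)\<^sup>2 * q j - 2 * qAB j * ((z j)\<^sup>2 * (1 - z j)) + qB j * ((z j)\<^sup>2 * (1 - 2 * z j))) * (clipN j \<omega>)\<^sup>2
       + - (fpc j \<omega> * q j))) / real n) \<longlonglongrightarrow> step_var \<omega>" .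
    moreover have "((z j - (z j)\<^sup>2) * q j) * clipN j \<omega> + (((z j)\<^sup>2 * q j - 2 * qAB j * ((z j)\<^sup>2 * (1 - z j)) + qB j * ((z j)\<^sup>2 * (1 - 2 * z j))) * (clipN j \<omega>)\<^sup>2
       + - (fpc j \<omega> * q j)) = incvar j \<omega>" for j
      unfolding incvar_def sqmean_def z_def[symmetric] q_def by (simp add: power2_eq_square algebra_simps)
    ultimately have "(\<lambda>n. (\<Sum>j=1..n. incvar j \<omega>) / real n) \<longlonglongrightarrow> step_var \<omega>" by (simp only:)
    then show ?case by (rule mean_diff_cancel_tendsto[OF elim(1)])
  qed
qed

end

subsection \<open>The confidence interval\<close>

context clt_urn
begin

definition W_inf :: "'a \<Rightarrow> real" where
  "W_inf \<omega> = 2 * (step_var \<omega> / (m_inf * N_inf \<omega>)\<^sup>2) + Z \<omega> * (1 - Z \<omega>) * (L \<omega> - 2 * inverse (N_inf \<omega>))"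

text \<open>Built from \<open>mdinc\<close> rather than from the increments of Z_n themselves, so
  that the rows are exact martingale differences; the discrepancy goes into
  \<open>scalederr_decomp\<close>.\<close>

definition xi :: "nat \<Rightarrow> nat \<Rightarrow> 'a \<Rightarrow> real" where
  "xi n j \<omega> = (if j \<le> n then (zeta j \<omega> - real j * mdinc j \<omega>) / sqrt (real n) else - sqrt (real n) * mdinc j \<omega>)"

lemma mart_diff_xi: "mart_diff (xi n)"
proof -
  have "mart_diff (\<lambda>j \<omega>. (if j \<le> n then 1 / sqrt (real n) else 0) * zeta j \<omega>
     + (if j \<le> n then - (real j / sqrt (real n)) else - sqrt (real n)) * mdinc j \<omega>)"
    by (intro mart_diff_add mart_diff_cmult mart_diff_zeta mart_diff_mdinc)
  moreover have "(\<lambda>j \<omega>. (if j \<le> n then 1 / sqrt (real n) else 0) * zeta j \<omega>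
     + (if j \<le> n then - (real j / sqrt (real n)) else - sqrt (real n)) * mdinc j \<omega>) = xi n"
    by (auto simp: xi_def fun_eq_iff diff_divide_distrib)
  ultimately show ?thesis by simp
qed

lemma scaled_mdinc_le: "1 \<le> j \<Longrightarrow> \<bar>real j * mdinc j \<omega>\<bar> \<le> Csq"
  using mdinc_le[of j \<omega>] by (simp add: abs_mult field_simps)

lemma zeta_mdinc_le: "1 \<le> j \<Longrightarrow> \<bar>zeta j \<omega> - real j * mdinc j \<omega>\<bar> \<le> 1 + Csq"
  using zeta_le[of j \<omega>] scaled_mdinc_le[of j \<omega>] by linarith

text \<open>The summands bound the sums of squares of the two blocks. The total also exceeds 1 + Csq
  and so bounds the single terms, as the central limit theorem uses one constant for both.\<close>

definition xiconst :: real where "xiconst = (1 + Csq)\<^sup>2 + Csq\<^sup>2"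

lemma xiconst_ge: "1 + Csq \<le> xiconst"
proof -
  have "(1 + Csq) * 1 \<le> (1 + Csq) * (1 + Csq)" using Csq_ge by (intro mult_left_mono) auto
  then show ?thesis by (simp add: xiconst_def power2_eq_square add_increasing2)
qed

lemma xi_le:
  assumes "1 \<le> n" "1 \<le> j"
  shows "\<bar>xi n j \<omega>\<bar> \<le> xiconst / sqrt (real n)"
proof (cases "j \<le> n")
  case True
  then have "\<bar>xi n j \<omega>\<bar> = \<bar>zeta j \<omega> - real j * mdinc j \<omega>\<bar> / sqrt (real n)" by (simp add: xi_def)
  also have "\<dots> \<le> xiconst / sqrt (real n)"
    using zeta_mdinc_le[OF assms(2), of \<omega>] xiconst_ge by (intro divide_right_mono) auto
  finally show ?thesis .
next
  case False
  have "\<bar>xi n j \<omega>\<bar> = sqrt (real n) * \<bar>mdinc j \<omega>\<bar>" using False by (simp add: xi_def abs_mult)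
  also have "\<dots> \<le> sqrt (real n) * (Csq / real n)"
  proof -
    have "Csq / real j \<le> Csq / real n" using False assms Csq_ge by (intro divide_left_mono) auto
    then show ?thesis using mdinc_le[OF assms(2), of \<omega>] by (intro mult_left_mono) auto
  qed
  also have "\<dots> = Csq / sqrt (real n)" using assms by (simp add: real_div_sqrt field_simps)
  also have "\<dots> \<le> xiconst / sqrt (real n)" using xiconst_ge by (intro divide_right_mono) auto
  finally show ?thesis .
qed

text \<open>In the second block the factor j^2 / j^2 is inserted: j times \<open>mdinc\<close> is of
  order one, so the tail takes the form of \<open>cesaro_tail_tendsto\<close>.\<close>

lemma xi_sq_sum:
  assumes n: "1 \<le> n"
  shows "(\<Sum>j=1..n\<^sup>2. (xi n j \<omega>)\<^sup>2) = (\<Sum>j=1..n. (zeta j \<omega> - real j * mdinc j \<omega>)\<^sup>2) / real n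
     + real n * (\<Sum>j=n+1..n\<^sup>2. (real j * mdinc j \<omega>)\<^sup>2 / (real j)\<^sup>2)"
proof -
  have "n \<le> n\<^sup>2" using n by (simp add: power2_eq_square)
  then have "{1..n\<^sup>2} = {1..n} \<union> {n+1..n\<^sup>2}" by auto
  then have "(\<Sum>j=1..n\<^sup>2. (xi n j \<omega>)\<^sup>2) = (\<Sum>j=1..n. (xi n j \<omega>)\<^sup>2) + (\<Sum>j=n+1..n\<^sup>2. (xi n j \<omega>)\<^sup>2)"
    by (simp add: sum.union_disjoint)
  also have "(\<Sum>j=1..n. (xi n j \<omega>)\<^sup>2) = (\<Sum>j=1..n. (zeta j \<omega> - real j * mdinc j \<omega>)\<^sup>2 / real n)"
    by (intro sum.cong) (auto simp: xi_def power_divide)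
  also have "(\<Sum>j=n+1..n\<^sup>2. (xi n j \<omega>)\<^sup>2) = (\<Sum>j=n+1..n\<^sup>2. real n * ((real j * mdinc j \<omega>)\<^sup>2 / (real j)\<^sup>2))"
    by (intro sum.cong) (auto simp: xi_def power_mult_distrib)
  finally show ?thesis by (simp only: sum_divide_distrib sum_distrib_left)
qed

lemma xi_sq_sum_le:
  assumes n: "1 \<le> n"
  shows "(\<Sum>j=1..n\<^sup>2. (xi n j \<omega>)\<^sup>2) \<le> xiconst"
proof -
  have "(\<Sum>j=1..n. (zeta j \<omega> - real j * mdinc j \<omega>)\<^sup>2) \<le> (\<Sum>j=1..n. (1 + Csq)\<^sup>2)"
    using power_mono[OF zeta_mdinc_le[of _ \<omega>], of _ 2] by (intro sum_mono) auto
  then have 1: "(\<Sum>j=1..n. (zeta j \<omega> - real j * mdinc j \<omega>)\<^sup>2) / real n \<le> (1 + Csq)\<^sup>2"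
    using n by (simp add: field_simps)
  have "(\<Sum>j=n+1..n\<^sup>2. (real j * mdinc j \<omega>)\<^sup>2 / (real j)\<^sup>2) \<le> (\<Sum>j=n+1..n\<^sup>2. Csq\<^sup>2 * (1 / (real j)\<^sup>2))"
  proof (intro sum_mono)
    fix j assume "j \<in> {n+1..n\<^sup>2}"
    then have "(real j * mdinc j \<omega>)\<^sup>2 \<le> Csq\<^sup>2" using power_mono[OF scaled_mdinc_le[of j \<omega>], of 2] by auto
    then show "(real j * mdinc j \<omega>)\<^sup>2 / (real j)\<^sup>2 \<le> Csq\<^sup>2 * (1 / (real j)\<^sup>2)" by (simp add: divide_right_mono)
  qed
  also have "\<dots> \<le> Csq\<^sup>2 * (1 / real n)"
    unfolding sum_distrib_left[symmetric] by (intro mult_left_mono sum_inverse_squares_le n) auto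
  finally have "real n * (\<Sum>j=n+1..n\<^sup>2. (real j * mdinc j \<omega>)\<^sup>2 / (real j)\<^sup>2) \<le> real n * (Csq\<^sup>2 * (1 / real n))"
    by (intro mult_left_mono) auto
  also have "\<dots> = Csq\<^sup>2" using n by simp
  finally show ?thesis unfolding xi_sq_sum[OF n] xiconst_def using 1 by linarith
qed

text \<open>Write j \<open>mdinc\<close> as \<open>k j\<close> times \<open>incnum\<close> with
  \<open>k j\<close> tending to \<kappa> = 1 / (m N). The first block yields the variance of
  \<open>zeta\<close>, a cross term and \<kappa>^2 times \<open>step_var\<close>; the second block
  yields the last of these once more.\<close>

lemma xi_sq_sum_tendsto: "AE \<omega> in M. (\<lambda>n. \<Sum>j=1..n\<^sup>2. (xi n j \<omega>)\<^sup>2) \<longlonglongrightarrow> W_inf \<omega>"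
  using mean_zeta_sq mean_zeta_incnum mean_incnum_sq scale_tendsto N_pos
proof eventually_elim
  case (elim \<omega>)
  define k where "k j = real j * invS (j - 1) \<omega>" for j
  define \<kappa> where "\<kappa> = 1 / (m_inf * N_inf \<omega>)"
  have k: "k \<longlonglongrightarrow> \<kappa>" using elim(4) unfolding k_def[abs_def] \<kappa>_def .
  have d: "real j * mdinc j \<omega> = k j * incnum j \<omega>" for j by (simp add: k_def mdinc_def)
  have "\<bar>(incnum j \<omega>)\<^sup>2\<bar> \<le> Csq\<^sup>2" for j using power_mono[OF incnum_le[of j \<omega>], of 2] by simp
  then have 1: "(\<lambda>n. (\<Sum>j=1..n. (k j)\<^sup>2 * (incnum j \<omega>)\<^sup>2) / real n) \<longlonglongrightarrow> \<kappa>\<^sup>2 * step_var \<omega>"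
    by (intro cesaro_mean_mult_tendsto[OF elim(3)[unfolded mean_def]] tendsto_power k)
  have "\<bar>zeta j \<omega> * incnum j \<omega>\<bar> \<le> 1 * Csq" for j
    unfolding abs_mult by (intro mult_mono zeta_le incnum_le) auto
  then have "(\<lambda>n. (\<Sum>j=1..n. (- 2 * k j) * (zeta j \<omega> * incnum j \<omega>)) / real n) \<longlonglongrightarrow> (- 2 * \<kappa>) * (m_inf * (Z \<omega> * (1 - Z \<omega>)))"
    by (intro cesaro_mean_mult_tendsto[OF elim(2)[unfolded mean_def]] tendsto_mult k tendsto_const)
  from mean_add_tendsto[OF mean_add_tendsto[OF elim(1)[unfolded mean_def] this] 1]
  have 2: "(\<lambda>n. (\<Sum>j=1..n. (zeta j \<omega> - real j * mdinc j \<omega>)\<^sup>2) / real n)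
    \<longlonglongrightarrow> Z \<omega> * (1 - Z \<omega>) * L \<omega> + (- 2 * \<kappa>) * (m_inf * (Z \<omega> * (1 - Z \<omega>))) + \<kappa>\<^sup>2 * step_var \<omega>"
    unfolding d by (simp add: power2_diff power_mult_distrib algebra_simps)
  have 3: "(\<lambda>n. real n * (\<Sum>j=n+1..n\<^sup>2. (real j * mdinc j \<omega>)\<^sup>2 / (real j)\<^sup>2)) \<longlonglongrightarrow> \<kappa>\<^sup>2 * step_var \<omega>"
    unfolding d using cesaro_tail_tendsto[OF 1] by (simp only: power_mult_distrib)
  have "(Z \<omega> * (1 - Z \<omega>) * L \<omega> + (- 2 * \<kappa>) * (m_inf * (Z \<omega> * (1 - Z \<omega>))) + \<kappa>\<^sup>2 * step_var \<omega>) + \<kappa>\<^sup>2 * step_var \<omega> = W_inf \<omega>"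
    using m_pos elim(5) by (simp add: W_inf_def \<kappa>_def power_divide algebra_simps inverse_eq_divide)
  with tendsto_add[OF 2 3]
  have "(\<lambda>n. (\<Sum>j=1..n. (zeta j \<omega> - real j * mdinc j \<omega>)\<^sup>2) / real n + real n * (\<Sum>j=n+1..n\<^sup>2. (real j * mdinc j \<omega>)\<^sup>2 / (real j)\<^sup>2)) \<longlonglongrightarrow> W_inf \<omega>"
    by simp
  then show ?case
  proof (rule Lim_transform_eventually)
    show "\<forall>\<^sub>F n in sequentially. (\<Sum>j=1..n. (zeta j \<omega> - real j * mdinc j \<omega>)\<^sup>2) / real n
        + real n * (\<Sum>j=n+1..n\<^sup>2. (real j * mdinc j \<omega>)\<^sup>2 / (real j)\<^sup>2) = (\<Sum>j=1..n\<^sup>2. (xi n j \<omega>)\<^sup>2)"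
      using eventually_ge_at_top[of 1] by eventually_elim (rule xi_sq_sum[symmetric])
  qed
qed

lemma emp_mean_eq:
  "AE \<omega> in M. \<forall>n. urn_M N X n \<omega> = mean (\<lambda>j \<omega>. clipX j \<omega> * invN j \<omega>) n \<omega>
     \<and> emp_mean (\<lambda>j \<omega>. real (A j \<omega>)) n \<omega> = mean clipA n \<omega>
     \<and> emp_mean (\<lambda>j \<omega>. (real (A j \<omega>))\<^sup>2) n \<omega> = mean (\<lambda>j \<omega>. (clipA j \<omega>)\<^sup>2) n \<omega>
     \<and> emp_mean (\<lambda>j \<omega>. (real (B j \<omega>))\<^sup>2) n \<omega> = mean (\<lambda>j \<omega>. (clipB j \<omega>)\<^sup>2) n \<omega>
     \<and> emp_mean (\<lambda>j \<omega>. real (A j \<omega>) * real (B j \<omega>)) n \<omega> = mean (\<lambda>j \<omega>. clipA j \<omega> * clipB j \<omega>) n \<omega>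
     \<and> emp_mean (\<lambda>j \<omega>. real (N j \<omega>)) n \<omega> = mean clipN n \<omega>
     \<and> emp_mean (\<lambda>j \<omega>. (real (N j \<omega>))\<^sup>2) n \<omega> = mean (\<lambda>j \<omega>. (clipN j \<omega>)\<^sup>2) n \<omega>
     \<and> emp_mean (\<lambda>j \<omega>. inverse (real (N j \<omega>))) n \<omega> = mean invN n \<omega>"
  using AE_processes_eq
proof eventually_elim
  case (elim \<omega>)
  have e: "real (N j \<omega>) = clipN j \<omega>" "real (X j \<omega>) = clipX j \<omega>" "real (A j \<omega>) = clipA j \<omega>" "real (B j \<omega>) = clipB j \<omega>" if "j \<in> {1..n}" for j n
    using elim that by auto
  show ?case unfolding urn_M_def emp_mean_def mean_def
    by (intro allI conjI arg_cong2[where f="(/)"] refl sum.cong) (simp_all only: e invN_def divide_inverse)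
qed

lemma urn_W_tendsto: "AE \<omega> in M. (\<lambda>n. urn_W N X A B n \<omega>) \<longlonglongrightarrow> W_inf \<omega>"
  using emp_mean_eq mean_fraction mean_clipA mean_clipA_sq mean_clipB_sq mean_clipA_clipB mean_clipN mean_clipN_sq mean_invN N_pos
proof eventually_elim
  case (elim \<omega>)
  have nz: "m_inf * N_inf \<omega> \<noteq> 0" "(m_inf * N_inf \<omega>)\<^sup>2 \<noteq> 0" "N_inf \<omega> \<noteq> 0" using m_pos elim(10) by auto
  have "(\<lambda>n. urn_W N X A B n \<omega>) \<longlonglongrightarrow> 2 * (Z \<omega> * (1 - Z \<omega>) *
        (((1 - Z \<omega>) * q_A * ((1 - Z \<omega>) * N_inf \<omega> + Z \<omega> * Q \<omega>) + Z \<omega> * q_B * (Z \<omega> * N_inf \<omega> + (1 - Z \<omega>) * Q \<omega>)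
            - 2 * Z \<omega> * (1 - Z \<omega>) * q_AB * (Q \<omega> - N_inf \<omega>))
          / (m_inf * N_inf \<omega>)\<^sup>2)) + Z \<omega> * (1 - Z \<omega>) * (L \<omega> - 2 * inverse (N_inf \<omega>))"
    unfolding urn_W_def urn_V'_def Let_def
    using elim(1) by (simp only:) (intro tendsto_intros elim nz)
  then show ?case by (simp add: W_inf_def step_var_def)
qed

text \<open>
  Jensen's inequality: replacing both replacement factors by their common mean does not increase
  the quadratic form, which bounds \<open>V'\<close> below by \<open>Z (1 - Z) / N\<close> in the limit.
\<close>

lemma quadratic_form_bound: "m_inf\<^sup>2 * (u - v)\<^sup>2 \<le> q_A * u\<^sup>2 - 2 * q_AB * (u * v) + q_B * v\<^sup>2"
proof (rule LIMSEQ_le)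
  show "(\<lambda>n. (m n)\<^sup>2 * (u - v)\<^sup>2) \<longlonglongrightarrow> m_inf\<^sup>2 * (u - v)\<^sup>2" by (intro tendsto_intros m_lim)
  show "(\<lambda>n. qA n * u\<^sup>2 - 2 * qAB n * (u * v) + qB n * v\<^sup>2) \<longlonglongrightarrow> q_A * u\<^sup>2 - 2 * q_AB * (u * v) + q_B * v\<^sup>2"
    by (intro tendsto_intros qA_tendsto qB_tendsto qAB_tendsto)
  have "(m n)\<^sup>2 * (u - v)\<^sup>2 \<le> qA n * u\<^sup>2 - 2 * qAB n * (u * v) + qB n * v\<^sup>2" if n: "1 \<le> n" for n
  proof -
    \<comment> \<open>Its mean is m (u - v) and its second moment is the quadratic form, so the
      claim is nonnegativity of its variance.\<close>
    define Y where "Y \<omega> = clipA n \<omega> * u - clipB n \<omega> * v" for \<omega>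
    note [measurable] = measurable_M_processes(2,3)[OF n]
    have i: "integrable M (clipA n)" "integrable M (clipB n)" "integrable M (\<lambda>\<omega>. (clipA n \<omega>)\<^sup>2)" "integrable M (\<lambda>\<omega>. (clipB n \<omega>)\<^sup>2)"
      "integrable M (\<lambda>\<omega>. clipA n \<omega> * clipB n \<omega>)"
      by (intro integrable_bounded_fun bounded_fun_intros bounded_funs; measurable)+
    have EY: "expectation Y = m n * (u - v)"
      unfolding Y_def using i expectation_clipA[OF n] expectation_clipB[OF n] by (simp add: algebra_simps)
    have iY: "integrable M Y" "integrable M (\<lambda>\<omega>. (Y \<omega>)\<^sup>2)"
      unfolding Y_def by (intro integrable_bounded_fun bounded_fun_intros bounded_funs; measurable)+
    have "expectation (\<lambda>\<omega>. (Y \<omega>)\<^sup>2) = expectation (\<lambda>\<omega>. u\<^sup>2 * (clipA n \<omega>)\<^sup>2 - 2 * (u * v) * (clipA n \<omega> * clipB n \<omega>) + v\<^sup>2 * (clipB n \<omega>)\<^sup>2)"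
      by (intro Bochner_Integration.integral_cong) (auto simp: Y_def power2_eq_square algebra_simps)
    also have "\<dots> = u\<^sup>2 * qA n - 2 * (u * v) * qAB n + v\<^sup>2 * qB n"
      unfolding qA_def qB_def qAB_def using i by simp
    finally have EY2: "expectation (\<lambda>\<omega>. (Y \<omega>)\<^sup>2) = u\<^sup>2 * qA n - 2 * (u * v) * qAB n + v\<^sup>2 * qB n" .
    have "0 \<le> variance Y" by (rule variance_positive)
    then have "(expectation Y)\<^sup>2 \<le> expectation (\<lambda>\<omega>. (Y \<omega>)\<^sup>2)" using variance_eq[OF iY] by simp
    then have "(m n)\<^sup>2 * (u - v)\<^sup>2 \<le> u\<^sup>2 * qA n - 2 * (u * v) * qAB n + v\<^sup>2 * qB n"
      unfolding EY EY2 power_mult_distrib .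
    then show ?thesis by (simp add: mult_ac)
  qed
  then show "\<exists>k. \<forall>n\<ge>k. (m n)\<^sup>2 * (u - v)\<^sup>2 \<le> qA n * u\<^sup>2 - 2 * qAB n * (u * v) + qB n * v\<^sup>2" by blast
qed

text \<open>The lower bound Z (1 - Z) / N for the limit of V' enters twice and cancels -2 Z (1 - Z)
  / N exactly, leaving at least Z (1 - Z) L.\<close>

lemma W_inf_pos: "AE \<omega> in M. 0 < W_inf \<omega>"
  using Z_bounds N_pos Q_pos L_pos
proof eventually_elim
  case (elim \<omega>)
  define z where "z = Z \<omega>"
  define n where "n = N_inf \<omega>"
  define q where "q = Q \<omega>"
  have z: "0 < z" "z < 1" "0 < n" "0 < q" using elim by (auto simp: z_def n_def q_def)
  \<comment> \<open>Arguments of opposite sign make u - v = 1 and give the coefficient of N; the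
    equal arguments of the next bound show that the coefficient of Q is nonnegative.\<close>
  have q1: "m_inf\<^sup>2 * 1 \<le> q_A * (1 - z)\<^sup>2 + 2 * q_AB * ((1 - z) * z) + q_B * z\<^sup>2"
    using quadratic_form_bound[of "1 - z" "- z"] by simp
  have q2: "0 \<le> q_A + q_B - 2 * q_AB" using quadratic_form_bound[of 1 1] by simp
  have "step_var \<omega> = z * (1 - z) * (n * (q_A * (1 - z)\<^sup>2 + 2 * q_AB * ((1 - z) * z) + q_B * z\<^sup>2) + z * (1 - z) * q * (q_A + q_B - 2 * q_AB))"
    unfolding step_var_def z_def[symmetric] n_def[symmetric] q_def[symmetric]
    by (simp add: power2_eq_square algebra_simps)
  also have "\<dots> \<ge> z * (1 - z) * (n * (m_inf\<^sup>2 * 1) + 0)"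
    using z q1 q2 by (intro mult_left_mono add_mono mult_nonneg_nonneg) auto
  finally have "z * (1 - z) * (n * m_inf\<^sup>2) / (m_inf * n)\<^sup>2 \<le> step_var \<omega> / (m_inf * n)\<^sup>2"
    by (intro divide_right_mono) auto
  moreover have "z * (1 - z) * (n * m_inf\<^sup>2) / (m_inf * n)\<^sup>2 = z * (1 - z) * inverse n"
    using z m_pos by (simp add: power2_eq_square field_simps)
  ultimately have "z * (1 - z) * L \<omega> \<le> W_inf \<omega>"
    unfolding W_inf_def z_def[symmetric] n_def[symmetric] by (simp add: right_diff_distrib)
  moreover have "0 < z * (1 - z) * L \<omega>" using z elim by simp
  ultimately show ?case by linarith
qed

lemma W_inf_measurable: "W_inf \<in> borel_measurable M"
  unfolding W_inf_def[abs_def] step_var_def[abs_def] using rv_limits by measurable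

section \<open>Adaptedness of the variance estimator and the normalised error\<close>

lemma emp_mean_measurable:
  assumes "\<And>j. j \<in> {1..n} \<Longrightarrow> f j \<in> borel_measurable G"
  shows "emp_mean f n \<in> borel_measurable G"
  unfolding emp_mean_def[abs_def] using assms by (intro borel_measurable_divide borel_measurable_sum borel_measurable_const) auto

text \<open>Measurability for \<open>F n\<close>, not merely for \<open>M\<close>: the central limit
  theorem rescales by an early value of the estimator and must know it before the bulk of the
  array.\<close>

lemma urn_W_measurable: "urn_W N X A B n \<in> borel_measurable (F n)"
proof -
  have c: "(\<lambda>\<omega>. g (Y \<omega>)) \<in> borel_measurable (F n)" if "Y \<in> measurable (F n) (count_space UNIV)"
    for g :: "nat \<Rightarrow> real" and Y using measurable_compose[OF that, of g] by simp
  have m: "urn_M N X n \<in> borel_measurable (F n)"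
    "emp_mean (\<lambda>j \<omega>. real (A j \<omega>)) n \<in> borel_measurable (F n)"
    "emp_mean (\<lambda>j \<omega>. (real (A j \<omega>))\<^sup>2) n \<in> borel_measurable (F n)"
    "emp_mean (\<lambda>j \<omega>. (real (B j \<omega>))\<^sup>2) n \<in> borel_measurable (F n)"
    "emp_mean (\<lambda>j \<omega>. real (A j \<omega>) * real (B j \<omega>)) n \<in> borel_measurable (F n)"
    "emp_mean (\<lambda>j \<omega>. real (N j \<omega>)) n \<in> borel_measurable (F n)"
    "emp_mean (\<lambda>j \<omega>. (real (N j \<omega>))\<^sup>2) n \<in> borel_measurable (F n)"
    "emp_mean (\<lambda>j \<omega>. inverse (real (N j \<omega>))) n \<in> borel_measurable (F n)"
    unfolding urn_M_def
    by (intro emp_mean_measurable borel_measurable_divide borel_measurable_times c measurable_F; simp)+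
  show ?thesis unfolding urn_W_def[abs_def] urn_V'_def[abs_def] Let_def
    by (intro borel_measurable_divide borel_measurable_inverse meas_intros m)
qed

text \<open>Z lies in the unit interval only almost surely; this version is bounded everywhere, as
  the central limit theorem asks of the normalised error.\<close>

definition clipLim :: "'a \<Rightarrow> real" where "clipLim \<omega> = max 0 (min 1 (Z \<omega>))"
definition scalederr :: "nat \<Rightarrow> 'a \<Rightarrow> real" where
  "scalederr n \<omega> = sqrt (real n) * (mean (\<lambda>j \<omega>. clipX j \<omega> * invN j \<omega>) n \<omega> - clipLim \<omega>)"

lemma clipLim_measurable: "clipLim \<in> borel_measurable M"
  unfolding clipLim_def[abs_def] using rv_limits(4) by measurable

lemma clipLim_eq: "AE \<omega> in M. clipLim \<omega> = Z \<omega>"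
  using Z_bounds by eventually_elim (auto simp: clipLim_def)

lemma mean_frac_measurable: "mean (\<lambda>j \<omega>. clipX j \<omega> * invN j \<omega>) n \<in> borel_measurable M"
  unfolding mean_def[abs_def]
  by (intro borel_measurable_divide borel_measurable_sum borel_measurable_times measurable_M_processes borel_measurable_const) auto

lemma scalederr_measurable: "scalederr n \<in> borel_measurable M"
  unfolding scalederr_def[abs_def] by (intro meas_intros mean_frac_measurable clipLim_measurable)

lemma scalederr_bounded: "bounded_fun (scalederr n)"
proof -
  have "bounded_fun clipLim" by (rule bounded_funI[of _ 1]) (auto simp: clipLim_def)
  then show ?thesis unfolding scalederr_def[abs_def] mean_def by (intro bounded_fun_intros bounded_funs)
qed

text \<open>Abel summation identifies the sum of \<open>zeta j\<close> - j (Z_j - Z_{j-1}) with n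
  (M_n - Z_n). What remains are the remainders \<open>increm\<close> of both blocks and the distance
  from Z_{n^2} to the limit.\<close>

lemma scalederr_decomp:
  assumes n: "1 \<le> n"
  shows "scalederr n \<omega> - (\<Sum>j=1..n\<^sup>2. xi n j \<omega>) = - ((\<Sum>j=1..n. real j * increm j \<omega>) / sqrt (real n))
     - sqrt (real n) * (\<Sum>j=n+1..n\<^sup>2. increm j \<omega>) + sqrt (real n) * (clipZ (n\<^sup>2) \<omega> - clipLim \<omega>)"
proof -
  define s where "s = sqrt (real n)"
  have s: "s > 0" "s * s = real n" using n by (auto simp: s_def)
  have nn: "n \<le> n\<^sup>2" using n by (simp add: power2_eq_square)
  define mf where "mf = mean (\<lambda>j \<omega>. clipX j \<omega> * invN j \<omega>) n \<omega>"
  have tel: "(\<Sum>i=1..j. clipZ i \<omega> - clipZ (i - 1) \<omega>) = clipZ j \<omega> - clipZ 0 \<omega>" for j by (induction j) auto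
  have "(\<Sum>j=1..n. real j * (clipZ j \<omega> - clipZ (j - 1) \<omega>)) = real n * (clipZ n \<omega> - clipZ 0 \<omega>) - (\<Sum>j=1..n. clipZ (j - 1) \<omega> - clipZ 0 \<omega>)"
    unfolding abel_sum_by_parts[of "\<lambda>i. clipZ i \<omega> - clipZ (i - 1) \<omega>" n] tel ..
  then have ab: "(\<Sum>j=1..n. real j * (clipZ j \<omega> - clipZ (j - 1) \<omega>)) = real n * clipZ n \<omega> - (\<Sum>j=1..n. clipZ (j - 1) \<omega>)"
    by (simp add: sum_subtractf algebra_simps)
  have "(\<Sum>j=1..n. real j * (clipZ j \<omega> - clipZ (j - 1) \<omega>)) = (\<Sum>j=1..n. real j * mdinc j \<omega> + real j * increm j \<omega>)"
  proof (intro sum.cong refl)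
    fix j assume "j \<in> {1..n}"
    then have "clipZ j \<omega> - clipZ (j - 1) \<omega> = mdinc j \<omega> + increm j \<omega>" by (intro clipZ_step') simp
    then show "real j * (clipZ j \<omega> - clipZ (j - 1) \<omega>) = real j * mdinc j \<omega> + real j * increm j \<omega>" by (simp only: distrib_left)
  qed
  then have dr: "(\<Sum>j=1..n. real j * mdinc j \<omega>) + (\<Sum>j=1..n. real j * increm j \<omega>) = real n * clipZ n \<omega> - (\<Sum>j=1..n. clipZ (j - 1) \<omega>)"
    using ab by (simp add: sum.distrib)
  have ze: "(\<Sum>j=1..n. zeta j \<omega>) = real n * mf - (\<Sum>j=1..n. clipZ (j - 1) \<omega>)"
    using n by (simp add: zeta_def sum_subtractf mf_def mean_def)
  have e1: "(\<Sum>j=1..n. zeta j \<omega> - real j * mdinc j \<omega>) = s * s * (mf - clipZ n \<omega>) + (\<Sum>j=1..n. real j * increm j \<omega>)"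
    unfolding s sum_subtractf ze using dr by (simp add: algebra_simps)
  have "{1..n\<^sup>2} = {1..n} \<union> {n+1..n\<^sup>2}" using nn by auto
  then have "(\<Sum>j=1..n\<^sup>2. xi n j \<omega>) = (\<Sum>j=1..n. xi n j \<omega>) + (\<Sum>j=n+1..n\<^sup>2. xi n j \<omega>)"
    by (simp add: sum.union_disjoint)
  also have "(\<Sum>j=1..n. xi n j \<omega>) = (\<Sum>j=1..n. zeta j \<omega> - real j * mdinc j \<omega>) / s"
    unfolding sum_divide_distrib s_def by (intro sum.cong) (auto simp: xi_def)
  also have "\<dots> = s * (mf - clipZ n \<omega>) + (\<Sum>j=1..n. real j * increm j \<omega>) / s"
    unfolding e1 using s(1) by (simp add: add_divide_distrib)
  also have "(\<Sum>j=n+1..n\<^sup>2. xi n j \<omega>) = - s * (\<Sum>j=n+1..n\<^sup>2. mdinc j \<omega>)"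
    unfolding sum_distrib_left s_def by (intro sum.cong) (auto simp: xi_def)
  finally have "scalederr n \<omega> - (\<Sum>j=1..n\<^sup>2. xi n j \<omega>) = s * (mf - clipLim \<omega>) - (s * (mf - clipZ n \<omega>) + (\<Sum>j=1..n. real j * increm j \<omega>) / s) + s * (\<Sum>j=n+1..n\<^sup>2. mdinc j \<omega>)"
    by (simp add: scalederr_def mf_def s_def)
  also have "(\<Sum>j=n+1..n\<^sup>2. mdinc j \<omega>) = clipZ (n\<^sup>2) \<omega> - clipZ n \<omega> - (\<Sum>j=n+1..n\<^sup>2. increm j \<omega>)"
    using clipZ_diff'[OF nn, of \<omega>] by linarith
  finally show ?thesis unfolding s_def by (simp add: algebra_simps)
qed

text \<open>The remainders are O(1 / j^2), so the first block contributes a harmonic sum, at most ln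
  n + 1, over sqrt n; the second contributes one more unit over sqrt n.\<close>

lemma drift_remainder_le:
  assumes n: "1 \<le> n"
  shows "\<bar>- ((\<Sum>j=1..n. real j * increm j \<omega>) / sqrt (real n)) - sqrt (real n) * (\<Sum>j=n+1..n\<^sup>2. increm j \<omega>)\<bar>
    \<le> Csq\<^sup>2 * ((ln (real n) + 2) / sqrt (real n))"
proof -
  have s: "sqrt (real n) > 0" using n by simp
  have "\<bar>\<Sum>j=1..n. real j * increm j \<omega>\<bar> \<le> (\<Sum>j=1..n. Csq\<^sup>2 * inverse (real j))"
  proof (intro order_trans[OF sum_abs] sum_mono)
    fix j assume "j \<in> {1..n}"
    then have j: "1 \<le> j" by simp
    have "real j * \<bar>increm j \<omega>\<bar> \<le> real j * (Csq\<^sup>2 * (1 / (real j)\<^sup>2))" by (intro mult_left_mono increm_le' j) auto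
    also have "\<dots> = Csq\<^sup>2 * inverse (real j)" using j by (simp add: power2_eq_square divide_inverse)
    finally show "\<bar>real j * increm j \<omega>\<bar> \<le> Csq\<^sup>2 * inverse (real j)" by (simp add: abs_mult)
  qed
  also have "\<dots> = Csq\<^sup>2 * harm n" by (simp add: harm_def sum_distrib_left)
  also have "\<dots> \<le> Csq\<^sup>2 * (ln (real n) + 1)" proof (intro mult_left_mono)
    show "harm n \<le> ln (real n) + 1" using euler_mascheroni_sequence_decreasing[of 1 n] n by (simp add: harm_expand)
  qed auto
  finally have h1: "\<bar>(\<Sum>j=1..n. real j * increm j \<omega>) / sqrt (real n)\<bar> \<le> Csq\<^sup>2 * (ln (real n) + 1) / sqrt (real n)"
    using s by (simp add: divide_right_mono)
  have h2: "\<bar>sqrt (real n) * (\<Sum>j=n+1..n\<^sup>2. increm j \<omega>)\<bar> \<le> Csq\<^sup>2 / sqrt (real n)"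
  proof -
    have "\<bar>\<Sum>j=n+1..n\<^sup>2. increm j \<omega>\<bar> \<le> (\<Sum>j=n+1..n\<^sup>2. Csq\<^sup>2 * (1 / (real j)\<^sup>2))"
      using n by (intro order_trans[OF sum_abs] sum_mono increm_le') auto
    also have "\<dots> \<le> Csq\<^sup>2 * (1 / real n)"
      unfolding sum_distrib_left[symmetric] by (intro mult_left_mono sum_inverse_squares_le n) auto
    finally have "sqrt (real n) * \<bar>\<Sum>j=n+1..n\<^sup>2. increm j \<omega>\<bar> \<le> sqrt (real n) * (Csq\<^sup>2 * (1 / real n))"
      by (intro mult_left_mono) auto
    also have "\<dots> = Csq\<^sup>2 / sqrt (real n)"
    proof -
      have "t * (Csq\<^sup>2 * (1 / (t * t))) = Csq\<^sup>2 / t" if "t > 0" for t :: real using that by simp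
      from this[OF s] show ?thesis by simp
    qed
    finally show ?thesis by (simp add: abs_mult)
  qed
  have "\<bar>- x - y\<bar> \<le> \<bar>x\<bar> + \<bar>y\<bar>" for x y :: real by simp
  from order_trans[OF this add_mono[OF h1 h2]]
  show ?thesis by (simp add: add_divide_distrib[symmetric] algebra_simps)
qed

text \<open>The remainders are uniformly small, and the distance from Z_{n^2} to the limit
  contributes 2 n times 4 Csq^4 / n^2.\<close>

lemma scalederr_L2: "(\<lambda>n. expectation (\<lambda>\<omega>. (scalederr n \<omega> - (\<Sum>j=1..n\<^sup>2. xi n j \<omega>))\<^sup>2)) \<longlonglongrightarrow> 0"
proof (rule Lim_null_comparison)
  define h where "h n = Csq\<^sup>2 * ((ln (real n) + 2) / sqrt (real n))" for n :: nat
  have "h \<longlonglongrightarrow> 0" unfolding h_def by real_asymp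
  moreover have "(\<lambda>n. 8 * Csq ^ 4 / real n) \<longlonglongrightarrow> 0" by real_asymp
  ultimately have "(\<lambda>n. 2 * (h n)\<^sup>2 + 8 * Csq ^ 4 / real n) \<longlonglongrightarrow> 2 * 0\<^sup>2 + 0" by (intro tendsto_intros)
  then show "(\<lambda>n. 2 * (h n)\<^sup>2 + 8 * Csq ^ 4 / real n) \<longlonglongrightarrow> 0" by simp
  show "\<forall>\<^sub>F n in sequentially. norm (expectation (\<lambda>\<omega>. (scalederr n \<omega> - (\<Sum>j=1..n\<^sup>2. xi n j \<omega>))\<^sup>2)) \<le> 2 * (h n)\<^sup>2 + 8 * Csq ^ 4 / real n"
    using eventually_ge_at_top[of 1]
  proof eventually_elim
    case (elim n)
    have Zcb: "bounded_fun clipLim" by (rule bounded_funI[of _ 1]) (auto simp: clipLim_def)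
    have xm: "xi n j \<in> borel_measurable M" if "1 \<le> j" for j by (rule mart_diff_measurable_M[OF mart_diff_xi that])
    have xb: "bounded_fun (xi n j)" if "1 \<le> j" for j by (rule mart_diff_bounded[OF mart_diff_xi that])
    have i1: "integrable M (\<lambda>\<omega>. (scalederr n \<omega> - (\<Sum>j=1..n\<^sup>2. xi n j \<omega>))\<^sup>2)"
      by (intro integrable_bounded_fun bounded_fun_intros scalederr_bounded xb meas_intros scalederr_measurable borel_measurable_sum xm) auto
    have i2: "integrable M (\<lambda>\<omega>. (clipZ (n\<^sup>2) \<omega> - clipLim \<omega>)\<^sup>2)"
      by (intro integrable_bounded_fun bounded_fun_intros Zcb bounded_funs meas_intros clipLim_measurable measurable_M_processes)
    have "expectation (\<lambda>\<omega>. (scalederr n \<omega> - (\<Sum>j=1..n\<^sup>2. xi n j \<omega>))\<^sup>2) \<le> expectation (\<lambda>\<omega>. 2 * (h n)\<^sup>2 + 2 * real n * (clipZ (n\<^sup>2) \<omega> - clipLim \<omega>)\<^sup>2)"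
    proof (intro integral_mono i1 Bochner_Integration.integrable_add integrable_mult_right i2 integrable_const)
      fix \<omega>
      define x where "x = - ((\<Sum>j=1..n. real j * increm j \<omega>) / sqrt (real n)) - sqrt (real n) * (\<Sum>j=n+1..n\<^sup>2. increm j \<omega>)"
      define y where "y = sqrt (real n) * (clipZ (n\<^sup>2) \<omega> - clipLim \<omega>)"
      have "\<bar>x\<bar>\<^sup>2 \<le> (h n)\<^sup>2" using drift_remainder_le[OF elim, of \<omega>] unfolding x_def h_def by (intro power_mono) auto
      moreover have "y\<^sup>2 = real n * (clipZ (n\<^sup>2) \<omega> - clipLim \<omega>)\<^sup>2" by (simp add: y_def power_mult_distrib)
      moreover have "(x + y)\<^sup>2 \<le> 2 * x\<^sup>2 + 2 * y\<^sup>2"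
        using sum_squares_ge_zero[of "x - y" 0] by (simp add: power2_eq_square algebra_simps)
      ultimately show "(scalederr n \<omega> - (\<Sum>j=1..n\<^sup>2. xi n j \<omega>))\<^sup>2 \<le> 2 * (h n)\<^sup>2 + 2 * real n * (clipZ (n\<^sup>2) \<omega> - clipLim \<omega>)\<^sup>2"
        unfolding scalederr_decomp[OF elim] x_def[symmetric] y_def[symmetric] by simp
    qed
    also have "\<dots> = 2 * (h n)\<^sup>2 + 2 * real n * expectation (\<lambda>\<omega>. (clipZ (n\<^sup>2) \<omega> - clipLim \<omega>)\<^sup>2)"
      using i2 by (simp add: prob_space)
    also have "expectation (\<lambda>\<omega>. (clipZ (n\<^sup>2) \<omega> - clipLim \<omega>)\<^sup>2) \<le> 4 * Csq ^ 4 / real (n\<^sup>2)"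
    proof (rule clipZ_L2_rate[OF clipLim_measurable])
      show "AE \<omega> in M. (\<lambda>n. clipZ n \<omega>) \<longlonglongrightarrow> clipLim \<omega>" using clipZ_lim clipLim_eq by eventually_elim simp
      show "1 \<le> n\<^sup>2" using elim by simp
    qed
    then have "2 * real n * expectation (\<lambda>\<omega>. (clipZ (n\<^sup>2) \<omega> - clipLim \<omega>)\<^sup>2) \<le> 2 * real n * (4 * Csq ^ 4 / real (n\<^sup>2))"
      by (intro mult_left_mono) auto
    also have "2 * real n * (4 * Csq ^ 4 / real (n\<^sup>2)) = 8 * Csq ^ 4 / real n" using elim by (simp add: power2_eq_square)
    finally show ?case by simp
  qed
qed

text \<open>The characteristic functions converge by \<open>martingale_array_clt\<close> with the
  estimator as \<open>V\<close> and row length n^2; Levy's theorem and the absence of atoms at the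
  end points give the probabilities.\<close>

theorem studentized_clt:
  "(\<lambda>n. prob {\<omega> \<in> space M. \<bar>scalederr n \<omega> / sqrt (urn_W N X A B n \<omega>)\<bar> \<le> q}) \<longlonglongrightarrow> measure std_normal_distribution {-q..q}"
proof -
  define R where "R n \<omega> = scalederr n \<omega> / sqrt (urn_W N X A B n \<omega>)" for n \<omega>
  have Wm: "urn_W N X A B n \<in> borel_measurable M" for n by (rule measurable_F_imp_M[OF urn_W_measurable])
  have Rm [measurable]: "R n \<in> borel_measurable M" for n
    unfolding R_def[abs_def] using Wm[of n] scalederr_measurable[of n] by measurable
  have rd: "real_distribution (distr M borel (R n))" for n by (rule real_distribution_distr) (rule Rm)
  have "weak_conv_m (\<lambda>n. distr M borel (R n)) std_normal_distribution"
  proof (rule levy_continuity[OF rd real_dist_normal_dist])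
    fix t
    have "char (distr M borel (R n)) t = expectation (\<lambda>\<omega>. exp (\<i> * complex_of_real (t * R n \<omega>)))" for n
      unfolding char_def by (subst integral_distr) auto
    moreover have "(\<lambda>n. expectation (\<lambda>\<omega>. exp (\<i> * complex_of_real (t * R n \<omega>)))) \<longlonglongrightarrow> complex_of_real (exp (- t\<^sup>2 / 2))"
      unfolding R_def
      by (rule martingale_array_clt[OF mart_diff_xi xi_le xi_sq_sum_le _ xi_sq_sum_tendsto urn_W_measurable urn_W_tendsto
            W_inf_measurable W_inf_pos scalederr_measurable scalederr_bounded scalederr_L2]) (simp_all add: power2_eq_square)
    ultimately show "(\<lambda>n. char (distr M borel (R n)) t) \<longlonglongrightarrow> char std_normal_distribution t"
      by (simp add: char_std_normal_distribution)
  qed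
  moreover have "emeasure std_normal_distribution (frontier {-q..q}) = 0"
  proof -
    interpret G: real_distribution std_normal_distribution by (rule real_dist_normal_dist)
    \<comment> \<open>Holds also for negative q, when the interval is empty.\<close>
    have "frontier {-q..q} \<subseteq> {-q} \<union> {q}"
      by (cases "-q \<le> q") (auto simp: frontier_def interior_atLeastAtMost_real)
    then have "measure std_normal_distribution (frontier {-q..q}) \<le> measure std_normal_distribution ({-q} \<union> {q})"
      by (intro G.finite_measure_mono) auto
    also have "\<dots> \<le> measure std_normal_distribution {-q} + measure std_normal_distribution {q}"
      by (intro measure_Un_le) auto
    finally have "measure std_normal_distribution (frontier {-q..q}) \<le> 0" by (simp add: std_normal_singleton)
    then show ?thesis by (simp add: G.emeasure_eq_measure measure_le_0_iff)
  qed
  ultimately have "(\<lambda>n. measure (distr M borel (R n)) {-q..q}) \<longlonglongrightarrow> measure std_normal_distribution {-q..q}"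
    using weak_conv_imp_continuity_set_conv[OF rd real_dist_normal_dist] by auto
  moreover have "measure (distr M borel (R n)) {-q..q} = prob {\<omega> \<in> space M. \<bar>R n \<omega>\<bar> \<le> q}" for n
    by (subst measure_distr) (auto intro!: arg_cong[where f=prob])
  ultimately show ?thesis by (simp add: R_def)
qed

lemma confidence_interval:
  assumes \<alpha>: "0 < \<alpha>" "\<alpha> < 1"
  shows "(\<lambda>n. measure M {\<omega> \<in> space M.
                     0 \<le> urn_W N X A B n \<omega> \<and>
                     \<bar>urn_M N X n \<omega> - Z \<omega>\<bar>
                       \<le> quantile std_normal_distribution (1 - \<alpha> / 2)
                          * sqrt (urn_W N X A B n \<omega> / real n)}) \<longlonglongrightarrow> 1 - \<alpha>"
proof -
  define q where "q = quantile std_normal_distribution (1 - \<alpha> / 2)"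
  define E where "E n = {\<omega> \<in> space M. 0 \<le> urn_W N X A B n \<omega> \<and> \<bar>urn_M N X n \<omega> - Z \<omega>\<bar> \<le> q * sqrt (urn_W N X A B n \<omega> / real n)}" for n
  define E' where "E' n = {\<omega> \<in> space M. \<bar>scalederr n \<omega> / sqrt (urn_W N X A B n \<omega>)\<bar> \<le> q}" for n
  \<comment> \<open>Off this event the studentised and the interval statements agree almost surely;
    on it \<open>sqrt\<close> and division take values without statistical meaning. Its probability
    vanishes, because W_n tends to a positive limit.\<close>
  define B' where "B' n = {\<omega> \<in> space M. urn_W N X A B n \<omega> \<le> 0}" for n
  have Wm [measurable]: "urn_W N X A B n \<in> borel_measurable M" for n by (rule measurable_F_imp_M[OF urn_W_measurable])
  have Mm [measurable]: "urn_M N X n \<in> borel_measurable M" for n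
    unfolding urn_M_def using rv_X rv_N by (intro emp_mean_measurable borel_measurable_divide) (auto intro: measurable_compose)
  note [measurable] = scalederr_measurable rv_limits(4)
  have [measurable]: "E n \<in> sets M" "E' n \<in> sets M" "B' n \<in> sets M" for n
    unfolding E_def E'_def B'_def by measurable
  have E'_lim: "(\<lambda>n. prob (E' n)) \<longlonglongrightarrow> 1 - \<alpha>"
    using studentized_clt[of q] measure_std_normal_quantile_interval[OF \<alpha>] unfolding E'_def q_def by simp
  have B_lim: "(\<lambda>n. prob (B' n)) \<longlonglongrightarrow> 0"
  proof -
    have "(\<lambda>n. expectation (\<lambda>\<omega>. indicator (B' n) \<omega>)) \<longlonglongrightarrow> expectation (\<lambda>\<omega>. 0::real)"
    proof (rule integral_dominated_convergence[where w="\<lambda>_. 1"])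
      show "AE \<omega> in M. (\<lambda>n. indicator (B' n) \<omega> :: real) \<longlonglongrightarrow> 0"
        using urn_W_tendsto W_inf_pos
      proof eventually_elim
        case (elim \<omega>)
        from order_tendstoD(1)[OF elim] show ?case
          by (intro tendsto_eventually) (auto elim!: eventually_mono simp: B'_def indicator_def)
      qed
    qed (auto simp: indicator_def)
    then show ?thesis by simp
  qed
  have close: "\<bar>prob (E n) - prob (E' n)\<bar> \<le> prob (B' n)" if n: "1 \<le> n" for n
  proof -
    have eq: "AE \<omega> in M. \<omega> \<notin> B' n \<longrightarrow> (\<omega> \<in> E n \<longleftrightarrow> \<omega> \<in> E' n)"
      using emp_mean_eq clipLim_eq
    proof eventually_elim
      case (elim \<omega>)
      define W where "W = urn_W N X A B n \<omega>"
      define s where "s = sqrt (real n)"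
      have s: "s > 0" using n by (simp add: s_def)
      show ?case
      proof
        assume "\<omega> \<notin> B' n"
        show "(\<omega> \<in> E n) = (\<omega> \<in> E' n)"
        proof (cases "\<omega> \<in> space M")
          case True
          then have W: "W > 0" using \<open>\<omega> \<notin> B' n\<close> by (simp add: B'_def W_def)
          define x where "x = \<bar>urn_M N X n \<omega> - Z \<omega>\<bar>"
          have "\<bar>scalederr n \<omega> / sqrt W\<bar> = s * x / sqrt W"
            using elim W s by (simp add: scalederr_def x_def s_def abs_mult)
          then have "\<bar>scalederr n \<omega> / sqrt W\<bar> \<le> q \<longleftrightarrow> x \<le> q * (sqrt W / s)"
            using W s by (simp add: field_simps)
          then show ?thesis using True W by (simp add: E_def E'_def W_def[symmetric] x_def[symmetric] s_def real_sqrt_divide)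
        qed (simp add: E_def E'_def)
      qed
    qed
    have "prob (E n) \<le> prob (E' n \<union> B' n)"
      by (rule finite_measure_mono_AE) (use eq in \<open>auto elim!: eventually_mono\<close>)
    also have "\<dots> \<le> prob (E' n) + prob (B' n)" by (intro measure_Un_le) auto
    finally have 1: "prob (E n) \<le> prob (E' n) + prob (B' n)" .
    have "prob (E' n) \<le> prob (E n \<union> B' n)"
      by (rule finite_measure_mono_AE) (use eq in \<open>auto elim!: eventually_mono\<close>)
    also have "\<dots> \<le> prob (E n) + prob (B' n)" by (intro measure_Un_le) auto
    finally show ?thesis using 1 by linarith
  qed
  have "(\<lambda>n. prob (E n) - prob (E' n)) \<longlonglongrightarrow> 0"
  proof (rule Lim_null_comparison[OF _ B_lim])
    show "\<forall>\<^sub>F n in sequentially. norm (prob (E n) - prob (E' n)) \<le> prob (B' n)"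
      using eventually_ge_at_top[of 1] by eventually_elim (simp add: close)
  qed
  from tendsto_add[OF this E'_lim] show ?thesis by (simp add: E_def q_def)
qed

end


theorem mainTheorem7:
  fixes M :: "'a measure" and a b C :: nat
    and N X A B :: "nat \<Rightarrow> 'a \<Rightarrow> nat"
    and m :: "nat \<Rightarrow> real" and m_inf q_A q_B q_AB :: real
    and N_inf Q L :: "'a \<Rightarrow> real"
  assumes urn: "hypergeom_urn M a b N X A B"
    and bound: "\<And>n. 1 \<le> n \<Longrightarrow> AE \<omega> in M. max (A n \<omega>) (max (B n \<omega>) (N n \<omega>)) \<le> C"
    and mean_A: "\<And>n. 1 \<le> n \<Longrightarrow> (\<integral>\<omega>. real (A n \<omega>) \<partial>M) = m n"
    and mean_B: "\<And>n. 1 \<le> n \<Longrightarrow> (\<integral>\<omega>. real (B n \<omega>) \<partial>M) = m n"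
    and m_lim: "m \<longlonglongrightarrow> m_inf" and m_pos: "0 < m_inf"
    and rv_limits: "N_inf \<in> borel_measurable M" "Q \<in> borel_measurable M" "L \<in> borel_measurable M"
    and N_lim: "AE \<omega> in M.
          (\<lambda>n. real_cond_exp M (urn_F M N X A B (n - 1)) (\<lambda>\<omega>. real (N n \<omega>)) \<omega>)
            \<longlonglongrightarrow> N_inf \<omega>"
    and Q_lim: "AE \<omega> in M.
          (\<lambda>n. real_cond_exp M (urn_F M N X A B (n - 1)) (\<lambda>\<omega>. (real (N n \<omega>))\<^sup>2) \<omega>)
            \<longlonglongrightarrow> Q \<omega>"
    and L_lim: "AE \<omega> in M.
          (\<lambda>n. real_cond_exp M (urn_F M N X A B (n - 1)) (\<lambda>\<omega>. inverse (real (N n \<omega>))) \<omega>)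
            \<longlonglongrightarrow> L \<omega>"
    and N_pos: "AE \<omega> in M. 0 < N_inf \<omega>"
    and Q_pos: "AE \<omega> in M. 0 < Q \<omega>"
    and L_pos: "AE \<omega> in M. 0 < L \<omega>"
    and L_bounded: "\<exists>c. AE \<omega> in M. L \<omega> \<le> c"
    and qA_lim: "(\<lambda>n. \<integral>\<omega>. (real (A n \<omega>))\<^sup>2 \<partial>M) \<longlonglongrightarrow> q_A"
    and qB_lim: "(\<lambda>n. \<integral>\<omega>. (real (B n \<omega>))\<^sup>2 \<partial>M) \<longlonglongrightarrow> q_B"
    and qAB_lim: "(\<lambda>n. \<integral>\<omega>. real (A n \<omega>) * real (B n \<omega>) \<partial>M) \<longlonglongrightarrow> q_AB"
    and q_pos: "0 < q_A" "0 < q_B" "0 < q_AB"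
  shows "(\<exists>Z \<in> borel_measurable M.
            AE \<omega> in M. (\<lambda>n. urn_Z a b N X A B n \<omega>) \<longlonglongrightarrow> Z \<omega>) \<and>
         (\<forall>Z \<in> borel_measurable M.
            (AE \<omega> in M. (\<lambda>n. urn_Z a b N X A B n \<omega>) \<longlonglongrightarrow> Z \<omega>) \<longrightarrow>
            (\<forall>\<alpha>::real. 0 < \<alpha> \<and> \<alpha> < 1 \<longrightarrow>
              (\<lambda>n. measure M {\<omega> \<in> space M.
                     0 \<le> urn_W N X A B n \<omega> \<and>
                     \<bar>urn_M N X n \<omega> - Z \<omega>\<bar>
                       \<le> quantile std_normal_distribution (1 - \<alpha> / 2)
                          * sqrt (urn_W N X A B n \<omega> / real n)})
                \<longlonglongrightarrow> 1 - \<alpha>))"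
proof -
  interpret bounded_urn M a b N X A B C m
    using urn bound mean_A mean_B by (simp add: bounded_urn_def bounded_urn_axioms_def)
  show ?thesis
  proof (intro conjI ballI impI allI)
    \<comment> \<open>Measurable as a pointwise \<open>lim\<close> of measurable functions; the set
      where the sequence diverges, on which \<open>lim\<close> says nothing, is null.\<close>
    define Z where "Z \<omega> = lim (\<lambda>n. clipZ n \<omega>)" for \<omega>
    have "Z \<in> borel_measurable M"
      unfolding Z_def[abs_def] using measurable_M_processes(9) by (rule borel_measurable_lim_metric)
    moreover have "AE \<omega> in M. (\<lambda>n. urn_Z a b N X A B n \<omega>) \<longlonglongrightarrow> Z \<omega>"
      using clipZ_AE_convergent AE_totals_eq by eventually_elim (simp add: Z_def convergent_LIMSEQ_iff)
    ultimately show "\<exists>Z \<in> borel_measurable M. AE \<omega> in M. (\<lambda>n. urn_Z a b N X A B n \<omega>) \<longlonglongrightarrow> Z \<omega>" by blast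
  next
    fix Z and \<alpha> :: real
    assume Z: "Z \<in> borel_measurable M" "AE \<omega> in M. (\<lambda>n. urn_Z a b N X A B n \<omega>) \<longlonglongrightarrow> Z \<omega>"
      and \<alpha>: "0 < \<alpha> \<and> \<alpha> < 1"
    \<comment> \<open>The limit is a parameter of the locale, so the conclusion holds for every
      measurable version of Z.\<close>
    interpret clt_urn M a b N X A B C m m_inf q_A q_B q_AB N_inf Q L Z
      by unfold_locales (fact m_lim m_pos rv_limits N_lim Q_lim L_lim N_pos Q_pos L_pos qA_lim qB_lim qAB_lim Z)+
    show "(\<lambda>n. measure M {\<omega> \<in> space M. 0 \<le> urn_W N X A B n \<omega> \<and> \<bar>urn_M N X n \<omega> - Z \<omega>\<bar>
             \<le> quantile std_normal_distribution (1 - \<alpha> / 2) * sqrt (urn_W N X A B n \<omega> / real n)}) \<longlonglongrightarrow> 1 - \<alpha>"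
      using confidence_interval \<alpha> by blast
  qed
qed

end
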